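(* Let $\nu\in(0,\infty)$, $0<a<b<\infty$ and $\gamma\in(0,\pi)$. Let $q$ be a real-valued function in $AC_{\mathrm{loc}}(0,b]$ such that the function $x\mapsto xq(x)$ belongs to $L^r(0,b)$ for some $r\in(2,\infty]$. For every $F\in\mathcal B_b$ define $$\widetilde F(z)=\sum_{\lambda_n\in\sigma(S_{a,\gamma})}\frac{K_a(z,\lambda_n)}{K_a(\lambda_n,\lambda_n)}\,F(\lambda_n).$$ Then for every $F\in\mathcal B_b$ and every $z\in\mathbb C$, $$|F(z)-\widetilde F(z)|\le h_{ab}(z)\int_a^b|\psi(x)|\,dx,$$ where $\psi\in L^2(0,b)$ is the function with $F(z)=\int_0^b\xi(z,x)\psi(x)\,dx$ for all $z\in\mathbb C$, and $$h_{ab}(z)=\sup_{x\in[a,b]}\bigl|\xi_a^{\mathrm{ext}}(z,x)-\xi(z,x)\bigr|,\qquad \xi_a^{\mathrm{ext}}(z,x)=\sum_{\lambda_n\in\sigma(S_{a,\gamma})}\frac{K_a(z,\lambda_n)}{K_a(\lambda_n,\lambda_n)}\,\xi(\lambda_n,x).$$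
   Context: Notation: $\xi_\nu(z,x)=z^{-\nu/2}\sqrt{\pi x/2}\,J_\nu(\sqrt z\,x)$ ($J_\nu$ the Bessel function), which is entire in $z$ and real for real $z$. Solution $\xi$: for each $z\in\mathbb C$, $\xi(z,\cdot)$ is the solution on $(0,b]$ of $-\varphi''+\left(\frac{\nu^2-1/4}{x^2}+q(x)\right)\varphi=z\varphi$ determined by the estimates, valid for all $z\in\mathbb C$, $x\in(0,b]$ with a constant $C=C(\nu,q,b)$, $$|\xi(z,x)-\xi_\nu(z,x)|\le C\Bigl(\tfrac{x}{1+|\sqrt z|x}\Bigr)^{\nu+\frac12}e^{|\mathrm{Im}\sqrt z|x}\int_0^x\frac{u|q(u)|}{1+|\sqrt z|u}du,$$ $$|\xi'(z,x)-\xi_\nu'(z,x)|\le C\Bigl(\tfrac{x}{1+|\sqrt z|x}\Bigr)^{\nu-\frac12}e^{|\mathrm{Im}\sqrt z|x}\int_0^x\frac{u|q(u)|}{1+|\sqrt z|u}du,$$ where $'$ is the derivative in $x$. The functions $\xi(\cdot,x)$ and $\xi'(\cdot,x)$ are entire and real on the real line. De Branges spaces: for $s\in(0,b]$, $\mathcal B_s=\{F(z)=\int_0^s\xi(z,x)\varphi(x)\,dx:\varphi\in L^2(0,s)\}$ with $\|F\|_{\mathcal B_s}^2=\int_0^s|\varphi(x)|^2dx$ (the map $\varphi\mapsto F$ is a bijection). Its reproducing kernel is $K_s(z,w)=\int_0^s\xi(z,x)\,\xi(\overline w,x)\,dx$. Operators and spectrum: $S_{s,\gamma}$ is the selfadjoint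 operator in $\mathcal B_s$ unitarily equivalent, via $\varphi\mapsto F$, to the selfadjoint operator $H_{s,\gamma}$ in $L^2(0,s)$ given by $-\frac{d^2}{dx^2}+\frac{\nu^2-1/4}{x^2}+q$ with boundary condition $\varphi(s)\cos\gamma+\varphi'(s)\sin\gamma=0$ and, if $\nu\in(0,1)$, also $\lim_{x\to0+}x^{\nu-1/2}\left((\nu+\tfrac12)\varphi(x)-x\varphi'(x)\right)=0$. Its spectrum is discrete, simple, bounded below, and equals $\sigma(S_{s,\gamma})=\sigma(H_{s,\gamma})=\{\lambda\in\mathbb R:\xi(\lambda,s)\cos\gamma+\xi'(\lambda,s)\sin\gamma=0\}$. *)

theory Defs
  imports "HOL-Analysis.Analysis"
begin

subsection \<open>Function spaces\<close>

text \<open>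
  Elements of Lebesgue spaces are represented by functions; whenever two representatives have to be
  compared this is done almost everywhere.
\<close>

definition in_Lp :: "ereal \<Rightarrow> real \<Rightarrow> (real \<Rightarrow> 'a::{banach, second_countable_topology}) \<Rightarrow> bool" where
  "in_Lp p s f \<longleftrightarrow>
     f \<in> borel_measurable (lebesgue_on {0<..<s}) \<and>
     (if p = \<infinity> then \<exists>M. AE x in lebesgue_on {0<..<s}. norm (f x) \<le> M
      else integrable (lebesgue_on {0<..<s}) (\<lambda>x. norm (f x) powr real_of_ereal p))"

definition L2 :: "real \<Rightarrow> (real \<Rightarrow> complex) set" where
  "L2 s = {\<phi>. \<phi> \<in> borel_measurable (lebesgue_on {0<..<s}) \<and>
               integrable (lebesgue_on {0<..<s}) (\<lambda>x. (norm (\<phi> x))\<^sup>2)}"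

definition L2_norm_on :: "real \<Rightarrow> (real \<Rightarrow> complex) \<Rightarrow> real" where
  "L2_norm_on s \<phi> = sqrt (LINT x|lebesgue_on {0<..<s}. (norm (\<phi> x))\<^sup>2)"

text \<open>
  Local absolute continuity on \<open>(0,s]\<close>, in the form customary in Sturm--Liouville theory: \<open>f\<close> is the
  indefinite integral of a function \<open>g\<close> that is integrable on compact subintervals of \<open>(0,s]\<close>.
  Such a \<open>g\<close> is the a.e. derivative of \<open>f\<close>, and \<open>f\<close> is continuous on \<open>(0,s]\<close>.
\<close>

definition AC_loc_deriv ::
    "real \<Rightarrow> (real \<Rightarrow> 'a::{banach, second_countable_topology}) \<Rightarrow> (real \<Rightarrow> 'a) \<Rightarrow> bool" where
  "AC_loc_deriv s f g \<longleftrightarrow>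
     (\<forall>x y. 0 < x \<and> x \<le> y \<and> y \<le> s \<longrightarrow>
        integrable (lebesgue_on {x..y}) g \<and> f y - f x = (LINT t|lebesgue_on {x..y}. g t))"

definition AC_loc :: "real \<Rightarrow> (real \<Rightarrow> 'a::{banach, second_countable_topology}) \<Rightarrow> bool" where
  "AC_loc s f \<longleftrightarrow> (\<exists>g. AC_loc_deriv s f g)"

subsection \<open>Bessel functions and the solution of the Bessel-type equation\<close>

definition Bessel_J :: "real \<Rightarrow> complex \<Rightarrow> complex" where
  "Bessel_J \<nu> w = (w / 2) powr of_real \<nu> *
     (\<Sum>k. (-1) ^ k / (fact k * of_real (Gamma (\<nu> + real k + 1))) * (w / 2) ^ (2 * k))"

text \<open>
  The formula \<open>z\<^sup>-\<^sup>\<nu>\<^sup>/\<^sup>2 (\<pi>x/2)\<^sup>1\<^sup>/\<^sup>2 J\<^sub>\<nu>(z\<^sup>1\<^sup>/\<^sup>2 x)\<close> has a removable singularity at \<open>z = 0\<close>; the value there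
  is the one of the entire extension (see \<open>xi_free_series\<close>).
\<close>

definition xi_free :: "real \<Rightarrow> complex \<Rightarrow> real \<Rightarrow> complex" where
  "xi_free \<nu> z x =
     (if z = 0 then of_real (sqrt (pi * x / 2) * (x / 2) powr \<nu> / Gamma (\<nu> + 1))
      else z powr of_real (- \<nu> / 2) * of_real (sqrt (pi * x / 2)) * Bessel_J \<nu> (csqrt z * of_real x))"

lemma xi_free_series:
  assumes "x > 0"
  shows "xi_free \<nu> z x = of_real (sqrt (pi * x / 2) * (x / 2) powr \<nu>) *
     (\<Sum>k. (-1) ^ k / (fact k * of_real (Gamma (\<nu> + real k + 1))) * of_real ((x / 2) ^ (2 * k)) * z ^ k)"
proof (cases "z = 0")
  case True
  have "(\<Sum>k. (-1) ^ k / (fact k * complex_of_real (Gamma (\<nu> + real k + 1))) *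
          of_real ((x / 2) ^ (2 * k)) * 0 ^ k) = 1 / complex_of_real (Gamma (\<nu> + 1))"
    by (subst suminf_finite[of "{0}"]) auto
  then show ?thesis
    using True by (simp add: xi_free_def)
next
  case False
  have "(csqrt z * of_real x / 2) powr of_real \<nu> = (of_real (x / 2) * csqrt z) powr of_real \<nu>"
    by (simp add: mult.commute)
  also have "\<dots> = exp (of_real \<nu> * (of_real (ln (x / 2)) + Ln (csqrt z)))"
    using False assms by (simp add: powr_def Ln_times_of_real Ln_of_real del: of_real_divide)
  also have "\<dots> = of_real ((x / 2) powr \<nu>) * z powr of_real (\<nu> / 2)"
  proof -
    have L: "Ln (csqrt z) = Ln z / 2"
    proof -
      have "csqrt z = exp (Ln z / 2)"
        using False by (simp add: csqrt_exp_Ln)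
      then show ?thesis
        using Ln_exp[of "Ln z / 2"] mpi_less_Im_Ln[OF False] Im_Ln_le_pi[OF False] by simp
    qed
    show ?thesis
      using False assms
      by (simp add: powr_def L algebra_simps exp_add flip: exp_of_real)
  qed
  finally have J: "(csqrt z * of_real x / 2) powr of_real \<nu> =
    of_real ((x / 2) powr \<nu>) * z powr of_real (\<nu> / 2)" .
  have pow: "(csqrt z * of_real x / 2) ^ (2 * k) = of_real ((x / 2) ^ (2 * k)) * z ^ k" for k
    by (simp add: power_mult power_mult_distrib power_divide)
  have cancel: "z powr of_real (- \<nu> / 2) * z powr of_real (\<nu> / 2) = 1"
    using False by (simp flip: powr_add)
  show ?thesis
    unfolding xi_free_def Bessel_J_def pow J using False cancel
    by (simp add: mult_ac)
qed

text \<open>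
  Derivative in \<open>x \<in> (0,b]\<close>, one-sided at \<open>x = b\<close>.
\<close>

definition dx :: "real \<Rightarrow> (real \<Rightarrow> complex) \<Rightarrow> real \<Rightarrow> complex" where
  "dx b f x = vector_derivative f (at x within {0<..b})"

text \<open>
  \<open>\<xi>(z,\<cdot>)\<close> solves the equation with spectral parameter \<open>z\<close> on \<open>(0,b]\<close> and satisfies, with one constant
  for all \<open>z\<close> and \<open>x\<close>, the two estimates that single it out. As \<open>q\<close> is continuous on \<open>(0,b]\<close>, solutions
  are classical. Values of \<open>\<xi>(z,\<cdot>)\<close> outside \<open>(0,b]\<close> play no role.
\<close>

definition regular_solution ::
    "real \<Rightarrow> (real \<Rightarrow> real) \<Rightarrow> real \<Rightarrow> (complex \<Rightarrow> real \<Rightarrow> complex) \<Rightarrow> bool" where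
  "regular_solution \<nu> q b \<xi> \<longleftrightarrow>
     (\<forall>z. \<forall>x\<in>{0<..b}.
        (\<xi> z has_vector_derivative dx b (\<xi> z) x) (at x within {0<..b}) \<and>
        (dx b (\<xi> z) has_vector_derivative dx b (dx b (\<xi> z)) x) (at x within {0<..b}) \<and>
        - dx b (dx b (\<xi> z)) x + of_real ((\<nu>\<^sup>2 - 1/4) / x\<^sup>2 + q x) * \<xi> z x = z * \<xi> z x) \<and>
     (\<exists>C. \<forall>z. \<forall>x\<in>{0<..b}.
        norm (\<xi> z x - xi_free \<nu> z x) \<le>
          C * (x / (1 + norm (csqrt z) * x)) powr (\<nu> + 1/2) * exp (\<bar>Im (csqrt z)\<bar> * x) *
          (LINT u|lebesgue_on {0<..<x}. u * \<bar>q u\<bar> / (1 + norm (csqrt z) * u)) \<and>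
        norm (dx b (\<xi> z) x - dx b (xi_free \<nu> z) x) \<le>
          C * (x / (1 + norm (csqrt z) * x)) powr (\<nu> - 1/2) * exp (\<bar>Im (csqrt z)\<bar> * x) *
          (LINT u|lebesgue_on {0<..<x}. u * \<bar>q u\<bar> / (1 + norm (csqrt z) * u)))"

subsection \<open>De Branges spaces\<close>

definition transform :: "(complex \<Rightarrow> real \<Rightarrow> complex) \<Rightarrow> real \<Rightarrow> (real \<Rightarrow> complex) \<Rightarrow> complex \<Rightarrow> complex" where
  "transform \<xi> s \<phi> z = (LINT x|lebesgue_on {0<..<s}. \<xi> z x * \<phi> x)"

definition dB :: "(complex \<Rightarrow> real \<Rightarrow> complex) \<Rightarrow> real \<Rightarrow> (complex \<Rightarrow> complex) set" where
  "dB \<xi> s = transform \<xi> s ` L2 s"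

definition dB_norm :: "(complex \<Rightarrow> real \<Rightarrow> complex) \<Rightarrow> real \<Rightarrow> (complex \<Rightarrow> complex) \<Rightarrow> real" where
  "dB_norm \<xi> s F = L2_norm_on s (SOME \<phi>. \<phi> \<in> L2 s \<and> transform \<xi> s \<phi> = F)"

definition dB_kernel :: "(complex \<Rightarrow> real \<Rightarrow> complex) \<Rightarrow> real \<Rightarrow> complex \<Rightarrow> complex \<Rightarrow> complex" where
  "dB_kernel \<xi> s z w = (LINT x|lebesgue_on {0<..<s}. \<xi> z x * \<xi> (cnj w) x)"

subsection \<open>The selfadjoint operators and their spectra\<close>

text \<open>
  Graph of \<open>H\<^sub>s\<^sub>,\<^sub>\<gamma>\<close>: \<open>\<phi>\<close> is the continuous representative of an element of the domain, \<open>\<phi>'\<close> its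
  (continuous) derivative on \<open>(0,s]\<close>, \<open>\<phi>''\<close> an a.e. derivative of \<open>\<phi>'\<close>, and \<open>\<eta>\<close> represents the image.
\<close>

definition H_graph ::
    "real \<Rightarrow> (real \<Rightarrow> real) \<Rightarrow> real \<Rightarrow> real \<Rightarrow> (real \<Rightarrow> complex) \<Rightarrow> (real \<Rightarrow> complex) \<Rightarrow> bool" where
  "H_graph \<nu> q s \<gamma> \<phi> \<eta> \<longleftrightarrow>
     \<phi> \<in> L2 s \<and> \<eta> \<in> L2 s \<and>
     (\<exists>\<phi>' \<phi>''. AC_loc_deriv s \<phi> \<phi>' \<and> AC_loc_deriv s \<phi>' \<phi>'' \<and>
        (AE x in lebesgue_on {0<..<s}.
           \<eta> x = - \<phi>'' x + of_real ((\<nu>\<^sup>2 - 1/4) / x\<^sup>2 + q x) * \<phi> x) \<and>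
        \<phi> s * of_real (cos \<gamma>) + \<phi>' s * of_real (sin \<gamma>) = 0 \<and>
        (\<nu> < 1 \<longrightarrow>
           ((\<lambda>x. of_real (x powr (\<nu> - 1/2)) * (of_real (\<nu> + 1/2) * \<phi> x - of_real x * \<phi>' x))
              \<longlongrightarrow> 0) (at_right 0)))"

text \<open>
  Graph of \<open>S\<^sub>s\<^sub>,\<^sub>\<gamma>\<close>: the image of the graph of \<open>H\<^sub>s\<^sub>,\<^sub>\<gamma>\<close> under the unitary map from \<open>L\<^sup>2(0,s)\<close>
  onto the de Branges space.
\<close>

definition S_graph ::
    "(complex \<Rightarrow> real \<Rightarrow> complex) \<Rightarrow> real \<Rightarrow> (real \<Rightarrow> real) \<Rightarrow> real \<Rightarrow> real \<Rightarrow>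
     (complex \<Rightarrow> complex) \<Rightarrow> (complex \<Rightarrow> complex) \<Rightarrow> bool" where
  "S_graph \<xi> \<nu> q s \<gamma> F G \<longleftrightarrow>
     (\<exists>\<phi> \<eta>. H_graph \<nu> q s \<gamma> \<phi> \<eta> \<and> F = transform \<xi> s \<phi> \<and> G = transform \<xi> s \<eta>)"

text \<open>
  The spectrum is the complement of the set of all \<open>l\<close> for which \<open>S - l\<close> maps its domain bijectively
  onto the space and has a bounded inverse.
\<close>

definition S_spectrum ::
    "(complex \<Rightarrow> real \<Rightarrow> complex) \<Rightarrow> real \<Rightarrow> (real \<Rightarrow> real) \<Rightarrow> real \<Rightarrow> real \<Rightarrow> complex set" where
  "S_spectrum \<xi> \<nu> q s \<gamma> =
     {l. \<not> ((\<forall>R \<in> dB \<xi> s. \<exists>!F. \<exists>G. S_graph \<xi> \<nu> q s \<gamma> F G \<and> (\<lambda>z. G z - l * F z) = R) \<and>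
            (\<exists>C. \<forall>F G. S_graph \<xi> \<nu> q s \<gamma> F G \<longrightarrow>
               dB_norm \<xi> s F \<le> C * dB_norm \<xi> s (\<lambda>z. G z - l * F z)))}"

subsection \<open>Sampling\<close>

text \<open>
  In the following \<open>\<sigma>\<close> is the spectrum that serves as set of sampling points for the space at \<open>a\<close>.
  The series over \<open>\<sigma>\<close> are unordered sums.
\<close>

definition sampling_term ::
    "(complex \<Rightarrow> real \<Rightarrow> complex) \<Rightarrow> real \<Rightarrow> (complex \<Rightarrow> complex) \<Rightarrow> complex \<Rightarrow> complex \<Rightarrow> complex" where
  "sampling_term \<xi> a F z l = dB_kernel \<xi> a z l / dB_kernel \<xi> a l l * F l"

definition sampling_sum ::
    "(complex \<Rightarrow> real \<Rightarrow> complex) \<Rightarrow> real \<Rightarrow> complex set \<Rightarrow> (complex \<Rightarrow> complex) \<Rightarrow> complex \<Rightarrow> complex" where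
  "sampling_sum \<xi> a \<sigma> F z = (\<Sum>\<^sub>\<infinity>l\<in>\<sigma>. sampling_term \<xi> a F z l)"

definition xi_ext ::
    "(complex \<Rightarrow> real \<Rightarrow> complex) \<Rightarrow> real \<Rightarrow> complex set \<Rightarrow> complex \<Rightarrow> real \<Rightarrow> complex" where
  "xi_ext \<xi> a \<sigma> z x = sampling_sum \<xi> a \<sigma> (\<lambda>l. \<xi> l x) z"

definition h_bound ::
    "(complex \<Rightarrow> real \<Rightarrow> complex) \<Rightarrow> real \<Rightarrow> real \<Rightarrow> complex set \<Rightarrow> complex \<Rightarrow> real" where
  "h_bound \<xi> a b \<sigma> z = (SUP x\<in>{a..b}. norm (xi_ext \<xi> a \<sigma> z x - \<xi> z x))"

end

theory Submission
  imports Defs "HOL-Complex_Analysis.Great_Picard"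
begin

text \<open>
  The spectrum of \<open>S\<^sub>a\<^sub>,\<^sub>\<gamma>\<close> is the zero set \<open>Z\<close> of \<open>\<Delta>(z) = \<xi>(z,a) cos \<gamma> + \<xi>'(z,a) sin \<gamma>\<close>, and the
  functions \<open>\<xi>(\<lambda>,\<cdot>)\<close>, \<open>\<lambda> \<in> Z\<close>, form a complete orthogonal system in \<open>L\<^sup>2(0,a)\<close>: they are the
  eigenfunctions of the resolvent, a compact symmetric operator, whose largest eigenvalue on the
  orthogonal complement of finitely many eigenfunctions is produced by the power iteration.
  Expanding \<open>\<xi>(z,\<cdot>)\<close> in this system gives the sampling formula on \<open>\<B>\<^sub>a\<close>.

  Splitting \<open>\<psi>\<close> at \<open>a\<close>, the sampling formula leaves only the contribution of \<open>[a,b]\<close>, which is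
  \<open>\<integral>\<^sub>a\<^sup>b (\<xi>(z,x) - \<xi>\<^sub>a\<^sup>e\<^sup>x\<^sup>t(z,x)) \<psi>(x) dx\<close> as soon as sum and integral may be interchanged. By Gronwall's
  inequality \<open>|\<xi>(\<lambda>,x)| \<le> M |\<xi>(\<lambda>,a)|\<close> on \<open>[a,b]\<close> uniformly in \<open>\<lambda> \<in> Z\<close>. Lagrange's identity
  \<open>(z - \<lambda>) K\<^sub>a(z,\<lambda>) sin \<gamma> = - \<xi>(\<lambda>,a) \<Delta>(z)\<close> therefore bounds the terms of the series by a multiple of
  \<open>\<xi>(\<lambda>,a)\<^sup>2 / (K\<^sub>a(\<lambda>,\<lambda>) |\<lambda>|)\<close>, which is summable because evaluation at \<open>a\<close> is bounded with respect to
  the quadratic form of the operator.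
\<close>

subsection \<open>Eigenvectors of compact symmetric operators\<close>

text \<open>Both end points cause difficulties. At \<open>0\<close> the potential is singular: for
  \<open>\<nu> < 1\<close> every solution is square integrable there, and for
  \<open>\<nu> < 1/2\<close> the Bessel term is even attractive. The domain functions
  \<open>dom\<close> are therefore described by growth \<open>x powr m\<close> with
  \<open>m > 1/2\<close>, which kills every boundary term at \<open>0\<close> for all
  \<open>\<nu>\<close> alike. Besides the equation, only the leading orders of \<open>\<xi>\<close>
  and its derivative at \<open>0\<close> enter; the last section extracts them from the defining
  estimates. At \<open>a\<close>, \<open>\<xi> z\<close> violates the boundary condition unless
  \<open>z \<in> Z\<close>, so it gets into the domain only after multiplication by a cutoff. The
  iteration acts on continuous real functions instead of classes in a Hilbert space: the resolvent
  maps balls of the \<open>L2\<close> seminorm to bounded equicontinuous families, and Arzela-Ascoli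
  supplies the compactness. A shift \<open>T\<close> makes the quadratic form at least
  \<open>u(a)\<^sup>2\<close> plus the squared norm; this one inequality yields uniqueness, a lower
  bound of the spectrum and control of the values at \<open>a\<close>.\<close>

lemma gronwall:
  fixes E E' :: "real \<Rightarrow> real"
  assumes cont: "continuous_on {c..d} E"
    and der: "\<And>x. c < x \<Longrightarrow> x < d \<Longrightarrow> (E has_real_derivative E' x) (at x)"
    and bnd: "\<And>x. c < x \<Longrightarrow> x < d \<Longrightarrow> \<bar>E' x\<bar> \<le> K * E x"
    and xy: "x \<in> {c..d}" "y \<in> {c..d}"
  shows "E x \<le> E y * exp (K * \<bar>x - y\<bar>)"
proof (cases "x \<le> y")
  case True
  \<comment> \<open>The integrating factor uses \<open>E' >= - K * E\<close>; for
    \<open>y < x\<close> the weight \<open>exp (- K * t)\<close> and the opposite half of the bound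
    take over, so the estimate works in both directions.\<close>
  have "E x * exp (K * x) \<le> E y * exp (K * y)"
  proof (rule DERIV_nonneg_imp_increasing_open[OF True])
    fix t assume t: "x < t" "t < y"
    then have t': "c < t" "t < d" using xy by auto
    have "((\<lambda>t. E t * exp (K * t)) has_real_derivative (E' t + K * E t) * exp (K * t)) (at t)"
      by (auto intro!: derivative_eq_intros der[OF t'] simp: algebra_simps)
    moreover have "(E' t + K * E t) * exp (K * t) \<ge> 0"
      using bnd[OF t'] by (intro mult_nonneg_nonneg) auto
    ultimately show "\<exists>z. ((\<lambda>t. E t * exp (K * t)) has_real_derivative z) (at t) \<and> z \<ge> 0"
      by blast
  next
    show "continuous_on {x..y} (\<lambda>t. E t * exp (K * t))"
      using xy by (intro continuous_intros continuous_on_subset[OF cont]) auto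
  qed
  then show ?thesis using True by (simp add: field_simps exp_diff)
next
  case False
  have "E x * exp (- K * x) \<le> E y * exp (- K * y)"
  proof (rule DERIV_nonpos_imp_decreasing_open[of y x "\<lambda>t. E t * exp (- K * t)"])
    show "y \<le> x" using False by simp
    fix t assume t: "y < t" "t < x"
    then have t': "c < t" "t < d" using xy by auto
    have "((\<lambda>t. E t * exp (- K * t)) has_real_derivative (E' t - K * E t) * exp (- K * t)) (at t)"
      by (auto intro!: derivative_eq_intros der[OF t'] simp: algebra_simps)
    moreover have "(E' t - K * E t) * exp (- K * t) \<le> 0"
      using bnd[OF t'] by (intro mult_nonpos_nonneg) auto
    ultimately show "\<exists>z. ((\<lambda>t. E t * exp (- K * t)) has_real_derivative z) (at t) \<and> z \<le> 0"
      by blast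
  next
    show "continuous_on {y..x} (\<lambda>t. E t * exp (- K * t))"
      using xy by (intro continuous_intros continuous_on_subset[OF cont]) auto
  qed
  then show ?thesis using False by (simp add: field_simps exp_diff exp_minus)
qed

section \<open>Inner products and Cauchy-Schwarz for continuous real functions\<close>

lemma continuous_on_Icc_bounded:
  fixes f :: "real \<Rightarrow> 'a::real_normed_vector"
  assumes "continuous_on {c..d} f"
  obtains B where "0 < B" "\<And>x. x \<in> {c..d} \<Longrightarrow> norm (f x) \<le> B"
proof -
  obtain B where "B > 0" "\<forall>y\<in>f ` {c..d}. norm y \<le> B"
    using compact_imp_bounded[OF compact_continuous_image[OF assms compact_Icc]]
    unfolding bounded_pos by blast
  then show ?thesis using that by blast
qed

text \<open>Bilinear and on real functions: spectrum and eigenfunctions are real, so complex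
  functions are later treated through their real and imaginary parts.\<close>

definition ip :: "real \<Rightarrow> (real \<Rightarrow> real) \<Rightarrow> (real \<Rightarrow> real) \<Rightarrow> real" where
  "ip a f g = integral {0..a} (\<lambda>x. f x * g x)"

lemma ip_commute: "ip a f g = ip a g f"
  by (simp add: ip_def mult.commute)

lemma ip_int:
  fixes f g :: "real \<Rightarrow> real"
  assumes "continuous_on {0..a} f" "continuous_on {0..a} g"
  shows "(\<lambda>x. f x * g x) integrable_on {0..a}"
  by (rule integrable_continuous_real) (intro continuous_intros assms)

lemma ip_cong:
  assumes "\<And>x. x \<in> {0..a} \<Longrightarrow> f x = f' x" "\<And>x. x \<in> {0..a} \<Longrightarrow> g x = g' x"
  shows "ip a f g = ip a f' g'"
  unfolding ip_def using assms by (intro integral_cong) auto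

lemma ip_lin_left:
  assumes "continuous_on {0..a} f" "continuous_on {0..a} g" "continuous_on {0..a} h"
  shows "ip a (\<lambda>x. c * f x + d * g x) h = c * ip a f h + d * ip a g h"
proof -
  have "ip a (\<lambda>x. c * f x + d * g x) h = integral {0..a} (\<lambda>x. c * (f x * h x) + d * (g x * h x))"
    unfolding ip_def by (simp add: algebra_simps)
  also have "\<dots> = c * ip a f h + d * ip a g h"
    using assms unfolding ip_def
    by (subst integral_add) (auto intro!: integrable_continuous_real continuous_intros)
  finally show ?thesis .
qed

lemma ip_lin_right:
  assumes "continuous_on {0..a} f" "continuous_on {0..a} g" "continuous_on {0..a} h"
  shows "ip a h (\<lambda>x. c * f x + d * g x) = c * ip a h f + d * ip a h g"
  using ip_lin_left[OF assms, of c d] by (simp add: ip_commute)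

lemma ip_sum_left:
  assumes "finite L" "\<And>l. l \<in> L \<Longrightarrow> continuous_on {0..a} (f l)" "continuous_on {0..a} h"
  shows "ip a (\<lambda>x. \<Sum>l\<in>L. c l * f l x) h = (\<Sum>l\<in>L. c l * ip a (f l) h)"
proof -
  have "ip a (\<lambda>x. \<Sum>l\<in>L. c l * f l x) h = integral {0..a} (\<lambda>x. \<Sum>l\<in>L. c l * (f l x * h x))"
    unfolding ip_def by (simp add: sum_distrib_right mult.assoc)
  also have "\<dots> = (\<Sum>l\<in>L. integral {0..a} (\<lambda>x. c l * (f l x * h x)))"
    using assms by (intro integral_sum) (auto intro!: integrable_continuous_real continuous_intros)
  finally show ?thesis by (simp add: ip_def)
qed

lemma ip_nonneg: "continuous_on {0..a} f \<Longrightarrow> 0 \<le> ip a f f"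
  unfolding ip_def by (intro integral_nonneg ip_int) auto

text \<open>The minimum of the polynomial, at \<open>t = - B / C\<close>, is nonnegative. In this
  form the argument serves Cauchy-Schwarz for the integral of continuous functions as well as for
  the Lebesgue integral.\<close>

lemma quadratic_discriminant_le:
  fixes A B C :: real
  assumes "\<And>t. 0 \<le> A + 2 * t * B + t\<^sup>2 * C" "0 \<le> C"
  shows "B\<^sup>2 \<le> A * C"
proof (cases "C = 0")
  case True
  have "B = 0"
  proof (rule ccontr)
    assume "B \<noteq> 0"
    \<comment> \<open>At this \<open>t\<close> the affine function \<open>A + 2 * t * B\<close>
      takes the value \<open>-1\<close>.\<close>
    then show False
      using assms(1)[of "- (A + 1) / (2 * B)"] True by (simp add: field_simps)
  qed
  then show ?thesis using True by simp
next
  case False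
  then have "C > 0" using assms(2) by simp
  have "0 \<le> (A + 2 * (- B / C) * B + (- B / C)\<^sup>2 * C) * C"
    using assms(1)[of "- B / C"] assms(2) by (intro mult_nonneg_nonneg) auto
  also have "\<dots> = A * C - B\<^sup>2"
    using \<open>C > 0\<close> by (simp add: field_simps power2_eq_square)
  finally show ?thesis by simp
qed

lemma integral_cauchy_schwarz:
  fixes f g :: "real \<Rightarrow> real"
  assumes f: "continuous_on {c..d} f" and g: "continuous_on {c..d} g"
  shows "(integral {c..d} (\<lambda>x. f x * g x))\<^sup>2 \<le>
    integral {c..d} (\<lambda>x. (f x)\<^sup>2) * integral {c..d} (\<lambda>x. (g x)\<^sup>2)"
proof (rule quadratic_discriminant_le)
  fix t :: real
  have "0 \<le> integral {c..d} (\<lambda>x. (f x + t * g x)\<^sup>2)"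
    using f g by (intro integral_nonneg integrable_continuous_real continuous_intros) auto
  also have "\<dots> = integral {c..d} (\<lambda>x. ((f x)\<^sup>2 + (2 * t) * (f x * g x)) + t\<^sup>2 * (g x)\<^sup>2)"
    by (simp add: power2_eq_square algebra_simps)
  also have "\<dots> = integral {c..d} (\<lambda>x. (f x)\<^sup>2) + 2 * t * integral {c..d} (\<lambda>x. f x * g x) +
      t\<^sup>2 * integral {c..d} (\<lambda>x. (g x)\<^sup>2)"
    using f g
    by (subst integral_add, (auto intro!: integrable_continuous_real continuous_intros)[2])+ simp
  finally show "0 \<le> integral {c..d} (\<lambda>x. (f x)\<^sup>2) + 2 * t * integral {c..d} (\<lambda>x. f x * g x) +
      t\<^sup>2 * integral {c..d} (\<lambda>x. (g x)\<^sup>2)" .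
next
  show "0 \<le> integral {c..d} (\<lambda>x. (g x)\<^sup>2)"
    using g by (intro integral_nonneg integrable_continuous_real continuous_intros) auto
qed

lemma ip_cauchy_schwarz:
  assumes "continuous_on {0..a} f" "continuous_on {0..a} g"
  shows "(ip a f g)\<^sup>2 \<le> ip a f f * ip a g g"
  using integral_cauchy_schwarz[OF assms] by (simp add: ip_def power2_eq_square)

lemma ip_eq_0D:
  assumes "0 < a" "continuous_on {0..a} f" "ip a f f = 0" "x \<in> {0..a}"
  shows "f x = 0"
proof -
  have "(\<forall>x\<in>{0..a}. f x * f x = 0)"
    using assms by (subst integral_eq_0_iff[symmetric]) (auto simp: ip_def intro!: continuous_intros)
  then show ?thesis using assms by auto
qed

text \<open>Along the power iteration of a symmetric operator the quotients of consecutive norms increase,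
  and a limit point of the normalised iterates is an eigenvector of the square of the operator.\<close>

lemma power_iteration_eigenvector:
  fixes R :: "(real \<Rightarrow> real) \<Rightarrow> real \<Rightarrow> real"
  assumes a: "0 < a"
    and lin: "\<And>f g c d x. \<lbrakk>continuous_on {0..a} f; continuous_on {0..a} g; x \<in> {0..a}\<rbrakk> \<Longrightarrow>
                R (\<lambda>x. c * f x + d * g x) x = c * R f x + d * R g x"
    and cont: "\<And>f. continuous_on {0..a} f \<Longrightarrow> continuous_on {0..a} (R f)"
    and sym: "\<And>f g. \<lbrakk>continuous_on {0..a} f; continuous_on {0..a} g\<rbrakk> \<Longrightarrow> ip a (R f) g = ip a f (R g)"
    and bnd: "\<And>f x. \<lbrakk>continuous_on {0..a} f; x \<in> {0..a}\<rbrakk> \<Longrightarrow> \<bar>R f x\<bar> \<le> B * sqrt (ip a f f)"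
    and equi: "\<And>f x y. \<lbrakk>continuous_on {0..a} f; x \<in> {0..a}; y \<in> {0..a}\<rbrakk> \<Longrightarrow>
                \<bar>R f x - R f y\<bar> \<le> sqrt (ip a f f) * \<bar>\<omega> x - \<omega> y\<bar>"
    and \<omega>: "continuous_on {0..a} \<omega>"
    and contL: "\<And>e. e \<in> L \<Longrightarrow> continuous_on {0..a} e"
    and invL: "\<And>f e. \<lbrakk>continuous_on {0..a} f; \<forall>e\<in>L. ip a f e = 0; e \<in> L\<rbrakk> \<Longrightarrow> ip a (R f) e = 0"
    and f: "continuous_on {0..a} f" "\<forall>e\<in>L. ip a f e = 0"
    and \<epsilon>: "0 \<le> \<epsilon>" "\<epsilon>\<^sup>2 * ip a f f < ip a (R f) (R f)"
  obtains w \<mu> where "continuous_on {0..a} w" "\<forall>e\<in>L. ip a w e = 0" "\<epsilon> < \<bar>\<mu>\<bar>"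
    "\<And>x. x \<in> {0..a} \<Longrightarrow> R w x = \<mu> * w x" "ip a w w > 0"
proof -
  define F where "F n = (R ^^ n) f" for n
  define A where "A n = ip a (F n) (F n)" for n
  have F0: "F 0 = f" and FS: "F (Suc n) = R (F n)" for n by (auto simp: F_def)
  have Fc: "continuous_on {0..a} (F n)" for n by (induction n) (auto simp: F0 FS f cont)
  have FL: "\<forall>e\<in>L. ip a (F n) e = 0" for n
    by (induction n) (use f invL Fc in \<open>auto simp: F0 FS\<close>)
  have A_nn: "0 \<le> A n" for n unfolding A_def by (rule ip_nonneg[OF Fc])
  \<comment> \<open>Moving one \<open>R\<close> across the inner product turns
    \<open>A (Suc n)\<close> into the product of \<open>F n\<close> and
    \<open>F (Suc (Suc n))\<close>; Cauchy-Schwarz then makes \<open>A\<close> log-convex, so the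
    quotients \<open>r\<close> increase.\<close>
  have lc: "(A (Suc n))\<^sup>2 \<le> A n * A (Suc (Suc n))" for n
  proof -
    have "A (Suc n) = ip a (F n) (F (Suc (Suc n)))"
      unfolding A_def using sym[OF Fc Fc[of "Suc n"], of n] by (simp only: FS)
    then show ?thesis unfolding A_def using ip_cauchy_schwarz[OF Fc Fc] by simp
  qed
  have A0: "A 0 > 0"
  proof (rule ccontr)
    assume "\<not> A 0 > 0"
    then have "A 0 = 0" using A_nn[of 0] by linarith
    then have "ip a f f = 0" by (simp add: A_def F0)
    then have "R f x = 0" if "x \<in> {0..a}" for x using bnd[OF f(1) that] by simp
    then have "ip a (R f) (R f) = ip a (\<lambda>_. 0) (\<lambda>_. 0)" by (intro ip_cong) auto
    then show False using \<epsilon> \<open>ip a f f = 0\<close> by (simp add: ip_def)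
  qed
  have A1: "A 1 > \<epsilon>\<^sup>2 * A 0" using \<epsilon> by (simp add: A_def F0 FS)
  have pos: "A n > 0 \<and> A (Suc n) > 0" for n
  proof (induction n)
    case 0
    have "0 \<le> \<epsilon>\<^sup>2 * A 0" using A0 by simp
    then have "A 1 > 0" using A1 by linarith
    then show ?case using A0 by simp
  next
    case (Suc n)
    have "0 < (A (Suc n))\<^sup>2" using Suc by simp
    also have "\<dots> \<le> A n * A (Suc (Suc n))" by (rule lc)
    finally have "A (Suc (Suc n)) > 0" using Suc by (simp add: zero_less_mult_iff)
    then show ?case using Suc by simp
  qed
  then have pos: "A n > 0" for n by blast
  define r where "r n = A (Suc n) / A n" for n
  have rinc: "r n \<le> r (Suc n)" for n
    unfolding r_def using lc[of n] pos[of n] pos[of "Suc n"] by (simp add: field_simps power2_eq_square)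
  \<comment> \<open>The pointwise bound, squared and integrated over \<open>{0..a}\<close>. The
    increasing quotients therefore converge; their limit \<open>s\<close> will be the square of the
    eigenvalue.\<close>
  have r_le: "r n \<le> B\<^sup>2 * a" for n
  proof -
    have "A (Suc n) \<le> integral {0..a} (\<lambda>x. B\<^sup>2 * A n)"
      unfolding A_def ip_def
    proof (rule integral_le)
      fix x assume x: "x \<in> {0..a}"
      have "\<bar>F (Suc n) x\<bar>\<^sup>2 \<le> (B * sqrt (ip a (F n) (F n)))\<^sup>2"
        using bnd[OF Fc x, of n] by (intro power_mono) (auto simp: FS)
      also have "\<dots> = B\<^sup>2 * ip a (F n) (F n)"
        using A_nn[of n] by (simp add: power_mult_distrib A_def)
      finally show "F (Suc n) x * F (Suc n) x \<le> B\<^sup>2 * integral {0..a} (\<lambda>x. F n x * F n x)"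
        by (simp add: power2_eq_square ip_def)
    qed (use ip_int[OF Fc Fc] in auto)
    then show ?thesis unfolding r_def using pos[of n] a by (simp add: field_simps)
  qed
  have "incseq r" using rinc by (rule incseq_SucI)
  then obtain s where s: "r \<longlonglongrightarrow> s" "\<And>n. r n \<le> s"
    using incseq_convergent[of r "B\<^sup>2 * a"] r_le by blast
  have s_gt: "s > \<epsilon>\<^sup>2"
  proof -
    have "\<epsilon>\<^sup>2 < r 0" using A1 A0 by (simp add: r_def field_simps)
    then show ?thesis using s(2)[of 0] by linarith
  qed
  have s_nn: "0 \<le> s" using s_gt zero_le_power2[of \<epsilon>] by linarith
  define g where "g n x = F n x / sqrt (A n)" for n x
  \<comment> \<open>Only values of \<open>R\<close> are equicontinuous, so the convergent
    subsequence is extracted from the images \<open>h\<close> of the normalised iterates and not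
    from \<open>g\<close> itself.\<close>
  define h where "h n = R (g n)" for n
  have gc: "continuous_on {0..a} (g n)" for n
    unfolding g_def[abs_def] using pos[of n] by (intro continuous_intros Fc) auto
  have hc: "continuous_on {0..a} (h n)" for n unfolding h_def by (rule cont[OF gc])
  have ipg: "ip a (g n) (g n) = 1" for n
  proof -
    have "ip a (g n) (g n) = ip a (\<lambda>x. (1 / sqrt (A n)) * F n x + 0 * F n x) (\<lambda>x. (1 / sqrt (A n)) * F n x + 0 * F n x)"
      by (intro ip_cong) (auto simp: g_def)
    also have "\<dots> = (1 / sqrt (A n)) * ((1 / sqrt (A n)) * A n)"
      by (subst ip_lin_left, (intro continuous_intros Fc)+)
         (subst ip_lin_right, (intro continuous_intros Fc)+, simp add: A_def)
    also have "\<dots> = 1" using pos[of n] by (simp add: field_simps)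
    finally show ?thesis .
  qed
  have Rscale: "R (\<lambda>x. c * u x) x = c * R u x" if "continuous_on {0..a} u" "x \<in> {0..a}" for c u x
    using lin[OF that(1) that(1) that(2), of c 0] by simp
  have g_alt: "g n = (\<lambda>x. (1 / sqrt (A n)) * F n x)" for n by (auto simp: g_def)
  have h_alt: "h n x = F (Suc n) x / sqrt (A n)" if "x \<in> {0..a}" for n x
    unfolding h_def g_alt using Rscale[OF Fc that, of "1 / sqrt (A n)" n] by (simp add: FS)
  have hbnd: "\<bar>h n x\<bar> \<le> B" if "x \<in> {0..a}" for n x
    using bnd[OF gc that, of n] by (simp add: h_def ipg)
  have hequi: "\<bar>h n x - h n y\<bar> \<le> \<bar>\<omega> x - \<omega> y\<bar>" if "x \<in> {0..a}" "y \<in> {0..a}" for n x y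
    using equi[OF gc that, of n] by (simp add: h_def ipg)
  obtain H \<kappa> where H: "continuous_on {0..a} H" and \<kappa>: "strict_mono (\<kappa> :: nat \<Rightarrow> nat)"
    and unif: "\<And>e. 0 < e \<Longrightarrow> \<exists>N. \<forall>n x. n \<ge> N \<and> x \<in> {0..a} \<longrightarrow> norm (h (\<kappa> n) x - H x) < e"
  proof (rule Arzela_Ascoli[of "{0..a}" h B])
    show "\<exists>d>0. \<forall>n y. y \<in> {0..a} \<and> norm (x - y) < d \<longrightarrow> norm (h n x - h n y) < e"
      if x: "x \<in> {0..a}" and e: "0 < e" for x e
    proof -
      from \<omega> x e obtain d where d: "d > 0" "\<And>y. y \<in> {0..a} \<Longrightarrow> dist y x < d \<Longrightarrow> dist (\<omega> y) (\<omega> x) < e"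
        unfolding continuous_on_iff by blast
      have "norm (h n x - h n y) < e" if "y \<in> {0..a}" "norm (x - y) < d" for n y
        using hequi[OF x that(1), of n] d(2)[OF that(1)] that(2) by (auto simp: dist_norm norm_minus_commute abs_minus_commute)
      then show ?thesis using d(1) by blast
    qed
  qed (use hbnd in \<open>auto\<close>)
  have Hlim: "(\<lambda>n. h (\<kappa> n) x) \<longlonglongrightarrow> H x" if "x \<in> {0..a}" for x
    using unif that unfolding LIMSEQ_iff by blast
  have Hbnd: "\<bar>H x\<bar> \<le> B" if "x \<in> {0..a}" for x
    using Lim_bounded[OF tendsto_rabs[OF Hlim[OF that]]] hbnd[OF that] by blast
  have B0: "0 \<le> B" using hbnd[of 0 0] a by auto
  have lim_ip: "(\<lambda>n. ip a (u n) (v n)) \<longlonglongrightarrow> ip a U V"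
    if u: "\<And>n. continuous_on {0..a} (u n)" "\<And>n x. x \<in> {0..a} \<Longrightarrow> \<bar>u n x\<bar> \<le> C"
          "\<And>x. x \<in> {0..a} \<Longrightarrow> (\<lambda>n. u n x) \<longlonglongrightarrow> U x"
       and v: "\<And>n. continuous_on {0..a} (v n)" "\<And>n x. x \<in> {0..a} \<Longrightarrow> \<bar>v n x\<bar> \<le> D"
          "\<And>x. x \<in> {0..a} \<Longrightarrow> (\<lambda>n. v n x) \<longlonglongrightarrow> V x" for u v U V C D
    unfolding ip_def
  proof (rule dominated_convergence(2)[where h = "\<lambda>_. C * D"])
    show "(\<lambda>x. u n x * v n x) integrable_on {0..a}" for n by (rule ip_int[OF u(1) v(1)])
    show "norm (u n x * v n x) \<le> C * D" if "x \<in> {0..a}" for n x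
      using u(2)[OF that, of n] v(2)[OF that, of n] by (auto simp: abs_mult intro!: mult_mono order_trans[OF abs_ge_zero])
  qed (use u(3) v(3) in \<open>auto intro!: tendsto_mult\<close>)
  define d where "d n = sqrt (ip a (\<lambda>x. h (\<kappa> n) x - H x) (\<lambda>x. h (\<kappa> n) x - H x))" for n
  have dlim: "d \<longlonglongrightarrow> 0"
  proof -
    have "(\<lambda>n. ip a (\<lambda>x. h (\<kappa> n) x - H x) (\<lambda>x. h (\<kappa> n) x - H x)) \<longlonglongrightarrow> ip a (\<lambda>_. 0) (\<lambda>_. 0)"
    proof (rule lim_ip[where C = "2 * B" and D = "2 * B"])
      show "\<bar>h (\<kappa> n) x - H x\<bar> \<le> 2 * B" if "x \<in> {0..a}" for n x
        using hbnd[OF that, of "\<kappa> n"] Hbnd[OF that] by linarith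
      then show "\<bar>h (\<kappa> n) x - H x\<bar> \<le> 2 * B" if "x \<in> {0..a}" for n x using that by blast
      show "(\<lambda>n. h (\<kappa> n) x - H x) \<longlonglongrightarrow> 0" if "x \<in> {0..a}" for x
        using Hlim[OF that] by (simp add: LIM_zero)
      then show "(\<lambda>n. h (\<kappa> n) x - H x) \<longlonglongrightarrow> 0" if "x \<in> {0..a}" for x using that by blast
    qed (intro continuous_intros hc H)+
    from tendsto_real_sqrt[OF this] show ?thesis by (simp add: d_def[abs_def] ip_def)
  qed
  have RH: "(\<lambda>n. R (h (\<kappa> n)) x) \<longlonglongrightarrow> R H x" if x: "x \<in> {0..a}" for x
  proof (rule LIM_zero_cancel, rule Lim_null_comparison)
    show "\<forall>\<^sub>F n in sequentially. norm (R (h (\<kappa> n)) x - R H x) \<le> B * d n"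
    proof (rule always_eventually, rule allI)
      fix n
      have "R (\<lambda>x. 1 * h (\<kappa> n) x + (-1) * H x) x = 1 * R (h (\<kappa> n)) x + (-1) * R H x"
        by (rule lin[OF hc H x])
      moreover have "(\<lambda>x. 1 * h (\<kappa> n) x + (-1) * H x) = (\<lambda>x. h (\<kappa> n) x - H x)" by auto
      ultimately have "R (h (\<kappa> n)) x - R H x = R (\<lambda>x. h (\<kappa> n) x - H x) x" by simp
      then show "norm (R (h (\<kappa> n)) x - R H x) \<le> B * d n"
        using bnd[OF _ x, of "\<lambda>x. h (\<kappa> n) x - H x"] hc H by (simp add: d_def continuous_intros)
    qed
    show "(\<lambda>n. B * d n) \<longlonglongrightarrow> 0" using tendsto_mult_left[OF dlim, of B] by simp
  qed
  have Rh_alt: "R (h n) x = F (Suc (Suc n)) x / sqrt (A n)" if "x \<in> {0..a}" for n x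
  proof -
    have "R (h n) x = R (\<lambda>x. (1 / sqrt (A n)) * F (Suc n) x) x"
    proof -
      \<comment> \<open>\<open>h n\<close> is a multiple of \<open>F (Suc n)\<close> only on
        \<open>{0..a}\<close>, while \<open>R\<close> is applied to functions on the whole line. The
        difference has norm \<open>0\<close>, so \<open>bnd\<close> annihilates its image.\<close>
      let ?e = "\<lambda>x. h n x - (1 / sqrt (A n)) * F (Suc n) x"
      have ec: "continuous_on {0..a} ?e" by (intro continuous_intros hc Fc)
      have "ip a ?e ?e = ip a (\<lambda>_. 0) (\<lambda>_. 0)" by (intro ip_cong) (auto simp: h_alt)
      then have "R ?e x = 0" using bnd[OF ec that] by (simp add: ip_def)
      moreover have "R (\<lambda>x. 1 * h n x + (-1) * ((1 / sqrt (A n)) * F (Suc n) x)) x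
          = 1 * R (h n) x + (-1) * R (\<lambda>x. (1 / sqrt (A n)) * F (Suc n) x) x"
        by (rule lin[OF hc _ that]) (intro continuous_intros Fc)
      ultimately show ?thesis by simp
    qed
    then show ?thesis using Rscale[OF Fc that, of "1 / sqrt (A n)" "Suc n"] by (simp add: FS)
  qed
  have Rhc: "continuous_on {0..a} (R (h n))" for n by (rule cont[OF hc])
  have iph: "ip a (h n) (h n) = r n" for n
  proof -
    have "ip a (h n) (h n) = ip a (\<lambda>x. (1 / sqrt (A n)) * F (Suc n) x + 0 * F n x) (\<lambda>x. (1 / sqrt (A n)) * F (Suc n) x + 0 * F n x)"
      by (intro ip_cong) (auto simp: h_alt)
    also have "\<dots> = (1 / sqrt (A n)) * ((1 / sqrt (A n)) * A (Suc n))"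
      by (subst ip_lin_left, (intro continuous_intros Fc)+)
         (subst ip_lin_right, (intro continuous_intros Fc)+, simp add: A_def)
    also have "\<dots> = r n" using pos[of n] by (simp add: field_simps r_def)
    finally show ?thesis .
  qed
  have ipRh: "ip a (R (h n)) (R (h n)) = r n * r (Suc n)" for n
  proof -
    have "ip a (R (h n)) (R (h n)) = ip a (\<lambda>x. (1 / sqrt (A n)) * F (Suc (Suc n)) x + 0 * F n x) (\<lambda>x. (1 / sqrt (A n)) * F (Suc (Suc n)) x + 0 * F n x)"
      by (intro ip_cong) (auto simp: Rh_alt)
    also have "\<dots> = (1 / sqrt (A n)) * ((1 / sqrt (A n)) * A (Suc (Suc n)))"
      by (subst ip_lin_left, (intro continuous_intros Fc)+)
         (subst ip_lin_right, (intro continuous_intros Fc)+, simp add: A_def)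
    also have "\<dots> = r n * r (Suc n)" using pos[of n] pos[of "Suc n"] by (simp add: field_simps r_def)
    finally show ?thesis .
  qed
  have rk: "(\<lambda>n. r (\<kappa> n)) \<longlonglongrightarrow> s" using LIMSEQ_subseq_LIMSEQ[OF s(1) \<kappa>] by (simp add: o_def)
  have rk': "(\<lambda>n. r (Suc (\<kappa> n))) \<longlonglongrightarrow> s"
    using LIMSEQ_subseq_LIMSEQ[OF LIMSEQ_Suc[OF s(1)] \<kappa>] by (simp add: o_def)
  have ipH: "ip a H H = s"
  proof (rule LIMSEQ_unique)
    show "(\<lambda>n. ip a (h (\<kappa> n)) (h (\<kappa> n))) \<longlonglongrightarrow> ip a H H"
      by (rule lim_ip[where C = B and D = B]) (use hc hbnd Hlim in auto)
    show "(\<lambda>n. ip a (h (\<kappa> n)) (h (\<kappa> n))) \<longlonglongrightarrow> s" using rk by (simp add: iph)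
  qed
  have sqr: "sqrt (r n) \<le> sqrt s" for n using s(2)[of n] by simp
  have Rhb: "\<bar>R (h n) x\<bar> \<le> B * sqrt s" if "x \<in> {0..a}" for n x
  proof -
    have "\<bar>R (h n) x\<bar> \<le> B * sqrt (r n)" using bnd[OF hc that, of n] by (simp add: iph)
    also have "\<dots> \<le> B * sqrt s" using B0 sqr by (intro mult_left_mono) auto
    finally show ?thesis .
  qed
  have ipRH: "ip a (R H) (R H) = s * s"
  proof (rule LIMSEQ_unique)
    show "(\<lambda>n. ip a (R (h (\<kappa> n))) (R (h (\<kappa> n)))) \<longlonglongrightarrow> ip a (R H) (R H)"
      by (rule lim_ip[where C = "B * sqrt s" and D = "B * sqrt s"]) (use Rhc Rhb RH in auto)
    show "(\<lambda>n. ip a (R (h (\<kappa> n))) (R (h (\<kappa> n)))) \<longlonglongrightarrow> s * s" using rk rk' by (auto simp: ipRh intro: tendsto_mult)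
  qed
  have HL: "\<forall>e\<in>L. ip a H e = 0"
  proof
    fix e assume e: "e \<in> L"
    obtain C where C: "\<And>x. x \<in> {0..a} \<Longrightarrow> norm (e x) \<le> C"
      using continuous_on_Icc_bounded[OF contL[OF e]] by blast
    have z: "ip a (h n) e = 0" for n
    proof -
      have "ip a (h n) e = ip a (\<lambda>x. (1 / sqrt (A n)) * F (Suc n) x + 0 * F n x) e"
        by (intro ip_cong) (auto simp: h_alt)
      also have "\<dots> = 0"
        using FL[of "Suc n"] e by (subst ip_lin_left) (auto intro!: continuous_intros Fc contL)
      finally show ?thesis .
    qed
    have "(\<lambda>n. ip a (h (\<kappa> n)) e) \<longlonglongrightarrow> ip a H e"
      by (rule lim_ip[where C = B and D = C]) (use hc hbnd Hlim contL[OF e] C in auto)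
    then show "ip a H e = 0" by (simp add: z LIMSEQ_const_iff)
  qed
  have RHc: "continuous_on {0..a} (R H)" and RRHc: "continuous_on {0..a} (R (R H))"
    using cont H by blast+
  \<comment> \<open>The squared norm of \<open>R (R H) - s * H\<close> expands to at most
    \<open>s\<^sup>3 - 2 * s * s\<^sup>2 + s\<^sup>2 * s = 0\<close>: the squared norms of
    \<open>H\<close>, \<open>R H\<close> and \<open>R (R H)\<close> are \<open>s\<close>,
    \<open>s\<^sup>2\<close> and at most \<open>s\<^sup>3\<close>.\<close>
  have RRH: "R (R H) x = s * H x" if "x \<in> {0..a}" for x
  proof -
    let ?D = "\<lambda>x. 1 * R (R H) x + (- s) * H x"
    have Dc: "continuous_on {0..a} ?D" by (intro continuous_intros RRHc H)
    have 1: "ip a (R (R H)) H = s * s" using sym[OF RHc H] ipRH by simp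
    have 2: "ip a (R (R H)) (R (R H)) \<le> s * s * s"
    proof (rule tendsto_upperbound)
      have RRh: "(\<lambda>n. R (R (h (\<kappa> n))) y) \<longlonglongrightarrow> R (R H) y" if y: "y \<in> {0..a}" for y
      proof (rule LIM_zero_cancel, rule Lim_null_comparison)
        let ?q = "\<lambda>n. ip a (\<lambda>x. R (h (\<kappa> n)) x - R H x) (\<lambda>x. R (h (\<kappa> n)) x - R H x)"
        show "\<forall>\<^sub>F n in sequentially. norm (R (R (h (\<kappa> n))) y - R (R H) y) \<le> B * sqrt (?q n)"
        proof (rule always_eventually, rule allI)
          fix n
          have "R (\<lambda>x. 1 * R (h (\<kappa> n)) x + (-1) * R H x) y = 1 * R (R (h (\<kappa> n))) y + (-1) * R (R H) y"
            by (rule lin[OF Rhc RHc y])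
          moreover have "(\<lambda>x. 1 * R (h (\<kappa> n)) x + (-1) * R H x) = (\<lambda>x. R (h (\<kappa> n)) x - R H x)" by auto
          ultimately show "norm (R (R (h (\<kappa> n))) y - R (R H) y) \<le> B * sqrt (?q n)"
            using bnd[OF _ y, of "\<lambda>x. R (h (\<kappa> n)) x - R H x"] Rhc RHc by (simp add: continuous_intros)
        qed
        have RHb: "\<bar>R H x\<bar> \<le> B * sqrt s" if "x \<in> {0..a}" for x
          using bnd[OF H that] by (simp add: ipH)
        have "?q \<longlonglongrightarrow> ip a (\<lambda>_. 0) (\<lambda>_. 0)"
        proof (rule lim_ip[where C = "2 * (B * sqrt s)" and D = "2 * (B * sqrt s)"])
          have *: "\<bar>R (h (\<kappa> n)) x - R H x\<bar> \<le> 2 * (B * sqrt s)" if "x \<in> {0..a}" for n x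
            using Rhb[OF that, of "\<kappa> n"] RHb[OF that] by linarith
          show "\<bar>R (h (\<kappa> n)) x - R H x\<bar> \<le> 2 * (B * sqrt s)" if "x \<in> {0..a}" for n x by (rule *[OF that])
          show "\<bar>R (h (\<kappa> n)) x - R H x\<bar> \<le> 2 * (B * sqrt s)" if "x \<in> {0..a}" for n x by (rule *[OF that])
          have **: "(\<lambda>n. R (h (\<kappa> n)) x - R H x) \<longlonglongrightarrow> 0" if "x \<in> {0..a}" for x
            using RH[OF that] by (simp add: LIM_zero)
          show "(\<lambda>n. R (h (\<kappa> n)) x - R H x) \<longlonglongrightarrow> 0" if "x \<in> {0..a}" for x by (rule **[OF that])
          show "(\<lambda>n. R (h (\<kappa> n)) x - R H x) \<longlonglongrightarrow> 0" if "x \<in> {0..a}" for x by (rule **[OF that])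
        qed (intro continuous_intros Rhc RHc)+
        then have "?q \<longlonglongrightarrow> 0" by (simp add: ip_def)
        from tendsto_mult_left[OF tendsto_real_sqrt[OF this], of B]
        show "(\<lambda>n. B * sqrt (?q n)) \<longlonglongrightarrow> 0" by simp
      qed
      show "(\<lambda>n. ip a (R (R (h (\<kappa> n)))) (R (R (h (\<kappa> n))))) \<longlonglongrightarrow> ip a (R (R H)) (R (R H))"
      proof (rule lim_ip[where C = "B * s" and D = "B * s"])
        have *: "\<bar>R (R (h (\<kappa> n))) x\<bar> \<le> B * s" if "x \<in> {0..a}" for n x
        proof -
          have r0: "0 \<le> r n" for n using pos[of n] pos[of "Suc n"] by (simp add: r_def)
          have "\<bar>R (R (h (\<kappa> n))) x\<bar> \<le> B * sqrt (r (\<kappa> n) * r (Suc (\<kappa> n)))"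
            using bnd[OF Rhc that, of "\<kappa> n"] by (simp add: ipRh)
          also have "\<dots> \<le> B * sqrt (s * s)"
            using B0 s(2) r0 s_nn
            by (intro mult_left_mono real_sqrt_le_mono mult_mono) auto
          also have "sqrt (s * s) = s" using s_nn by simp
          finally show ?thesis .
        qed
        show "\<bar>R (R (h (\<kappa> n))) x\<bar> \<le> B * s" if "x \<in> {0..a}" for n x by (rule *[OF that])
        show "\<bar>R (R (h (\<kappa> n))) x\<bar> \<le> B * s" if "x \<in> {0..a}" for n x by (rule *[OF that])
      qed (use cont[OF Rhc] RRh in auto)
      show "\<forall>\<^sub>F n in sequentially. ip a (R (R (h (\<kappa> n)))) (R (R (h (\<kappa> n)))) \<le> s * s * s"
      proof (rule always_eventually, rule allI)
        fix n
        let ?m = "\<kappa> n"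
        have "R (R (h ?m)) x = F (Suc (Suc (Suc ?m))) x / sqrt (A ?m)" if "x \<in> {0..a}" for x
        proof -
          let ?e = "\<lambda>x. R (h ?m) x - (1 / sqrt (A ?m)) * F (Suc (Suc ?m)) x"
          have ec: "continuous_on {0..a} ?e" by (intro continuous_intros Rhc Fc)
          have "ip a ?e ?e = ip a (\<lambda>_. 0) (\<lambda>_. 0)" by (intro ip_cong) (auto simp: Rh_alt)
          then have "R ?e x = 0" using bnd[OF ec that] by (simp add: ip_def)
          moreover have "R (\<lambda>x. 1 * R (h ?m) x + (-1) * ((1 / sqrt (A ?m)) * F (Suc (Suc ?m)) x)) x
              = 1 * R (R (h ?m)) x + (-1) * R (\<lambda>x. (1 / sqrt (A ?m)) * F (Suc (Suc ?m)) x) x"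
            by (rule lin[OF Rhc _ that]) (intro continuous_intros Fc)
          ultimately show ?thesis using Rscale[OF Fc that, of "1 / sqrt (A ?m)" "Suc (Suc ?m)"] by (simp add: FS)
        qed
        then have "ip a (R (R (h ?m))) (R (R (h ?m))) = ip a (\<lambda>x. (1 / sqrt (A ?m)) * F (Suc (Suc (Suc ?m))) x + 0 * F n x)
            (\<lambda>x. (1 / sqrt (A ?m)) * F (Suc (Suc (Suc ?m))) x + 0 * F n x)"
          by (intro ip_cong) auto
        also have "\<dots> = (1 / sqrt (A ?m)) * ((1 / sqrt (A ?m)) * A (Suc (Suc (Suc ?m))))"
          by (subst ip_lin_left, (intro continuous_intros Fc)+)
             (subst ip_lin_right, (intro continuous_intros Fc)+, simp add: A_def)
        also have "\<dots> = r ?m * r (Suc ?m) * r (Suc (Suc ?m))"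
          using pos[of ?m] pos[of "Suc ?m"] pos[of "Suc (Suc ?m)"] by (simp add: field_simps r_def)
        also have "\<dots> \<le> s * s * s"
        proof -
          have r0: "0 \<le> r n" for n using pos[of n] pos[of "Suc n"] by (simp add: r_def)
          show ?thesis using s(2) r0 s_nn by (intro mult_mono mult_nonneg_nonneg) auto
        qed
        finally show "ip a (R (R (h ?m))) (R (R (h ?m))) \<le> s * s * s" .
      qed
    qed simp
    have "ip a ?D ?D = ip a (R (R H)) (R (R H)) - 2 * s * ip a (R (R H)) H + s\<^sup>2 * ip a H H"
      unfolding ip_lin_left[OF RRHc H Dc] ip_lin_right[OF RRHc H RRHc] ip_lin_right[OF RRHc H H]
      by (simp add: ip_commute[of a H "R (R H)"] algebra_simps power2_eq_square)
    also have "\<dots> \<le> 0" using 1 2 ipH by (simp add: power2_eq_square algebra_simps)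
    finally have "ip a ?D ?D = 0" using ip_nonneg[OF Dc] by linarith
    from ip_eq_0D[OF a Dc this that] show ?thesis by simp
  qed
  define \<rho> where "\<rho> = sqrt s"
  have s0: "s > 0" using s_gt \<epsilon>(1) zero_le_power2[of \<epsilon>] by linarith
  have \<rho>: "\<rho> > \<epsilon>" "\<rho> * \<rho> = s" "\<rho> > 0"
    using s0 real_less_rsqrt[OF s_gt] by (simp_all add: \<rho>_def)
  \<comment> \<open>On \<open>H\<close> the product of \<open>R + \<rho>\<close> and
    \<open>R - \<rho>\<close> is zero: either \<open>w\<close>, the image of \<open>H\<close> under
    \<open>R - \<rho>\<close>, is an eigenvector for \<open>- \<rho>\<close>, or it vanishes and
    \<open>H\<close> itself is an eigenvector for \<open>\<rho>\<close>.\<close>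
  define w where "w x = 1 * R H x + (- \<rho>) * H x" for x
  have wc: "continuous_on {0..a} w" unfolding w_def[abs_def] by (intro continuous_intros RHc H)
  show ?thesis
  proof (cases "ip a w w > 0")
    case True
    have "ip a w e = 0" if "e \<in> L" for e
      unfolding w_def[abs_def] using HL invL[OF H HL that] that
      by (subst ip_lin_left[OF RHc H contL]) auto
    moreover have "R w x = (- \<rho>) * w x" if "x \<in> {0..a}" for x
    proof -
      have "\<rho> * (\<rho> * H x) = s * H x" by (simp add: \<rho>(2) flip: mult.assoc)
      then show ?thesis
        unfolding w_def[abs_def] lin[OF RHc H that] using RRH[OF that] \<rho>(2) by (simp add: algebra_simps)
    qed
    ultimately show ?thesis using that[of w "- \<rho>"] wc \<rho> True by auto
  next
    case False
    then have "ip a w w = 0" using ip_nonneg[OF wc] by linarith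
    then have "R H x = \<rho> * H x" if "x \<in> {0..a}" for x
      using ip_eq_0D[OF a wc _ that] by (simp add: w_def)
    then show ?thesis using that[of H \<rho>] H HL \<rho> ipH s0 by auto
  qed
qed

subsection \<open>Integration by parts and linear differential equations\<close>

text \<open>\<open>h\<close> may be unbounded, so the smallness of the increments in the parts
  formula below has to come from the continuity of the indefinite integral of \<open>norm h\<close>.
  Using \<open>min\<close> and \<open>max\<close> serves increments on both sides of
  \<open>t\<close>.\<close>

lemma abs_integrable_integral_small:
  fixes h :: "real \<Rightarrow> 'a::euclidean_space"
  assumes "h absolutely_integrable_on {c..d}" "t \<in> {c..d}" "0 < e"
  obtains \<delta> where "0 < \<delta>"
    "\<And>s. s \<in> {c..d} \<Longrightarrow> \<bar>s - t\<bar> < \<delta> \<Longrightarrow> integral {min s t..max s t} (\<lambda>u. norm (h u)) < e"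
proof -
  let ?N = "\<lambda>u. norm (h u)"
  have N: "?N integrable_on {c..d}" using assms(1) by (simp add: absolutely_integrable_on_def)
  from indefinite_integral_continuous_1[OF N] assms(2,3)
  obtain \<delta> where \<delta>: "\<delta> > 0" "\<And>s. s \<in> {c..d} \<Longrightarrow> dist s t < \<delta> \<Longrightarrow> dist (integral {c..s} ?N) (integral {c..t} ?N) < e"
    unfolding continuous_on_iff by blast
  show ?thesis
  proof (rule that[OF \<delta>(1)])
    fix s assume s: "s \<in> {c..d}" "\<bar>s - t\<bar> < \<delta>"
    have "integral {c..min s t} ?N + integral {min s t..max s t} ?N = integral {c..max s t} ?N"
      using s assms(2) by (intro Henstock_Kurzweil_Integration.integral_combine integrable_subinterval_real[OF N]) auto
    then show "integral {min s t..max s t} ?N < e"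
      using \<delta>(2)[OF s(1)] s(2) by (auto simp: dist_real_def min_def max_def split: if_splits)
  qed
qed

text \<open>The difference of the two sides, as a function of the right end point, has derivative
  \<open>0\<close> everywhere, although the integrals are differentiable only almost everywhere.\<close>

lemma integral_by_parts_indefinite:
  fixes f f' h :: "real \<Rightarrow> complex"
  assumes cd: "c \<le> d" and h: "h absolutely_integrable_on {c..d}"
    and der: "\<And>x. x \<in> {c..d} \<Longrightarrow> (f has_vector_derivative f' x) (at x within {c..d})"
    and f': "continuous_on {c..d} f'"
  shows "((\<lambda>t. f' t * integral {c..t} h + f t * h t) has_integral f d * integral {c..d} h) {c..d}"
proof -
  define I where "I t = integral {c..t} h" for t
  have hi: "h integrable_on {c..d}" using h by (simp add: absolutely_integrable_on_def)
  have Ic: "continuous_on {c..d} I" unfolding I_def[abs_def] by (rule indefinite_integral_continuous_1[OF hi])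
  have fc: "continuous_on {c..d} f"
    using der by (rule continuous_on_vector_derivative)
  have fh: "(\<lambda>t. f t * h t) absolutely_integrable_on {c..d}"
    by (rule absolutely_integrable_bounded_measurable_product[OF bilinear_times _ _ _ h])
       (use fc in \<open>auto intro!: continuous_imp_measurable_on_sets_lebesgue compact_imp_bounded compact_continuous_image\<close>)
  have f'I: "(\<lambda>t. f' t * I t) absolutely_integrable_on {c..d}"
    by (intro absolutely_integrable_continuous_real continuous_intros f' Ic)
  define G where "G t = f' t * I t + f t * h t" for t
  have G: "G integrable_on {c..d}"
    unfolding G_def[abs_def] using fh f'I by (intro integrable_add) (auto simp: absolutely_integrable_on_def)
  define A where "A t = f t * I t - integral {c..t} G" for t
  obtain K where K: "\<And>x. x \<in> {c..d} \<Longrightarrow> norm (f' x) \<le> K"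
    using continuous_on_Icc_bounded[OF f'] by blast
  have K0: "0 \<le> K" using order_trans[OF norm_ge_zero K[of c]] cd by auto
  have lip: "norm (f x - f y) \<le> K * \<bar>x - y\<bar>" if "x \<in> {c..d}" "y \<in> {c..d}" for x y
  proof -
    have "norm (f x - f y) \<le> K * norm (x - y)"
    proof (rule differentiable_bound[of "{c..d}" f "\<lambda>x h. h *\<^sub>R f' x"])
      show "onorm (\<lambda>h. h *\<^sub>R f' x) \<le> K" if "x \<in> {c..d}" for x
        using K[OF that] by (intro onorm_le) (simp add: mult.commute[of K] mult_left_mono)
    qed (use that der in \<open>auto simp: has_vector_derivative_def\<close>)
    then show ?thesis by simp
  qed
  \<comment> \<open>The increment of \<open>A\<close> is the integral of
    \<open>f' t * (I x - I t) + (f y - f t) * h t\<close>. Either summand contributes at most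
    \<open>K * (y - x)\<close> times the integral of \<open>norm h\<close>, and the last factor
    tends to \<open>0\<close> with \<open>y - x\<close>.\<close>
  have key: "norm (A y - A x) \<le> 2 * K * (y - x) * integral {x..y} (\<lambda>u. norm (h u))"
    if xy: "x \<in> {c..d}" "y \<in> {c..d}" "x \<le> y" for x y
  proof -
    have sub: "{x..y} \<subseteq> {c..d}" using xy by auto
    have hxy: "h integrable_on {x..y}" "(\<lambda>t. f t * h t) integrable_on {x..y}" "(\<lambda>t. f' t * I t) integrable_on {x..y}"
      "(\<lambda>u. norm (h u)) integrable_on {x..y}" "f' integrable_on {x..y}"
      using integrable_subinterval_real[OF _ sub] hi fh f'I h integrable_continuous_interval[OF f']
      unfolding absolutely_integrable_on_def by blast+
    have Iy: "I t - I x = integral {x..t} h" if "t \<in> {x..y}" for t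
    proof -
      have "integral {c..x} h + integral {x..t} h = integral {c..t} h"
        by (rule Henstock_Kurzweil_Integration.integral_combine)
           (use integrable_subinterval_real[OF hi, of c t] xy that in auto)
      then show ?thesis unfolding I_def by (metis add_diff_cancel_left')
    qed
    have Gxy: "integral {c..y} G - integral {c..x} G = integral {x..y} G"
    proof -
      have "integral {c..x} G + integral {x..y} G = integral {c..y} G"
        by (rule Henstock_Kurzweil_Integration.integral_combine)
           (use integrable_subinterval_real[OF G, of c y] xy in auto)
      then show ?thesis by (metis add_diff_cancel_left')
    qed
    have fxy: "(f' has_integral (f y - f x)) {x..y}"
      by (rule fundamental_theorem_of_calculus[OF xy(3)])
         (use der sub in \<open>blast intro: has_vector_derivative_within_subset\<close>)
    have 1: "((\<lambda>t. f' t * (I x - I t) + (f y - f t) * h t) has_integral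
        ((f y - f x) * I x - integral {x..y} (\<lambda>t. f' t * I t)) + (f y * integral {x..y} h - integral {x..y} (\<lambda>t. f t * h t))) {x..y}"
    proof -
      have "((\<lambda>t. (f' t * I x - f' t * I t) + (f y * h t - f t * h t)) has_integral
        ((f y - f x) * I x - integral {x..y} (\<lambda>t. f' t * I t)) + (f y * integral {x..y} h - integral {x..y} (\<lambda>t. f t * h t))) {x..y}"
        by (intro has_integral_add has_integral_diff has_integral_mult_left fxy integrable_integral hxy has_integral_mult_right)
      then show ?thesis by (simp add: right_diff_distrib left_diff_distrib)
    qed
    have "A y - A x = ((f y - f x) * I x - integral {x..y} (\<lambda>t. f' t * I t)) + (f y * integral {x..y} h - integral {x..y} (\<lambda>t. f t * h t))"
      unfolding A_def using Iy[of y] Gxy xy(3) hxy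
      by (simp add: G_def[abs_def] integral_add algebra_simps)
    also have "\<dots> = integral {x..y} (\<lambda>t. f' t * (I x - I t) + (f y - f t) * h t)"
      using 1 by (simp add: integral_unique)
    also have "norm \<dots> \<le> integral {x..y} (\<lambda>t. K * integral {x..y} (\<lambda>u. norm (h u)) + K * (y - x) * norm (h t))"
    proof (rule Henstock_Kurzweil_Integration.integral_norm_bound_integral)
      show "(\<lambda>t. f' t * (I x - I t) + (f y - f t) * h t) integrable_on {x..y}" using 1 by blast
      show "(\<lambda>t. K * integral {x..y} (\<lambda>u. norm (h u)) + K * (y - x) * norm (h t)) integrable_on {x..y}"
        using hxy by (intro integrable_add integrable_on_mult_right) auto
      fix t assume t: "t \<in> {x..y}"
      have "norm (I x - I t) = norm (integral {x..t} h)" using Iy[OF t] by (metis norm_minus_commute)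
      also have "\<dots> \<le> integral {x..t} (\<lambda>u. norm (h u))"
        using t integrable_subinterval_real[OF hxy(1), of x t] integrable_subinterval_real[OF hxy(4), of x t]
        by (intro Henstock_Kurzweil_Integration.integral_norm_bound_integral) auto
      also have "\<dots> \<le> integral {x..y} (\<lambda>u. norm (h u))"
        using t integrable_subinterval_real[OF hxy(4), of x t] hxy(4) by (intro integral_subset_le) auto
      finally have i: "norm (I x - I t) \<le> integral {x..y} (\<lambda>u. norm (h u))" .
      have ii: "norm (f y - f t) \<le> K * (y - x)"
        using lip[of y t] t xy K0 by (auto intro!: order_trans[OF lip[of y t]] mult_left_mono)
      have "norm (f' t * (I x - I t) + (f y - f t) * h t) \<le> norm (f' t) * norm (I x - I t) + norm (f y - f t) * norm (h t)"
        by (rule order_trans[OF norm_triangle_ineq]) (simp add: norm_mult)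
      also have "\<dots> \<le> K * integral {x..y} (\<lambda>u. norm (h u)) + K * (y - x) * norm (h t)"
        using i ii K[of t] t xy K0 sub by (intro add_mono mult_mono) auto
      finally show "norm (f' t * (I x - I t) + (f y - f t) * h t) \<le> \<dots>" .
    qed
    also have "\<dots> = integral {x..y} (\<lambda>t. K * integral {x..y} (\<lambda>u. norm (h u))) +
        integral {x..y} (\<lambda>t. (K * (y - x)) * norm (h t))"
      by (rule integral_add) (use hxy in \<open>auto intro!: integrable_on_mult_right\<close>)
    also have "\<dots> = 2 * K * (y - x) * integral {x..y} (\<lambda>u. norm (h u))"
      by (subst integral_mult_right) (use xy in \<open>simp add: algebra_simps\<close>)
    finally show ?thesis .
  qed
  have "(A has_vector_derivative 0) (at t within {c..d})" if t: "t \<in> {c..d}" for t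
    unfolding has_vector_derivative_def has_derivative_within_alt
  proof (intro conjI allI impI)
    fix e :: real assume e: "e > 0"
    \<comment> \<open>The denominator \<open>2 * K + 1\<close> instead of \<open>2 * K\<close>
      covers \<open>K = 0\<close>.\<close>
    obtain \<delta> where \<delta>: "0 < \<delta>"
      "\<And>s. s \<in> {c..d} \<Longrightarrow> \<bar>s - t\<bar> < \<delta> \<Longrightarrow> integral {min s t..max s t} (\<lambda>u. norm (h u)) < e / (2 * K + 1)"
      using abs_integrable_integral_small[OF h t, of "e / (2 * K + 1)"] e K0 by auto
    show "\<exists>d'>0. \<forall>y\<in>{c..d}. norm (y - t) < d' \<longrightarrow> norm (A y - A t - (y - t) *\<^sub>R 0) \<le> e * norm (y - t)"
    proof (intro exI[of _ \<delta>] conjI \<delta>(1) ballI impI)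
      fix y assume y: "y \<in> {c..d}" "norm (y - t) < \<delta>"
      let ?J = "integral {min y t..max y t} (\<lambda>u. norm (h u))"
      have "norm (A y - A t) \<le> 2 * K * \<bar>y - t\<bar> * ?J"
        using key[of y t] key[of t y] y t by (cases "y \<le> t") (auto simp: min_def max_def norm_minus_commute)
      also have "\<dots> = \<bar>y - t\<bar> * (2 * K * ?J)" by simp
      also have "\<dots> \<le> \<bar>y - t\<bar> * e"
      proof (rule mult_left_mono)
        have J: "?J < e / (2 * K + 1)" using \<delta>(2) y by auto
        have "2 * K * ?J \<le> 2 * K * (e / (2 * K + 1))" using J K0 by (intro mult_left_mono) auto
        also have "\<dots> \<le> e" using K0 e by (simp add: field_simps)
        finally show "2 * K * ?J \<le> e" .
      qed auto
      finally show "norm (A y - A t - (y - t) *\<^sub>R 0) \<le> e * norm (y - t)" by (simp add: mult.commute)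
    qed
  qed (simp add: bounded_linear_scaleR_left)
  then obtain C where "\<And>x. x \<in> {c..d} \<Longrightarrow> A x = C"
    using has_vector_derivative_zero_constant[of "{c..d}" A] by auto
  then have "A d = A c" using cd by auto
  then have "integral {c..d} G = f d * integral {c..d} h" by (simp add: A_def I_def)
  then show ?thesis using integrable_integral[OF G] by (simp add: G_def[abs_def] I_def)
qed

lemma uniform_limit_integral_LIMSEQ:
  fixes f :: "nat \<Rightarrow> real \<Rightarrow> 'a::banach"
  assumes "uniform_limit {c..d} f g sequentially" "\<And>n. continuous_on {c..d} (f n)"
  shows "(\<lambda>n. integral {c..d} (f n)) \<longlonglongrightarrow> integral {c..d} g"
proof -
  obtain I J where IJ: "\<And>n. (f n has_integral I n) {c..d}" "(g has_integral J) {c..d}" "I \<longlonglongrightarrow> J"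
    using uniform_limit_integral[OF assms trivial_limit_sequentially] by blast
  have "(\<lambda>n. integral {c..d} (f n)) = I" "integral {c..d} g = J"
    using IJ(1,2) by (auto intro!: ext integral_unique)
  then show ?thesis using IJ(3) by simp
qed

text \<open>Picard iteration started at the regular end point \<open>a\<close>. The increments are
  bounded by \<open>B * (K * (a - x)) ^ n / fact n\<close>, hence summable uniformly on each
  \<open>{c..a}\<close> with \<open>c > 0\<close>; the coefficient may be unbounded at
  \<open>0\<close>, so \<open>K\<close> depends on \<open>c\<close> while the series themselves do
  not.\<close>

lemma linear_ode_exists:
  fixes W :: "real \<Rightarrow> complex" and \<alpha> \<beta> :: complex
  assumes a: "0 < a" and W: "continuous_on {0<..a} W"
  obtains u v where "u a = \<alpha>" "v a = \<beta>"
    "\<And>x. x \<in> {0<..a} \<Longrightarrow> (u has_vector_derivative v x) (at x within {0<..a})"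
    "\<And>x. x \<in> {0<..a} \<Longrightarrow> (v has_vector_derivative W x * u x) (at x within {0<..a})"
proof -
  \<comment> \<open>The Picard increments rather than the iterates, so that the solution is the sum
    of a series.\<close>
  define S :: "nat \<Rightarrow> (real \<Rightarrow> complex) \<times> (real \<Rightarrow> complex)" where
    "S = rec_nat (\<lambda>_. \<alpha>, \<lambda>_. \<beta>)
       (\<lambda>_ p. (\<lambda>x. - integral {x..a} (snd p), \<lambda>x. - integral {x..a} (\<lambda>t. W t * fst p t)))"
  define f where "f n = fst (S n)" for n
  define g where "g n = snd (S n)" for n
  have f0: "f 0 = (\<lambda>_. \<alpha>)" and g0: "g 0 = (\<lambda>_. \<beta>)" by (auto simp: f_def g_def S_def)
  have fS: "f (Suc n) = (\<lambda>x. - integral {x..a} (g n))"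
    and gS: "g (Suc n) = (\<lambda>x. - integral {x..a} (\<lambda>t. W t * f n t))" for n
    by (auto simp: f_def g_def S_def)
  define u where "u x = (\<Sum>n. f n x)" for x
  define v where "v x = (\<Sum>n. g n x)" for x
  define B where "B = max (norm \<alpha>) (norm \<beta>)"
  have *: "continuous_on {c..a} u \<and> continuous_on {c..a} v \<and>
      (\<forall>x\<in>{c..a}. u x = \<alpha> - integral {x..a} v \<and> v x = \<beta> - integral {x..a} (\<lambda>t. W t * u t))"
    if c: "0 < c" "c \<le> a" for c
  proof -
    have Wc: "continuous_on {c..a} W" using W c by (auto elim: continuous_on_subset)
    have fg: "continuous_on {c..a} (f n) \<and> continuous_on {c..a} (g n)" for n
    proof (induction n)
      case (Suc n)
      then show ?case
        unfolding fS gS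
        by (intro conjI continuous_on_minus indefinite_integral_continuous_1' integrable_continuous_interval
            continuous_on_mult Wc) auto
    qed (auto simp: f0 g0)
    \<comment> \<open>\<open>K >= 1\<close> lets one majorant serve both recursions, whose factors
      are \<open>1\<close> and \<open>norm (W t)\<close>.\<close>
    obtain K where K: "\<And>x. x \<in> {c..a} \<Longrightarrow> norm (W x) \<le> K" "1 \<le> K"
    proof -
      obtain K where "0 < K" "\<And>x. x \<in> {c..a} \<Longrightarrow> norm (W x) \<le> K"
        using continuous_on_Icc_bounded[OF Wc] by blast
      then show ?thesis using that[of "max 1 K"] by (auto simp: max.coboundedI2)
    qed
    have int: "((\<lambda>t. K * (B * (K * (a - t)) ^ n / fact n)) has_integral B * (K * (a - x)) ^ Suc n / fact (Suc n)) {x..a}"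
      if "x \<le> a" for n x
    proof -
      have "((\<lambda>t. K * (B * (K * (a - t)) ^ n / fact n)) has_integral
          (- B * (K * (a - a)) ^ Suc n / fact (Suc n) - - B * (K * (a - x)) ^ Suc n / fact (Suc n))) {x..a}"
      proof (rule fundamental_theorem_of_calculus[OF that])
        fix t
        have "((\<lambda>t. (K * (a - t)) ^ Suc n) has_real_derivative real (Suc n) * (K * (a - t)) ^ n * (- K)) (at t within {x..a})"
        proof -
          have "((\<lambda>t. K * (a - t)) has_real_derivative - K) (at t within {x..a})"
            by (auto intro!: derivative_eq_intros)
          from DERIV_power[OF this, of "Suc n"] show ?thesis by (simp add: mult_ac)
        qed
        from DERIV_cmult[OF this, of "- B / fact (Suc n)"]
        have "((\<lambda>t. - B * (K * (a - t)) ^ Suc n / fact (Suc n)) has_real_derivative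
            - B * (real (Suc n) * (K * (a - t)) ^ n * (- K)) / fact (Suc n)) (at t within {x..a})"
          by (simp only: times_divide_eq_left)
        also have "- B * (real (Suc n) * (K * (a - t)) ^ n * (- K)) / fact (Suc n) = K * (B * (K * (a - t)) ^ n / fact n)"
          by (simp del: of_nat_Suc)
        finally show "((\<lambda>t. - B * (K * (a - t)) ^ Suc n / fact (Suc n)) has_vector_derivative
            K * (B * (K * (a - t)) ^ n / fact n)) (at t within {x..a})"
          by (simp add: has_real_derivative_iff_has_vector_derivative)
      qed
      then show ?thesis by simp
    qed
    have bnd: "norm (f n x) \<le> B * (K * (a - x)) ^ n / fact n \<and> norm (g n x) \<le> B * (K * (a - x)) ^ n / fact n"
      if "x \<in> {c..a}" for n x
      using that
    proof (induction n arbitrary: x)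
      case (Suc n)
      have sub: "{x..a} \<subseteq> {c..a}" using Suc.prems by auto
      have B0: "0 \<le> B * (K * (a - t)) ^ n / fact n" if "t \<in> {x..a}" for t
        using Suc.IH[of t] that sub by (meson norm_ge_zero order_trans subsetD)
      have i: "g n integrable_on {x..a}" "(\<lambda>t. W t * f n t) integrable_on {x..a}"
        "(\<lambda>t. K * (B * (K * (a - t)) ^ n / fact n)) integrable_on {x..a}"
        using has_integral_integrable[OF int[of x n]] Suc.prems
          integrable_continuous_interval[OF continuous_on_subset[OF conjunct2[OF fg] sub]]
          integrable_continuous_interval[OF continuous_on_subset[OF continuous_on_mult[OF Wc conjunct1[OF fg]] sub]]
        by auto
      have "norm (integral {x..a} (g n)) \<le> integral {x..a} (\<lambda>t. K * (B * (K * (a - t)) ^ n / fact n))"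
      proof (rule Henstock_Kurzweil_Integration.integral_norm_bound_integral)
        fix t assume t: "t \<in> {x..a}"
        have "norm (g n t) \<le> 1 * (B * (K * (a - t)) ^ n / fact n)" using Suc.IH[of t] t sub by auto
        also have "\<dots> \<le> K * (B * (K * (a - t)) ^ n / fact n)"
          using K(2) B0[OF t] by (intro mult_right_mono) auto
        finally show "norm (g n t) \<le> \<dots>" .
      qed (fact i)+
      moreover have "norm (integral {x..a} (\<lambda>t. W t * f n t)) \<le> integral {x..a} (\<lambda>t. K * (B * (K * (a - t)) ^ n / fact n))"
      proof (rule Henstock_Kurzweil_Integration.integral_norm_bound_integral)
        fix t assume t: "t \<in> {x..a}"
        show "norm (W t * f n t) \<le> K * (B * (K * (a - t)) ^ n / fact n)"
          unfolding norm_mult using K Suc.IH[of t] t sub by (intro mult_mono) auto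
      qed (fact i)+
      moreover have "integral {x..a} (\<lambda>t. K * (B * (K * (a - t)) ^ n / fact n)) = B * (K * (a - x)) ^ Suc n / fact (Suc n)"
        using int[of x n] Suc.prems by (intro integral_unique) auto
      ultimately show ?case by (simp only: fS gS norm_minus_cancel)
    qed (auto simp: f0 g0 B_def)
    define M where "M n = B * (K * a) ^ n / fact n" for n
    have M: "norm (f n x) \<le> M n" "norm (g n x) \<le> M n" if x: "x \<in> {c..a}" for n x
    proof -
      have "B * (K * (a - x)) ^ n / fact n \<le> M n"
        unfolding M_def using K(2) c x
        by (intro divide_right_mono mult_left_mono power_mono) (auto simp: B_def le_max_iff_disj)
      then show "norm (f n x) \<le> M n" "norm (g n x) \<le> M n" using bnd[OF x, of n] by linarith+
    qed
    have Ms: "summable M"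
      unfolding M_def using summable_mult[OF summable_exp[of "K * a"], of B] by (simp add: field_simps)
    have uf: "uniform_limit {c..a} (\<lambda>N x. \<Sum>n<N. f n x) u sequentially"
      unfolding u_def[abs_def] using M(1) Ms by (intro Weierstrass_m_test) auto
    have vg: "uniform_limit {c..a} (\<lambda>N x. \<Sum>n<N. g n x) v sequentially"
      unfolding v_def[abs_def] using M(2) Ms by (intro Weierstrass_m_test) auto
    have pc: "continuous_on {c..a} (\<lambda>x. \<Sum>n<N. f n x)" "continuous_on {c..a} (\<lambda>x. \<Sum>n<N. g n x)" for N
      using fg by (auto intro!: continuous_on_sum)
    have uc: "continuous_on {c..a} u"
      by (rule uniform_limit_theorem[OF _ uf]) (use pc in auto)
    have vc: "continuous_on {c..a} v"
      by (rule uniform_limit_theorem[OF _ vg]) (use pc in auto)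
    have pS: "(\<Sum>n<Suc N. f n x) = \<alpha> - integral {x..a} (\<lambda>t. \<Sum>n<N. g n t)"
      "(\<Sum>n<Suc N. g n x) = \<beta> - integral {x..a} (\<lambda>t. W t * (\<Sum>n<N. f n t))" if x: "x \<in> {c..a}" for N x
    proof -
      have sub: "{x..a} \<subseteq> {c..a}" using x by auto
      have i: "g n integrable_on {x..a}" "(\<lambda>t. W t * f n t) integrable_on {x..a}" for n
        using integrable_continuous_interval[OF continuous_on_subset[OF conjunct2[OF fg] sub]]
          integrable_continuous_interval[OF continuous_on_subset[OF continuous_on_mult[OF Wc conjunct1[OF fg]] sub]]
        by blast+
      show "(\<Sum>n<Suc N. f n x) = \<alpha> - integral {x..a} (\<lambda>t. \<Sum>n<N. g n t)"
        by (subst integral_sum) (auto simp: i sum.lessThan_Suc_shift f0 fS sum_negf simp del: sum.lessThan_Suc)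
      show "(\<Sum>n<Suc N. g n x) = \<beta> - integral {x..a} (\<lambda>t. W t * (\<Sum>n<N. f n t))"
        unfolding sum_distrib_left
        by (subst integral_sum) (auto simp: i sum.lessThan_Suc_shift g0 gS sum_negf simp del: sum.lessThan_Suc)
    qed
    have "u x = \<alpha> - integral {x..a} v \<and> v x = \<beta> - integral {x..a} (\<lambda>t. W t * u t)" if x: "x \<in> {c..a}" for x
    proof
      have sub: "{x..a} \<subseteq> {c..a}" using x by auto
      have "(\<lambda>N. integral {x..a} (\<lambda>t. \<Sum>n<N. g n t)) \<longlonglongrightarrow> integral {x..a} v"
        by (rule uniform_limit_integral_LIMSEQ[OF uniform_limit_on_subset[OF vg sub] continuous_on_subset[OF pc(2) sub]])
      then have "(\<lambda>N. \<Sum>n<Suc N. f n x) \<longlonglongrightarrow> \<alpha> - integral {x..a} v"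
        unfolding pS[OF x] by (intro tendsto_intros)
      moreover have "(\<lambda>N. \<Sum>n<Suc N. f n x) \<longlonglongrightarrow> u x"
        by (rule LIMSEQ_Suc[OF tendsto_uniform_limitI[OF uf x]])
      ultimately show "u x = \<alpha> - integral {x..a} v" by (rule LIMSEQ_unique[rotated])
      have Wuf: "uniform_limit {c..a} (\<lambda>N x. W x * (\<Sum>n<N. f n x)) (\<lambda>x. W x * u x) sequentially"
        by (rule uniform_lim_mult[OF uniform_limit_const uf])
           (use Wc uc in \<open>auto intro!: compact_imp_bounded compact_continuous_image\<close>)
      have "(\<lambda>N. integral {x..a} (\<lambda>t. W t * (\<Sum>n<N. f n t))) \<longlonglongrightarrow> integral {x..a} (\<lambda>t. W t * u t)"
        by (rule uniform_limit_integral_LIMSEQ[OF uniform_limit_on_subset[OF Wuf sub]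
              continuous_on_subset[OF continuous_on_mult[OF Wc pc(1)] sub]])
      then have "(\<lambda>N. \<Sum>n<Suc N. g n x) \<longlonglongrightarrow> \<beta> - integral {x..a} (\<lambda>t. W t * u t)"
        unfolding pS[OF x] by (intro tendsto_intros)
      moreover have "(\<lambda>N. \<Sum>n<Suc N. g n x) \<longlonglongrightarrow> v x"
        by (rule LIMSEQ_Suc[OF tendsto_uniform_limitI[OF vg x]])
      ultimately show "v x = \<beta> - integral {x..a} (\<lambda>t. W t * u t)" by (rule LIMSEQ_unique[rotated])
    qed
    then show ?thesis using uc vc by blast
  qed
  show ?thesis
  proof (rule that)
    show "u a = \<alpha>" "v a = \<beta>" using *[of a] a by auto
    fix x assume x: "x \<in> {0<..a}"
    let ?c = "x / 2"
    have c: "0 < ?c" "?c \<le> a" and xc: "x \<in> {?c..a}" using x by auto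
    note u = *[OF c]
    have at: "at x within {?c..a} = at x within {0<..a}"
      by (rule at_within_nhd[of _ "{?c<..}"]) (use x in auto)
    have Wc: "continuous_on {?c..a} W" using W c by (auto elim: continuous_on_subset)
    have "((\<lambda>x. \<alpha> - integral {x..a} v) has_vector_derivative 0 - - v x) (at x within {?c..a})"
      by (intro has_vector_derivative_diff has_vector_derivative_const integral_has_vector_derivative' xc) (use u in auto)
    then have "(u has_vector_derivative v x) (at x within {?c..a})"
      using has_vector_derivative_transform[OF xc, of u "\<lambda>x. \<alpha> - integral {x..a} v" "0 - - v x"] u by auto
    then show "(u has_vector_derivative v x) (at x within {0<..a})" by (simp only: at)
    have "((\<lambda>x. \<beta> - integral {x..a} (\<lambda>t. W t * u t)) has_vector_derivative 0 - - (W x * u x)) (at x within {?c..a})"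
      by (intro has_vector_derivative_diff has_vector_derivative_const
          integral_has_vector_derivative'[where f = "\<lambda>t. W t * u t"] xc)
         (use u Wc in \<open>auto intro!: continuous_on_mult\<close>)
    then have "(v has_vector_derivative W x * u x) (at x within {?c..a})"
      using has_vector_derivative_transform[OF xc, of v "\<lambda>x. \<beta> - integral {x..a} (\<lambda>t. W t * u t)" "0 - - (W x * u x)"] u
      by auto
    then show "(v has_vector_derivative W x * u x) (at x within {0<..a})" by (simp only: at)
  qed
qed

subsection \<open>Solutions of the Bessel-type equation\<close>

lemma has_vector_derivative_quotient:
  fixes f g :: "real \<Rightarrow> complex"
  assumes "(f has_vector_derivative f') (at x within S)" "(g has_vector_derivative g') (at x within S)" "g x \<noteq> 0"
  shows "((\<lambda>x. f x / g x) has_vector_derivative (f' * g x - f x * g') / (g x * g x)) (at x within S)"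
proof -
  have "((\<lambda>x. f x / g x) has_derivative (\<lambda>h. ((h *\<^sub>R f') * g x - f x * (h *\<^sub>R g')) / (g x * g x))) (at x within S)"
    using has_derivative_divide'[OF assms(1,2)[unfolded has_vector_derivative_def] assms(3)] .
  moreover have "(\<lambda>h. ((h *\<^sub>R f') * g x - f x * (h *\<^sub>R g')) / (g x * g x)) =
      (\<lambda>h. h *\<^sub>R ((f' * g x - f x * g') / (g x * g x)))"
    by (simp add: fun_eq_iff scaleR_conv_of_real algebra_simps diff_divide_distrib)
  ultimately show ?thesis by (simp only: has_vector_derivative_def)
qed

text \<open>\<open>\<eta>\<close> is the derivative of \<open>\<xi>\<close> in \<open>x\<close>. Of
  the estimates that single out \<open>\<xi>\<close> only the leading order at \<open>0\<close> is
  kept. It determines \<open>\<xi> z\<close> among all solutions; the positive real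
  \<open>c0\<close>, the same for every \<open>z\<close>, rules out zeros near \<open>0\<close> and
  nonreal multiples.\<close>

locale bessel_problem =
  fixes \<nu> a b \<gamma> :: real and q :: "real \<Rightarrow> real" and \<xi> \<eta> :: "complex \<Rightarrow> real \<Rightarrow> complex" and c0 :: real
  assumes nu: "0 < \<nu>" and a: "0 < a" and ab: "a < b" and gamma: "0 < \<gamma>" "\<gamma> < pi"
    and q_cont: "continuous_on {0<..b} q"
    and q_int: "(\<lambda>x. x * \<bar>q x\<bar>) integrable_on {0..a}"
    and xi_deriv: "\<And>z x. x \<in> {0<..b} \<Longrightarrow> (\<xi> z has_vector_derivative \<eta> z x) (at x within {0<..b})"
    and eta_deriv: "\<And>z x. x \<in> {0<..b} \<Longrightarrow>
      (\<eta> z has_vector_derivative (of_real ((\<nu>\<^sup>2 - 1/4) / x\<^sup>2 + q x) - z) * \<xi> z x) (at x within {0<..b})"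
    and c0: "0 < c0"
    and xi_lim: "\<And>z. ((\<lambda>x. \<xi> z x / of_real (x powr (\<nu> + 1/2))) \<longlongrightarrow> of_real c0) (at_right 0)"
    and eta_lim: "\<And>z. ((\<lambda>x. \<eta> z x / of_real (x powr (\<nu> - 1/2))) \<longlongrightarrow> of_real ((\<nu> + 1/2) * c0)) (at_right 0)"
begin

text \<open>\<open>x powr k\<close> and \<open>x powr (1 - k)\<close> solve the unperturbed equation
  at \<open>z = 0\<close>; \<open>\<xi>\<close> has order \<open>k\<close> at \<open>0\<close>, and
  order \<open>1 - k\<close> bounds every solution.\<close>

definition k :: real where "k = \<nu> + 1/2"
text \<open>The order at \<open>0\<close> that variation of constants provides for an integrable
  right-hand side: the solution \<open>\<xi>\<close> would allow \<open>k\<close>, the source term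
  no more than \<open>1\<close>.\<close>

definition m :: real where "m = min k 1"
definition P :: "real \<Rightarrow> real" where "P x = (\<nu>\<^sup>2 - 1/4) / x\<^sup>2 + q x"
definition \<Delta> :: "complex \<Rightarrow> complex" where "\<Delta> z = \<xi> z a * of_real (cos \<gamma>) + \<eta> z a * of_real (sin \<gamma>)"
definition Z :: "complex set" where "Z = {z. \<Delta> z = 0}"

lemma sin_gamma: "sin \<gamma> > 0"
  using gamma by (rule sin_gt_zero)

lemma P_cont: "continuous_on {0<..b} P"
  unfolding P_def[abs_def] by (intro continuous_intros q_cont) auto

definition sol :: "complex \<Rightarrow> (real \<Rightarrow> complex) \<Rightarrow> (real \<Rightarrow> complex) \<Rightarrow> bool" where
  "sol l u u' \<longleftrightarrow> (\<forall>x\<in>{0<..a}.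
     (u has_vector_derivative u' x) (at x within {0<..a}) \<and>
     (u' has_vector_derivative (of_real (P x) - l) * u x) (at x within {0<..a}))"

lemma solD:
  assumes "sol l u u'" "x \<in> {0<..a}"
  shows "(u has_vector_derivative u' x) (at x within {0<..a})"
    "(u' has_vector_derivative (of_real (P x) - l) * u x) (at x within {0<..a})"
  using assms by (auto simp: sol_def)

lemma at_within_interior_a: "0 < x \<Longrightarrow> x < a \<Longrightarrow> at x within {0<..a} = at x"
  by (rule at_within_interior) (auto simp: interior_open intro!: interiorI[of "{0<..<a}"])

lemma sol_xi: "sol z (\<xi> z) (\<eta> z)"
  unfolding sol_def
proof (intro ballI conjI)
  fix x assume x: "x \<in> {0<..a}"
  then have "x \<in> {0<..b}" "{0<..a} \<subseteq> {0<..b}" using ab by auto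
  then show "(\<xi> z has_vector_derivative \<eta> z x) (at x within {0<..a})"
    "(\<eta> z has_vector_derivative (of_real (P x) - z) * \<xi> z x) (at x within {0<..a})"
    using xi_deriv eta_deriv unfolding P_def by (blast intro: has_vector_derivative_within_subset)+
qed

lemma sol_cont:
  assumes "sol l u u'"
  shows "continuous_on {0<..a} u" "continuous_on {0<..a} u'"
  by (rule continuous_on_vector_derivative[OF solD(1)[OF assms]], assumption)
     (rule continuous_on_vector_derivative[OF solD(2)[OF assms]], assumption)

lemmas xi_cont = sol_cont(1)[OF sol_xi] and eta_cont = sol_cont(2)[OF sol_xi]

section \<open>Wronskians and the initial value problem\<close>

lemma sol_lin:
  assumes "sol l u u'" "sol l v v'"
  shows "sol l (\<lambda>x. c * u x + d * v x) (\<lambda>x. c * u' x + d * v' x)"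
  unfolding sol_def
proof (intro ballI conjI)
  fix x assume x: "x \<in> {0<..a}"
  show "((\<lambda>x. c * u x + d * v x) has_vector_derivative c * u' x + d * v' x) (at x within {0<..a})"
    by (intro has_vector_derivative_add has_vector_derivative_mult_right solD[OF assms(1) x] solD[OF assms(2) x])
  have "((\<lambda>x. c * u' x + d * v' x) has_vector_derivative
      c * ((of_real (P x) - l) * u x) + d * ((of_real (P x) - l) * v x)) (at x within {0<..a})"
    by (intro has_vector_derivative_add has_vector_derivative_mult_right solD[OF assms(1) x] solD[OF assms(2) x])
  then show "((\<lambda>x. c * u' x + d * v' x) has_vector_derivative (of_real (P x) - l) * (c * u x + d * v x)) (at x within {0<..a})"
    by (simp add: algebra_simps)
qed

lemma wronskian_has_derivative:
  assumes "sol l u u'" "sol l' v v'" "x \<in> {0<..a}"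
  shows "((\<lambda>x. u x * v' x - u' x * v x) has_vector_derivative (l - l') * u x * v x) (at x within {0<..a})"
proof -
  have "((\<lambda>x. u x * v' x - u' x * v x) has_vector_derivative
      (u x * ((of_real (P x) - l') * v x) + u' x * v' x) - (u' x * v' x + (of_real (P x) - l) * u x * v x)) (at x within {0<..a})"
    by (intro has_vector_derivative_diff has_vector_derivative_mult solD[OF assms(1,3)] solD[OF assms(2,3)])
  then show ?thesis by (simp add: algebra_simps)
qed

lemma wronskian_const:
  assumes "sol l u u'" "sol l v v'" "x \<in> {0<..a}" "y \<in> {0<..a}"
  shows "u x * v' x - u' x * v x = u y * v' y - u' y * v y"
proof -
  have "convex {0<..a}" by auto
  moreover have "((\<lambda>x. u x * v' x - u' x * v x) has_vector_derivative 0) (at t within {0<..a})"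
    if "t \<in> {0<..a}" for t
    using wronskian_has_derivative[OF assms(1,2) that] by simp
  ultimately obtain c where "\<And>t. t \<in> {0<..a} \<Longrightarrow> u t * v' t - u' t * v t = c"
    using has_vector_derivative_zero_constant[of "{0<..a}" "\<lambda>x. u x * v' x - u' x * v x"] by blast
  then show ?thesis using assms(3,4) by metis
qed

text \<open>Gronwall's inequality for \<open>|u|\<^sup>2 + |u'|\<^sup>2\<close>, on an interval that
  stays away from the singular end point and on which the coefficient \<open>P - l\<close> is
  therefore bounded.\<close>

lemma sol_zero:
  assumes "sol l u u'" "x0 \<in> {0<..a}" "u x0 = 0" "u' x0 = 0" "x \<in> {0<..a}"
  shows "u x = 0" "u' x = 0"
proof -
  define c where "c = min x x0"
  have c: "0 < c" "c \<le> a" using assms by (auto simp: c_def)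
  have sub: "{c..a} \<subseteq> {0<..a}" "{c..a} \<subseteq> {0<..b}" using c ab by auto
  obtain K where K: "K > 0" "\<And>x. x \<in> {c..a} \<Longrightarrow> norm (of_real (P x) - l) \<le> K"
  proof -
    have "continuous_on {c..a} (\<lambda>x. complex_of_real (P x) - l)"
      by (intro continuous_intros continuous_on_subset[OF P_cont sub(2)])
    then show ?thesis using continuous_on_Icc_bounded that by blast
  qed
  define E where "E x = u x \<bullet> u x + u' x \<bullet> u' x" for x
  define E' where "E' x = 2 * (u x \<bullet> u' x) + 2 * (u' x \<bullet> ((of_real (P x) - l) * u x))" for x
  have "E x \<le> E x0 * exp ((1 + K) * \<bar>x - x0\<bar>)"
  proof (rule gronwall)
    show "continuous_on {c..a} E"
      unfolding E_def[abs_def] using sol_cont[OF assms(1)] sub by (auto intro!: continuous_intros elim: continuous_on_subset)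
    show "x \<in> {c..a}" "x0 \<in> {c..a}" using assms by (auto simp: c_def)
    fix t assume t: "c < t" "t < a"
    then have t': "t \<in> {0<..a}" "t \<in> {c..a}" using c by auto
    note D = solD[OF assms(1) t'(1), unfolded at_within_interior_a[OF less_trans[OF c(1) t(1)] t(2)]]
    have "(E has_vector_derivative E' t) (at t)"
    proof -
      have "(E has_vector_derivative (u t \<bullet> u' t + u' t \<bullet> u t) +
          (u' t \<bullet> ((of_real (P t) - l) * u t) + ((of_real (P t) - l) * u t) \<bullet> u' t)) (at t)"
        unfolding E_def[abs_def]
        by (intro has_vector_derivative_add bounded_bilinear.has_vector_derivative[OF bounded_bilinear_inner] D)
      then show ?thesis by (simp add: E'_def inner_commute)
    qed
    then show "(E has_real_derivative E' t) (at t)" by (simp add: has_real_derivative_iff_has_vector_derivative)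
    have "\<bar>u t \<bullet> u' t\<bar> \<le> norm (u t) * norm (u' t)" by (rule Cauchy_Schwarz_ineq2)
    moreover have "\<bar>u' t \<bullet> ((of_real (P t) - l) * u t)\<bar> \<le> K * (norm (u t) * norm (u' t))"
    proof -
      have "\<bar>u' t \<bullet> ((of_real (P t) - l) * u t)\<bar> \<le> norm (u' t) * (norm (of_real (P t) - l) * norm (u t))"
        using Cauchy_Schwarz_ineq2[of "u' t" "(of_real (P t) - l) * u t"] by (simp add: norm_mult)
      also have "\<dots> \<le> norm (u' t) * (K * norm (u t))"
        using K(2)[OF t'(2)] by (intro mult_left_mono mult_right_mono) auto
      finally show ?thesis by (simp add: mult_ac)
    qed
    moreover have "2 * (norm (u t) * norm (u' t)) \<le> E t"
      using sum_squares_bound[of "norm (u t)" "norm (u' t)"] by (simp add: E_def power2_norm_eq_inner mult.assoc)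
    ultimately have "\<bar>E' t\<bar> \<le> (1 + K) * (2 * (norm (u t) * norm (u' t)))"
      unfolding E'_def by (simp add: algebra_simps)
    also have "\<dots> \<le> (1 + K) * E t"
      using K(1) \<open>2 * (norm (u t) * norm (u' t)) \<le> E t\<close> by (intro mult_left_mono) auto
    finally show "\<bar>E' t\<bar> \<le> (1 + K) * E t" .
  qed
  then have "u x \<bullet> u x + u' x \<bullet> u' x \<le> 0" using assms by (simp add: E_def)
  then have "u x \<bullet> u x = 0" "u' x \<bullet> u' x = 0"
    using inner_ge_zero[of "u x"] inner_ge_zero[of "u' x"] by linarith+
  then show "u x = 0" "u' x = 0" by simp_all
qed

text \<open>A vanishing Wronskian makes the data at \<open>a\<close> proportional, and the data
  determine the solution.\<close>

lemma sol_proportional: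
  assumes "sol l u u'" "sol l v v'" "v a \<noteq> 0 \<or> v' a \<noteq> 0" "u a * v' a - u' a * v a = 0"
  obtains c where "\<And>x. x \<in> {0<..a} \<Longrightarrow> u x = c * v x" "\<And>x. x \<in> {0<..a} \<Longrightarrow> u' x = c * v' x"
proof -
  have "\<exists>c. u a = c * v a \<and> u' a = c * v' a"
  proof (cases "v a = 0")
    case True
    then show ?thesis using assms by (intro exI[of _ "u' a / v' a"]) auto
  next
    case False
    then show ?thesis using assms by (intro exI[of _ "u a / v a"]) (auto simp: field_simps)
  qed
  then obtain c where c: "u a = c * v a" "u' a = c * v' a" by blast
  have s: "sol l (\<lambda>x. 1 * u x + (- c) * v x) (\<lambda>x. 1 * u' x + (- c) * v' x)"
    by (rule sol_lin[OF assms(1,2)])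
  have "a \<in> {0<..a}" using a by simp
  from sol_zero[OF s this] show ?thesis using c by (intro that[of c]) auto
qed

text \<open>The limit controls \<open>f\<close> near \<open>0\<close>, continuity on the compact
  rest of the interval does so away from it.\<close>

lemma powr_weight_bound:
  fixes f :: "real \<Rightarrow> complex"
  assumes f: "continuous_on {0<..a} f" and L: "((\<lambda>x. f x / of_real (x powr p)) \<longlongrightarrow> L) (at_right 0)"
  obtains C where "0 < C" "\<And>x. x \<in> {0<..a} \<Longrightarrow> norm (f x) \<le> C * x powr p"
proof -
  have "\<forall>\<^sub>F x in at_right 0. norm (f x / of_real (x powr p)) < norm L + 1"
    using order_tendstoD(2)[OF tendsto_norm[OF L], of "norm L + 1"] by simp
  then obtain d where d: "d > 0" "\<And>x. 0 < x \<Longrightarrow> x < d \<Longrightarrow> norm (f x / of_real (x powr p)) < norm L + 1"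
    unfolding eventually_at_right_field by auto
  define d' where "d' = min d a"
  have sub: "{d'..a} \<subseteq> {0<..a}" using d a by (auto simp: d'_def)
  have "continuous_on {d'..a} (\<lambda>x. f x / of_real (x powr p))"
    using sub by (intro continuous_intros continuous_on_subset[OF f sub]) auto
  then obtain B where B: "B > 0" "\<And>x. x \<in> {d'..a} \<Longrightarrow> norm (f x / of_real (x powr p)) \<le> B"
    using continuous_on_Icc_bounded by blast
  show ?thesis
  proof (rule that[of "norm L + 1 + B"])
    show "0 < norm L + 1 + B" using B by (simp add: add_nonneg_pos)
    fix x assume x: "x \<in> {0<..a}"
    have "norm (f x / of_real (x powr p)) \<le> norm L + 1 + B"
    proof (cases "x < d'")
      case True
      then show ?thesis using d(2)[of x] x B by (auto simp: d'_def)
    next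
      case False
      then have "norm (f x / of_real (x powr p)) \<le> B" using B(2)[of x] x by auto
      then show ?thesis using norm_ge_zero[of L] by linarith
    qed
    then show "norm (f x) \<le> (norm L + 1 + B) * x powr p"
      using x by (simp add: norm_divide field_simps)
  qed
qed

lemma xi_bound:
  obtains C where "0 < C" "\<And>x. x \<in> {0<..a} \<Longrightarrow> norm (\<xi> z x) \<le> C * x powr k"
    "\<And>x. x \<in> {0<..a} \<Longrightarrow> norm (\<eta> z x) \<le> C * x powr (k - 1)"
proof -
  obtain C where C: "0 < C" "\<And>x. x \<in> {0<..a} \<Longrightarrow> norm (\<xi> z x) \<le> C * x powr k"
    using powr_weight_bound[OF xi_cont xi_lim] unfolding k_def by blast
  obtain D where D: "0 < D" "\<And>x. x \<in> {0<..a} \<Longrightarrow> norm (\<eta> z x) \<le> D * x powr (k - 1)"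
    using powr_weight_bound[OF eta_cont eta_lim] unfolding k_def by auto
  show ?thesis
    by (rule that[of "C + D"])
      (use C(1) D(1) in \<open>auto intro!: order_trans[OF C(2)] order_trans[OF D(2)] mult_right_mono\<close>)
qed

lemma xi_close:
  assumes "0 < e"
  obtains d where "0 < d" "d \<le> a" "\<And>x. x \<in> {0<..d} \<Longrightarrow> norm (\<xi> z x / of_real (x powr k) - of_real c0) < e"
proof -
  have "\<forall>\<^sub>F x in at_right 0. dist (\<xi> z x / of_real (x powr k)) (of_real c0) < e"
    using tendstoD[OF xi_lim assms] by (simp add: k_def)
  then obtain d where d: "d > 0" "\<And>x. 0 < x \<Longrightarrow> x < d \<Longrightarrow> dist (\<xi> z x / of_real (x powr k)) (of_real c0) < e"
    unfolding eventually_at_right_field by auto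
  show ?thesis
    by (rule that[of "min (d / 2) a"]) (use d a in \<open>auto simp: dist_norm\<close>)
qed

lemma xi_lower:
  obtains d where "0 < d" "d \<le> a" "\<And>x. x \<in> {0<..d} \<Longrightarrow> c0 / 2 * x powr k \<le> norm (\<xi> z x)"
proof -
  have "0 < c0 / 4" using c0 by simp
  then obtain d where d: "0 < d" "d \<le> a"
    "\<And>x. x \<in> {0<..d} \<Longrightarrow> norm (\<xi> z x / of_real (x powr k) - of_real c0) < c0 / 4"
    by (rule xi_close[where z = z]) blast
  show ?thesis
  proof (rule that[OF d(1,2)])
    fix x assume x: "x \<in> {0<..d}"
    have "norm (complex_of_real c0) - norm (\<xi> z x / of_real (x powr k)) < c0 / 4"
      using d(3)[OF x] by (metis norm_minus_commute norm_triangle_ineq2 order_le_less_trans)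
    then have "c0 / 2 < norm (\<xi> z x / of_real (x powr k))" using c0 by simp
    then show "c0 / 2 * x powr k \<le> norm (\<xi> z x)" using x by (simp add: norm_divide field_simps)
  qed
qed

text \<open>Vanishing data at \<open>a\<close> would make \<open>\<xi> z\<close> zero everywhere,
  against its lower bound near \<open>0\<close>.\<close>

lemma xi_nontrivial: "\<xi> z a \<noteq> 0 \<or> \<eta> z a \<noteq> 0"
proof (rule ccontr)
  assume "\<not> (\<xi> z a \<noteq> 0 \<or> \<eta> z a \<noteq> 0)"
  then have 0: "\<xi> z x = 0" if "x \<in> {0<..a}" for x
    using sol_zero(1)[OF sol_xi, of a] that a by auto
  obtain d where "0 < d" "d \<le> a" "\<And>x. x \<in> {0<..d} \<Longrightarrow> c0 / 2 * x powr k \<le> norm (\<xi> z x)"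
    by (rule xi_lower[where z = z]) blast
  from this(3)[of d] 0[of d] this(1,2) show False using c0 by (simp add: mult_le_0_iff)
qed

text \<open>By reduction of order every solution is the sum of a multiple of \<open>\<xi>\<close> and
  \<open>\<xi> \<integral> 1 / \<xi>\<^sup>2\<close>, and \<open>\<xi>\<close> is comparable to \<open>x\<^sup>k\<close> near \<open>0\<close>.\<close>

lemma sol_bound:
  assumes "sol l u u'"
  obtains C where "0 < C" "\<And>x. x \<in> {0<..a} \<Longrightarrow> norm (u x) \<le> C * x powr (1 - k)"
    "\<And>x. x \<in> {0<..a} \<Longrightarrow> norm (u' x) \<le> C * x powr (- k)"
proof -
  obtain d where d: "0 < d" "d \<le> a" "\<And>x. x \<in> {0<..d} \<Longrightarrow> c0 / 2 * x powr k \<le> norm (\<xi> l x)"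
    by (rule xi_lower[where z = l]) blast
  obtain C where C: "0 < C" "\<And>x. x \<in> {0<..a} \<Longrightarrow> norm (\<xi> l x) \<le> C * x powr k"
    "\<And>x. x \<in> {0<..a} \<Longrightarrow> norm (\<eta> l x) \<le> C * x powr (k - 1)"
    by (rule xi_bound[where z = l]) blast
  \<comment> \<open>The constant Wronskian; the quotient \<open>u / \<xi>\<close> has derivative
    \<open>- w / \<xi>\<^sup>2\<close>.\<close>
  define w where "w = u a * \<eta> l a - u' a * \<xi> l a"
  have W: "u x * \<eta> l x - u' x * \<xi> l x = w" if "x \<in> {0<..a}" for x
    unfolding w_def using a by (intro wronskian_const[OF assms sol_xi that]) auto
  have nz: "\<xi> l x \<noteq> 0" if "x \<in> {0<..d}" for x
  proof
    assume "\<xi> l x = 0"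
    then have "c0 / 2 * x powr k \<le> 0" using d(3)[OF that] by simp
    moreover have "0 < c0 / 2 * x powr k" using c0 that by simp
    ultimately show False by linarith
  qed
  \<comment> \<open>Integrating the majorant \<open>norm w / (c0 / 2 * t powr k)\<^sup>2\<close> of
    the derivative produces \<open>B * x powr (- 2 * \<nu>)\<close>, because
    \<open>2 * k - 1 = 2 * \<nu>\<close>.\<close>
  define B where "B = norm w / (c0 / 2)\<^sup>2 / (2 * \<nu>)"
  have B0: "0 \<le> B" unfolding B_def using nu by simp
  have quot: "norm (u x / \<xi> l x) \<le> norm (u d / \<xi> l d) + B * x powr (- 2 * \<nu>)" if x: "x \<in> {0<..d}" for x
  proof (cases "x = d")
    case True
    then show ?thesis using B0 x by simp
  next
    case False
    then have xd: "x < d" "0 < x" using x by auto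
    have sub: "{x..d} \<subseteq> {0<..a}" using xd d by auto
    have nz': "\<And>t. t \<in> {x..d} \<Longrightarrow> \<xi> l t \<noteq> 0" using nz xd by auto
    have "norm (u d / \<xi> l d - u x / \<xi> l x) \<le> - B * d powr (- 2 * \<nu>) - (- B * x powr (- 2 * \<nu>))"
    proof (rule differentiable_bound_general[OF xd(1)])
      show "continuous_on {x..d} (\<lambda>x. u x / \<xi> l x)"
        using nz' by (intro continuous_intros continuous_on_subset[OF sol_cont(1)[OF assms] sub] continuous_on_subset[OF xi_cont sub]) auto
      show "continuous_on {x..d} (\<lambda>x. - B * x powr (- 2 * \<nu>))"
        using xd by (intro continuous_intros) auto
      fix t assume t: "x < t" "t < d"
      then have t': "t \<in> {0<..a}" "0 < t" "t < a" "t \<in> {0<..d}" using xd d by auto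
      note D = solD[OF assms t'(1), unfolded at_within_interior_a[OF t'(2,3)]]
        solD[OF sol_xi t'(1), unfolded at_within_interior_a[OF t'(2,3)]]
      have "((\<lambda>x. u x / \<xi> l x) has_vector_derivative (u' t * \<xi> l t - u t * \<eta> l t) / (\<xi> l t * \<xi> l t)) (at t)"
        by (rule has_vector_derivative_quotient[OF D(1) D(3) nz[OF t'(4)]])
      also have "(u' t * \<xi> l t - u t * \<eta> l t) / (\<xi> l t * \<xi> l t) = - w / (\<xi> l t)\<^sup>2"
        using W[OF t'(1)] by (auto simp: power2_eq_square diff_divide_distrib)
      finally show "((\<lambda>x. u x / \<xi> l x) has_vector_derivative - w / (\<xi> l t)\<^sup>2) (at t)" .
      have "((\<lambda>x. - B * x powr (- 2 * \<nu>)) has_real_derivative B * (2 * \<nu>) * t powr (- 2 * \<nu> - 1)) (at t)"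
        using t'(2) by (auto intro!: derivative_eq_intros)
      then show "((\<lambda>x. - B * x powr (- 2 * \<nu>)) has_vector_derivative norm w / (c0 / 2)\<^sup>2 * t powr (- 2 * k)) (at t)"
        using nu by (simp add: has_real_derivative_iff_has_vector_derivative B_def k_def)
      have "(c0 / 2 * t powr k)\<^sup>2 \<le> (norm (\<xi> l t))\<^sup>2"
        using d(3)[OF t'(4)] c0 by (intro power_mono) auto
      then have "norm w / (norm (\<xi> l t))\<^sup>2 \<le> norm w / (c0 / 2 * t powr k)\<^sup>2"
        using c0 t' nz[OF t'(4)] by (intro divide_left_mono mult_pos_pos) auto
      also have "\<dots> = norm w / (c0 / 2)\<^sup>2 * t powr (- 2 * k)"
      proof -
        have "(t powr k)\<^sup>2 = t powr (2 * k)" by (simp add: power2_eq_square flip: powr_add)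
        then have "(c0 / 2 * t powr k)\<^sup>2 = (c0 / 2)\<^sup>2 * t powr (2 * k)" by (simp only: power_mult_distrib)
        moreover have "t powr (- 2 * k) = inverse (t powr (2 * k))" using powr_minus[of t "2 * k"] by simp
        ultimately show ?thesis by (simp only: divide_inverse inverse_mult_distrib mult.assoc)
      qed
      finally show "norm (- w / (\<xi> l t)\<^sup>2) \<le> norm w / (c0 / 2)\<^sup>2 * t powr (- 2 * k)"
        by (simp add: norm_divide norm_power)
    qed
    then have "norm (u x / \<xi> l x) \<le> norm (u d / \<xi> l d) + (B * x powr (- 2 * \<nu>) - B * d powr (- 2 * \<nu>))"
      using norm_triangle_ineq2[of "u x / \<xi> l x" "u d / \<xi> l d"] by (simp add: norm_minus_commute)
    moreover have "0 \<le> B * d powr (- 2 * \<nu>)" using B0 by simp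
    ultimately show ?thesis by linarith
  qed
  \<comment> \<open>For \<open>x <= d\<close> the factor \<open>(d / x) powr (2 * \<nu>)\<close> is
    at least \<open>1\<close>, which absorbs the constant term into the power.\<close>
  define A where "A = norm (u d / \<xi> l d) * d powr (2 * \<nu>) + B"
  have A0: "0 \<le> A" unfolding A_def using B0 by simp
  have quot': "norm (u x) \<le> A * C * x powr (1 - k)" if x: "x \<in> {0<..d}" for x
  proof -
    have "1 \<le> d powr (2 * \<nu>) * x powr (- 2 * \<nu>)"
      using x nu powr_mono2[of "2 * \<nu>" x d] by (simp add: powr_minus field_simps)
    then have "norm (u d / \<xi> l d) * 1 \<le> norm (u d / \<xi> l d) * (d powr (2 * \<nu>) * x powr (- 2 * \<nu>))"
      by (intro mult_left_mono) auto
    then have "norm (u x / \<xi> l x) \<le> A * x powr (- 2 * \<nu>)"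
      using quot[OF x] unfolding A_def by (simp add: algebra_simps)
    then have "norm (u x) \<le> A * x powr (- 2 * \<nu>) * norm (\<xi> l x)"
      using nz[OF x] by (simp add: norm_divide field_simps)
    also have "\<dots> \<le> A * x powr (- 2 * \<nu>) * (C * x powr k)"
      using A0 C(2)[of x] x d by (intro mult_left_mono mult_nonneg_nonneg) auto
    also have "\<dots> = A * C * (x powr (- 2 * \<nu>) * x powr k)" by simp
    also have "x powr (- 2 * \<nu>) * x powr k = x powr (1 - k)"
      unfolding powr_add[symmetric] by (simp add: k_def)
    finally show ?thesis .
  qed
  \<comment> \<open>The derivative is read off the Wronskian identity divided by
    \<open>\<xi>\<close>, in which \<open>u * \<eta>\<close> is bounded.\<close>
  have quot2: "norm (u' x) \<le> (A * C * C + norm w) / (c0 / 2) * x powr (- k)" if x: "x \<in> {0<..d}" for x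
  proof -
    have xa: "x \<in> {0<..a}" using x d by auto
    have "u' x * \<xi> l x = u x * \<eta> l x - w" using W[OF xa] by (simp add: algebra_simps)
    then have "norm (u' x) * norm (\<xi> l x) \<le> norm (u x) * norm (\<eta> l x) + norm w"
      by (metis norm_mult norm_triangle_ineq4)
    also have "norm (u x) * norm (\<eta> l x) \<le> (A * C * x powr (1 - k)) * (C * x powr (k - 1))"
      using quot'[OF x] C xa A0 by (intro mult_mono mult_nonneg_nonneg) auto
    also have "\<dots> = A * C * C * (x powr (1 - k) * x powr (k - 1))" by simp
    also have "x powr (1 - k) * x powr (k - 1) = 1" using x by (simp add: powr_add[symmetric])
    finally have "norm (u' x) * norm (\<xi> l x) \<le> A * C * C + norm w" by simp
    moreover have "norm (u' x) * (c0 / 2 * x powr k) \<le> norm (u' x) * norm (\<xi> l x)"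
      using d(3)[OF x] by (intro mult_left_mono) auto
    ultimately have "norm (u' x) * (c0 / 2 * x powr k) \<le> A * C * C + norm w" by linarith
    then show ?thesis using c0 x by (simp add: powr_minus field_simps)
  qed
  have sub: "{d..a} \<subseteq> {0<..a}" using d by auto
  obtain B1 where B1: "B1 > 0" "\<And>x. x \<in> {d..a} \<Longrightarrow> norm (u x / of_real (x powr (1 - k))) \<le> B1"
  proof -
    have "continuous_on {d..a} (\<lambda>x. u x / of_real (x powr (1 - k)))"
      using d by (intro continuous_intros continuous_on_subset[OF sol_cont(1)[OF assms] sub]) auto
    then show ?thesis using continuous_on_Icc_bounded that by blast
  qed
  obtain B2 where B2: "B2 > 0" "\<And>x. x \<in> {d..a} \<Longrightarrow> norm (u' x / of_real (x powr (- k))) \<le> B2"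
  proof -
    have "continuous_on {d..a} (\<lambda>x. u' x / of_real (x powr (- k)))"
      using d by (intro continuous_intros continuous_on_subset[OF sol_cont(2)[OF assms] sub]) auto
    then show ?thesis using continuous_on_Icc_bounded that by blast
  qed
  define D where "D = A * C + (A * C * C + norm w) / (c0 / 2) + B1 + B2"
  have nn: "0 \<le> A * C" "0 \<le> (A * C * C + norm w) / (c0 / 2)" using A0 C(1) c0 by auto
  show ?thesis
  proof (rule that[of D])
    show "0 < D" unfolding D_def using nn B1(1) B2(1) by linarith
    fix x assume x: "x \<in> {0<..a}"
    have le: "A * C \<le> D" "(A * C * C + norm w) / (c0 / 2) \<le> D" "B1 \<le> D" "B2 \<le> D"
      unfolding D_def using nn B1(1) B2(1) by linarith+
    show "norm (u x) \<le> D * x powr (1 - k)"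
    proof (cases "x \<le> d")
      case True
      then show ?thesis using quot'[of x] x le by (auto intro!: order_trans[OF quot'[of x]] mult_right_mono)
    next
      case False
      then have "norm (u x) \<le> B1 * x powr (1 - k)" using B1(2)[of x] x by (simp add: norm_divide field_simps)
      also have "\<dots> \<le> D * x powr (1 - k)" using le by (intro mult_right_mono) auto
      finally show ?thesis .
    qed
    show "norm (u' x) \<le> D * x powr (- k)"
    proof (cases "x \<le> d")
      case True
      then show ?thesis using quot2[of x] x le by (auto intro!: order_trans[OF quot2[of x]] mult_right_mono)
    next
      case False
      then have "norm (u' x) \<le> B2 * x powr (- k)" using B2(2)[of x] x by (simp add: norm_divide field_simps)
      also have "\<dots> \<le> D * x powr (- k)" using le by (intro mult_right_mono) auto
      finally show ?thesis .
    qed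
  qed
qed

text \<open>\<open>u a * \<Delta> l\<close> is a combination of the boundary form of
  \<open>u\<close> and its Wronskian with \<open>\<xi> l\<close>. When both vanish and
  \<open>\<Delta> l\<close> does not, the data of \<open>u\<close> at \<open>a\<close> are
  zero.\<close>

lemma sol_eq_0:
  assumes "sol l u u'" "u a * of_real (cos \<gamma>) + u' a * of_real (sin \<gamma>) = 0" "\<Delta> l \<noteq> 0"
    and "u a * \<eta> l a - u' a * \<xi> l a = 0" "x \<in> {0<..a}"
  shows "u x = 0" "u' x = 0"
proof -
  have "u a * \<Delta> l = (u a * of_real (cos \<gamma>) + u' a * of_real (sin \<gamma>)) * \<xi> l a
      + of_real (sin \<gamma>) * (u a * \<eta> l a - u' a * \<xi> l a)"
    by (simp add: \<Delta>_def algebra_simps)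
  then have "u a = 0" using assms by simp
  then have "u' a = 0" using assms(2) sin_gamma by simp
  show "u x = 0" "u' x = 0"
    using sol_zero[OF assms(1) _ \<open>u a = 0\<close> \<open>u' a = 0\<close> assms(5)] a by auto
qed

section \<open>Nonreal spectral parameters, reality of the zeros and of the eigenfunctions\<close>

lemma powr_tendsto_0:
  assumes "0 < p"
  shows "((\<lambda>t::real. t powr p) \<longlongrightarrow> 0) (at_right 0)"
proof -
  have "\<forall>\<^sub>F t::real in at_right 0. 0 \<le> t"
    unfolding eventually_at_right_field by (intro exI[of _ 1]) auto
  then have "((\<lambda>t::real. t powr p) \<longlongrightarrow> 0 powr p) (at_right 0)"
    using assms by (intro tendsto_powr' tendsto_ident_at tendsto_const) auto
  then show ?thesis by simp
qed

text \<open>The imaginary part of \<open>\<eta> * cnj \<xi>\<close> divided by \<open>Im z\<close>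
  has derivative \<open>- |\<xi>|\<^sup>2\<close> and tends to \<open>0\<close> at \<open>0\<close>;
  a zero at \<open>x\<close> would make it vanish on all of \<open>(0, x]\<close> and with it
  \<open>\<xi> z\<close>. This gives the reality of \<open>Z\<close> and also shows that
  \<open>\<xi> z\<close> has no zeros for nonreal \<open>z\<close>.\<close>

lemma nonreal_quotient:
  assumes z: "Im z \<noteq> 0" and x: "x \<in> {0<..a}"
  shows "Im (\<eta> z x * cnj (\<xi> z x)) \<noteq> 0"
proof
  assume 0: "Im (\<eta> z x * cnj (\<xi> z x)) = 0"
  obtain C where C: "0 < C" "\<And>x. x \<in> {0<..a} \<Longrightarrow> norm (\<xi> z x) \<le> C * x powr k"
    "\<And>x. x \<in> {0<..a} \<Longrightarrow> norm (\<eta> z x) \<le> C * x powr (k - 1)"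
    by (rule xi_bound[where z = z]) blast
  define g where "g t = Im (\<eta> z t * cnj (\<xi> z t)) / Im z" for t
  have g': "(g has_real_derivative - (norm (\<xi> z t))\<^sup>2) (at t)" if t: "0 < t" "t < a" for t
  proof -
    have t': "t \<in> {0<..a}" using t by auto
    note D = solD[OF sol_xi t', unfolded at_within_interior_a[OF t]]
    have "((\<lambda>t. Im (\<eta> z t * cnj (\<xi> z t)) / Im z) has_vector_derivative
        Im (\<eta> z t * cnj (\<eta> z t) + (of_real (P t) - z) * \<xi> z t * cnj (\<xi> z t)) / Im z) (at t)"
      by (intro bounded_linear.has_vector_derivative[OF bounded_linear_divide]
          bounded_linear.has_vector_derivative[OF bounded_linear_Im] has_vector_derivative_mult has_vector_derivative_cnj D)
    also have "Im (\<eta> z t * cnj (\<eta> z t) + (of_real (P t) - z) * \<xi> z t * cnj (\<xi> z t)) / Im z = - (norm (\<xi> z t))\<^sup>2"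
      using z by (simp add: complex_mult_cnj cmod_power2 mult.assoc)
    finally show ?thesis by (simp add: g_def[abs_def] has_real_derivative_iff_has_vector_derivative)
  qed
  have mono: "g y \<le> g x'" if "0 < x'" "x' \<le> y" "y \<le> x" for x' y
  proof (rule DERIV_nonpos_imp_decreasing_open[OF that(2)])
    show "continuous_on {x'..y} g"
      unfolding g_def[abs_def] using that x
      by (intro continuous_intros continuous_on_subset[OF xi_cont] continuous_on_subset[OF eta_cont]) (use z in auto)
    show "\<exists>l. (g has_real_derivative l) (at t) \<and> l \<le> 0" if "x' < t" "t < y" for t
      using g'[of t] that \<open>0 < x'\<close> \<open>y \<le> x\<close> x by auto
  qed
  have lim: "(g \<longlongrightarrow> 0) (at_right 0)"
  proof (rule Lim_null_comparison)
    show "\<forall>\<^sub>F t in at_right 0. norm (g t) \<le> C * C / \<bar>Im z\<bar> * t powr (2 * \<nu>)"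
      unfolding eventually_at_right_field
    proof (intro exI[of _ a] conjI a allI impI)
      fix t assume t: "0 < t" "t < a"
      then have t': "t \<in> {0<..a}" by auto
      have "\<bar>Im (\<eta> z t * cnj (\<xi> z t))\<bar> \<le> norm (\<eta> z t) * norm (\<xi> z t)"
        using abs_Im_le_cmod[of "\<eta> z t * cnj (\<xi> z t)"] by (simp add: norm_mult)
      also have "\<dots> \<le> (C * t powr (k - 1)) * (C * t powr k)"
        using C t' by (intro mult_mono) auto
      also have "\<dots> = C * C * t powr (2 * \<nu>)"
        by (simp add: k_def powr_add[symmetric])
      finally show "norm (g t) \<le> C * C / \<bar>Im z\<bar> * t powr (2 * \<nu>)"
        using z by (simp add: g_def field_simps)
    qed
    have "0 < 2 * \<nu>" using nu by simp
    from tendsto_mult_left[OF powr_tendsto_0[OF this], of "C * C / \<bar>Im z\<bar>"]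
    show "((\<lambda>t. C * C / \<bar>Im z\<bar> * t powr (2 * \<nu>)) \<longlongrightarrow> 0) (at_right 0)" by simp
  qed
  have gle: "g y \<le> 0" if y: "0 < y" "y \<le> x" for y
  proof (rule tendsto_lowerbound[OF lim])
    show "\<forall>\<^sub>F t in at_right 0. g y \<le> g t"
      unfolding eventually_at_right_field using mono y by (intro exI[of _ y]) auto
  qed simp
  \<comment> \<open>Squeezed between \<open>0\<close> from above, by the limit at \<open>0\<close>,
    and \<open>g x = 0\<close> from below, by monotonicity.\<close>
  have g0: "g y = 0" if y: "0 < y" "y \<le> x" for y
    using gle[OF y] mono[OF y] 0 by (simp add: g_def)
  have xi0: "\<xi> z y = 0" if y: "0 < y" "y < x" for y
  proof -
    have "(g has_real_derivative 0) (at y)"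
    proof -
      have "((\<lambda>_. 0) has_real_derivative 0) (at y)" by simp
      then show ?thesis
        by (rule has_field_derivative_transform_within_open[of _ _ _ "{0<..<x}"]) (use y g0 in auto)
    qed
    moreover have "(g has_real_derivative - (norm (\<xi> z y))\<^sup>2) (at y)"
      using g'[of y] y x by auto
    ultimately have "0 = - (norm (\<xi> z y))\<^sup>2" by (rule DERIV_unique)
    then show ?thesis by simp
  qed
  obtain d where d: "0 < d" "d \<le> a" "\<And>x. x \<in> {0<..d} \<Longrightarrow> c0 / 2 * x powr k \<le> norm (\<xi> z x)"
    by (rule xi_lower[where z = z]) blast
  define y where "y = min d x / 2"
  have y: "0 < y" "y < x" "y \<le> d" using d x by (auto simp: y_def)
  have "c0 / 2 * y powr k \<le> 0" using d(3)[of y] xi0[OF y(1,2)] y by simp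
  moreover have "0 < c0 / 2 * y powr k" using c0 y by simp
  ultimately show False by linarith
qed

text \<open>At a zero of \<open>\<Delta>\<close> the boundary condition makes
  \<open>\<eta> * cnj \<xi>\<close> at \<open>a\<close> a real multiple of
  \<open>|\<xi>|\<^sup>2\<close>.\<close>

lemma Z_real: "l \<in> Z \<Longrightarrow> Im l = 0"
proof (rule ccontr)
  assume l: "l \<in> Z" "Im l \<noteq> 0"
  then have "\<eta> l a * of_real (sin \<gamma>) = - of_real (cos \<gamma>) * \<xi> l a"
    by (simp add: Z_def \<Delta>_def add_eq_0_iff2 mult.commute)
  then have "(\<eta> l a * of_real (sin \<gamma>)) * cnj (\<xi> l a) = (- of_real (cos \<gamma>) * \<xi> l a) * cnj (\<xi> l a)"
    by (rule arg_cong)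
  then have "\<eta> l a * cnj (\<xi> l a) * of_real (sin \<gamma>) = - of_real (cos \<gamma>) * (\<xi> l a * cnj (\<xi> l a))"
    by (simp only: mult_ac)
  then have "Im (\<eta> l a * cnj (\<xi> l a) * of_real (sin \<gamma>)) = Im (- of_real (cos \<gamma>) * (\<xi> l a * cnj (\<xi> l a)))"
    by (rule arg_cong)
  then have "Im (\<eta> l a * cnj (\<xi> l a)) * sin \<gamma> = 0"
    by (simp add: complex_mult_cnj)
  then show False using nonreal_quotient[OF l(2), of a] a sin_gamma by simp
qed

text \<open>The conjugate solves the same equation and its Wronskian with \<open>\<xi> l\<close>
  tends to \<open>0\<close> at \<open>0\<close>, so it is a multiple of \<open>\<xi> l\<close>; the
  real leading coefficient \<open>c0\<close> makes the factor \<open>1\<close>.\<close>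

lemma xi_real:
  assumes l: "Im l = 0" and x: "x \<in> {0<..a}"
  shows "cnj (\<xi> l x) = \<xi> l x" "cnj (\<eta> l x) = \<eta> l x"
proof -
  have cl: "cnj l = l" using l by (simp add: complex_eq_iff)
  have s: "sol l (\<lambda>x. cnj (\<xi> l x)) (\<lambda>x. cnj (\<eta> l x))"
    unfolding sol_def
  proof (intro ballI conjI)
    fix x assume x: "x \<in> {0<..a}"
    show "((\<lambda>x. cnj (\<xi> l x)) has_vector_derivative cnj (\<eta> l x)) (at x within {0<..a})"
      by (intro has_vector_derivative_cnj solD[OF sol_xi x])
    have "((\<lambda>x. cnj (\<eta> l x)) has_vector_derivative cnj ((of_real (P x) - l) * \<xi> l x)) (at x within {0<..a})"
      by (intro has_vector_derivative_cnj solD[OF sol_xi x])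
    then show "((\<lambda>x. cnj (\<eta> l x)) has_vector_derivative (of_real (P x) - l) * cnj (\<xi> l x)) (at x within {0<..a})"
      by (simp add: cl)
  qed
  obtain C where C: "0 < C" "\<And>x. x \<in> {0<..a} \<Longrightarrow> norm (\<xi> l x) \<le> C * x powr k"
    "\<And>x. x \<in> {0<..a} \<Longrightarrow> norm (\<eta> l x) \<le> C * x powr (k - 1)"
    by (rule xi_bound[where z = l]) blast
  let ?W = "\<lambda>x. cnj (\<xi> l x) * \<eta> l x - cnj (\<eta> l x) * \<xi> l x"
  have "(?W \<longlongrightarrow> 0) (at_right 0)"
  proof (rule Lim_null_comparison)
    show "\<forall>\<^sub>F t in at_right 0. norm (?W t) \<le> 2 * C * C * t powr (2 * \<nu>)"
      unfolding eventually_at_right_field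
    proof (intro exI[of _ a] conjI a allI impI)
      fix t assume t: "0 < t" "t < a"
      then have t': "t \<in> {0<..a}" by auto
      have "norm (?W t) \<le> norm (\<xi> l t) * norm (\<eta> l t) + norm (\<eta> l t) * norm (\<xi> l t)"
        by (rule order_trans[OF norm_triangle_ineq4]) (simp add: norm_mult)
      also have "\<dots> \<le> (C * t powr k) * (C * t powr (k - 1)) + (C * t powr (k - 1)) * (C * t powr k)"
        using C t' by (intro add_mono mult_mono) auto
      also have "\<dots> = 2 * C * C * t powr (2 * \<nu>)"
        by (simp add: k_def powr_add[symmetric])
      finally show "norm (?W t) \<le> 2 * C * C * t powr (2 * \<nu>)" .
    qed
    from tendsto_mult_left[OF powr_tendsto_0[of "2 * \<nu>"], of "2 * C * C"] nu
    show "((\<lambda>t. 2 * C * C * t powr (2 * \<nu>)) \<longlongrightarrow> 0) (at_right 0)" by simp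
  qed
  moreover have "(?W \<longlongrightarrow> ?W a) (at_right 0)"
  proof (rule tendsto_eventually)
    show "\<forall>\<^sub>F t in at_right 0. ?W t = ?W a"
      unfolding eventually_at_right_field
    proof (intro exI[of _ a] conjI a allI impI)
      fix t assume "0 < t" "t < a"
      then show "?W t = ?W a" using a by (intro wronskian_const[OF s sol_xi]) auto
    qed
  qed
  ultimately have "?W a = 0" using tendsto_unique[OF trivial_limit_at_right_real] by blast
  from sol_proportional[OF s sol_xi xi_nontrivial this]
  obtain c where c: "\<And>x. x \<in> {0<..a} \<Longrightarrow> cnj (\<xi> l x) = c * \<xi> l x"
    "\<And>x. x \<in> {0<..a} \<Longrightarrow> cnj (\<eta> l x) = c * \<eta> l x" by blast
  let ?r = "\<lambda>x. \<xi> l x / of_real (x powr (\<nu> + 1/2))"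
  have "((\<lambda>x. cnj (?r x)) \<longlongrightarrow> cnj (of_real c0)) (at_right 0)"
    by (intro tendsto_cnj xi_lim)
  moreover have "((\<lambda>x. cnj (?r x)) \<longlongrightarrow> c * of_real c0) (at_right 0)"
  proof (rule Lim_transform_eventually[OF tendsto_mult_left[OF xi_lim[of l], of c]])
    show "\<forall>\<^sub>F x in at_right 0. c * ?r x = cnj (?r x)"
      unfolding eventually_at_right_field using c(1) a by (intro exI[of _ a]) auto
  qed
  ultimately have "cnj (complex_of_real c0) = c * of_real c0"
    using tendsto_unique[OF trivial_limit_at_right_real] by blast
  then have "c = 1" using c0 by simp
  then show "cnj (\<xi> l x) = \<xi> l x" "cnj (\<eta> l x) = \<eta> l x" using c x by auto
qed

end

subsection \<open>The quadratic form\<close>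

text \<open>Values at \<open>0\<close> of functions such as \<open>\<xi> z\<close> are arbitrary.
  Redefining them as the limit makes arguments on the compact interval \<open>{0..c}\<close>
  available.\<close>

lemma extend_by_zero_continuous:
  fixes F :: "real \<Rightarrow> 'b::real_normed_vector"
  assumes F: "continuous_on {0<..c} F" and p: "0 < p"
    and bnd: "\<And>x. x \<in> {0<..c} \<Longrightarrow> norm (F x) \<le> C * x powr p"
  shows "continuous_on {0..c} (\<lambda>x. if x = 0 then 0 else F x)"
  unfolding continuous_on_eq_continuous_within
proof
  fix x assume x: "x \<in> {0..c}"
  show "continuous (at x within {0..c}) (\<lambda>x. if x = 0 then 0 else F x)"
  proof (cases "x = 0")
    case True
    have lim: "((\<lambda>x::real. C * x powr p) \<longlongrightarrow> 0) (at 0 within {0..c})"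
    proof -
      have "((\<lambda>x::real. x powr p) \<longlongrightarrow> 0 powr p) (at 0 within {0..c})"
        using p by (intro tendsto_powr' tendsto_ident_at tendsto_const) (auto simp: eventually_at_filter)
      from tendsto_mult_left[OF this, of C] show ?thesis by simp
    qed
    have "((\<lambda>x. if x = 0 then 0 else F x) \<longlongrightarrow> 0) (at 0 within {0..c})"
    proof (rule Lim_null_comparison[OF _ lim])
      show "\<forall>\<^sub>F x in at 0 within {0..c}. norm (if x = 0 then 0 else F x) \<le> C * x powr p"
        unfolding eventually_at_filter by (rule always_eventually) (auto intro!: bnd)
    qed
    then show ?thesis using True by (simp add: continuous_within)
  next
    case False
    then have "x \<in> {0<..c}" using x by auto
    then have c: "continuous (at x within {0<..c}) F" using F by (simp add: continuous_on_eq_continuous_within)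
    have at: "at x within {0..c} = at x within {0<..c}"
      by (rule at_within_nhd[of _ "{0<..}"]) (use \<open>x \<in> {0<..c}\<close> in auto)
    have "continuous (at x within {0<..c}) (\<lambda>x. if x = 0 then 0 else F x)"
      by (rule continuous_transform_within[OF c, of 1]) (use \<open>x \<in> {0<..c}\<close> in auto)
    then show ?thesis by (simp add: at)
  qed
qed

text \<open>The decay of order \<open>p > 0\<close> removes the boundary term at the singular end
  point.\<close>

lemma fundamental_theorem_of_calculus_zero:
  fixes F :: "real \<Rightarrow> 'b::real_normed_vector"
  assumes F: "continuous_on {0<..c} F" and p: "0 < p" and c: "0 < c"
    and bnd: "\<And>x. x \<in> {0<..c} \<Longrightarrow> norm (F x) \<le> C * x powr p"
    and der: "\<And>x. 0 < x \<Longrightarrow> x < c \<Longrightarrow> (F has_vector_derivative F' x) (at x)"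
  shows "(F' has_integral F c) {0..c}"
proof -
  define G where "G x = (if x = 0 then 0 else F x)" for x
  have "(F' has_integral G c - G 0) {0..c}"
  proof (rule fundamental_theorem_of_calculus_interior)
    show "continuous_on {0..c} G"
      unfolding G_def[abs_def] by (rule extend_by_zero_continuous[OF F p bnd])
    fix x assume x: "x \<in> {0<..<c}"
    have "(F has_vector_derivative F' x) (at x)" using der[of x] x by auto
    then show "(G has_vector_derivative F' x) (at x)"
      by (rule has_vector_derivative_transform_within_open[of _ _ _ "{0<..}"]) (use x in \<open>auto simp: G_def\<close>)
  qed (use c in auto)
  then show ?thesis using c by (simp add: G_def)
qed

text \<open>Passage from an integral identity to a classical derivative when the integrand is
  continuous.\<close>

lemma indefinite_integral_derivative:
  fixes u g :: "real \<Rightarrow> 'b::euclidean_space"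
  assumes int: "\<And>x y. 0 < x \<Longrightarrow> x \<le> y \<Longrightarrow> y \<le> c \<Longrightarrow> (g has_integral (u y - u x)) {x..y}"
    and g: "continuous_on {0<..<c} g" and x: "0 < x" "x < c"
  shows "(u has_vector_derivative g x) (at x)"
proof -
  define s where "s = x / 2"
  define t where "t = (x + c) / 2"
  have st: "0 < s" "s < x" "x < t" "t < c" using x by (auto simp: s_def t_def)
  have "continuous_on {s..t} g" using st by (intro continuous_on_subset[OF g]) auto
  then have "((\<lambda>y. integral {s..y} g) has_vector_derivative g x) (at x within {s..t})"
    by (rule integral_has_vector_derivative) (use st in auto)
  then have "((\<lambda>y. u s + integral {s..y} g) has_vector_derivative 0 + g x) (at x within {s..t})"
    by (intro has_vector_derivative_add has_vector_derivative_const)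
  then have A: "((\<lambda>y. u s + integral {s..y} g) has_vector_derivative g x) (at x within {s..t})" by simp
  have B: "u y = u s + integral {s..y} g" if "y \<in> {s..t}" for y
  proof -
    have "integral {s..y} g = u y - u s" using that st by (intro integral_unique int) auto
    then show ?thesis by simp
  qed
  have "(u has_vector_derivative g x) (at x within {s..t})"
    by (rule has_vector_derivative_transform[OF _ B A]) (use st in auto)
  moreover have "at x within {s..t} = at x"
    using st by (intro at_within_interior) (simp add: interior_atLeastAtMost_real)
  ultimately show ?thesis by simp
qed

text \<open>\<open>f\<close> is controlled only on \<open>{0<..c}\<close> while the primitive of
  \<open>h\<close> starts at \<open>0\<close>: its part up to \<open>x\<close> is a constant that
  multiplies \<open>f y - f x\<close>. This is the lower half of the variation of constants
  formula.\<close>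

lemma integral_by_parts_from_zero:
  fixes f f' h :: "real \<Rightarrow> complex"
  assumes h: "h absolutely_integrable_on {0..c}"
    and der: "\<And>x. x \<in> {0<..c} \<Longrightarrow> (f has_vector_derivative f' x) (at x within {0<..c})"
    and f': "continuous_on {0<..c} f'" and xy: "0 < x" "x \<le> y" "y \<le> c"
  shows "((\<lambda>t. f' t * integral {0..t} h + f t * h t) has_integral
    (f y * integral {0..y} h - f x * integral {0..x} h)) {x..y}"
proof -
  have sub: "{x..y} \<subseteq> {0<..c}" "{x..y} \<subseteq> {0..c}" using xy by auto
  have der': "\<And>t. t \<in> {x..y} \<Longrightarrow> (f has_vector_derivative f' t) (at t within {x..y})"
    using der sub by (blast intro: has_vector_derivative_within_subset)
  have hi: "h integrable_on {0..c}" using h by (simp add: absolutely_integrable_on_def)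
  have "h absolutely_integrable_on {x..y}" by (rule set_integrable_subset[OF h _ sub(2)]) auto
  then have 1: "((\<lambda>t. f' t * integral {x..t} h + f t * h t) has_integral f y * integral {x..y} h) {x..y}"
    by (intro integral_by_parts_indefinite xy der' continuous_on_subset[OF f' sub(1)])
  have 2: "((\<lambda>t. f' t * integral {0..x} h) has_integral (f y - f x) * integral {0..x} h) {x..y}"
    by (intro has_integral_mult_left fundamental_theorem_of_calculus xy der')
  have comb: "integral {0..x} h + integral {x..t} h = integral {0..t} h" if "t \<in> {x..y}" for t
    using that xy by (intro Henstock_Kurzweil_Integration.integral_combine integrable_subinterval_real[OF hi]) auto
  have "((\<lambda>t. (f' t * integral {0..x} h) + (f' t * integral {x..t} h + f t * h t)) has_integral
      (f y - f x) * integral {0..x} h + f y * integral {x..y} h) {x..y}"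
    by (rule has_integral_add[OF 2 1])
  moreover have "(f y - f x) * integral {0..x} h + f y * integral {x..y} h
      = f y * integral {0..y} h - f x * integral {0..x} h"
    using comb[of y, symmetric] xy by (simp add: algebra_simps)
  ultimately have "((\<lambda>t. (f' t * integral {0..x} h) + (f' t * integral {x..t} h + f t * h t)) has_integral
      f y * integral {0..y} h - f x * integral {0..x} h) {x..y}" by simp
  then show ?thesis
  proof (rule has_integral_eq[rotated])
    fix t assume "t \<in> {x..y}"
    from comb[OF this, symmetric]
    show "f' t * integral {0..x} h + (f' t * integral {x..t} h + f t * h t) = f' t * integral {0..t} h + f t * h t"
      by (simp add: algebra_simps)
  qed
qed

text \<open>The upper half: \<open>h\<close> is integrable only away from \<open>0\<close>, so its
  primitive is taken from the other end point.\<close>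

lemma integral_by_parts_to_end:
  fixes f f' h :: "real \<Rightarrow> complex"
  assumes h: "\<And>s. 0 < s \<Longrightarrow> h absolutely_integrable_on {s..c}"
    and der: "\<And>x. x \<in> {0<..c} \<Longrightarrow> (f has_vector_derivative f' x) (at x within {0<..c})"
    and f': "continuous_on {0<..c} f'" and xy: "0 < x" "x \<le> y" "y \<le> c"
  shows "((\<lambda>t. f' t * integral {t..c} h - f t * h t) has_integral
    (f y * integral {y..c} h - f x * integral {x..c} h)) {x..y}"
proof -
  have sub: "{x..y} \<subseteq> {0<..c}" "{x..y} \<subseteq> {x..c}" using xy by auto
  have der': "\<And>t. t \<in> {x..y} \<Longrightarrow> (f has_vector_derivative f' t) (at t within {x..y})"
    using der sub by (blast intro: has_vector_derivative_within_subset)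
  have hi: "h integrable_on {x..c}" using h[OF xy(1)] by (simp add: absolutely_integrable_on_def)
  have "h absolutely_integrable_on {x..y}" by (rule set_integrable_subset[OF h[OF xy(1)] _ sub(2)]) auto
  then have 1: "((\<lambda>t. f' t * integral {x..t} h + f t * h t) has_integral f y * integral {x..y} h) {x..y}"
    by (intro integral_by_parts_indefinite xy der' continuous_on_subset[OF f' sub(1)])
  have 2: "((\<lambda>t. f' t * integral {x..c} h) has_integral (f y - f x) * integral {x..c} h) {x..y}"
    by (intro has_integral_mult_left fundamental_theorem_of_calculus xy der')
  have comb: "integral {x..t} h + integral {t..c} h = integral {x..c} h" if "t \<in> {x..y}" for t
    using that xy by (intro Henstock_Kurzweil_Integration.integral_combine hi) auto
  have "((\<lambda>t. (f' t * integral {x..c} h) - (f' t * integral {x..t} h + f t * h t)) has_integral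
      (f y - f x) * integral {x..c} h - f y * integral {x..y} h) {x..y}"
    by (rule has_integral_diff[OF 2 1])
  moreover have "(f y - f x) * integral {x..c} h - f y * integral {x..y} h
      = f y * integral {y..c} h - f x * integral {x..c} h"
    using comb[of y, symmetric] xy by (simp add: algebra_simps)
  ultimately have "((\<lambda>t. (f' t * integral {x..c} h) - (f' t * integral {x..t} h + f t * h t)) has_integral
      f y * integral {y..c} h - f x * integral {x..c} h) {x..y}" by simp
  then show ?thesis
    by (rule has_integral_eq[rotated]) (simp add: comb[symmetric] algebra_simps)
qed

section \<open>Domain functions, symmetry and semiboundedness\<close>

context bessel_problem
begin

lemma k_gt: "1/2 < k" and m_gt: "1/2 < m" and m_le: "m \<le> 1" "m \<le> k" and mk: "0 < m + k - 1"
  using nu by (auto simp: k_def m_def min_def)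

text \<open>\<open>f\<close> is the image of \<open>u\<close> under the differential expression. The
  growth bounds stand for the condition at \<open>0\<close>, uniformly in \<open>\<nu>\<close>: as
  \<open>m > 1/2\<close>, products such as \<open>u * v'\<close> are of order
  \<open>x powr (2 * m - 1)\<close> and leave no boundary term, and as \<open>m + k > 1\<close>, the
  only solutions in \<open>dom\<close> are multiples of \<open>\<xi>\<close>.\<close>

definition dom :: "(real \<Rightarrow> real) \<Rightarrow> (real \<Rightarrow> real) \<Rightarrow> (real \<Rightarrow> real) \<Rightarrow> bool" where
  "dom u u' f \<longleftrightarrow> continuous_on {0..a} u \<and> continuous_on {0<..a} u' \<and> continuous_on {0..a} f \<and>
     (\<forall>x\<in>{0<..<a}. (u has_real_derivative u' x) (at x) \<and> (u' has_real_derivative P x * u x - f x) (at x)) \<and>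
     (\<exists>C. \<forall>x\<in>{0<..a}. \<bar>u x\<bar> \<le> C * x powr m \<and> \<bar>u' x\<bar> \<le> C * x powr (m - 1)) \<and>
     u a * cos \<gamma> + u' a * sin \<gamma> = 0"

lemma domD:
  assumes "dom u u' f"
  shows "continuous_on {0..a} u" "continuous_on {0<..a} u'" "continuous_on {0..a} f"
    "\<And>x. 0 < x \<Longrightarrow> x < a \<Longrightarrow> (u has_real_derivative u' x) (at x)"
    "\<And>x. 0 < x \<Longrightarrow> x < a \<Longrightarrow> (u' has_real_derivative P x * u x - f x) (at x)"
    "u a * cos \<gamma> + u' a * sin \<gamma> = 0"
  using assms by (auto simp: dom_def)

lemma dom_bound:
  assumes "dom u u' f"
  obtains C where "0 < C" "\<And>x. x \<in> {0<..a} \<Longrightarrow> \<bar>u x\<bar> \<le> C * x powr m"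
    "\<And>x. x \<in> {0<..a} \<Longrightarrow> \<bar>u' x\<bar> \<le> C * x powr (m - 1)"
proof -
  obtain C where C: "\<forall>x\<in>{0<..a}. \<bar>u x\<bar> \<le> C * x powr m \<and> \<bar>u' x\<bar> \<le> C * x powr (m - 1)"
    using assms by (auto simp: dom_def)
  have *: "C * x powr p \<le> (\<bar>C\<bar> + 1) * x powr p" for x p :: real by (intro mult_right_mono) auto
  show ?thesis
  proof (rule that[of "\<bar>C\<bar> + 1"])
    fix x assume "x \<in> {0<..a}"
    then have "\<bar>u x\<bar> \<le> C * x powr m" "\<bar>u' x\<bar> \<le> C * x powr (m - 1)" using C by blast+
    then show "\<bar>u x\<bar> \<le> (\<bar>C\<bar> + 1) * x powr m" "\<bar>u' x\<bar> \<le> (\<bar>C\<bar> + 1) * x powr (m - 1)"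
      using *[of x m] *[of x "m - 1"] by linarith+
  qed simp
qed

lemma dom_lin:
  assumes u: "dom u u' f" and v: "dom v v' g"
  shows "dom (\<lambda>x. c * u x + d * v x) (\<lambda>x. c * u' x + d * v' x) (\<lambda>x. c * f x + d * g x)"
  unfolding dom_def
proof (intro conjI ballI)
  note U = domD[OF u] and V = domD[OF v]
  show "continuous_on {0..a} (\<lambda>x. c * u x + d * v x)" "continuous_on {0<..a} (\<lambda>x. c * u' x + d * v' x)"
    "continuous_on {0..a} (\<lambda>x. c * f x + d * g x)"
    by (intro continuous_intros U V)+
  fix x assume x: "x \<in> {0<..<a}"
  then have x': "0 < x" "x < a" by auto
  show "((\<lambda>x. c * u x + d * v x) has_real_derivative c * u' x + d * v' x) (at x)"
    by (intro DERIV_add DERIV_cmult U(4) V(4) x')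
  have "((\<lambda>x. c * u' x + d * v' x) has_real_derivative c * (P x * u x - f x) + d * (P x * v x - g x)) (at x)"
    by (intro DERIV_add DERIV_cmult U(5) V(5) x')
  then show "((\<lambda>x. c * u' x + d * v' x) has_real_derivative P x * (c * u x + d * v x) - (c * f x + d * g x)) (at x)"
    by (simp add: algebra_simps)
next
  obtain C where C: "0 < C" "\<And>x. x \<in> {0<..a} \<Longrightarrow> \<bar>u x\<bar> \<le> C * x powr m"
    "\<And>x. x \<in> {0<..a} \<Longrightarrow> \<bar>u' x\<bar> \<le> C * x powr (m - 1)" by (rule dom_bound[OF u]) blast
  obtain D where D: "0 < D" "\<And>x. x \<in> {0<..a} \<Longrightarrow> \<bar>v x\<bar> \<le> D * x powr m"
    "\<And>x. x \<in> {0<..a} \<Longrightarrow> \<bar>v' x\<bar> \<le> D * x powr (m - 1)" by (rule dom_bound[OF v]) blast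
  have tri: "\<bar>c * y + d * z\<bar> \<le> (\<bar>c\<bar> * C + \<bar>d\<bar> * D) * w" if "\<bar>y\<bar> \<le> C * w" "\<bar>z\<bar> \<le> D * w" for y z w
  proof -
    have "\<bar>c * y + d * z\<bar> \<le> \<bar>c\<bar> * \<bar>y\<bar> + \<bar>d\<bar> * \<bar>z\<bar>"
      by (rule order_trans[OF abs_triangle_ineq]) (simp add: abs_mult)
    also have "\<dots> \<le> \<bar>c\<bar> * (C * w) + \<bar>d\<bar> * (D * w)"
      using that by (intro add_mono mult_left_mono) auto
    finally show ?thesis by (simp add: algebra_simps)
  qed
  show "\<exists>B. \<forall>x\<in>{0<..a}. \<bar>c * u x + d * v x\<bar> \<le> B * x powr m \<and> \<bar>c * u' x + d * v' x\<bar> \<le> B * x powr (m - 1)"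
    using tri C D by (intro exI[of _ "\<bar>c\<bar> * C + \<bar>d\<bar> * D"]) blast
next
  have "(c * u a + d * v a) * cos \<gamma> + (c * u' a + d * v' a) * sin \<gamma> =
      c * (u a * cos \<gamma> + u' a * sin \<gamma>) + d * (v a * cos \<gamma> + v' a * sin \<gamma>)"
    by (simp add: algebra_simps)
  then show "(c * u a + d * v a) * cos \<gamma> + (c * u' a + d * v' a) * sin \<gamma> = 0"
    using domD(6)[OF u] domD(6)[OF v] by simp
qed

lemma dom_cong:
  assumes "dom u u' f" "\<And>x. x \<in> {0..a} \<Longrightarrow> f x = g x"
  shows "dom u u' g"
  using assms continuous_on_cong[OF refl assms(2), of "{0..a}"] by (auto simp: dom_def)

lemma dom_sum:
  assumes "finite L" "\<And>l. l \<in> L \<Longrightarrow> dom (u l) (u' l) (f l)"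
  shows "dom (\<lambda>x. \<Sum>l\<in>L. c l * u l x) (\<lambda>x. \<Sum>l\<in>L. c l * u' l x) (\<lambda>x. \<Sum>l\<in>L. c l * f l x)"
  using assms
proof (induction L rule: finite_induct)
  case empty
  then show ?case by (auto simp: dom_def intro!: exI[of _ 0])
next
  case (insert l L)
  then show ?case using dom_lin[of "u l" "u' l" "f l" _ _ _ "c l" 1] by simp
qed

text \<open>Lagrange's identity. The Wronskian of \<open>u\<close> and \<open>v\<close> vanishes at
  \<open>0\<close> by growth and at \<open>a\<close> because both satisfy the same boundary
  condition, where \<open>sin \<gamma> > 0\<close> can be divided out.\<close>

lemma dom_symmetric:
  assumes u: "dom u u' f" and v: "dom v v' g"
  shows "ip a f v = ip a u g"
proof -
  note U = domD[OF u] and V = domD[OF v]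
  obtain C where C: "0 < C" "\<And>x. x \<in> {0<..a} \<Longrightarrow> \<bar>u x\<bar> \<le> C * x powr m"
    "\<And>x. x \<in> {0<..a} \<Longrightarrow> \<bar>u' x\<bar> \<le> C * x powr (m - 1)" by (rule dom_bound[OF u]) blast
  obtain D where D: "0 < D" "\<And>x. x \<in> {0<..a} \<Longrightarrow> \<bar>v x\<bar> \<le> D * x powr m"
    "\<And>x. x \<in> {0<..a} \<Longrightarrow> \<bar>v' x\<bar> \<le> D * x powr (m - 1)" by (rule dom_bound[OF v]) blast
  have "((\<lambda>x. f x * v x - u x * g x) has_integral u a * v' a - u' a * v a) {0..a}"
  proof (rule fundamental_theorem_of_calculus_zero[where p = "2 * m - 1" and C = "2 * C * D" and F = "\<lambda>x. u x * v' x - u' x * v x"])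
    have sub: "{0<..a} \<subseteq> {0..a}" by auto
    show "continuous_on {0<..a} (\<lambda>x. u x * v' x - u' x * v x)"
      by (intro continuous_intros U V continuous_on_subset[OF U(1) sub] continuous_on_subset[OF V(1) sub])
    show "norm (u x * v' x - u' x * v x) \<le> 2 * C * D * x powr (2 * m - 1)" if x: "x \<in> {0<..a}" for x
    proof -
      have "norm (u x * v' x - u' x * v x) \<le> \<bar>u x\<bar> * \<bar>v' x\<bar> + \<bar>u' x\<bar> * \<bar>v x\<bar>"
        unfolding real_norm_def by (rule order_trans[OF abs_triangle_ineq4]) (simp add: abs_mult)
      also have "\<dots> \<le> (C * x powr m) * (D * x powr (m - 1)) + (C * x powr (m - 1)) * (D * x powr m)"
        using C D x by (intro add_mono mult_mono) auto
      also have "\<dots> = 2 * C * D * (x powr m * x powr (m - 1))" by simp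
      also have "x powr m * x powr (m - 1) = x powr (2 * m - 1)" by (simp flip: powr_add)
      finally show ?thesis .
    qed
    show "((\<lambda>x. u x * v' x - u' x * v x) has_vector_derivative f x * v x - u x * g x) (at x)" if x: "0 < x" "x < a" for x
    proof -
      have "((\<lambda>x. u x * v' x - u' x * v x) has_real_derivative
          (u' x * v' x + (P x * v x - g x) * u x) - ((P x * u x - f x) * v x + v' x * u' x)) (at x)"
        by (intro DERIV_diff DERIV_mult U(4,5)[OF x] V(4,5)[OF x])
      then show ?thesis by (simp add: has_real_derivative_iff_has_vector_derivative algebra_simps)
    qed
  qed (use m_gt a in auto)
  moreover have "sin \<gamma> * (u a * v' a - u' a * v a) = u a * (v a * cos \<gamma> + v' a * sin \<gamma>) - v a * (u a * cos \<gamma> + u' a * sin \<gamma>)"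
    by (simp add: algebra_simps)
  then have "u a * v' a - u' a * v a = 0" using U(6) V(6) sin_gamma by simp
  ultimately have "integral {0..a} (\<lambda>x. f x * v x - u x * g x) = 0" by (simp add: integral_unique)
  then show ?thesis
    unfolding ip_def using ip_int[OF U(3) V(1)] ip_int[OF U(1) V(3)] by (subst (asm) integral_diff) auto
qed

text \<open>\<open>x powr (- k) * u\<close> has derivative
  \<open>x powr (- k) * (u' - k * u / x)\<close>; Cauchy-Schwarz separates the weight from the
  energy of the completed square.\<close>

lemma dom_weighted_diff:
  assumes u: "dom u u' f" and x: "0 < x" "x \<le> y" "y \<le> a"
  shows "(y powr (- k) * u y - x powr (- k) * u x)\<^sup>2 \<le>
    integral {x..y} (\<lambda>s. s powr (- 2 * k)) * integral {x..y} (\<lambda>s. (u' s - k * u s / s)\<^sup>2)"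
proof -
  note U = domD[OF u]
  have sub: "{x..y} \<subseteq> {0<..a}" "{x..y} \<subseteq> {0..a}" using x by auto
  have g: "continuous_on {x..y} (\<lambda>s. u' s - k * u s / s)"
    using x by (intro continuous_intros continuous_on_subset[OF U(2) sub(1)] continuous_on_subset[OF U(1) sub(2)]) auto
  have w: "continuous_on {x..y} (\<lambda>s. s powr (- k))" using x by (intro continuous_intros) auto
  have "((\<lambda>s. s powr (- k) * (u' s - k * u s / s)) has_integral (y powr (- k) * u y - x powr (- k) * u x)) {x..y}"
  proof (rule fundamental_theorem_of_calculus_interior[OF x(2)])
    show "continuous_on {x..y} (\<lambda>s. s powr (- k) * u s)"
      by (intro continuous_intros w continuous_on_subset[OF U(1) sub(2)])
    fix s assume "s \<in> {x<..<y}"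
    then have s: "0 < s" "s < a" using x by auto
    have "((\<lambda>s. s powr (- k)) has_real_derivative - k * s powr (- k - 1)) (at s)"
      using s by (auto intro!: derivative_eq_intros)
    from DERIV_mult[OF this U(4)[OF s]]
    have "((\<lambda>s. s powr (- k) * u s) has_real_derivative s powr (- k) * (u' s - k * u s / s)) (at s)"
      using s by (simp add: powr_diff field_simps)
    then show "((\<lambda>s. s powr (- k) * u s) has_vector_derivative s powr (- k) * (u' s - k * u s / s)) (at s)"
      by (simp add: has_real_derivative_iff_has_vector_derivative)
  qed
  then have "y powr (- k) * u y - x powr (- k) * u x = integral {x..y} (\<lambda>s. s powr (- k) * (u' s - k * u s / s))"
    by (simp add: integral_unique)
  also have "\<dots>\<^sup>2 \<le> integral {x..y} (\<lambda>s. (s powr (- k))\<^sup>2) * integral {x..y} (\<lambda>s. (u' s - k * u s / s)\<^sup>2)"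
    by (rule integral_cauchy_schwarz[OF w g])
  also have "(\<lambda>s. (s powr (- k))\<^sup>2) = (\<lambda>s::real. s powr (- 2 * k))"
    by (auto simp: power2_eq_square simp flip: powr_add)
  finally show ?thesis .
qed

text \<open>Completing the square with respect to the solution \<open>x\<^sup>k\<close> of the unperturbed equation at
  \<open>z = 0\<close> turns the Bessel part of the quadratic form into \<open>\<integral> (u' - k u / x)\<^sup>2\<close>, which
  dominates \<open>q\<close> because \<open>x q\<close> is integrable.\<close>

lemma form_identity:
  assumes u: "dom u u' f" and e: "0 < e" "e \<le> a"
  shows "integral {e..a} (\<lambda>x. f x * u x) = (k * (u a)\<^sup>2 / a - u' a * u a) - (k * (u e)\<^sup>2 / e - u' e * u e)
    + integral {e..a} (\<lambda>s. (u' s - k * u s / s)\<^sup>2) + integral {e..a} (\<lambda>x. q x * (u x)\<^sup>2)"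
proof -
  note U = domD[OF u]
  have sub: "{e..a} \<subseteq> {0<..a}" "{e..a} \<subseteq> {0..a}" "{e..a} \<subseteq> {0<..b}" using e ab by auto
  have uc: "continuous_on {e..a} u" "continuous_on {e..a} u'" "continuous_on {e..a} f" "continuous_on {e..a} q"
    by (rule continuous_on_subset[OF U(1) sub(2)] continuous_on_subset[OF U(2) sub(1)]
        continuous_on_subset[OF U(3) sub(2)] continuous_on_subset[OF q_cont sub(3)])+
  have g: "continuous_on {e..a} (\<lambda>s. u' s - k * u s / s)"
    using e by (intro continuous_intros uc) auto
  have i: "(\<lambda>s. (u' s - k * u s / s)\<^sup>2) integrable_on {e..a}" "(\<lambda>x. q x * (u x)\<^sup>2) integrable_on {e..a}"
    "(\<lambda>x. f x * u x) integrable_on {e..a}"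
    by (intro integrable_continuous_real continuous_on_power g, (intro integrable_continuous_real continuous_intros uc)+)
  have "((\<lambda>x. f x * u x - ((u' x - k * u x / x)\<^sup>2 + q x * (u x)\<^sup>2)) has_integral
      ((k * (u a)\<^sup>2 / a - u' a * u a) - (k * (u e)\<^sup>2 / e - u' e * u e))) {e..a}"
  proof (rule fundamental_theorem_of_calculus_interior[OF e(2)])
    show "continuous_on {e..a} (\<lambda>x. k * (u x)\<^sup>2 / x - u' x * u x)"
      using e by (intro continuous_intros uc) auto
    fix x assume "x \<in> {e<..<a}"
    then have x: "0 < x" "x < a" using e by auto
    have P: "P x = (k * k - k) / x\<^sup>2 + q x" 
    proof -
      have "\<nu>\<^sup>2 - 1/4 = k * k - k" by (simp add: k_def power2_eq_square algebra_simps)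
      then show ?thesis by (simp add: P_def)
    qed
    have "((\<lambda>x. k * (u x)\<^sup>2 / x - u' x * u x) has_real_derivative
        (k * (2 * u x * u' x) * x - k * (u x)\<^sup>2) / (x * x) - ((P x * u x - f x) * u x + u' x * u' x)) (at x)"
      using x by (auto intro!: derivative_eq_intros U(4,5)[OF x] simp: power2_eq_square)
    also have "(k * (2 * u x * u' x) * x - k * (u x)\<^sup>2) / (x * x) - ((P x * u x - f x) * u x + u' x * u' x) =
        f x * u x - ((u' x - k * u x / x)\<^sup>2 + q x * (u x)\<^sup>2)"
      using x unfolding P by (simp add: field_simps power2_eq_square)
    finally show "((\<lambda>x. k * (u x)\<^sup>2 / x - u' x * u x) has_vector_derivative
        f x * u x - ((u' x - k * u x / x)\<^sup>2 + q x * (u x)\<^sup>2)) (at x)"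
      by (simp add: has_real_derivative_iff_has_vector_derivative)
  qed
  then have "integral {e..a} (\<lambda>x. f x * u x - ((u' x - k * u x / x)\<^sup>2 + q x * (u x)\<^sup>2)) =
     ((k * (u a)\<^sup>2 / a - u' a * u a) - (k * (u e)\<^sup>2 / e - u' e * u e))"
    by (rule integral_unique)
  then show ?thesis using i by (simp add: integral_diff integral_add integrable_add)
qed

lemma integral_power_weight:
  assumes "0 < x" "x \<le> y"
  shows "integral {x..y} (\<lambda>s. s powr (- 2 * k)) \<le> x powr (- 2 * \<nu>) / (2 * \<nu>)"
proof -
  have "((\<lambda>s. s powr (- 2 * k)) has_integral (- (y powr (- 2 * \<nu>)) / (2 * \<nu>) - - (x powr (- 2 * \<nu>)) / (2 * \<nu>))) {x..y}"
  proof (rule fundamental_theorem_of_calculus[OF assms(2)])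
    fix s assume "s \<in> {x..y}"
    then have s: "0 < s" using assms by auto
    have "((\<lambda>s. - (s powr (- 2 * \<nu>)) / (2 * \<nu>)) has_real_derivative s powr (- 2 * k)) (at s)"
      using s nu by (auto intro!: derivative_eq_intros simp: k_def)
    then show "((\<lambda>s. - (s powr (- 2 * \<nu>)) / (2 * \<nu>)) has_vector_derivative s powr (- 2 * k)) (at s within {x..y})"
      by (simp add: has_real_derivative_iff_has_vector_derivative has_vector_derivative_at_within)
  qed
  then have "integral {x..y} (\<lambda>s. s powr (- 2 * k)) = x powr (- 2 * \<nu>) / (2 * \<nu>) - y powr (- 2 * \<nu>) / (2 * \<nu>)"
    by (simp add: integral_unique)
  moreover have "0 \<le> y powr (- 2 * \<nu>) / (2 * \<nu>)" using nu by simp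
  ultimately show ?thesis by linarith
qed

text \<open>A Hardy type bound. Comparing \<open>x powr (- k) * u\<close> at \<open>x\<close> and at
  \<open>a\<close> costs a weight integral of order \<open>x powr (- 2 * \<nu>)\<close>, which is
  just the factor between \<open>(x powr (- k) * u)\<^sup>2\<close> and
  \<open>u\<^sup>2 / x\<close>.\<close>

lemma dom_pointwise:
  assumes u: "dom u u' f" and x: "0 < x" "x \<le> a"
  shows "(u x)\<^sup>2 / x \<le> 2 * (u a)\<^sup>2 / a + integral {x..a} (\<lambda>s. (u' s - k * u s / s)\<^sup>2) / \<nu>"
proof -
  define E where "E = integral {x..a} (\<lambda>s. (u' s - k * u s / s)\<^sup>2)"
  have E0: "0 \<le> E" unfolding E_def
  proof (rule integral_nonneg)
    have sub: "{x..a} \<subseteq> {0<..a}" "{x..a} \<subseteq> {0..a}" using x by auto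
    show "(\<lambda>s. (u' s - k * u s / s)\<^sup>2) integrable_on {x..a}"
      using x by (intro integrable_continuous_real continuous_intros continuous_on_subset[OF domD(2)[OF u] sub(1)]
          continuous_on_subset[OF domD(1)[OF u] sub(2)]) auto
  qed auto
  define A where "A = a powr (- k) * u a"
  define X where "X = x powr (- k) * u x"
  have "(A - X)\<^sup>2 \<le> integral {x..a} (\<lambda>s. s powr (- 2 * k)) * E"
    unfolding A_def X_def E_def by (rule dom_weighted_diff[OF u x order_refl])
  also have "\<dots> \<le> x powr (- 2 * \<nu>) / (2 * \<nu>) * E"
    by (intro mult_right_mono integral_power_weight E0 x)
  finally have d: "(A - X)\<^sup>2 \<le> x powr (- 2 * \<nu>) / (2 * \<nu>) * E" .
  have "X\<^sup>2 \<le> 2 * A\<^sup>2 + 2 * (A - X)\<^sup>2"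
  proof -
    have "0 \<le> (2 * A - X)\<^sup>2" by simp
    then show ?thesis by (simp add: power2_eq_square algebra_simps)
  qed
  also have "2 * (A - X)\<^sup>2 \<le> 2 * (x powr (- 2 * \<nu>) / (2 * \<nu>) * E)" by (rule mult_left_mono[OF d]) simp
  also have "\<dots> = x powr (- 2 * \<nu>) / \<nu> * E" using nu by simp
  finally have X: "X\<^sup>2 \<le> 2 * A\<^sup>2 + x powr (- 2 * \<nu>) / \<nu> * E" by simp
  have sq: "(t powr (- k))\<^sup>2 = t powr (- 2 * \<nu>) / t" if "0 < t" for t
  proof -
    have "(t powr (- k))\<^sup>2 = t powr (- k + - k)" by (simp only: power2_eq_square powr_add)
    also have "- k + - k = - 2 * \<nu> - 1" by (simp add: k_def)
    finally show ?thesis using that by (simp add: powr_diff)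
  qed
  have "x powr (- 2 * \<nu>) * ((u x)\<^sup>2 / x) = X\<^sup>2"
    unfolding X_def power_mult_distrib sq[OF x(1)] by simp
  also have "\<dots> \<le> 2 * (a powr (- 2 * \<nu>) * ((u a)\<^sup>2 / a)) + x powr (- 2 * \<nu>) / \<nu> * E"
    using X unfolding A_def power_mult_distrib sq[OF a] by simp
  also have "\<dots> \<le> 2 * (x powr (- 2 * \<nu>) * ((u a)\<^sup>2 / a)) + x powr (- 2 * \<nu>) / \<nu> * E"
  proof -
    have "a powr (- 2 * \<nu>) \<le> x powr (- 2 * \<nu>)" using x nu by (intro powr_mono2') auto
    then show ?thesis using a by (intro add_right_mono mult_left_mono mult_right_mono) auto
  qed
  also have "\<dots> = x powr (- 2 * \<nu>) * (2 * (u a)\<^sup>2 / a + E / \<nu>)" by (simp add: algebra_simps)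
  finally have "x powr (- 2 * \<nu>) * ((u x)\<^sup>2 / x) \<le> x powr (- 2 * \<nu>) * (2 * (u a)\<^sup>2 / a + E / \<nu>)" .
  then show ?thesis unfolding E_def by (rule mult_left_le_imp_le) (use x in simp)
qed

text \<open>A trace inequality with a small factor \<open>h\<close> before the energy:
  \<open>u(a)\<close> is compared with \<open>u(y)\<close> for \<open>y\<close> in
  \<open>{a - h..a}\<close> and the result integrated over \<open>y\<close>. The constant is
  \<open>a powr (2 * k) * 2 * (a / 2) powr (- 2 * k)\<close>, since
  \<open>y >= a / 2\<close>.\<close>

lemma dom_endpoint:
  assumes u: "dom u u' f" and h: "0 < h" "h \<le> a / 2" and e: "0 < e" "e \<le> a / 2"
  shows "(u a)\<^sup>2 \<le> 2 powr (2 * k + 1) * (ip a u u / h + h * integral {e..a} (\<lambda>s. (u' s - k * u s / s)\<^sup>2))"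
proof -
  note U = domD[OF u]
  define E where "E = integral {e..a} (\<lambda>s. (u' s - k * u s / s)\<^sup>2)"
  define C where "C = (2::real) powr (2 * k + 1)"
  have g: "continuous_on {y..a} (\<lambda>s. (u' s - k * u s / s)\<^sup>2)" if "0 < y" for y
  proof -
    have sub: "{y..a} \<subseteq> {0<..a}" "{y..a} \<subseteq> {0..a}" using that by auto
    show ?thesis
      using that by (intro continuous_intros continuous_on_subset[OF U(2) sub(1)] continuous_on_subset[OF U(1) sub(2)]) auto
  qed
  have pt: "(u a)\<^sup>2 \<le> C * (u y)\<^sup>2 + C * h * E" if y: "y \<in> {a - h..a}" for y
  proof -
    have y': "0 < y" "y \<le> a" "e \<le> y" "a / 2 \<le> y" "a - y \<le> h" using y h e a by auto
    define A where "A = a powr (- k) * u a"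
    define Y where "Y = y powr (- k) * u y"
    define c where "c = (a / 2) powr (- 2 * k)"
    have c: "s powr (- 2 * k) \<le> c" if "a / 2 \<le> s" for s
      unfolding c_def using that a k_gt by (intro powr_mono2') auto
    have "integral {y..a} (\<lambda>s. s powr (- 2 * k)) \<le> integral {y..a} (\<lambda>s. c)"
      using y' c by (intro integral_le integrable_continuous_real continuous_intros) auto
    also have "\<dots> = (a - y) * c" using y' by simp
    also have "\<dots> \<le> h * c" using y' by (intro mult_right_mono) (auto simp: c_def)
    finally have i1: "integral {y..a} (\<lambda>s. s powr (- 2 * k)) \<le> h * c" .
    have i2: "integral {y..a} (\<lambda>s. (u' s - k * u s / s)\<^sup>2) \<le> E"
      unfolding E_def using y' e by (intro integral_subset_le integrable_continuous_real g) auto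
    have "(A - Y)\<^sup>2 \<le> integral {y..a} (\<lambda>s. s powr (- 2 * k)) * integral {y..a} (\<lambda>s. (u' s - k * u s / s)\<^sup>2)"
      unfolding A_def Y_def by (rule dom_weighted_diff[OF u y'(1,2) order_refl])
    also have "\<dots> \<le> (h * c) * E"
      using i1 i2 h y' by (intro mult_mono integral_nonneg integrable_continuous_real g) (auto simp: c_def)
    finally have d: "(A - Y)\<^sup>2 \<le> h * c * E" .
    have sq: "(t powr (- k))\<^sup>2 = t powr (- 2 * k)" for t
      by (simp add: power2_eq_square flip: powr_add)
    have "A\<^sup>2 \<le> 2 * Y\<^sup>2 + 2 * (A - Y)\<^sup>2"
    proof -
      have "0 \<le> (2 * Y - A)\<^sup>2" by simp
      then show ?thesis by (simp add: power2_eq_square algebra_simps)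
    qed
    also have "Y\<^sup>2 \<le> c * (u y)\<^sup>2"
      unfolding Y_def power_mult_distrib sq using c[OF y'(4)] by (intro mult_right_mono) auto
    finally have "A\<^sup>2 \<le> 2 * c * (u y)\<^sup>2 + 2 * (h * c * E)" using d by linarith
    moreover have "a powr (2 * k) * A\<^sup>2 = (u a)\<^sup>2"
      unfolding A_def power_mult_distrib sq using a by (simp add: powr_minus field_simps)
    moreover have "a powr (2 * k) * (2 * c) = C"
      using a by (simp add: c_def C_def powr_divide powr_minus powr_add field_simps)
    ultimately have "(u a)\<^sup>2 \<le> a powr (2 * k) * (2 * c * (u y)\<^sup>2 + 2 * (h * c * E))"
      by (metis mult_left_mono powr_ge_zero)
    also have "\<dots> = (a powr (2 * k) * (2 * c)) * (u y)\<^sup>2 + (a powr (2 * k) * (2 * c)) * h * E" by (simp add: algebra_simps)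
    finally show ?thesis unfolding \<open>a powr (2 * k) * (2 * c) = C\<close> .
  qed
  have sub: "{a - h..a} \<subseteq> {0..a}" using h a by auto
  have uu: "continuous_on {a - h..a} (\<lambda>y. (u y)\<^sup>2)" by (intro continuous_intros continuous_on_subset[OF U(1) sub])
  have "h * (u a)\<^sup>2 = integral {a - h..a} (\<lambda>y. (u a)\<^sup>2)" using h by simp
  also have "\<dots> \<le> integral {a - h..a} (\<lambda>y. C * (u y)\<^sup>2 + C * h * E)"
    using pt by (intro integral_le integrable_continuous_real continuous_intros continuous_on_subset[OF U(1) sub]) auto
  also have "\<dots> = C * integral {a - h..a} (\<lambda>y. (u y)\<^sup>2) + h * (C * h * E)"
    using h by (subst integral_add) (auto intro!: integrable_continuous_real continuous_intros continuous_on_subset[OF U(1) sub])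
  also have "integral {a - h..a} (\<lambda>y. (u y)\<^sup>2) \<le> integral {0..a} (\<lambda>y. (u y)\<^sup>2)"
    by (intro integral_subset_le sub integrable_continuous_real[OF uu]
        integrable_continuous_real[OF continuous_on_power[OF U(1)]]) auto
  also have "\<dots> = ip a u u" by (simp add: ip_def power2_eq_square)
  finally have "h * (u a)\<^sup>2 \<le> C * ip a u u + h * (C * h * E)"
    by (simp add: C_def)
  then have "(u a)\<^sup>2 \<le> (C * ip a u u + h * (C * h * E)) / h"
    using h by (simp add: field_simps)
  also have "\<dots> = C * (ip a u u / h + h * E)" using h by (simp add: field_simps)
  finally show ?thesis by (simp add: C_def E_def)
qed

text \<open>Three terms compete with the energy \<open>E\<close>: \<open>q\<close> near
  \<open>0\<close>, controlled by \<open>dom_pointwise\<close> and the small integral of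
  \<open>x * |q|\<close>; \<open>q\<close> on \<open>{\<delta>..a}\<close>, where it is bounded; and
  the boundary terms at \<open>a\<close>, which the trace inequality trades against a small part of
  \<open>E\<close>.\<close>

lemma form_bound:
  obtains T where "0 \<le> T"
    "\<And>u u' f. dom u u' f \<Longrightarrow> (u a)\<^sup>2 + ip a u u \<le> ip a f u + T * ip a u u"
proof -
  have "continuous_on {0..a} (\<lambda>t. integral {0..t} (\<lambda>x. x * \<bar>q x\<bar>))"
    by (rule indefinite_integral_continuous_1[OF q_int])
  moreover have "0 \<in> {0..a}" "0 < \<nu> / 4" using a nu by auto
  \<comment> \<open>The bound \<open>\<nu> / 4\<close> is dictated by the summand
    \<open>E / \<nu>\<close> of \<open>W\<close> below: the part of \<open>q\<close> near
    \<open>0\<close> then costs only \<open>E / 4\<close>.\<close>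
  ultimately obtain d where d: "d > 0" "\<And>t. t \<in> {0..a} \<Longrightarrow> dist t 0 < d \<Longrightarrow>
      dist (integral {0..t} (\<lambda>x. x * \<bar>q x\<bar>)) (integral {0..0} (\<lambda>x. x * \<bar>q x\<bar>)) < \<nu> / 4"
    unfolding continuous_on_iff by blast
  define \<delta> where "\<delta> = min (d / 2) (a / 2)"
  have \<delta>: "0 < \<delta>" "\<delta> \<le> a / 2" "\<delta> < a" using d a by (auto simp: \<delta>_def)
  have \<kappa>: "integral {0..\<delta>} (\<lambda>x. x * \<bar>q x\<bar>) \<le> \<nu> / 4"
  proof -
    have "\<delta> < d" using d(1) by (auto simp: \<delta>_def)
    then show ?thesis using d(2)[of \<delta>] \<delta> by (auto simp: dist_norm)
  qed
  have "continuous_on {\<delta>..a} q" using \<delta> ab by (intro continuous_on_subset[OF q_cont]) auto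
  then obtain Q where Q: "0 < Q" "\<And>x. x \<in> {\<delta>..a} \<Longrightarrow> norm (q x) \<le> Q" using continuous_on_Icc_bounded by blast
  define ct where "ct = cos \<gamma> / sin \<gamma>"
  \<comment> \<open>All coefficients of \<open>u(a)\<^sup>2\<close>: the boundary condition, the
    completed square, the part of \<open>q\<close> near \<open>0\<close>, and the term on the left
    of the claim.\<close>
  define B where "B = \<bar>ct\<bar> + k / a + \<nu> / (2 * a) + 1"
  define C where "C = (2::real) powr (2 * k + 1)"
  have B: "0 < B" unfolding B_def using a nu k_gt by (simp add: add_nonneg_pos)
  have C: "0 < C" by (simp add: C_def)
  \<comment> \<open>With \<open>B * C * h <= 1 / 4\<close> the boundary terms cost a second
    \<open>E / 4\<close>, so half of the energy is left over.\<close>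
  define h where "h = min (a / 2) (1 / (4 * B * C))"
  have h: "0 < h" "h \<le> a / 2" "B * C * h \<le> 1 / 4"
  proof -
    show "0 < h" "h \<le> a / 2" using a B C by (auto simp: h_def)
    have "B * C * h \<le> B * C * (1 / (4 * B * C))" using B C by (intro mult_left_mono) (auto simp: h_def)
    then show "B * C * h \<le> 1 / 4" using B C by simp
  qed
  \<comment> \<open>\<open>Q\<close> stems from the bounded part of \<open>q\<close>,
    \<open>B * C / h\<close> from the trace inequality and \<open>1\<close> from the norm on the
    left of the claim.\<close>
  define T where "T = Q + B * C / h + 1"
  show ?thesis
  proof (rule that[of T])
    show "0 \<le> T" unfolding T_def using Q B C h by simp
    fix u u' f assume u: "dom u u' f"
    note U = domD[OF u]
    define S where "S = ip a u u"
    have S: "0 \<le> S" unfolding S_def by (rule ip_nonneg[OF U(1)])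
    obtain D where D: "0 < D" "\<And>x. x \<in> {0<..a} \<Longrightarrow> \<bar>u x\<bar> \<le> D * x powr m"
      "\<And>x. x \<in> {0<..a} \<Longrightarrow> \<bar>u' x\<bar> \<le> D * x powr (m - 1)" by (rule dom_bound[OF u]) blast
    have u'a: "u' a = - ct * u a" using U(6) sin_gamma by (simp add: ct_def field_simps)
    \<comment> \<open>The terms of the identity need not be integrable separately up to
      \<open>0\<close>; the estimate is made on \<open>{e..a}\<close> with an explicit error that
      vanishes with \<open>e\<close>.\<close>
    have main: "(u a)\<^sup>2 + S \<le> integral {e..a} (\<lambda>x. f x * u x) + T * S + (k + 1) * D\<^sup>2 * e powr (2 * m - 1)"
      if e: "0 < e" "e \<le> \<delta>" for e
    proof -
      have e': "e \<le> a / 2" "e \<le> a" using e \<delta> by auto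
      define E where "E = integral {e..a} (\<lambda>s. (u' s - k * u s / s)\<^sup>2)"
      have sub: "{e..a} \<subseteq> {0<..a}" "{e..a} \<subseteq> {0..a}" "{e..a} \<subseteq> {0<..b}" using e ab by auto
      have uc: "continuous_on {e..a} u" "continuous_on {e..a} u'" "continuous_on {e..a} q"
        by (rule continuous_on_subset[OF U(1) sub(2)] continuous_on_subset[OF U(2) sub(1)]
            continuous_on_subset[OF q_cont sub(3)])+
      have E0: "0 \<le> E" unfolding E_def
        using e by (intro integral_nonneg integrable_continuous_real continuous_intros uc) auto
      have gc: "(\<lambda>s. (u' s - k * u s / s)\<^sup>2) integrable_on {e..a}"
        using e by (intro integrable_continuous_real continuous_intros uc) auto
      define W where "W = 2 * (u a)\<^sup>2 / a + E / \<nu>"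
      \<comment> \<open>This turns \<open>|q| * u\<^sup>2\<close> into \<open>W * (x * |q|)\<close>,
        with the energy inside the constant \<open>W\<close>.\<close>
      have pw: "(u x)\<^sup>2 \<le> x * W" if "x \<in> {e..a}" for x
      proof -
        have x: "0 < x" "x \<le> a" using that e by auto
        have "integral {x..a} (\<lambda>s. (u' s - k * u s / s)\<^sup>2) \<le> E"
          unfolding E_def using that gc integrable_subinterval_real[OF gc, of x a]
          by (intro integral_subset_le) auto
        then have "integral {x..a} (\<lambda>s. (u' s - k * u s / s)\<^sup>2) / \<nu> \<le> E / \<nu>" using nu by (simp add: divide_right_mono)
        then have "(u x)\<^sup>2 / x \<le> W" using dom_pointwise[OF u x] by (simp add: W_def)
        then show ?thesis using x by (simp add: field_simps)
      qed
      have W0: "0 \<le> W" unfolding W_def using E0 a nu by simp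
      have qi: "(\<lambda>x. \<bar>q x\<bar> * (u x)\<^sup>2) integrable_on {e..a}" "(\<lambda>x. q x * (u x)\<^sup>2) integrable_on {e..a}"
        "(\<lambda>x. x * \<bar>q x\<bar>) integrable_on {e..a}"
        by (intro integrable_continuous_real continuous_intros uc)+
      have qs: "g integrable_on {e..\<delta>}" "g integrable_on {\<delta>..a}" if "g integrable_on {e..a}" for g :: "real \<Rightarrow> real"
        using integrable_subinterval_real[OF that] e \<delta> by auto
      have "integral {e..\<delta>} (\<lambda>x. \<bar>q x\<bar> * (u x)\<^sup>2) \<le> integral {e..\<delta>} (\<lambda>x. W * (x * \<bar>q x\<bar>))"
      proof (rule integral_le)
        show "(\<lambda>x. W * (x * \<bar>q x\<bar>)) integrable_on {e..\<delta>}" by (intro integrable_on_mult_right qs(1)[OF qi(3)])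
        fix x assume "x \<in> {e..\<delta>}"
        then have "\<bar>q x\<bar> * (u x)\<^sup>2 \<le> \<bar>q x\<bar> * (x * W)" using pw[of x] \<delta> by (intro mult_left_mono) auto
        then show "\<bar>q x\<bar> * (u x)\<^sup>2 \<le> W * (x * \<bar>q x\<bar>)" by (simp add: mult_ac)
      qed (rule qs(1)[OF qi(1)])
      also have "\<dots> = W * integral {e..\<delta>} (\<lambda>x. x * \<bar>q x\<bar>)" by simp
      also have "\<dots> \<le> W * integral {0..\<delta>} (\<lambda>x. x * \<bar>q x\<bar>)"
        using e \<delta> W0 qs(1)[OF qi(3)] integrable_subinterval_real[OF q_int, of 0 \<delta>]
        by (intro mult_left_mono integral_subset_le) auto
      also have "\<dots> \<le> W * (\<nu> / 4)" using \<kappa> W0 by (intro mult_left_mono)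
      also have "\<dots> = \<nu> / (2 * a) * (u a)\<^sup>2 + E / 4" using a nu by (simp add: W_def field_simps)
      finally have q1: "integral {e..\<delta>} (\<lambda>x. \<bar>q x\<bar> * (u x)\<^sup>2) \<le> \<nu> / (2 * a) * (u a)\<^sup>2 + E / 4" .
      have uc2: "continuous_on {\<delta>..a} (\<lambda>x. (u x)\<^sup>2)"
        using \<delta> by (intro continuous_intros continuous_on_subset[OF U(1)]) auto
      have "integral {\<delta>..a} (\<lambda>x. \<bar>q x\<bar> * (u x)\<^sup>2) \<le> integral {\<delta>..a} (\<lambda>x. Q * (u x)\<^sup>2)"
        using Q by (intro integral_le qs(2)[OF qi(1)] integrable_on_mult_right integrable_continuous_real[OF uc2] mult_right_mono) auto
      also have "\<dots> = Q * integral {\<delta>..a} (\<lambda>x. (u x)\<^sup>2)" by simp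
      also have "\<dots> \<le> Q * integral {0..a} (\<lambda>x. (u x)\<^sup>2)"
        using Q \<delta> by (intro mult_left_mono integral_subset_le integrable_continuous_real[OF uc2]
            integrable_continuous_real[OF continuous_on_power[OF U(1)]]) auto
      also have "\<dots> = Q * S" by (simp add: S_def ip_def power2_eq_square)
      finally have q2: "integral {\<delta>..a} (\<lambda>x. \<bar>q x\<bar> * (u x)\<^sup>2) \<le> Q * S" .
      have "integral {e..\<delta>} (\<lambda>x. \<bar>q x\<bar> * (u x)\<^sup>2) + integral {\<delta>..a} (\<lambda>x. \<bar>q x\<bar> * (u x)\<^sup>2) = integral {e..a} (\<lambda>x. \<bar>q x\<bar> * (u x)\<^sup>2)"
        using e \<delta> by (intro Henstock_Kurzweil_Integration.integral_combine qi) auto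
      moreover have "norm (integral {e..a} (\<lambda>x. q x * (u x)\<^sup>2)) \<le> integral {e..a} (\<lambda>x. \<bar>q x\<bar> * (u x)\<^sup>2)"
        using qi by (intro Henstock_Kurzweil_Integration.integral_norm_bound_integral) (auto simp: abs_mult)
      ultimately have qq: "integral {e..a} (\<lambda>x. q x * (u x)\<^sup>2) \<ge> - (\<nu> / (2 * a) * (u a)\<^sup>2 + E / 4 + Q * S)"
        using q1 q2 by auto
      have "\<bar>k * (u e)\<^sup>2 / e - u' e * u e\<bar> \<le> (k + 1) * D\<^sup>2 * e powr (2 * m - 1)"
      proof -
        have ea: "e \<in> {0<..a}" using e e' by auto
        have "\<bar>u e\<bar>\<^sup>2 \<le> (D * e powr m)\<^sup>2" using D(2)[OF ea] by (intro power_mono) auto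
        also have "(D * e powr m)\<^sup>2 = D\<^sup>2 * (e powr m * e powr m)" by (simp add: power2_eq_square)
        also have "e powr m * e powr m = e powr (2 * m - 1) * e" using e by (simp add: powr_diff flip: powr_add)
        finally have 1: "(u e)\<^sup>2 / e \<le> D\<^sup>2 * e powr (2 * m - 1)" using e by (simp add: field_simps)
        have "\<bar>u' e * u e\<bar> \<le> (D * e powr (m - 1)) * (D * e powr m)"
          unfolding abs_mult using D ea by (intro mult_mono) auto
        also have "\<dots> = D\<^sup>2 * e powr (2 * m - 1)" by (simp add: power2_eq_square flip: powr_add)
        finally have 2: "\<bar>u' e * u e\<bar> \<le> D\<^sup>2 * e powr (2 * m - 1)" .
        have "\<bar>k * (u e)\<^sup>2 / e - u' e * u e\<bar> \<le> k * ((u e)\<^sup>2 / e) + \<bar>u' e * u e\<bar>"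
          using k_gt e by (auto intro!: order_trans[OF abs_triangle_ineq4])
        also have "\<dots> \<le> k * (D\<^sup>2 * e powr (2 * m - 1)) + D\<^sup>2 * e powr (2 * m - 1)"
          using 1 2 k_gt by (intro add_mono mult_left_mono) auto
        finally show ?thesis by (simp add: algebra_simps)
      qed
      moreover have "k * (u a)\<^sup>2 / a - u' a * u a \<ge> - (\<bar>ct\<bar> + k / a) * (u a)\<^sup>2"
      proof -
        have "k * (u a)\<^sup>2 / a - u' a * u a = k / a * (u a)\<^sup>2 + ct * (u a)\<^sup>2" by (simp add: u'a power2_eq_square)
        moreover have "ct * (u a)\<^sup>2 \<ge> - \<bar>ct\<bar> * (u a)\<^sup>2" by (intro mult_right_mono) auto
        moreover have "0 \<le> k / a * (u a)\<^sup>2" using k_gt a by simp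
        moreover have "- (\<bar>ct\<bar> + k / a) * (u a)\<^sup>2 = - \<bar>ct\<bar> * (u a)\<^sup>2 - k / a * (u a)\<^sup>2" by (simp add: algebra_simps)
        ultimately show ?thesis by linarith
      qed
      moreover have "B * (u a)\<^sup>2 \<le> B * (C * (S / h + h * E))"
        using dom_endpoint[OF u h(1,2) e(1) e'(1)] B unfolding C_def S_def E_def by (intro mult_left_mono) auto
      moreover have "B * (C * (S / h + h * E)) \<le> B * C / h * S + E / 4"
      proof -
        have "(B * C * h) * E \<le> 1 / 4 * E" using h(3) E0 by (intro mult_right_mono)
        then show ?thesis by (simp add: algebra_simps)
      qed
      ultimately show ?thesis
        using form_identity[OF u e(1) e'(2)] qq E0 unfolding T_def B_def E_def[symmetric]
        by (simp add: algebra_simps)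
    qed
    have "((\<lambda>e. integral {e..a} (\<lambda>x. f x * u x) + T * S + (k + 1) * D\<^sup>2 * e powr (2 * m - 1)) \<longlongrightarrow>
        integral {0..a} (\<lambda>x. f x * u x) + T * S + (k + 1) * D\<^sup>2 * 0) (at_right 0)"
    proof (intro tendsto_intros powr_tendsto_0)
      show "0 < 2 * m - 1" using m_gt by simp
      have "continuous_on {0..a} (\<lambda>e. integral {e..a} (\<lambda>x. f x * u x))"
        by (rule indefinite_integral_continuous_1'[OF ip_int[OF U(3) U(1)]])
      then have "((\<lambda>e. integral {e..a} (\<lambda>x. f x * u x)) \<longlongrightarrow> integral {0..a} (\<lambda>x. f x * u x)) (at 0 within {0..a})"
        using a by (auto simp: continuous_on_def)
      then show "((\<lambda>e. integral {e..a} (\<lambda>x. f x * u x)) \<longlongrightarrow> integral {0..a} (\<lambda>x. f x * u x)) (at_right 0)"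
        using at_within_Icc_at_right[OF a] by simp
    qed
    then have "(u a)\<^sup>2 + S \<le> integral {0..a} (\<lambda>x. f x * u x) + T * S + (k + 1) * D\<^sup>2 * 0"
    proof (rule tendsto_lowerbound)
      show "\<forall>\<^sub>F e in at_right 0. (u a)\<^sup>2 + S \<le> integral {e..a} (\<lambda>x. f x * u x) + T * S + (k + 1) * D\<^sup>2 * e powr (2 * m - 1)"
        unfolding eventually_at_right_field using main \<delta> by (intro exI[of _ \<delta>]) auto
    qed simp
    then show "(u a)\<^sup>2 + ip a u u \<le> ip a f u + T * ip a u u" by (simp add: ip_def S_def)
  qed
qed

end

subsection \<open>Variation of constants\<close>

lemma continuous_on_half_open:
  fixes f :: "real \<Rightarrow> 'b::topological_space"
  assumes "\<And>s. 0 < s \<Longrightarrow> s \<le> c \<Longrightarrow> continuous_on {s..c} f"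
  shows "continuous_on {0<..c} f"
  unfolding continuous_on_eq_continuous_within
proof
  fix x assume x: "x \<in> {0<..c}"
  have "continuous (at x within {x / 2..c}) f"
    using assms[of "x / 2"] x by (auto simp: continuous_on_eq_continuous_within)
  moreover have "at x within {x / 2..c} = at x within {0<..c}"
    by (rule at_within_nhd[of _ "{x / 2<..}"]) (use x in auto)
  ultimately show "continuous (at x within {0<..c}) f" by simp
qed

text \<open>Continuity of \<open>u'\<close> up to \<open>c\<close> upgrades the interior derivatives
  to a one-sided derivative at \<open>c\<close>, through the integral of \<open>u'\<close>.\<close>

lemma derivative_within_half_open:
  fixes u u' :: "real \<Rightarrow> 'b::euclidean_space"
  assumes u: "continuous_on {0<..c} u" and u': "continuous_on {0<..c} u'"
    and der: "\<And>x. 0 < x \<Longrightarrow> x < c \<Longrightarrow> (u has_vector_derivative u' x) (at x)"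
    and x: "x \<in> {0<..c}"
  shows "(u has_vector_derivative u' x) (at x within {0<..c})"
proof -
  define s where "s = x / 2"
  have s: "0 < s" "s < x" "s \<le> c" using x by (auto simp: s_def)
  have sub: "{s..c} \<subseteq> {0<..c}" using s by auto
  have "((\<lambda>y. integral {s..y} u') has_vector_derivative u' x) (at x within {s..c})"
    by (rule integral_has_vector_derivative) (use s x sub u' in \<open>auto elim: continuous_on_subset\<close>)
  then have "((\<lambda>y. u s + integral {s..y} u') has_vector_derivative 0 + u' x) (at x within {s..c})"
    by (intro has_vector_derivative_add has_vector_derivative_const)
  then have A: "((\<lambda>y. u s + integral {s..y} u') has_vector_derivative u' x) (at x within {s..c})" by simp
  have B: "u y = u s + integral {s..y} u'" if y: "y \<in> {s..c}" for y
  proof -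
    have "(u' has_integral (u y - u s)) {s..y}"
    proof (rule fundamental_theorem_of_calculus_interior)
      show "continuous_on {s..y} u" using y s by (intro continuous_on_subset[OF u]) auto
      show "(u has_vector_derivative u' t) (at t)" if "t \<in> {s<..<y}" for t
        using der[of t] that y s by auto
    qed (use y in auto)
    then have "integral {s..y} u' = u y - u s" by (rule integral_unique)
    then show ?thesis by simp
  qed
  have "(u has_vector_derivative u' x) (at x within {s..c})"
    by (rule has_vector_derivative_transform[OF _ B A]) (use s x in auto)
  moreover have "at x within {s..c} = at x within {0<..c}"
    by (rule at_within_nhd[of _ "{s<..}"]) (use x s in auto)
  ultimately show ?thesis by simp
qed

context bessel_problem
begin

text \<open>Integral form, because \<open>\<rho>\<close> is to be merely integrable and
  \<open>u'\<close> is then only absolutely continuous. \<open>B\<close> is meant to be uniform in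
  \<open>\<rho>\<close>, which enters through its \<open>L1\<close> norm.\<close>

definition weak_sol ::
    "complex \<Rightarrow> (real \<Rightarrow> complex) \<Rightarrow> (real \<Rightarrow> complex) \<Rightarrow> (real \<Rightarrow> complex) \<Rightarrow> real \<Rightarrow> bool" where
  "weak_sol l \<rho> u u' B \<longleftrightarrow> continuous_on {0<..a} u \<and> continuous_on {0<..a} u' \<and>
     (\<forall>x y. 0 < x \<and> x \<le> y \<and> y \<le> a \<longrightarrow> (u' has_integral (u y - u x)) {x..y} \<and>
        ((\<lambda>t. (of_real (P t) - l) * u t - \<rho> t) has_integral (u' y - u' x)) {x..y}) \<and>
     (\<forall>x\<in>{0<..a}. norm (u x) \<le> B * x powr m * integral {0..a} (\<lambda>s. norm (\<rho> s)) \<and>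
        norm (u' x) \<le> B * x powr (m - 1) * integral {0..a} (\<lambda>s. norm (\<rho> s))) \<and>
     u a * of_real (cos \<gamma>) + u' a * of_real (sin \<gamma>) = 0"

text \<open>Variation of constants with \<open>\<xi>\<close> and the solution \<open>\<theta>\<close> that satisfies the boundary
  condition at \<open>a\<close>; the Wronskian of the two is \<open>\<Delta>\<close>.\<close>

lemma resolvent_exists:
  assumes l: "\<Delta> l \<noteq> 0"
  obtains B where "0 < B" "\<And>\<rho>. \<rho> absolutely_integrable_on {0..a} \<Longrightarrow> \<exists>u u'. weak_sol l \<rho> u u' B"
proof -
  have sub: "{0<..a} \<subseteq> {0<..b}" using ab by auto
  obtain \<theta> \<theta>' where \<theta>: "\<theta> a = of_real (sin \<gamma>)" "\<theta>' a = - of_real (cos \<gamma>)"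
    "\<And>x. x \<in> {0<..a} \<Longrightarrow> (\<theta> has_vector_derivative \<theta>' x) (at x within {0<..a})"
    "\<And>x. x \<in> {0<..a} \<Longrightarrow> (\<theta>' has_vector_derivative (of_real (P x) - l) * \<theta> x) (at x within {0<..a})"
  proof (rule linear_ode_exists[OF a, of "\<lambda>x. of_real (P x) - l"])
    show "continuous_on {0<..a} (\<lambda>x. complex_of_real (P x) - l)"
      by (intro continuous_intros continuous_on_subset[OF P_cont sub])
  qed blast
  have s\<theta>: "sol l \<theta> \<theta>'" unfolding sol_def using \<theta> by blast
  obtain C1 where C1: "0 < C1" "\<And>x. x \<in> {0<..a} \<Longrightarrow> norm (\<theta> x) \<le> C1 * x powr (1 - k)"
    "\<And>x. x \<in> {0<..a} \<Longrightarrow> norm (\<theta>' x) \<le> C1 * x powr (- k)" by (rule sol_bound[OF s\<theta>]) blast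
  obtain C2 where C2: "0 < C2" "\<And>x. x \<in> {0<..a} \<Longrightarrow> norm (\<xi> l x) \<le> C2 * x powr k"
    "\<And>x. x \<in> {0<..a} \<Longrightarrow> norm (\<eta> l x) \<le> C2 * x powr (k - 1)" by (rule xi_bound[where z = l]) blast
  have W: "\<theta> x * \<eta> l x - \<theta>' x * \<xi> l x = \<Delta> l" if "x \<in> {0<..a}" for x
  proof -
    have "\<theta> x * \<eta> l x - \<theta>' x * \<xi> l x = \<theta> a * \<eta> l a - \<theta>' a * \<xi> l a"
      using a by (intro wronskian_const[OF s\<theta> sol_xi that]) auto
    then show ?thesis by (simp add: \<theta> \<Delta>_def algebra_simps)
  qed
  define A where "A = a powr (1 - m)"
  have A: "0 < A" using a by (simp add: A_def)
  \<comment> \<open>The product of orders in the kernel for \<open>x <= s\<close>, bounded by a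
    function of \<open>x\<close> alone; the cap of \<open>m\<close> at \<open>1\<close> originates
    here.\<close>
  have mix: "x powr k * s powr (1 - k) \<le> A * x powr m" if "0 < x" "x \<le> s" "s \<le> a" for x s
  proof -
    have "x powr k = x powr m * x powr (k - m)" by (simp flip: powr_add)
    also have "\<dots> \<le> x powr m * s powr (k - m)"
      using that m_le by (intro mult_left_mono powr_mono2) auto
    finally have "x powr k * s powr (1 - k) \<le> x powr m * s powr (k - m) * s powr (1 - k)"
      by (intro mult_right_mono) auto
    also have "\<dots> = x powr m * s powr (1 - m)" by (simp add: mult.assoc flip: powr_add)
    also have "\<dots> \<le> x powr m * A"
      unfolding A_def using that m_le by (intro mult_left_mono powr_mono2) auto
    finally show ?thesis by (simp add: mult.commute)
  qed
  have mix': "x powr (k - 1) * s powr (1 - k) \<le> A * x powr (m - 1)" if "0 < x" "x \<le> s" "s \<le> a" for x s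
  proof -
    have "x powr (k - 1) * s powr (1 - k) = (x powr k * s powr (1 - k)) / x" using that by (simp add: powr_diff)
    also have "\<dots> \<le> (A * x powr m) / x" using mix[OF that] that by (intro divide_right_mono) auto
    finally show ?thesis using that by (simp add: powr_diff)
  qed
  define B where "B = 2 * C1 * C2 * A / norm (\<Delta> l)"
  show ?thesis
  proof (rule that[of B])
    show "0 < B" unfolding B_def using C1 C2 A l by simp
    fix \<rho> :: "real \<Rightarrow> complex" assume \<rho>: "\<rho> absolutely_integrable_on {0..a}"
    define J where "J = integral {0..a} (\<lambda>s. norm (\<rho> s))"
    have n\<rho>: "(\<lambda>s. norm (\<rho> s)) integrable_on {0..a}" using \<rho> by (simp add: absolutely_integrable_on_def)
    have nJ: "integral {x..y} (\<lambda>s. norm (\<rho> s)) \<le> J" if "0 \<le> x" "y \<le> a" for x y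
      unfolding J_def using that n\<rho> integrable_on_subinterval[OF n\<rho>, of x y] by (intro integral_subset_le) auto
    \<comment> \<open>\<open>\<xi> l\<close> has no prescribed value at \<open>0\<close>; setting it
      to \<open>0\<close> makes the factor continuous and hence bounded on
      \<open>{0..a}\<close>.\<close>
    define h1 where "h1 s = (if s = 0 then 0 else \<xi> l s) * \<rho> s" for s
    define h2 where "h2 s = \<theta> s * \<rho> s" for s
    have h1: "h1 absolutely_integrable_on {0..a}"
      unfolding h1_def[abs_def]
    proof (rule absolutely_integrable_bounded_measurable_product[OF bilinear_times _ _ _ \<rho>])
      have gc: "continuous_on {0..a} (\<lambda>s. if s = 0 then 0 else \<xi> l s)"
        by (rule extend_by_zero_continuous[OF xi_cont _ C2(2)]) (use k_gt in auto)
      show "(\<lambda>s. if s = 0 then 0 else \<xi> l s) \<in> borel_measurable (lebesgue_on {0..a})"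
        by (rule continuous_imp_measurable_on_sets_lebesgue[OF gc]) auto
      show "bounded ((\<lambda>s. if s = 0 then 0 else \<xi> l s) ` {0..a})"
        by (rule compact_imp_bounded[OF compact_continuous_image[OF gc compact_Icc]])
    qed auto
    have h2: "h2 absolutely_integrable_on {s..a}" if "0 < s" for s
      unfolding h2_def[abs_def]
    proof (rule absolutely_integrable_bounded_measurable_product[OF bilinear_times])
      have "continuous_on {s..a} \<theta>" using that by (intro continuous_on_subset[OF sol_cont(1)[OF s\<theta>]]) auto
      then show "\<theta> \<in> borel_measurable (lebesgue_on {s..a})" "bounded (\<theta> ` {s..a})"
        by (auto intro!: continuous_imp_measurable_on_sets_lebesgue compact_imp_bounded compact_continuous_image)
      show "\<rho> absolutely_integrable_on {s..a}" by (rule set_integrable_subset[OF \<rho>]) (use that in auto)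
    qed auto
    define I1 where "I1 x = integral {0..x} h1" for x
    define I2 where "I2 x = integral {x..a} h2" for x
    have h1i: "h1 integrable_on {0..a}" using h1 by (simp add: absolutely_integrable_on_def)
    have h2i: "h2 integrable_on {s..a}" if "0 < s" for s using h2[OF that] by (simp add: absolutely_integrable_on_def)
    have I1c: "continuous_on {0<..a} I1"
      unfolding I1_def[abs_def] by (rule continuous_on_subset[OF indefinite_integral_continuous_1[OF h1i]]) auto
    have I2c: "continuous_on {0<..a} I2"
      unfolding I2_def[abs_def] by (intro continuous_on_half_open indefinite_integral_continuous_1' h2i)
    define u where "u x = (\<theta> x * I1 x + \<xi> l x * I2 x) / \<Delta> l" for x
    define u' where "u' x = (\<theta>' x * I1 x + \<eta> l x * I2 x) / \<Delta> l" for x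
    note cont = sol_cont[OF s\<theta>] xi_cont eta_cont I1c I2c
    have Pc: "continuous_on {0<..a} (\<lambda>x. (of_real (P x) - l) * f x)" if "continuous_on {0<..a} f" for f
      by (intro continuous_intros that continuous_on_subset[OF P_cont sub])
    have uc: "continuous_on {0<..a} u" "continuous_on {0<..a} u'"
      unfolding u_def[abs_def] u'_def[abs_def] using l by (intro continuous_intros cont; simp)+
    have int: "(u' has_integral (u y - u x)) {x..y} \<and>
        ((\<lambda>t. (of_real (P t) - l) * u t - \<rho> t) has_integral (u' y - u' x)) {x..y}"
      if xy: "0 < x" "x \<le> y" "y \<le> a" for x y
    proof
      have "((\<lambda>t. ((\<theta>' t * I1 t + \<theta> t * h1 t) + (\<eta> l t * I2 t - \<xi> l t * h2 t)) / \<Delta> l) has_integral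
          ((\<theta> y * I1 y - \<theta> x * I1 x) + (\<xi> l y * I2 y - \<xi> l x * I2 x)) / \<Delta> l) {x..y}"
        unfolding I1_def I2_def
        by (intro has_integral_divide has_integral_add integral_by_parts_from_zero[OF h1 \<theta>(3) cont(2) xy]
            integral_by_parts_to_end[OF h2 solD(1)[OF sol_xi] eta_cont xy])
      moreover have "((\<theta> y * I1 y - \<theta> x * I1 x) + (\<xi> l y * I2 y - \<xi> l x * I2 x)) / \<Delta> l = u y - u x"
        by (simp add: u_def diff_divide_distrib add_divide_distrib)
      ultimately have "((\<lambda>t. ((\<theta>' t * I1 t + \<theta> t * h1 t) + (\<eta> l t * I2 t - \<xi> l t * h2 t)) / \<Delta> l) has_integral u y - u x) {x..y}"
        by simp
      then show "(u' has_integral (u y - u x)) {x..y}"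
      proof (rule has_integral_eq[rotated])
        fix t assume "t \<in> {x..y}"
        then have "t \<noteq> 0" using xy by auto
        then show "((\<theta>' t * I1 t + \<theta> t * h1 t) + (\<eta> l t * I2 t - \<xi> l t * h2 t)) / \<Delta> l = u' t"
          by (simp add: u'_def h1_def h2_def)
      qed
      have "((\<lambda>t. (((of_real (P t) - l) * \<theta> t * I1 t + \<theta>' t * h1 t) + ((of_real (P t) - l) * \<xi> l t * I2 t - \<eta> l t * h2 t)) / \<Delta> l) has_integral
          ((\<theta>' y * I1 y - \<theta>' x * I1 x) + (\<eta> l y * I2 y - \<eta> l x * I2 x)) / \<Delta> l) {x..y}"
        unfolding I1_def I2_def
        by (intro has_integral_divide has_integral_add integral_by_parts_from_zero[OF h1 \<theta>(4) Pc[OF cont(1)] xy]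
            integral_by_parts_to_end[OF h2 solD(2)[OF sol_xi] Pc[OF xi_cont] xy])
      moreover have "((\<theta>' y * I1 y - \<theta>' x * I1 x) + (\<eta> l y * I2 y - \<eta> l x * I2 x)) / \<Delta> l = u' y - u' x"
        by (simp add: u'_def diff_divide_distrib add_divide_distrib)
      ultimately have "((\<lambda>t. (((of_real (P t) - l) * \<theta> t * I1 t + \<theta>' t * h1 t) + ((of_real (P t) - l) * \<xi> l t * I2 t - \<eta> l t * h2 t)) / \<Delta> l) has_integral
          u' y - u' x) {x..y}" by simp
      then show "((\<lambda>t. (of_real (P t) - l) * u t - \<rho> t) has_integral (u' y - u' x)) {x..y}"
      proof (rule has_integral_eq[rotated])
        fix t assume "t \<in> {x..y}"
        then have t: "t \<noteq> 0" "t \<in> {0<..a}" using xy by auto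
        have "((of_real (P t) - l) * \<theta> t * I1 t + \<theta>' t * h1 t) + ((of_real (P t) - l) * \<xi> l t * I2 t - \<eta> l t * h2 t)
            = (of_real (P t) - l) * (\<theta> t * I1 t + \<xi> l t * I2 t) - (\<theta> t * \<eta> l t - \<theta>' t * \<xi> l t) * \<rho> t"
          using t by (simp add: h1_def h2_def algebra_simps)
        then show "(((of_real (P t) - l) * \<theta> t * I1 t + \<theta>' t * h1 t) + ((of_real (P t) - l) * \<xi> l t * I2 t - \<eta> l t * h2 t)) / \<Delta> l
            = (of_real (P t) - l) * u t - \<rho> t"
          unfolding W[OF t(2)] using l by (simp add: u_def diff_divide_distrib)
      qed
    qed
    have i1: "norm (f * I1 x) \<le> E * J"
      if x: "x \<in> {0<..a}" and E: "\<And>s. s \<in> {0<..x} \<Longrightarrow> norm (f * \<xi> l s) \<le> E" "0 \<le> E" for f x E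
    proof -
      have "f * I1 x = integral {0..x} (\<lambda>s. f * h1 s)" by (simp add: I1_def)
      also have "norm \<dots> \<le> integral {0..x} (\<lambda>s. E * norm (\<rho> s))"
      proof (rule Henstock_Kurzweil_Integration.integral_norm_bound_integral)
        show "(\<lambda>s. f * h1 s) integrable_on {0..x}"
          using x by (intro integrable_on_mult_right integrable_subinterval_real[OF h1i]) auto
        show "(\<lambda>s. E * norm (\<rho> s)) integrable_on {0..x}"
          using x by (intro integrable_on_mult_right integrable_subinterval_real[OF n\<rho>]) auto
        fix s assume s: "s \<in> {0..x}"
        show "norm (f * h1 s) \<le> E * norm (\<rho> s)"
        proof (cases "s = 0")
          case True
          then show ?thesis using E(2) by (simp add: h1_def)
        next
          case False
          have "norm (f * h1 s) = norm (f * \<xi> l s) * norm (\<rho> s)" using False by (simp add: h1_def norm_mult)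
          also have "\<dots> \<le> E * norm (\<rho> s)" using E(1)[of s] s False by (intro mult_right_mono) auto
          finally show ?thesis .
        qed
      qed
      also have "\<dots> = E * integral {0..x} (\<lambda>s. norm (\<rho> s))" by simp
      also have "\<dots> \<le> E * J" using nJ[of 0 x] x E by (intro mult_left_mono) auto
      finally show ?thesis .
    qed
    have i2: "norm (f * I2 x) \<le> E * J"
      if x: "x \<in> {0<..a}" and E: "\<And>s. s \<in> {x..a} \<Longrightarrow> norm (f * \<theta> s) \<le> E" for f x E
    proof -
      have E0: "0 \<le> E" using order_trans[OF norm_ge_zero E[of x]] x by auto
      have "f * I2 x = integral {x..a} (\<lambda>s. f * h2 s)" by (simp add: I2_def)
      also have "norm \<dots> \<le> integral {x..a} (\<lambda>s. E * norm (\<rho> s))"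
      proof (rule Henstock_Kurzweil_Integration.integral_norm_bound_integral)
        show "(\<lambda>s. f * h2 s) integrable_on {x..a}"
          using x by (intro integrable_on_mult_right h2i) auto
        show "(\<lambda>s. E * norm (\<rho> s)) integrable_on {x..a}"
          using x by (intro integrable_on_mult_right integrable_subinterval_real[OF n\<rho>]) auto
        fix s assume s: "s \<in> {x..a}"
        have "norm (f * h2 s) = norm (f * \<theta> s) * norm (\<rho> s)" by (simp add: h2_def norm_mult)
        also have "\<dots> \<le> E * norm (\<rho> s)" using E[OF s] by (intro mult_right_mono) auto
        finally show "norm (f * h2 s) \<le> E * norm (\<rho> s)" .
      qed
      also have "\<dots> = E * integral {x..a} (\<lambda>s. norm (\<rho> s))" by simp
      also have "\<dots> \<le> E * J" using nJ[of x a] x E0 by (intro mult_left_mono) auto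
      finally show ?thesis .
    qed
    have fin: "norm ((f * I1 x + g * I2 x) / \<Delta> l) \<le> B * w * J"
      if "norm (f * I1 x) \<le> (C1 * C2 * (A * w)) * J" "norm (g * I2 x) \<le> (C1 * C2 * (A * w)) * J" for f g x w
    proof -
      have "norm (f * I1 x + g * I2 x) \<le> (C1 * C2 * (A * w)) * J + (C1 * C2 * (A * w)) * J"
        using norm_triangle_ineq[of "f * I1 x" "g * I2 x"] that by linarith
      then have "norm (f * I1 x + g * I2 x) / norm (\<Delta> l) \<le> ((C1 * C2 * (A * w)) * J + (C1 * C2 * (A * w)) * J) / norm (\<Delta> l)"
        by (rule divide_right_mono) simp
      also have "\<dots> = B * w * J" by (simp add: B_def add_divide_distrib)
      finally show ?thesis by (simp add: norm_divide)
    qed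
    have bnd: "norm (u x) \<le> B * x powr m * J \<and> norm (u' x) \<le> B * x powr (m - 1) * J" if x: "x \<in> {0<..a}" for x
    proof
      have x': "0 < x" "x \<le> a" using x by auto
      have "norm (\<theta> x * \<xi> l s) \<le> C1 * C2 * (A * x powr m)" if s: "s \<in> {0<..x}" for s
      proof -
        have "norm (\<theta> x * \<xi> l s) \<le> (C1 * x powr (1 - k)) * (C2 * s powr k)"
          unfolding norm_mult using C1 C2 x s by (intro mult_mono) auto
        also have "\<dots> \<le> (C1 * x powr (1 - k)) * (C2 * x powr k)"
          using C1 C2 x s k_gt by (intro mult_left_mono powr_mono2) auto
        also have "\<dots> = C1 * C2 * (x powr k * x powr (1 - k))" by simp
        also have "\<dots> \<le> C1 * C2 * (A * x powr m)" using mix[of x x] x' C1 C2 by (intro mult_left_mono) auto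
        finally show ?thesis .
      qed
      then have 1: "norm (\<theta> x * I1 x) \<le> (C1 * C2 * (A * x powr m)) * J"
        using C1 C2 A by (intro i1[OF x]) auto
      have "norm (\<xi> l x * \<theta> s) \<le> C1 * C2 * (A * x powr m)" if s: "s \<in> {x..a}" for s
      proof -
        have "norm (\<xi> l x * \<theta> s) \<le> (C2 * x powr k) * (C1 * s powr (1 - k))"
          unfolding norm_mult using C1 C2 x s by (intro mult_mono) auto
        also have "\<dots> = C1 * C2 * (x powr k * s powr (1 - k))" by simp
        also have "\<dots> \<le> C1 * C2 * (A * x powr m)" using mix[of x s] x' s C1 C2 by (intro mult_left_mono) auto
        finally show ?thesis .
      qed
      then have 2: "norm (\<xi> l x * I2 x) \<le> (C1 * C2 * (A * x powr m)) * J" by (intro i2[OF x]) auto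
      show "norm (u x) \<le> B * x powr m * J" unfolding u_def by (rule fin[OF 1 2])
      have "norm (\<theta>' x * \<xi> l s) \<le> C1 * C2 * (A * x powr (m - 1))" if s: "s \<in> {0<..x}" for s
      proof -
        have "norm (\<theta>' x * \<xi> l s) \<le> (C1 * x powr (- k)) * (C2 * s powr k)"
          unfolding norm_mult using C1 C2 x s by (intro mult_mono) auto
        also have "\<dots> \<le> (C1 * x powr (- k)) * (C2 * x powr k)"
          using C1 C2 x s k_gt by (intro mult_left_mono powr_mono2) auto
        also have "\<dots> = C1 * C2 * (x powr (k - 1) * x powr (1 - k))"
          by (simp flip: powr_add)
        also have "\<dots> \<le> C1 * C2 * (A * x powr (m - 1))" using mix'[of x x] x' C1 C2 by (intro mult_left_mono) auto
        finally show ?thesis .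
      qed
      then have 3: "norm (\<theta>' x * I1 x) \<le> (C1 * C2 * (A * x powr (m - 1))) * J"
        using C1 C2 A by (intro i1[OF x]) auto
      have "norm (\<eta> l x * \<theta> s) \<le> C1 * C2 * (A * x powr (m - 1))" if s: "s \<in> {x..a}" for s
      proof -
        have "norm (\<eta> l x * \<theta> s) \<le> (C2 * x powr (k - 1)) * (C1 * s powr (1 - k))"
          unfolding norm_mult using C1 C2 x s by (intro mult_mono) auto
        also have "\<dots> = C1 * C2 * (x powr (k - 1) * s powr (1 - k))" by simp
        also have "\<dots> \<le> C1 * C2 * (A * x powr (m - 1))" using mix'[of x s] x' s C1 C2 by (intro mult_left_mono) auto
        finally show ?thesis .
      qed
      then have 4: "norm (\<eta> l x * I2 x) \<le> (C1 * C2 * (A * x powr (m - 1))) * J" by (intro i2[OF x]) auto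
      show "norm (u' x) \<le> B * x powr (m - 1) * J" unfolding u'_def by (rule fin[OF 3 4])
    qed
    \<comment> \<open>At \<open>a\<close> only the \<open>\<theta>\<close> part survives, in
      \<open>u\<close> and in \<open>u'\<close>, so the boundary condition is inherited from
      \<open>\<theta>\<close>.\<close>
    have "I2 a = 0" by (simp add: I2_def)
    then have "u a * of_real (cos \<gamma>) + u' a * of_real (sin \<gamma>) = 0"
      by (simp add: u_def u'_def \<theta> field_simps)
    then show "\<exists>u u'. weak_sol l \<rho> u u' B"
      unfolding weak_sol_def using uc int bnd unfolding J_def by blast
  qed
qed

section \<open>The spectral shift, the real eigenfunctions and the classical resolvent\<close>

definition T :: real where
  "T = (SOME T. 0 \<le> T \<and> (\<forall>u u' f. dom u u' f \<longrightarrow> (u a)\<^sup>2 + ip a u u \<le> ip a f u + T * ip a u u))"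

text \<open>A fixed choice of the constant of \<open>form_bound\<close>. It becomes the spectral
  shift: \<open>- T\<close> lies below \<open>Z\<close>, and the resolvent is taken there.\<close>

lemma T_nonneg: "0 \<le> T"
  and form: "dom u u' f \<Longrightarrow> (u a)\<^sup>2 + ip a u u \<le> ip a f u + T * ip a u u"
proof -
  have "\<exists>T. 0 \<le> T \<and> (\<forall>u u' f. dom u u' f \<longrightarrow> (u a)\<^sup>2 + ip a u u \<le> ip a f u + T * ip a u u)"
    by (rule form_bound) blast
  from someI_ex[OF this, folded T_def]
  show "0 \<le> T" "dom u u' f \<Longrightarrow> (u a)\<^sup>2 + ip a u u \<le> ip a f u + T * ip a u u" by blast+
qed

text \<open>A real version of \<open>\<xi> l\<close>, redefined at \<open>0\<close> by its limit. It
  represents \<open>\<xi> l\<close> on \<open>{0<..a}\<close> when \<open>l\<close> is real.\<close>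

definition ev :: "complex \<Rightarrow> real \<Rightarrow> real" where "ev l x = (if x = 0 then 0 else Re (\<xi> l x))"

lemma ev_cont: "continuous_on {0..a} (ev l)"
proof -
  obtain C where C: "0 < C" "\<And>x. x \<in> {0<..a} \<Longrightarrow> norm (\<xi> l x) \<le> C * x powr k"
    "\<And>x. x \<in> {0<..a} \<Longrightarrow> norm (\<eta> l x) \<le> C * x powr (k - 1)" by (rule xi_bound[where z = l]) blast
  show ?thesis
    unfolding ev_def[abs_def]
  proof (rule extend_by_zero_continuous[where p = k and C = C])
    show "norm (Re (\<xi> l x)) \<le> C * x powr k" if "x \<in> {0<..a}" for x
      using C(2)[OF that] abs_Re_le_cmod[of "\<xi> l x"] by simp
  qed (use k_gt in \<open>auto intro!: continuous_intros xi_cont\<close>)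
qed

lemma ev_real: "Im l = 0 \<Longrightarrow> x \<in> {0<..a} \<Longrightarrow> \<xi> l x = of_real (ev l x)"
  using xi_real(1)[of l x] by (auto simp: ev_def complex_eq_iff)

text \<open>\<open>k >= m\<close> makes the order \<open>k\<close> of \<open>\<xi>\<close> at
  \<open>0\<close> admissible, at the price of a factor \<open>a powr (k - m)\<close>.\<close>

lemma ev_dom:
  assumes l: "l \<in> Z"
  shows "dom (ev l) (\<lambda>x. Re (\<eta> l x)) (\<lambda>x. Re l * ev l x)"
  unfolding dom_def
proof (intro conjI ballI)
  show "continuous_on {0..a} (ev l)" "continuous_on {0<..a} (\<lambda>x. Re (\<eta> l x))" "continuous_on {0..a} (\<lambda>x. Re l * ev l x)"
    by (intro continuous_intros ev_cont eta_cont)+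
  have li: "Im l = 0" by (rule Z_real[OF l])
  fix x assume x: "x \<in> {0<..<a}"
  then have x': "0 < x" "x < a" "x \<in> {0<..a}" by auto
  note D = solD[OF sol_xi x'(3), unfolded at_within_interior_a[OF x'(1,2)]]
  have "((\<lambda>x. Re (\<xi> l x)) has_vector_derivative Re (\<eta> l x)) (at x)"
    by (rule bounded_linear.has_vector_derivative[OF bounded_linear_Re D(1)])
  then have "(ev l has_vector_derivative Re (\<eta> l x)) (at x)"
    by (rule has_vector_derivative_transform_within_open[of _ _ _ "{0<..}"]) (use x in \<open>auto simp: ev_def\<close>)
  then show "(ev l has_real_derivative Re (\<eta> l x)) (at x)"
    by (simp add: has_real_derivative_iff_has_vector_derivative)
  have "((\<lambda>x. Re (\<eta> l x)) has_vector_derivative Re ((of_real (P x) - l) * \<xi> l x)) (at x)"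
    by (rule bounded_linear.has_vector_derivative[OF bounded_linear_Re D(2)])
  also have "Re ((of_real (P x) - l) * \<xi> l x) = P x * ev l x - Re l * ev l x"
    using x li by (simp add: ev_def algebra_simps)
  finally show "((\<lambda>x. Re (\<eta> l x)) has_real_derivative P x * ev l x - Re l * ev l x) (at x)"
    by (simp add: has_real_derivative_iff_has_vector_derivative)
next
  obtain C where C: "0 < C" "\<And>x. x \<in> {0<..a} \<Longrightarrow> norm (\<xi> l x) \<le> C * x powr k"
    "\<And>x. x \<in> {0<..a} \<Longrightarrow> norm (\<eta> l x) \<le> C * x powr (k - 1)" by (rule xi_bound[where z = l]) blast
  have p: "C * x powr (q + k) \<le> C * a powr (k - m) * x powr (q + m)" if "x \<in> {0<..a}" for x q
  proof -
    have "q + k = (k - m) + (q + m)" by simp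
    then have "x powr (q + k) = x powr (k - m) * x powr (q + m)" by (simp only: powr_add)
    also have "\<dots> \<le> a powr (k - m) * x powr (q + m)"
      using that m_le by (intro mult_right_mono powr_mono2) auto
    finally show ?thesis using C(1) by (simp add: mult.assoc)
  qed
  show "\<exists>C. \<forall>x\<in>{0<..a}. \<bar>ev l x\<bar> \<le> C * x powr m \<and> \<bar>Re (\<eta> l x)\<bar> \<le> C * x powr (m - 1)"
  proof (intro exI[of _ "C * a powr (k - m)"] ballI conjI)
    fix x assume x: "x \<in> {0<..a}"
    show "\<bar>ev l x\<bar> \<le> C * a powr (k - m) * x powr m"
      using C(2)[OF x] p[OF x, of 0] abs_Re_le_cmod[of "\<xi> l x"] x by (simp add: ev_def)
    show "\<bar>Re (\<eta> l x)\<bar> \<le> C * a powr (k - m) * x powr (m - 1)"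
      using C(3)[OF x] p[OF x, of "-1"] abs_Re_le_cmod[of "\<eta> l x"] x by simp
  qed
next
  have "Re (\<Delta> l) = 0" using l by (simp add: Z_def)
  then show "ev l a * cos \<gamma> + Re (\<eta> l a) * sin \<gamma> = 0" using a by (simp add: \<Delta>_def ev_def)
qed

lemma ev_pos: "Im l = 0 \<Longrightarrow> 0 < ip a (ev l) (ev l)"
proof (rule ccontr)
  assume l: "Im l = 0" and "\<not> 0 < ip a (ev l) (ev l)"
  then have "ip a (ev l) (ev l) = 0" using ip_nonneg[OF ev_cont, of l] by linarith
  then have 0: "ev l x = 0" if "x \<in> {0..a}" for x using ip_eq_0D[OF a ev_cont _ that] by simp
  obtain d where d: "0 < d" "d \<le> a" "\<And>x. x \<in> {0<..d} \<Longrightarrow> c0 / 2 * x powr k \<le> norm (\<xi> l x)"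
    by (rule xi_lower[where z = l]) blast
  have "\<xi> l d = 0" using 0[of d] ev_real[OF l, of d] d by simp
  then have "c0 / 2 * d powr k \<le> 0" using d(3)[of d] d(1) by simp
  moreover have "0 < c0 / 2 * d powr k" using c0 d(1) by simp
  ultimately show False by linarith
qed

text \<open>The eigenfunction inserted into the form inequality, with the term
  \<open>u(a)\<^sup>2\<close> dropped and the positive norm divided out.\<close>

lemma Z_ge: "l \<in> Z \<Longrightarrow> 1 \<le> Re l + T"
proof -
  assume l: "l \<in> Z"
  have "(ev l a)\<^sup>2 + ip a (ev l) (ev l) \<le> ip a (\<lambda>x. Re l * ev l x) (ev l) + T * ip a (ev l) (ev l)"
    by (rule form[OF ev_dom[OF l]])
  also have "ip a (\<lambda>x. Re l * ev l x) (ev l) = Re l * ip a (ev l) (ev l)"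
    using ip_lin_left[OF ev_cont ev_cont ev_cont, of "Re l" l 0 l l] by simp
  finally have "ip a (ev l) (ev l) \<le> Re l * ip a (ev l) (ev l) + T * ip a (ev l) (ev l)"
    using zero_le_power2[of "ev l a"] by linarith
  then have "1 * ip a (ev l) (ev l) \<le> (Re l + T) * ip a (ev l) (ev l)"
    by (simp add: algebra_simps)
  then show ?thesis using ev_pos[OF Z_real[OF l]] by (simp only: mult_le_cancel_right_pos)
qed

lemma minus_T_not_in_Z: "\<Delta> (- of_real T) \<noteq> 0"
  using Z_ge[of "- of_real T"] by (auto simp: Z_def)

lemma ev_orthogonal:
  assumes "l \<in> Z" "l' \<in> Z" "l \<noteq> l'"
  shows "ip a (ev l) (ev l') = 0"
proof -
  have "ip a (\<lambda>x. Re l * ev l x) (ev l') = ip a (ev l) (\<lambda>x. Re l' * ev l' x)"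
    by (rule dom_symmetric[OF ev_dom ev_dom]) (use assms in auto)
  then have "Re l * ip a (ev l) (ev l') = Re l' * ip a (ev l) (ev l')"
    using ip_lin_left[OF ev_cont ev_cont ev_cont, of "Re l" l 0 l l'] ip_lin_right[OF ev_cont ev_cont ev_cont, of l "Re l'" l' 0 l'] by simp
  moreover have "Re l \<noteq> Re l'" using assms Z_real by (auto simp: complex_eq_iff)
  ultimately show ?thesis by simp
qed

text \<open>The difference of two solutions has image \<open>- T\<close> times itself, so the
  right-hand side of the form inequality is zero.\<close>

lemma dom_unique:
  assumes u: "dom u u' (\<lambda>x. f x - T * u x)" and v: "dom v v' (\<lambda>x. f x - T * v x)" and x: "x \<in> {0..a}"
  shows "u x = v x"
proof -
  let ?d = "\<lambda>x. 1 * u x + (-1) * v x"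
  have d: "dom ?d (\<lambda>x. 1 * u' x + (-1) * v' x) (\<lambda>x. (- T) * ?d x + 0 * ?d x)"
    by (rule dom_cong[OF dom_lin[OF u v]]) (simp add: algebra_simps)
  note c = domD(1)[OF d]
  have "(?d a)\<^sup>2 + ip a ?d ?d \<le> ip a (\<lambda>x. (- T) * ?d x + 0 * ?d x) ?d + T * ip a ?d ?d" by (rule form[OF d])
  also have "\<dots> = 0" unfolding ip_lin_left[OF c c c] by simp
  finally have "ip a ?d ?d = 0" using ip_nonneg[OF c] zero_le_power2[of "?d a"] by linarith
  from ip_eq_0D[OF a c this x] show ?thesis by simp
qed

text \<open>Real parts of the weak solution at \<open>- T\<close>, which is classical for continuous
  \<open>f\<close>. The \<open>L1\<close> norm in its bounds is replaced by \<open>sqrt a\<close>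
  times the \<open>L2\<close> norm, the norm of the power iteration.\<close>

lemma dom_resolvent:
  obtains B where "0 < B"
    "\<And>f. continuous_on {0..a} f \<Longrightarrow> \<exists>u u'. dom u u' (\<lambda>x. f x - T * u x) \<and>
       (\<forall>x\<in>{0<..a}. \<bar>u x\<bar> \<le> B * x powr m * sqrt (ip a f f) \<and> \<bar>u' x\<bar> \<le> B * x powr (m - 1) * sqrt (ip a f f))"
proof -
  obtain B where B: "0 < B"
    "\<And>\<rho>. \<rho> absolutely_integrable_on {0..a} \<Longrightarrow> \<exists>u u'. weak_sol (- of_real T) \<rho> u u' B"
    by (rule resolvent_exists[OF minus_T_not_in_Z]) blast
  show ?thesis
  proof (rule that[of "B * sqrt a"])
    show "0 < B * sqrt a" using B a by simp
    fix f :: "real \<Rightarrow> real" assume f: "continuous_on {0..a} f"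
    define J where "J = integral {0..a} (\<lambda>s. norm (complex_of_real (f s)))"
    have "(\<lambda>x. complex_of_real (f x)) absolutely_integrable_on {0..a}"
      by (intro absolutely_integrable_continuous_real continuous_intros f)
    then obtain w w' where "weak_sol (- of_real T) (\<lambda>x. complex_of_real (f x)) w w' B" using B(2) by blast
    then have w: "continuous_on {0<..a} w" "continuous_on {0<..a} w'"
      "\<And>x y. 0 < x \<Longrightarrow> x \<le> y \<Longrightarrow> y \<le> a \<Longrightarrow> (w' has_integral (w y - w x)) {x..y}"
      "\<And>x y. 0 < x \<Longrightarrow> x \<le> y \<Longrightarrow> y \<le> a \<Longrightarrow>
         ((\<lambda>t. (of_real (P t) - (- of_real T)) * w t - of_real (f t)) has_integral (w' y - w' x)) {x..y}"
      "\<And>x. x \<in> {0<..a} \<Longrightarrow> norm (w x) \<le> B * x powr m * J"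
      "\<And>x. x \<in> {0<..a} \<Longrightarrow> norm (w' x) \<le> B * x powr (m - 1) * J"
      "w a * of_real (cos \<gamma>) + w' a * of_real (sin \<gamma>) = 0"
      unfolding weak_sol_def J_def by blast+
    have J: "J \<le> sqrt a * sqrt (ip a f f)"
    proof -
      have "J = integral {0..a} (\<lambda>x. \<bar>f x\<bar> * 1)" by (simp add: J_def)
      then have "J\<^sup>2 \<le> integral {0..a} (\<lambda>x. \<bar>f x\<bar>\<^sup>2) * integral {0..a} (\<lambda>x. 1\<^sup>2)"
        using integral_cauchy_schwarz[of 0 a "\<lambda>x. \<bar>f x\<bar>" "\<lambda>x. 1"] f by (simp add: continuous_intros)
      also have "\<dots> = a * ip a f f" using a by (simp add: ip_def power2_eq_square)
      finally have "sqrt (J\<^sup>2) \<le> sqrt (a * ip a f f)" by (rule real_sqrt_le_mono)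
      then show ?thesis by (simp add: real_sqrt_mult)
    qed
    have Jm: "B * y * J \<le> B * sqrt a * y * sqrt (ip a f f)" if "0 \<le> y" for y
      using mult_left_mono[OF J, of "B * y"] B(1) that by (simp add: mult_ac)
    define u where "u x = (if x = 0 then 0 else Re (w x))" for x
    define u' where "u' x = Re (w' x)" for x
    have bu: "\<bar>u x\<bar> \<le> B * sqrt a * x powr m * sqrt (ip a f f)" "\<bar>u' x\<bar> \<le> B * sqrt a * x powr (m - 1) * sqrt (ip a f f)"
      if x: "x \<in> {0<..a}" for x
      using w(5,6)[OF x] abs_Re_le_cmod[of "w x"] abs_Re_le_cmod[of "w' x"] Jm[of "x powr m"] Jm[of "x powr (m - 1)"] x
      by (auto simp: u_def u'_def)
    have uc: "continuous_on {0..a} u"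
      unfolding u_def[abs_def]
    proof (rule extend_by_zero_continuous[where p = m and C = "B * sqrt a * sqrt (ip a f f)"])
      show "norm (Re (w x)) \<le> B * sqrt a * sqrt (ip a f f) * x powr m" if "x \<in> {0<..a}" for x
        using bu(1)[OF that] that by (simp add: u_def mult_ac)
    qed (use m_gt in \<open>auto intro!: continuous_intros w\<close>)
    have sub: "{0<..<a} \<subseteq> {0<..a}" "{0<..<a} \<subseteq> {0..a}" "{0<..<a} \<subseteq> {0<..b}" using ab by auto
    have d: "dom u u' (\<lambda>x. f x - T * u x)"
      unfolding dom_def
    proof (intro conjI ballI)
      show "continuous_on {0..a} u" by (rule uc)
      show "continuous_on {0..a} (\<lambda>x. f x - T * u x)" by (intro continuous_intros f uc)
      show "continuous_on {0<..a} u'" unfolding u'_def[abs_def] by (intro continuous_intros w)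
      fix x assume "x \<in> {0<..<a}"
      then have x: "0 < x" "x < a" by auto
      have "(w has_vector_derivative w' x) (at x)"
        by (rule indefinite_integral_derivative[OF w(3) continuous_on_subset[OF w(2) sub(1)] x])
      then have "((\<lambda>x. Re (w x)) has_vector_derivative u' x) (at x)"
        unfolding u'_def by (rule bounded_linear.has_vector_derivative[OF bounded_linear_Re])
      then have "(u has_vector_derivative u' x) (at x)"
        by (rule has_vector_derivative_transform_within_open[of _ _ _ "{0<..}"]) (use x in \<open>auto simp: u_def\<close>)
      then show "(u has_real_derivative u' x) (at x)" by (simp add: has_real_derivative_iff_has_vector_derivative)
      have "continuous_on {0<..<a} (\<lambda>t. (of_real (P t) - (- of_real T)) * w t - of_real (f t))"
        by (intro continuous_intros continuous_on_subset[OF w(1) sub(1)] continuous_on_subset[OF f sub(2)] continuous_on_subset[OF P_cont sub(3)])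
      from indefinite_integral_derivative[OF w(4) this x]
      have "(w' has_vector_derivative (of_real (P x) - (- of_real T)) * w x - of_real (f x)) (at x)" .
      from bounded_linear.has_vector_derivative[OF bounded_linear_Re this]
      show "(u' has_real_derivative P x * u x - (f x - T * u x)) (at x)"
        using x by (simp add: has_real_derivative_iff_has_vector_derivative u'_def[abs_def] u_def algebra_simps)
    next
      show "\<exists>C. \<forall>x\<in>{0<..a}. \<bar>u x\<bar> \<le> C * x powr m \<and> \<bar>u' x\<bar> \<le> C * x powr (m - 1)"
        using bu by (intro exI[of _ "B * sqrt a * sqrt (ip a f f)"]) (auto simp: mult_ac)
      have "Re (w a * of_real (cos \<gamma>) + w' a * of_real (sin \<gamma>)) = 0" using w(7) by simp
      then show "u a * cos \<gamma> + u' a * sin \<gamma> = 0" using a by (simp add: u_def u'_def)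
    qed
    then show "\<exists>u u'. dom u u' (\<lambda>x. f x - T * u x) \<and>
       (\<forall>x\<in>{0<..a}. \<bar>u x\<bar> \<le> B * sqrt a * x powr m * sqrt (ip a f f) \<and> \<bar>u' x\<bar> \<le> B * sqrt a * x powr (m - 1) * sqrt (ip a f f))"
      using bu by blast
  qed
qed

end

subsection \<open>The resolvent and completeness of the eigenfunctions\<close>

lemma max_power_derivative:
  fixes t :: real
  shows "((\<lambda>t. max 0 t ^ Suc (Suc n)) has_real_derivative real (Suc (Suc n)) * max 0 t ^ Suc n) (at t)"
proof -
  consider "t > 0" | "t < 0" | "t = 0" by linarith
  then show ?thesis
  proof cases
    case 1
    have "((\<lambda>t. t ^ Suc (Suc n)) has_real_derivative real (Suc (Suc n)) * t ^ Suc n) (at t)"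
      using DERIV_pow[of "Suc (Suc n)" t UNIV] by simp
    then have "((\<lambda>t. max 0 t ^ Suc (Suc n)) has_real_derivative real (Suc (Suc n)) * t ^ Suc n) (at t)"
      by (rule has_field_derivative_transform_within_open[of _ _ _ "{0<..}"]) (use 1 in \<open>auto simp: max_def\<close>)
    then show ?thesis using 1 by (simp add: max_def)
  next
    case 2
    have "((\<lambda>t. 0) has_real_derivative 0) (at t)" by simp
    then have "((\<lambda>t. max 0 t ^ Suc (Suc n)) has_real_derivative 0) (at t)"
      by (rule has_field_derivative_transform_within_open[of _ _ _ "{..<0}"]) (use 2 in \<open>auto simp: max_def\<close>)
    then show ?thesis using 2 by (simp add: max_def)
  next
    case 3
    have "((\<lambda>h::real. max 0 h ^ Suc (Suc n) / h) \<longlongrightarrow> 0) (at 0)"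
    proof (rule Lim_null_comparison)
      show "\<forall>\<^sub>F h in at 0. norm (max 0 h ^ Suc (Suc n) / h) \<le> max 0 h ^ Suc n"
      proof (rule always_eventually, rule allI)
        fix h :: real
        show "norm (max 0 h ^ Suc (Suc n) / h) \<le> max 0 h ^ Suc n"
          by (cases "h > 0") (auto simp: max_def)
      qed
      have "((\<lambda>h::real. max 0 h ^ Suc n) \<longlongrightarrow> max 0 0 ^ Suc n) (at 0)"
        by (intro tendsto_intros)
      then show "((\<lambda>h::real. max 0 h ^ Suc n) \<longlongrightarrow> 0) (at 0)" by simp
    qed
    then show ?thesis using 3 by (simp add: DERIV_def)
  qed
qed

text \<open>The cube makes the function twice continuously differentiable across \<open>c\<close>
  and \<open>d\<close>.\<close>

definition bump :: "real \<Rightarrow> real \<Rightarrow> real \<Rightarrow> real" where "bump c d x = max 0 ((x - c) * (d - x)) ^ 3"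

text \<open>For \<open>c < d\<close> these functions tend to the indicator of the open interval
  \<open>(c, d)\<close> as \<open>n\<close> grows, with values in \<open>[0, 1]\<close> and two
  continuous derivatives.\<close>

definition cutoff :: "real \<Rightarrow> real \<Rightarrow> nat \<Rightarrow> real \<Rightarrow> real" where
  "cutoff c d n x = 1 - exp (- (real n * bump c d x))"

text \<open>Vanishing of the cutoff and its derivative from \<open>d\<close> on makes the boundary
  condition at \<open>a\<close> trivial. The linear bound of the derivative serves the case
  \<open>c = 0\<close>: a factor \<open>x\<close> has to compensate \<open>\<eta>\<close>, whose
  order at \<open>0\<close> is only \<open>k - 1\<close>.\<close>

lemma cutoff_derivatives:
  assumes cd: "0 \<le> c" "c < d"
  obtains \<tau>' \<tau>'' where
    "\<And>x. (cutoff c d n has_real_derivative \<tau>' x) (at x)" "\<And>x. (\<tau>' has_real_derivative \<tau>'' x) (at x)"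
    "continuous_on UNIV \<tau>''" "\<And>x. d \<le> x \<Longrightarrow> cutoff c d n x = 0" "\<And>x. d \<le> x \<Longrightarrow> \<tau>' x = 0"
    "\<And>x. 0 \<le> x \<Longrightarrow> \<bar>\<tau>' x\<bar> \<le> real n * (3 * d\<^sup>2 * d * (2 * d)) * x"
proof -
  define g where "g x = max 0 ((x - c) * (d - x))" for x
  define g' where "g' x = c + d - 2 * x" for x
  define s' where "s' x = 3 * (g x)\<^sup>2 * g' x" for x
  define s'' where "s'' x = 6 * g x * g' x * g' x - 6 * (g x)\<^sup>2" for x
  have q: "((\<lambda>x. (x - c) * (d - x)) has_real_derivative g' x) (at x)" for x
    by (auto intro!: derivative_eq_intros simp: g'_def algebra_simps)
  have g3: "(bump c d has_real_derivative s' x) (at x)" for x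
  proof -
    have "((\<lambda>x. max 0 ((x - c) * (d - x)) ^ Suc (Suc 1)) has_real_derivative
        real (Suc (Suc 1)) * max 0 ((x - c) * (d - x)) ^ Suc 1 * g' x) (at x)"
      by (rule DERIV_chain'[OF q max_power_derivative])
    then show ?thesis by (simp add: bump_def[abs_def] s'_def g_def numeral_3_eq_3 power2_eq_square)
  qed
  have g2: "((\<lambda>x. (g x)\<^sup>2) has_real_derivative 2 * g x * g' x) (at x)" for x
  proof -
    have "((\<lambda>x. max 0 ((x - c) * (d - x)) ^ Suc (Suc 0)) has_real_derivative
        real (Suc (Suc 0)) * max 0 ((x - c) * (d - x)) ^ Suc 0 * g' x) (at x)"
      by (rule DERIV_chain'[OF q max_power_derivative])
    then show ?thesis by (simp add: g_def numeral_2_eq_2)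
  qed
  have s'': "(s' has_real_derivative s'' x) (at x)" for x
  proof -
    have "((\<lambda>x. 3 * ((g x)\<^sup>2 * g' x)) has_real_derivative 3 * (2 * g x * g' x * g' x + (- 2) * (g x)\<^sup>2)) (at x)"
      by (intro DERIV_cmult DERIV_mult g2) (auto intro!: derivative_eq_intros simp: g'_def[abs_def])
    then show ?thesis by (simp add: s'_def[abs_def] s''_def mult.assoc)
  qed
  define \<tau>' where "\<tau>' x = real n * s' x * exp (- (real n * bump c d x))" for x
  define \<tau>'' where "\<tau>'' x = real n * s'' x * exp (- (real n * bump c d x)) - real n * s' x * (real n * s' x) * exp (- (real n * bump c d x))" for x
  have e: "((\<lambda>x. exp (- (real n * bump c d x))) has_real_derivative - (real n * s' x) * exp (- (real n * bump c d x))) (at x)" for x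
    by (auto intro!: derivative_eq_intros g3)
  have cg: "continuous_on UNIV g" "continuous_on UNIV g'" "continuous_on UNIV (bump c d)"
    unfolding g_def[abs_def] g'_def[abs_def] bump_def[abs_def] by (intro continuous_intros)+
  have g_le: "0 \<le> g x" "g x \<le> x * d" if "0 \<le> x" for x
  proof -
    show "0 \<le> g x" by (simp add: g_def)
    show "g x \<le> x * d"
    proof (cases "c \<le> x \<and> x \<le> d")
      case True
      then have "(x - c) * (d - x) \<le> x * d" using cd that by (intro mult_mono) auto
      then show ?thesis using that cd by (simp add: g_def)
    next
      case False
      then have "(x - c) * (d - x) \<le> 0" using cd by (auto simp: mult_le_0_iff)
      then show ?thesis using that cd by (simp add: g_def)
    qed
  qed
  have g_d: "g x = 0" if "d \<le> x" for x
    using that cd by (auto simp: g_def max_def mult_le_0_iff not_le zero_le_mult_iff)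
  show ?thesis
  proof (rule that[of \<tau>' \<tau>''])
    show "(cutoff c d n has_real_derivative \<tau>' x) (at x)" for x
    proof -
      have "((\<lambda>x. 1 - exp (- (real n * bump c d x))) has_real_derivative 0 - - (real n * s' x) * exp (- (real n * bump c d x))) (at x)"
        by (intro DERIV_diff DERIV_const e)
      then show ?thesis by (simp add: cutoff_def[abs_def] \<tau>'_def)
    qed
    show "(\<tau>' has_real_derivative \<tau>'' x) (at x)" for x
    proof -
      have "((\<lambda>x. (real n * s' x) * exp (- (real n * bump c d x))) has_real_derivative
          (real n * s'' x) * exp (- (real n * bump c d x)) + - (real n * s' x) * exp (- (real n * bump c d x)) * (real n * s' x)) (at x)"
        by (intro DERIV_mult DERIV_cmult s'' e)
      then show ?thesis by (simp add: \<tau>'_def[abs_def] \<tau>''_def algebra_simps)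
    qed
    show "continuous_on UNIV \<tau>''"
      unfolding \<tau>''_def[abs_def] s''_def s'_def by (intro continuous_intros cg)
    show "cutoff c d n x = 0" if "d \<le> x" for x
      using g_d[OF that] by (simp add: cutoff_def bump_def g_def)
    show "\<tau>' x = 0" if "d \<le> x" for x
      using g_d[OF that] by (simp add: \<tau>'_def s'_def)
    show "\<bar>\<tau>' x\<bar> \<le> real n * (3 * d\<^sup>2 * d * (2 * d)) * x" if x: "0 \<le> x" for x
    proof (cases "x \<le> d")
      case False
      then have "\<tau>' x = 0" using g_d[of x] by (simp add: \<tau>'_def s'_def)
      then show ?thesis using x cd by simp
    next
      case True
      have "\<bar>s' x\<bar> = 3 * (g x)\<^sup>2 * \<bar>g' x\<bar>" by (simp add: s'_def abs_mult)
      also have "\<dots> \<le> 3 * (x * d)\<^sup>2 * (2 * d)"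
        using g_le[OF x] x True cd by (intro mult_mono power_mono) (auto simp: g'_def)
      also have "\<dots> = 3 * d\<^sup>2 * (2 * d) * (x * x)" by (simp add: power2_eq_square)
      also have "\<dots> \<le> 3 * d\<^sup>2 * (2 * d) * (x * d)"
        using x True cd by (intro mult_left_mono) auto
      finally have s: "\<bar>s' x\<bar> \<le> 3 * d\<^sup>2 * d * (2 * d) * x" by (simp add: mult_ac)
      have "\<bar>\<tau>' x\<bar> = real n * \<bar>s' x\<bar> * exp (- (real n * bump c d x))" by (simp add: \<tau>'_def abs_mult)
      also have "\<dots> \<le> real n * \<bar>s' x\<bar> * 1"
        by (intro mult_left_mono) (auto simp: bump_def)
      also have "\<dots> \<le> real n * (3 * d\<^sup>2 * d * (2 * d) * x)" using s by (simp add: mult_left_mono)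
      finally show ?thesis by (simp add: mult_ac)
    qed
  qed
qed

lemma cutoff_range: "0 \<le> cutoff c d n x" "cutoff c d n x \<le> 1"
  by (auto simp: cutoff_def bump_def)

lemma cutoff_limit:
  assumes "c < d"
  shows "(\<lambda>n. cutoff c d n x) \<longlonglongrightarrow> (if c < x \<and> x < d then 1 else 0)"
proof (cases "(x - c) * (d - x) > 0")
  case True
  then have b: "bump c d x > 0" by (simp add: bump_def)
  have "exp (- bump c d x) < 1" using b by simp
  then have "norm (exp (- bump c d x)) < 1" by simp
  then have "(\<lambda>n. exp (- bump c d x) ^ n) \<longlonglongrightarrow> 0" by (rule LIMSEQ_power_zero)
  then have "(\<lambda>n. 1 - exp (- bump c d x) ^ n) \<longlonglongrightarrow> 1 - 0" by (rule tendsto_diff[OF tendsto_const])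
  moreover have "exp (- bump c d x) ^ n = exp (- (real n * bump c d x))" for n
    by (simp flip: exp_of_nat_mult)
  moreover have "c < x \<and> x < d" using True assms by (auto simp: zero_less_mult_iff)
  ultimately show ?thesis by (simp add: cutoff_def)
next
  case False
  then have "bump c d x = 0" by (simp add: bump_def)
  moreover have "\<not> (c < x \<and> x < d)" using False by (auto simp: zero_less_mult_iff)
  ultimately show ?thesis by (simp add: cutoff_def del: de_Morgan_conj)
qed

section \<open>The resolvent as a compact symmetric operator\<close>

context bessel_problem
begin

text \<open>The resolvent at \<open>- T\<close>, as an operator on continuous functions. By
  \<open>dom_unique\<close> the choice is determined on \<open>{0..a}\<close>; elsewhere the values
  are arbitrary.\<close>

definition R :: "(real \<Rightarrow> real) \<Rightarrow> real \<Rightarrow> real" where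
  "R f = (SOME u. \<exists>u'. dom u u' (\<lambda>x. f x - T * u x))"

lemma R_dom:
  assumes "continuous_on {0..a} f"
  obtains u' where "dom (R f) u' (\<lambda>x. f x - T * R f x)"
proof -
  obtain B where "0 < B" "\<And>f. continuous_on {0..a} f \<Longrightarrow> \<exists>u u'. dom u u' (\<lambda>x. f x - T * u x) \<and>
       (\<forall>x\<in>{0<..a}. \<bar>u x\<bar> \<le> B * x powr m * sqrt (ip a f f) \<and> \<bar>u' x\<bar> \<le> B * x powr (m - 1) * sqrt (ip a f f))"
    by (rule dom_resolvent) blast
  then have "\<exists>u u'. dom u u' (\<lambda>x. f x - T * u x)" using assms by blast
  from someI_ex[OF this] show ?thesis using that unfolding R_def by blast
qed

lemma R_eq:
  assumes f: "continuous_on {0..a} f" and v: "dom v v' (\<lambda>x. f x - T * v x)" and x: "x \<in> {0..a}"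
  shows "R f x = v x"
proof -
  obtain u' where u': "dom (R f) u' (\<lambda>x. f x - T * R f x)" by (rule R_dom[OF f])
  show ?thesis by (rule dom_unique[OF u' v x])
qed

lemma R_cont: "continuous_on {0..a} f \<Longrightarrow> continuous_on {0..a} (R f)"
  by (rule R_dom) (auto dest: domD(1))

lemma R_lin:
  assumes f: "continuous_on {0..a} f" and g: "continuous_on {0..a} g" and x: "x \<in> {0..a}"
  shows "R (\<lambda>x. c * f x + d * g x) x = c * R f x + d * R g x"
proof -
  obtain u' where u': "dom (R f) u' (\<lambda>x. f x - T * R f x)" by (rule R_dom[OF f])
  obtain v' where v': "dom (R g) v' (\<lambda>x. g x - T * R g x)" by (rule R_dom[OF g])
  show ?thesis
  proof (rule R_eq[OF _ _ x])
    show "continuous_on {0..a} (\<lambda>x. c * f x + d * g x)" by (intro continuous_intros f g)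
    show "dom (\<lambda>x. c * R f x + d * R g x) (\<lambda>x. c * u' x + d * v' x) (\<lambda>x. c * f x + d * g x - T * (c * R f x + d * R g x))"
      by (rule dom_cong[OF dom_lin[OF u' v']]) (simp add: algebra_simps)
  qed
qed

lemma R_symmetric:
  assumes f: "continuous_on {0..a} f" and g: "continuous_on {0..a} g"
  shows "ip a (R f) g = ip a f (R g)"
proof -
  obtain u' where u': "dom (R f) u' (\<lambda>x. f x - T * R f x)" by (rule R_dom[OF f])
  obtain v' where v': "dom (R g) v' (\<lambda>x. g x - T * R g x)" by (rule R_dom[OF g])
  note Rf = R_cont[OF f] and Rg = R_cont[OF g]
  have "ip a (\<lambda>x. f x - T * R f x) (R g) = ip a (R f) (\<lambda>x. g x - T * R g x)"
    by (rule dom_symmetric[OF u' v'])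
  moreover have "ip a (\<lambda>x. 1 * f x + (- T) * R f x) (R g) = 1 * ip a f (R g) + (- T) * ip a (R f) (R g)"
    by (rule ip_lin_left[OF f Rf Rg])
  moreover have "ip a (R f) (\<lambda>x. 1 * g x + (- T) * R g x) = 1 * ip a (R f) g + (- T) * ip a (R f) (R g)"
    by (rule ip_lin_right[OF g Rg Rf])
  ultimately show ?thesis by simp
qed

text \<open>The two bounds express compactness: images of the unit ball are bounded and share a
  modulus of continuity, that of the primitive \<open>\<omega>\<close> of the bound for the
  derivative.\<close>

lemma R_estimates:
  obtains B \<omega> where "0 < B" "continuous_on {0..a} \<omega>"
    "\<And>f x. continuous_on {0..a} f \<Longrightarrow> x \<in> {0..a} \<Longrightarrow> \<bar>R f x\<bar> \<le> B * sqrt (ip a f f)"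
    "\<And>f x y. continuous_on {0..a} f \<Longrightarrow> x \<in> {0..a} \<Longrightarrow> y \<in> {0..a} \<Longrightarrow>
       \<bar>R f x - R f y\<bar> \<le> sqrt (ip a f f) * \<bar>\<omega> x - \<omega> y\<bar>"
proof -
  obtain B where B: "0 < B" "\<And>f. continuous_on {0..a} f \<Longrightarrow> \<exists>u u'. dom u u' (\<lambda>x. f x - T * u x) \<and>
       (\<forall>x\<in>{0<..a}. \<bar>u x\<bar> \<le> B * x powr m * sqrt (ip a f f) \<and> \<bar>u' x\<bar> \<le> B * x powr (m - 1) * sqrt (ip a f f))"
    by (rule dom_resolvent) blast
  have m: "0 < m" using m_gt by simp
  define \<omega> where "\<omega> x = B / m * x powr m" for x
  have key: "\<bar>R f y - R f x\<bar> \<le> sqrt (ip a f f) * (\<omega> y - \<omega> x)" if f: "continuous_on {0..a} f" and xy: "0 \<le> x" "x \<le> y" "y \<le> a" for f x y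
  proof -
    define J where "J = sqrt (ip a f f)"
    have J: "0 \<le> J" unfolding J_def using ip_nonneg[OF f] by simp
    obtain u u' where u: "dom u u' (\<lambda>x. f x - T * u x)"
      "\<And>x. x \<in> {0<..a} \<Longrightarrow> \<bar>u x\<bar> \<le> B * x powr m * J" "\<And>x. x \<in> {0<..a} \<Longrightarrow> \<bar>u' x\<bar> \<le> B * x powr (m - 1) * J"
      using B(2)[OF f] unfolding J_def by blast
    have Ru: "R f t = u t" if "t \<in> {0..a}" for t by (rule R_eq[OF f u(1) that])
    have "\<bar>u y - u x\<bar> \<le> J * \<omega> y - J * \<omega> x"
    proof (cases "x = y")
      case False
      then have "x < y" using xy by simp
      have "norm (u y - u x) \<le> J * \<omega> y - J * \<omega> x"
      proof (rule differentiable_bound_general[OF \<open>x < y\<close>])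
        show "continuous_on {x..y} u" using xy by (intro continuous_on_subset[OF domD(1)[OF u(1)]]) auto
        show "continuous_on {x..y} (\<lambda>x. J * \<omega> x)"
          unfolding \<omega>_def using xy m by (intro continuous_intros continuous_on_powr') auto
        fix t assume t: "x < t" "t < y"
        then have t': "0 < t" "t < a" "t \<in> {0<..a}" using xy by auto
        show "(u has_vector_derivative u' t) (at t)"
          using domD(4)[OF u(1) t'(1,2)] by (simp add: has_real_derivative_iff_has_vector_derivative)
        have "((\<lambda>x. J * \<omega> x) has_real_derivative J * (B / m * (m * t powr (m - 1)))) (at t)"
          unfolding \<omega>_def using t' by (intro DERIV_cmult has_real_derivative_powr) auto
        then show "((\<lambda>x. J * \<omega> x) has_vector_derivative B * t powr (m - 1) * J) (at t)"
          using m by (simp add: has_real_derivative_iff_has_vector_derivative mult_ac)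
        show "norm (u' t) \<le> B * t powr (m - 1) * J" using u(3)[OF t'(3)] by simp
      qed
      then show ?thesis by simp
    qed simp
    then show ?thesis using Ru xy by (simp add: J_def algebra_simps)
  qed
  have R0: "R f 0 = 0" if f: "continuous_on {0..a} f" for f
  proof -
    obtain u' where u': "dom (R f) u' (\<lambda>x. f x - T * R f x)" by (rule R_dom[OF f])
    obtain C where C: "0 < C" "\<And>x. x \<in> {0<..a} \<Longrightarrow> \<bar>R f x\<bar> \<le> C * x powr m"
      "\<And>x. x \<in> {0<..a} \<Longrightarrow> \<bar>u' x\<bar> \<le> C * x powr (m - 1)" by (rule dom_bound[OF u']) blast
    have "((\<lambda>x. R f x) \<longlongrightarrow> R f 0) (at 0 within {0..a})"
      using R_cont[OF f] a by (auto simp: continuous_on_def)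
    then have "((\<lambda>x. R f x) \<longlongrightarrow> R f 0) (at_right 0)" using at_within_Icc_at_right[OF a] by simp
    moreover have "((\<lambda>x. R f x) \<longlongrightarrow> 0) (at_right 0)"
    proof (rule Lim_null_comparison)
      show "\<forall>\<^sub>F x in at_right 0. norm (R f x) \<le> C * x powr m"
        unfolding eventually_at_right_field using C a by (intro exI[of _ a]) auto
      show "((\<lambda>x. C * x powr m) \<longlongrightarrow> 0) (at_right 0)"
        using tendsto_mult_left[OF powr_tendsto_0[OF m], of C] by simp
    qed
    ultimately show ?thesis using tendsto_unique[OF trivial_limit_at_right_real] by blast
  qed
  have wmono: "\<omega> x \<le> \<omega> y" if "0 \<le> x" "x \<le> y" for x y
    unfolding \<omega>_def using that m B by (intro mult_left_mono powr_mono2) auto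
  show ?thesis
  proof (rule that[of "\<omega> a + 1" \<omega>])
    show "0 < \<omega> a + 1" using wmono[of 0 a] a by (simp add: \<omega>_def)
    show "continuous_on {0..a} \<omega>" unfolding \<omega>_def using m by (intro continuous_intros continuous_on_powr') auto
    fix f :: "real \<Rightarrow> real" assume f: "continuous_on {0..a} f"
    have s: "0 \<le> sqrt (ip a f f)" using ip_nonneg[OF f] by simp
    show "\<bar>R f x\<bar> \<le> (\<omega> a + 1) * sqrt (ip a f f)" if x: "x \<in> {0..a}" for x
    proof -
      have "\<bar>R f x\<bar> \<le> sqrt (ip a f f) * (\<omega> x - \<omega> 0)" using key[OF f, of 0 x] x R0[OF f] by simp
      also have "\<dots> \<le> sqrt (ip a f f) * (\<omega> a + 1)"
        using wmono[of x a] x s by (intro mult_left_mono) (auto simp: \<omega>_def[of 0])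
      finally show ?thesis by (simp add: mult.commute)
    qed
    show "\<bar>R f x - R f y\<bar> \<le> sqrt (ip a f f) * \<bar>\<omega> x - \<omega> y\<bar>" if xy: "x \<in> {0..a}" "y \<in> {0..a}" for x y
    proof (cases "x \<le> y")
      case True
      then show ?thesis using key[OF f, of x y] xy wmono[of x y] by (simp add: abs_minus_commute)
    next
      case False
      then show ?thesis using key[OF f, of y x] xy wmono[of y x] by simp
    qed
  qed
qed

lemma R_ev:
  assumes l: "l \<in> Z" and x: "x \<in> {0..a}"
  shows "R (ev l) x = ev l x / (Re l + T)"
proof -
  have T: "Re l + T > 0" using Z_ge[OF l] by simp
  have "dom (\<lambda>x. inverse (Re l + T) * ev l x + 0 * ev l x) (\<lambda>x. inverse (Re l + T) * Re (\<eta> l x) + 0 * Re (\<eta> l x))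
      (\<lambda>x. ev l x - T * (inverse (Re l + T) * ev l x + 0 * ev l x))"
    by (rule dom_cong[OF dom_lin[OF ev_dom[OF l] ev_dom[OF l]]]) (use T in \<open>simp add: field_simps\<close>)
  from R_eq[OF ev_cont this x] show ?thesis by (simp add: divide_inverse)
qed

text \<open>The Wronskian of order \<open>m\<close> against order \<open>k\<close> is at most of
  order \<open>m + k - 1 > 0\<close>, hence tends to \<open>0\<close> at \<open>0\<close>; and it is
  constant.\<close>

lemma wronskian_at_end_zero:
  assumes s: "sol l u u'" and C: "\<And>x. x \<in> {0<..a} \<Longrightarrow> norm (u x) \<le> C * x powr m"
    "\<And>x. x \<in> {0<..a} \<Longrightarrow> norm (u' x) \<le> C * x powr (m - 1)"
  shows "u a * \<eta> l a - u' a * \<xi> l a = 0"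
proof -
  obtain D where D: "0 < D" "\<And>x. x \<in> {0<..a} \<Longrightarrow> norm (\<xi> l x) \<le> D * x powr k"
    "\<And>x. x \<in> {0<..a} \<Longrightarrow> norm (\<eta> l x) \<le> D * x powr (k - 1)" by (rule xi_bound[where z = l]) blast
  have C0: "0 \<le> C"
  proof -
    have "0 \<le> C * a powr m" using order_trans[OF norm_ge_zero C(1)[of a]] a by simp
    then show ?thesis using a by (simp add: zero_le_mult_iff)
  qed
  let ?W = "\<lambda>x. u x * \<eta> l x - u' x * \<xi> l x"
  have "(?W \<longlongrightarrow> 0) (at_right 0)"
  proof (rule Lim_null_comparison)
    show "\<forall>\<^sub>F t in at_right 0. norm (?W t) \<le> 2 * C * D * t powr (m + k - 1)"
      unfolding eventually_at_right_field
    proof (intro exI[of _ a] conjI a allI impI)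
      fix t assume t: "0 < t" "t < a"
      then have t': "t \<in> {0<..a}" by auto
      have "norm (?W t) \<le> norm (u t) * norm (\<eta> l t) + norm (u' t) * norm (\<xi> l t)"
        by (rule order_trans[OF norm_triangle_ineq4]) (simp add: norm_mult)
      also have "\<dots> \<le> (C * t powr m) * (D * t powr (k - 1)) + (C * t powr (m - 1)) * (D * t powr k)"
        using C D C0 t' by (intro add_mono mult_mono) auto
      also have "\<dots> = C * D * (t powr m * t powr (k - 1) + t powr (m - 1) * t powr k)" by (simp add: algebra_simps)
      also have "t powr m * t powr (k - 1) = t powr (m + k - 1)" by (simp add: add_diff_eq flip: powr_add)
      also have "t powr (m - 1) * t powr k = t powr (m + k - 1)" by (simp add: algebra_simps flip: powr_add)
      finally show "norm (?W t) \<le> 2 * C * D * t powr (m + k - 1)" by simp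
    qed
    from tendsto_mult_left[OF powr_tendsto_0[OF mk], of "2 * C * D"]
    show "((\<lambda>t. 2 * C * D * t powr (m + k - 1)) \<longlongrightarrow> 0) (at_right 0)" by simp
  qed
  moreover have "(?W \<longlongrightarrow> ?W a) (at_right 0)"
  proof (rule tendsto_eventually)
    show "\<forall>\<^sub>F t in at_right 0. ?W t = ?W a"
      unfolding eventually_at_right_field
    proof (intro exI[of _ a] conjI a allI impI)
      fix t assume "0 < t" "t < a"
      then show "?W t = ?W a" using a by (intro wronskian_const[OF s sol_xi]) auto
    qed
  qed
  ultimately show ?thesis using tendsto_unique[OF trivial_limit_at_right_real] by blast
qed

text \<open>\<open>R w = \<mu> * w\<close> says that \<open>R w\<close> solves the homogeneous
  equation at \<open>l = 1 / \<mu> - T\<close>. Its decay at \<open>0\<close> forces it to be a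
  multiple of \<open>\<xi> l\<close>, and its boundary condition at \<open>a\<close> then gives
  \<open>\<Delta> l = 0\<close>.\<close>

lemma R_eigenvector:
  assumes w: "continuous_on {0..a} w" "0 < ip a w w" and \<mu>: "\<mu> \<noteq> 0"
    and eig: "\<And>x. x \<in> {0..a} \<Longrightarrow> R w x = \<mu> * w x"
  obtains l c where "l \<in> Z" "Re l + T = 1 / \<mu>" "\<And>x. x \<in> {0..a} \<Longrightarrow> w x = c * ev l x"
proof -
  obtain v' where v': "dom (R w) v' (\<lambda>x. w x - T * R w x)" by (rule R_dom[OF w(1)])
  define lr where "lr = 1 / \<mu> - T"
  define l where "l = complex_of_real lr"
  define v where "v = R w"
  have d: "dom v v' (\<lambda>x. lr * v x)"
    unfolding v_def by (rule dom_cong[OF v']) (use \<mu> eig in \<open>simp add: lr_def field_simps\<close>)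
  note D = domD[OF d]
  have sub: "{0<..a} \<subseteq> {0..a}" "{0<..a} \<subseteq> {0<..b}" using ab by auto
  have vc: "continuous_on {0<..a} v" by (rule continuous_on_subset[OF D(1) sub(1)])
  have Pv: "continuous_on {0<..a} (\<lambda>x. P x * v x - lr * v x)"
    by (intro continuous_intros vc continuous_on_subset[OF P_cont sub(2)])
  have s: "sol l (\<lambda>x. of_real (v x)) (\<lambda>x. of_real (v' x))"
    unfolding sol_def
  proof (intro ballI conjI)
    fix x assume x: "x \<in> {0<..a}"
    have "(v has_vector_derivative v' x) (at x within {0<..a})"
      by (rule derivative_within_half_open[OF vc D(2) _ x])
        (use D(4) in \<open>simp add: has_real_derivative_iff_has_vector_derivative\<close>)
    then show "((\<lambda>x. of_real (v x)) has_vector_derivative complex_of_real (v' x)) (at x within {0<..a})"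
      by (rule bounded_linear.has_vector_derivative[OF bounded_linear_of_real])
    have "(v' has_vector_derivative P x * v x - lr * v x) (at x within {0<..a})"
      by (rule derivative_within_half_open[OF D(2) Pv _ x])
        (use D(5) in \<open>simp add: has_real_derivative_iff_has_vector_derivative\<close>)
    then have "((\<lambda>x. of_real (v' x)) has_vector_derivative complex_of_real (P x * v x - lr * v x)) (at x within {0<..a})"
      by (rule bounded_linear.has_vector_derivative[OF bounded_linear_of_real])
    then show "((\<lambda>x. of_real (v' x)) has_vector_derivative (complex_of_real (P x) - l) * of_real (v x)) (at x within {0<..a})"
      by (simp add: l_def algebra_simps)
  qed
  obtain C where C: "0 < C" "\<And>x. x \<in> {0<..a} \<Longrightarrow> \<bar>v x\<bar> \<le> C * x powr m"
    "\<And>x. x \<in> {0<..a} \<Longrightarrow> \<bar>v' x\<bar> \<le> C * x powr (m - 1)" by (rule dom_bound[OF d]) blast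
  have W: "of_real (v a) * \<eta> l a - of_real (v' a) * \<xi> l a = 0"
    by (rule wronskian_at_end_zero[OF s, of C]) (use C in auto)
  obtain c where c: "\<And>x. x \<in> {0<..a} \<Longrightarrow> complex_of_real (v x) = c * \<xi> l x"
    "\<And>x. x \<in> {0<..a} \<Longrightarrow> complex_of_real (v' x) = c * \<eta> l x"
    by (rule sol_proportional[OF s sol_xi xi_nontrivial W]) blast
  have v0: "v 0 = 0"
  proof -
    have "w 0 = v 0 / \<mu>" using eig[of 0] a \<mu> by (simp add: v_def)
    moreover have "((\<lambda>x. v x) \<longlongrightarrow> v 0) (at_right 0)"
      using D(1) a at_within_Icc_at_right[OF a] by (metis atLeastAtMost_iff continuous_on_def less_eq_real_def)
    moreover have "((\<lambda>x. v x) \<longlongrightarrow> 0) (at_right 0)"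
    proof (rule Lim_null_comparison)
      show "\<forall>\<^sub>F x in at_right 0. norm (v x) \<le> C * x powr m"
        unfolding eventually_at_right_field using C a by (intro exI[of _ a]) auto
      show "((\<lambda>x. C * x powr m) \<longlongrightarrow> 0) (at_right 0)"
        using tendsto_mult_left[OF powr_tendsto_0, of m C] m_gt by simp
    qed
    ultimately show ?thesis using tendsto_unique[OF trivial_limit_at_right_real] by blast
  qed
  have l: "Im l = 0" by (simp add: l_def)
  have vev: "v x = Re c * ev l x" if "x \<in> {0..a}" for x
  proof (cases "x = 0")
    case True
    then show ?thesis by (simp add: v0 ev_def)
  next
    case False
    then have x: "x \<in> {0<..a}" using that by auto
    have "v x = Re (c * of_real (ev l x))" using c(1)[OF x] ev_real[OF l x] by (metis Re_complex_of_real)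
    then show ?thesis by simp
  qed
  have wv: "w x = v x / \<mu>" if "x \<in> {0..a}" for x using eig[OF that] \<mu> by (simp add: v_def)
  have cnz: "c \<noteq> 0"
  proof
    assume "c = 0"
    then have "ip a w w = ip a (\<lambda>_. 0) (\<lambda>_. 0)" using wv vev by (intro ip_cong) auto
    then show False using w(2) by (simp add: ip_def)
  qed
  have "c * \<Delta> l = of_real (v a) * of_real (cos \<gamma>) + of_real (v' a) * of_real (sin \<gamma>)"
    using c[of a] a by (simp add: \<Delta>_def algebra_simps)
  also have "\<dots> = of_real (v a * cos \<gamma> + v' a * sin \<gamma>)" by simp
  also have "\<dots> = 0" using D(6) by simp
  finally have "l \<in> Z" using cnz by (simp add: Z_def)
  then show ?thesis
    by (rule that[of l "Re c / \<mu>"]) (use wv vev in \<open>auto simp: l_def lr_def\<close>)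
qed

text \<open>If the bound failed, the power iteration inside the orthogonal complement of the
  eigenfunctions with eigenvalue above \<open>\<epsilon>\<close> would produce an eigenvector with
  eigenvalue of modulus above \<open>\<epsilon>\<close>. It is a multiple of one of these
  eigenfunctions, hence orthogonal to itself.\<close>

lemma R_gap:
  assumes f: "continuous_on {0..a} f" and \<epsilon>: "0 \<le> \<epsilon>"
    and orth: "\<And>l. l \<in> Z \<Longrightarrow> \<epsilon> < 1 / (Re l + T) \<Longrightarrow> ip a f (ev l) = 0"
  shows "ip a (R f) (R f) \<le> \<epsilon>\<^sup>2 * ip a f f"
proof (rule ccontr)
  assume "\<not> ip a (R f) (R f) \<le> \<epsilon>\<^sup>2 * ip a f f"
  then have gt: "\<epsilon>\<^sup>2 * ip a f f < ip a (R f) (R f)" by simp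
  define L where "L = ev ` {l \<in> Z. \<epsilon> < 1 / (Re l + T)}"
  obtain B \<omega> where B: "0 < B" "continuous_on {0..a} \<omega>"
    "\<And>f x. continuous_on {0..a} f \<Longrightarrow> x \<in> {0..a} \<Longrightarrow> \<bar>R f x\<bar> \<le> B * sqrt (ip a f f)"
    "\<And>f x y. continuous_on {0..a} f \<Longrightarrow> x \<in> {0..a} \<Longrightarrow> y \<in> {0..a} \<Longrightarrow>
       \<bar>R f x - R f y\<bar> \<le> sqrt (ip a f f) * \<bar>\<omega> x - \<omega> y\<bar>"
    by (rule R_estimates) blast
  show False
  proof (rule power_iteration_eigenvector[where R = R and a = a and B = B and \<omega> = \<omega> and L = L and f = f and \<epsilon> = \<epsilon>])
    show "0 < a" by (rule a)
    show "R (\<lambda>x. c * f x + d * g x) x = c * R f x + d * R g x"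
      if "continuous_on {0..a} f" "continuous_on {0..a} g" "x \<in> {0..a}" for f g c d x
      by (rule R_lin[OF that])
    show "continuous_on {0..a} (R f)" if "continuous_on {0..a} f" for f by (rule R_cont[OF that])
    show "ip a (R f) g = ip a f (R g)" if "continuous_on {0..a} f" "continuous_on {0..a} g" for f g
      by (rule R_symmetric[OF that])
    show "\<bar>R f x\<bar> \<le> B * sqrt (ip a f f)" if "continuous_on {0..a} f" "x \<in> {0..a}" for f x by (rule B(3)[OF that])
    show "\<bar>R f x - R f y\<bar> \<le> sqrt (ip a f f) * \<bar>\<omega> x - \<omega> y\<bar>"
      if "continuous_on {0..a} f" "x \<in> {0..a}" "y \<in> {0..a}" for f x y by (rule B(4)[OF that])
    show "continuous_on {0..a} \<omega>" by (rule B(2))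
    show "continuous_on {0..a} e" if "e \<in> L" for e using that ev_cont by (auto simp: L_def)
    show "ip a (R f) e = 0" if h: "continuous_on {0..a} f" "\<forall>e\<in>L. ip a f e = 0" "e \<in> L" for f e
    proof -
      obtain l where l: "l \<in> Z" "e = ev l" using h(3) by (auto simp: L_def)
      have "ip a (R f) e = ip a f (R (ev l))" unfolding l(2) by (rule R_symmetric[OF h(1) ev_cont])
      also have "\<dots> = ip a f (\<lambda>x. inverse (Re l + T) * ev l x + 0 * ev l x)"
        by (intro ip_cong) (use R_ev[OF l(1)] in \<open>auto simp: divide_inverse\<close>)
      also have "\<dots> = inverse (Re l + T) * ip a f (ev l) + 0 * ip a f (ev l)"
        by (rule ip_lin_right[OF ev_cont ev_cont h(1)])
      also have "\<dots> = 0" using h(2,3) l by simp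
      finally show ?thesis .
    qed
    show "continuous_on {0..a} f" by (rule f)
    show "\<forall>e\<in>L. ip a f e = 0" using orth by (auto simp: L_def)
    show "0 \<le> \<epsilon>" by (rule \<epsilon>)
    show "\<epsilon>\<^sup>2 * ip a f f < ip a (R f) (R f)" by (rule gt)
    fix w \<mu> assume w: "continuous_on {0..a} w" "\<forall>e\<in>L. ip a w e = 0" "\<epsilon> < \<bar>\<mu>\<bar>"
      "\<And>x. x \<in> {0..a} \<Longrightarrow> R w x = \<mu> * w x" "0 < ip a w w"
    have "\<mu> \<noteq> 0" using w(3) \<epsilon> by auto
    show False
    proof (rule R_eigenvector[OF w(1,5) \<open>\<mu> \<noteq> 0\<close> w(4)])
      fix l c assume l: "l \<in> Z" "Re l + T = 1 / \<mu>" "\<And>x. x \<in> {0..a} \<Longrightarrow> w x = c * ev l x"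
    \<comment> \<open>Excludes the negative eigenvalue that the power iteration leaves
      possible.\<close>
    have "1 \<le> 1 / \<mu>" using Z_ge[OF l(1)] unfolding l(2) .
    then have "1 / \<mu> > 0" by linarith
    then have "\<epsilon> < 1 / (Re l + T)" using w(3) l(2) by simp
    then have "ip a w (ev l) = 0" using w(2) l(1) by (auto simp: L_def)
    moreover have "ip a w w = ip a w (\<lambda>x. c * ev l x + 0 * ev l x)" using l(3) by (intro ip_cong) auto
    then have "ip a w w = c * ip a w (ev l)" using ip_lin_right[OF ev_cont ev_cont w(1), of c l 0 l] by simp
    ultimately show False using w(5) by simp
    qed
  qed
qed

section \<open>Finite combinations of eigenfunctions and their density\<close>

lemma ip_ev_sum:
  assumes L: "finite L" "L \<subseteq> Z"
  shows "l \<in> L \<Longrightarrow> ip a (\<lambda>x. \<Sum>l\<in>L. c l * ev l x) (ev l) = c l * ip a (ev l) (ev l)"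
    "ip a (\<lambda>x. \<Sum>l\<in>L. c l * ev l x) (\<lambda>x. \<Sum>l\<in>L. c l * ev l x) = (\<Sum>l\<in>L. (c l)\<^sup>2 * ip a (ev l) (ev l))"
proof -
  have *: "ip a (\<lambda>x. \<Sum>l\<in>L. c l * ev l x) (ev l) = c l * ip a (ev l) (ev l)" if l: "l \<in> L" for l
  proof -
    have "ip a (\<lambda>x. \<Sum>l\<in>L. c l * ev l x) (ev l) = (\<Sum>l'\<in>L. c l' * ip a (ev l') (ev l))"
      by (rule ip_sum_left[OF L(1) ev_cont ev_cont])
    also have "\<dots> = (\<Sum>l'\<in>L. if l' = l then c l * ip a (ev l) (ev l) else 0)"
      by (intro sum.cong refl) (use ev_orthogonal L l in auto)
    also have "\<dots> = c l * ip a (ev l) (ev l)" using L(1) l by simp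
    finally show ?thesis .
  qed
  then show "l \<in> L \<Longrightarrow> ip a (\<lambda>x. \<Sum>l\<in>L. c l * ev l x) (ev l) = c l * ip a (ev l) (ev l)" by blast
  have "ip a (\<lambda>x. \<Sum>l\<in>L. c l * ev l x) (\<lambda>x. \<Sum>l\<in>L. c l * ev l x) = (\<Sum>l\<in>L. c l * ip a (ev l) (\<lambda>x. \<Sum>l\<in>L. c l * ev l x))"
    by (rule ip_sum_left[OF L(1) ev_cont]) (intro continuous_intros ev_cont)
  also have "\<dots> = (\<Sum>l\<in>L. (c l)\<^sup>2 * ip a (ev l) (ev l))"
  proof (intro sum.cong refl)
    fix l assume "l \<in> L"
    then have "ip a (ev l) (\<lambda>x. \<Sum>l\<in>L. c l * ev l x) = c l * ip a (ev l) (ev l)" by (subst ip_commute) (rule *)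
    then show "c l * ip a (ev l) (\<lambda>x. \<Sum>l\<in>L. c l * ev l x) = (c l)\<^sup>2 * ip a (ev l) (ev l)"
      by (simp add: power2_eq_square)
  qed
  finally show "ip a (\<lambda>x. \<Sum>l\<in>L. c l * ev l x) (\<lambda>x. \<Sum>l\<in>L. c l * ev l x) = (\<Sum>l\<in>L. (c l)\<^sup>2 * ip a (ev l) (ev l))" .
qed

lemma R_ev_sum:
  assumes L: "finite L" "L \<subseteq> Z" and x: "x \<in> {0..a}"
  shows "R (\<lambda>x. \<Sum>l\<in>L. c l * ev l x) x = (\<Sum>l\<in>L. c l / (Re l + T) * ev l x)"
proof (rule R_eq[OF _ _ x])
  show "continuous_on {0..a} (\<lambda>x. \<Sum>l\<in>L. c l * ev l x)" by (intro continuous_intros ev_cont)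
  have T: "Re l + T \<noteq> 0" if "l \<in> L" for l using Z_ge[of l] that L by auto
  have "c l / (Re l + T) * (Re l * ev l x) = c l * ev l x - T * (c l / (Re l + T) * ev l x)" if "l \<in> L" for l x
    using T[OF that] by (simp add: field_simps)
  then have e: "(\<Sum>l\<in>L. c l / (Re l + T) * (Re l * ev l x)) = (\<Sum>l\<in>L. c l * ev l x) - T * (\<Sum>l\<in>L. c l / (Re l + T) * ev l x)" for x
    by (simp add: sum_distrib_left flip: sum_subtractf)
  have "dom (\<lambda>x. \<Sum>l\<in>L. c l / (Re l + T) * ev l x) (\<lambda>x. \<Sum>l\<in>L. c l / (Re l + T) * Re (\<eta> l x))
      (\<lambda>x. \<Sum>l\<in>L. c l / (Re l + T) * (Re l * ev l x))"
    by (rule dom_sum[OF L(1)]) (use ev_dom L in auto)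
  then show "dom (\<lambda>x. \<Sum>l\<in>L. c l / (Re l + T) * ev l x) (\<lambda>x. \<Sum>l\<in>L. c l / (Re l + T) * Re (\<eta> l x))
     (\<lambda>x. (\<Sum>l\<in>L. c l * ev l x) - T * (\<Sum>l\<in>L. c l / (Re l + T) * ev l x))"
    by (simp only: e)
qed

text \<open>\<open>R\<close> is Hilbert-Schmidt because \<open>R f x\<close> is bounded by the norm
  of \<open>f\<close>: this bounds the sum of
  \<open>(ev l x)\<^sup>2 / (N l * (Re l + T)\<^sup>2)\<close> at each \<open>x\<close>, and
  integration over \<open>x\<close> leaves the squares of the eigenvalues.\<close>

lemma eigenvalue_square_sum:
  obtains C where "\<And>L. finite L \<Longrightarrow> L \<subseteq> Z \<Longrightarrow> (\<Sum>l\<in>L. (1 / (Re l + T))\<^sup>2) \<le> C"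
proof -
  obtain B \<omega> where B: "0 < B" "continuous_on {0..a} \<omega>"
    "\<And>f x. continuous_on {0..a} f \<Longrightarrow> x \<in> {0..a} \<Longrightarrow> \<bar>R f x\<bar> \<le> B * sqrt (ip a f f)"
    "\<And>f x y. continuous_on {0..a} f \<Longrightarrow> x \<in> {0..a} \<Longrightarrow> y \<in> {0..a} \<Longrightarrow>
       \<bar>R f x - R f y\<bar> \<le> sqrt (ip a f f) * \<bar>\<omega> x - \<omega> y\<bar>"
    by (rule R_estimates) blast
  show ?thesis
  proof (rule that[of "B\<^sup>2 * a"])
    fix L assume L: "finite L" "L \<subseteq> Z"
    define N where "N l = ip a (ev l) (ev l)" for l
    define M where "M l = 1 / (Re l + T)" for l
    have N: "0 < N l" if "l \<in> L" for l unfolding N_def using that L Z_real by (intro ev_pos) auto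
    have pt: "(\<Sum>l\<in>L. (M l)\<^sup>2 / N l * (ev l x)\<^sup>2) \<le> B\<^sup>2" if x: "x \<in> {0..a}" for x
    proof -
      define S where "S = (\<Sum>l\<in>L. (M l)\<^sup>2 / N l * (ev l x)\<^sup>2)"
      have S0: "0 \<le> S" unfolding S_def using N by (intro sum_nonneg) (simp add: less_imp_le)
      \<comment> \<open>A partial sum of the kernel of \<open>R\<close> at \<open>x\<close>, chosen
        so that \<open>R f x\<close> and the squared norm of \<open>f\<close> are both
        \<open>S\<close>; hence \<open>S <= B * sqrt S\<close>.\<close>
      define f where "f = (\<lambda>y. \<Sum>l\<in>L. (M l * ev l x / N l) * ev l y)"
      have fc: "continuous_on {0..a} f" unfolding f_def by (intro continuous_intros ev_cont)
      have "R f x = (\<Sum>l\<in>L. (M l * ev l x / N l) / (Re l + T) * ev l x)"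
        unfolding f_def by (rule R_ev_sum[OF L x])
      also have "\<dots> = S" unfolding S_def by (intro sum.cong refl) (simp add: M_def power2_eq_square)
      finally have RS: "R f x = S" .
      have "ip a f f = (\<Sum>l\<in>L. (M l * ev l x / N l)\<^sup>2 * N l)"
        unfolding f_def N_def by (rule ip_ev_sum(2)[OF L])
      also have "\<dots> = S" unfolding S_def
        by (intro sum.cong refl) (use N in \<open>simp add: power2_eq_square field_simps\<close>)
      finally have "S \<le> B * sqrt S" using B(3)[OF fc x] RS by simp
      then have "sqrt S * sqrt S \<le> B * sqrt S" using S0 by simp
      then have "sqrt S \<le> B"
      proof (cases "S = 0")
        case False
        then have "0 < sqrt S" using S0 by simp
        with \<open>sqrt S * sqrt S \<le> B * sqrt S\<close> show ?thesis by (rule mult_right_le_imp_le)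
      qed (use B(1) in simp)
      then have "(sqrt S)\<^sup>2 \<le> B\<^sup>2" using S0 by (intro power_mono) auto
      then show ?thesis using S0 by (simp add: S_def)
    qed
    have e2: "continuous_on {0..a} (\<lambda>x. (ev l x)\<^sup>2)" for l by (intro continuous_intros ev_cont)
    have "(\<Sum>l\<in>L. (M l)\<^sup>2) = (\<Sum>l\<in>L. (M l)\<^sup>2 / N l * N l)"
      by (intro sum.cong refl) (use N in force)
    also have "\<dots> = (\<Sum>l\<in>L. integral {0..a} (\<lambda>x. (M l)\<^sup>2 / N l * (ev l x)\<^sup>2))"
      by (simp add: N_def ip_def power2_eq_square)
    also have "\<dots> = integral {0..a} (\<lambda>x. \<Sum>l\<in>L. (M l)\<^sup>2 / N l * (ev l x)\<^sup>2)"
      using L(1) by (intro integral_sum[symmetric] integrable_continuous_real continuous_intros e2)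
    also have "\<dots> \<le> integral {0..a} (\<lambda>x. B\<^sup>2)"
      using pt by (intro integral_le integrable_continuous_real continuous_intros e2) auto
    also have "\<dots> = B\<^sup>2 * a" using a by simp
    finally show "(\<Sum>l\<in>L. (1 / (Re l + T))\<^sup>2) \<le> B\<^sup>2 * a" by (simp add: M_def)
  qed
qed

text \<open>Each such \<open>l\<close> contributes at least \<open>1 / K\<^sup>2\<close> to the
  bounded sum of squares, which limits the cardinality of finite subsets.\<close>

lemma Z_finite_below: "finite {l \<in> Z. Re l \<le> M}"
proof -
  obtain C where C: "\<And>L. finite L \<Longrightarrow> L \<subseteq> Z \<Longrightarrow> (\<Sum>l\<in>L. (1 / (Re l + T))\<^sup>2) \<le> C"
    by (rule eigenvalue_square_sum) blast
  define K where "K = \<bar>M\<bar> + T + 1"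
  have K: "0 < K" unfolding K_def using T_nonneg by simp
  have "finite {l \<in> Z. Re l \<le> M} \<and> card {l \<in> Z. Re l \<le> M} \<le> nat \<lceil>C * K\<^sup>2\<rceil>"
  proof (rule finite_if_finite_subsets_card_bdd)
    fix L assume L: "L \<subseteq> {l \<in> Z. Re l \<le> M}" "finite L"
    have "1 / K\<^sup>2 \<le> (1 / (Re l + T))\<^sup>2" if "l \<in> L" for l
    proof -
      have "1 \<le> Re l + T" "Re l \<le> M" using that L Z_ge by auto
      then have "(Re l + T)\<^sup>2 \<le> K\<^sup>2" unfolding K_def by (intro power_mono) auto
      then show ?thesis using \<open>1 \<le> Re l + T\<close> K by (simp add: power_one_over field_simps)
    qed
    then have "(\<Sum>l\<in>L. 1 / K\<^sup>2) \<le> (\<Sum>l\<in>L. (1 / (Re l + T))\<^sup>2)" by (rule sum_mono)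
    also have "\<dots> \<le> C" using L by (intro C) auto
    finally have "real (card L) \<le> C * K\<^sup>2" using K by (simp add: field_simps)
    then show "card L \<le> nat \<lceil>C * K\<^sup>2\<rceil>" by linarith
  qed
  then show ?thesis by simp
qed

text \<open>\<open>u = R f1\<close>, and \<open>R\<close> has norm at most \<open>\<epsilon>\<close>
  on the complement of the finitely many eigenfunctions with eigenvalue above
  \<open>\<epsilon>\<close>. Projecting \<open>f1\<close> onto these and applying \<open>R\<close>
  gives the approximation of \<open>u\<close>.\<close>

lemma complete_dom:
  assumes u: "dom u u' f" and e: "0 < e"
  obtains L c where "finite L" "L \<subseteq> Z"
    "ip a (\<lambda>x. u x - (\<Sum>l\<in>L. c l * ev l x)) (\<lambda>x. u x - (\<Sum>l\<in>L. c l * ev l x)) < e"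
proof -
  define f1 where "f1 x = f x + T * u x" for x
  note U = domD[OF u]
  have f1: "continuous_on {0..a} f1" unfolding f1_def[abs_def] by (intro continuous_intros U)
  have Rf1: "R f1 x = u x" if "x \<in> {0..a}" for x
    by (rule R_eq[OF f1 _ that, of u u']) (rule dom_cong[OF u], simp add: f1_def)
  have n1: "0 \<le> ip a f1 f1" by (rule ip_nonneg[OF f1])
  \<comment> \<open>Makes \<open>\<epsilon>\<^sup>2\<close> times the squared norm of
    \<open>f1\<close> smaller than \<open>e\<close>; the summand \<open>1\<close> covers a vanishing
    norm.\<close>
  define \<epsilon> where "\<epsilon> = sqrt (e / (ip a f1 f1 + 1))"
  have \<epsilon>: "0 < \<epsilon>" "\<epsilon>\<^sup>2 * ip a f1 f1 < e"
  proof -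
    show "0 < \<epsilon>" unfolding \<epsilon>_def using e n1 by simp
    have "\<epsilon>\<^sup>2 * ip a f1 f1 = e * (ip a f1 f1 / (ip a f1 f1 + 1))" unfolding \<epsilon>_def using e n1 by simp
    also have "\<dots> < e * 1" using e n1 by (intro mult_strict_left_mono) auto
    finally show "\<epsilon>\<^sup>2 * ip a f1 f1 < e" by simp
  qed
  define L where "L = {l \<in> Z. \<epsilon> < 1 / (Re l + T)}"
  have L: "finite L" "L \<subseteq> Z"
  proof -
    have "L \<subseteq> {l \<in> Z. Re l \<le> 1 / \<epsilon>}"
    proof
      fix l assume l: "l \<in> L"
      then have "1 \<le> Re l + T" "\<epsilon> < 1 / (Re l + T)" using Z_ge by (auto simp: L_def)
      then have "(Re l + T) * \<epsilon> < 1" by (simp add: field_simps)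
      then have "Re l + T < 1 / \<epsilon>" using \<epsilon> by (simp add: field_simps)
      then show "l \<in> {l \<in> Z. Re l \<le> 1 / \<epsilon>}" using l T_nonneg by (auto simp: L_def)
    qed
    then show "finite L" using Z_finite_below finite_subset by blast
    show "L \<subseteq> Z" by (auto simp: L_def)
  qed
  define N where "N l = ip a (ev l) (ev l)" for l
  have N: "0 < N l" if "l \<in> L" for l unfolding N_def using that L Z_real by (intro ev_pos) auto
  define p where "p l = ip a f1 (ev l) / N l" for l
  define g where "g = (\<lambda>x. \<Sum>l\<in>L. p l * ev l x)"
  have g: "continuous_on {0..a} g" unfolding g_def by (intro continuous_intros ev_cont)
  define f2 where "f2 x = 1 * f1 x + (-1) * g x" for x
  have f2: "continuous_on {0..a} f2" unfolding f2_def[abs_def] by (intro continuous_intros f1 g)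
  have gl: "ip a g (ev l) = ip a f1 (ev l)" if "l \<in> L" for l
    unfolding g_def ip_ev_sum(1)[OF L that] p_def using N[OF that] by (simp add: N_def)
  have orth: "ip a f2 (ev l) = 0" if "l \<in> L" for l
    unfolding f2_def[abs_def] ip_lin_left[OF f1 g ev_cont] using gl[OF that] by simp
  have "ip a f2 g = 0"
  proof -
    have "ip a g f2 = (\<Sum>l\<in>L. p l * ip a (ev l) f2)"
      unfolding g_def by (rule ip_sum_left[OF L(1) ev_cont f2])
    moreover have "ip a (ev l) f2 = 0" if "l \<in> L" for l by (subst ip_commute) (rule orth[OF that])
    ultimately have "ip a g f2 = 0" by simp
    then show ?thesis by (subst ip_commute)
  qed
  then have fg: "ip a f1 g = ip a g g"
    unfolding f2_def[abs_def] ip_lin_left[OF f1 g g] by simp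
  have "ip a f2 f2 = 1 * ip a f1 f2 + (-1) * ip a g f2"
    by (subst f2_def[abs_def]) (rule ip_lin_left[OF f1 g f2])
  also have "ip a g f2 = 0" using \<open>ip a f2 g = 0\<close> by (subst ip_commute)
  also have "ip a f1 f2 = ip a f1 f1 - ip a f1 g"
    unfolding f2_def[abs_def] ip_lin_right[OF f1 g f1] by simp
  finally have "ip a f2 f2 \<le> ip a f1 f1" using fg ip_nonneg[OF g] by simp
  then have b: "\<epsilon>\<^sup>2 * ip a f2 f2 \<le> \<epsilon>\<^sup>2 * ip a f1 f1" by (intro mult_left_mono) auto
  have "ip a (R f2) (R f2) \<le> \<epsilon>\<^sup>2 * ip a f2 f2"
    by (rule R_gap[OF f2 less_imp_le[OF \<epsilon>(1)]]) (use orth in \<open>auto simp: L_def\<close>)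
  then have lt: "ip a (R f2) (R f2) < e" using b \<epsilon>(2) by linarith
  have Rf2: "R f2 x = u x - (\<Sum>l\<in>L. p l / (Re l + T) * ev l x)" if x: "x \<in> {0..a}" for x
  proof -
    have "R f2 x = 1 * R f1 x + (-1) * R g x" unfolding f2_def[abs_def] by (rule R_lin[OF f1 g x])
    then show ?thesis unfolding g_def R_ev_sum[OF L x] Rf1[OF x] by simp
  qed
  show ?thesis
  proof (rule that[OF L])
    have "ip a (\<lambda>x. u x - (\<Sum>l\<in>L. p l / (Re l + T) * ev l x)) (\<lambda>x. u x - (\<Sum>l\<in>L. p l / (Re l + T) * ev l x)) = ip a (R f2) (R f2)"
      by (intro ip_cong) (use Rf2 in auto)
    then show "ip a (\<lambda>x. u x - (\<Sum>l\<in>L. (\<lambda>l. p l / (Re l + T)) l * ev l x)) (\<lambda>x. u x - (\<Sum>l\<in>L. (\<lambda>l. p l / (Re l + T)) l * ev l x)) < e"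
      using lt by simp
  qed
qed

text \<open>For arbitrary \<open>z\<close> nothing is known about the boundary condition of
  \<open>\<xi> z\<close> at \<open>a\<close>; the cutoff vanishes there with its derivative and
  brings the product into \<open>dom\<close>. The factor \<open>\<kappa>\<close> will be
  \<open>1\<close> or \<open>- \<i>\<close>, to select the real or the imaginary part.\<close>

lemma cutoff_dom:
  assumes cd: "0 \<le> c" "c < d" "d \<le> a"
  obtains u' f where "dom (\<lambda>x. if x = 0 then 0 else Re (\<kappa> * \<xi> z x) * cutoff c d n x) u' f"
proof -
  obtain \<tau>' \<tau>'' where \<tau>:
    "\<And>x. (cutoff c d n has_real_derivative \<tau>' x) (at x)" "\<And>x. (\<tau>' has_real_derivative \<tau>'' x) (at x)"
    "continuous_on UNIV \<tau>''" "\<And>x. d \<le> x \<Longrightarrow> cutoff c d n x = 0" "\<And>x. d \<le> x \<Longrightarrow> \<tau>' x = 0"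
    "\<And>x. 0 \<le> x \<Longrightarrow> \<bar>\<tau>' x\<bar> \<le> real n * (3 * d\<^sup>2 * d * (2 * d)) * x"
    by (rule cutoff_derivatives[OF cd(1,2), where n = n]) blast
  define \<tau> where "\<tau> = cutoff c d n"
  define M where "M = real n * (3 * d\<^sup>2 * d * (2 * d))"
  have M0: "0 \<le> M" using cd by (simp add: M_def)
  have c\<tau>: "continuous_on S \<tau>" "continuous_on S \<tau>'" "continuous_on S \<tau>''" for S
    unfolding \<tau>_def
    by (rule DERIV_continuous_on[OF has_field_derivative_at_within[OF \<tau>(1)]]
        DERIV_continuous_on[OF has_field_derivative_at_within[OF \<tau>(2)]]
        continuous_on_subset[OF \<tau>(3) subset_UNIV])+
  have \<tau>1: "\<bar>\<tau> x\<bar> \<le> 1" for x using cutoff_range[of c d n x] by (simp add: \<tau>_def)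
  have \<tau>2: "\<bar>\<tau>' x\<bar> \<le> M * x" if "0 \<le> x" for x using \<tau>(6)[OF that] by (simp add: M_def)
  obtain M2 where M2: "0 < M2" "\<And>x. x \<in> {0..a} \<Longrightarrow> norm (\<tau>'' x) \<le> M2"
    using continuous_on_Icc_bounded[OF c\<tau>(3)] by blast
  obtain D where D: "0 < D" "\<And>x. x \<in> {0<..a} \<Longrightarrow> norm (\<xi> z x) \<le> D * x powr k"
    "\<And>x. x \<in> {0<..a} \<Longrightarrow> norm (\<eta> z x) \<le> D * x powr (k - 1)" by (rule xi_bound[where z = z]) blast
  define X where "X x = Re (\<kappa> * \<xi> z x)" for x
  define Y where "Y x = Re (\<kappa> * \<eta> z x)" for x
  define V where "V x = Re (\<kappa> * z * \<xi> z x)" for x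
  \<comment> \<open>The factor \<open>1 + norm z\<close> covers \<open>\<xi>\<close>,
    \<open>\<eta>\<close> and the term \<open>z * \<xi>\<close> of the image at once.\<close>
  define C where "C = norm \<kappa> * D * (1 + norm z)"
  have C0: "0 \<le> C" using D by (simp add: C_def)
  have C1: "norm \<kappa> * D * w \<le> C * w" if "0 \<le> w" for w
    unfolding C_def using that D by (simp add: algebra_simps)
  have C2: "norm \<kappa> * norm z * D * w \<le> C * w" if "0 \<le> w" for w
    unfolding C_def using that D by (simp add: algebra_simps)
  have bX: "\<bar>X x\<bar> \<le> C * x powr k" and bY: "\<bar>Y x\<bar> \<le> C * x powr (k - 1)" and bV: "\<bar>V x\<bar> \<le> C * x powr k"
    if x: "x \<in> {0<..a}" for x
  proof -
    have "\<bar>X x\<bar> \<le> norm \<kappa> * norm (\<xi> z x)" unfolding X_def using abs_Re_le_cmod[of "\<kappa> * \<xi> z x"] by (simp add: norm_mult)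
    also have "\<dots> \<le> norm \<kappa> * (D * x powr k)" using D x by (intro mult_left_mono) auto
    also have "\<dots> \<le> C * x powr k" using C1[of "x powr k"] by (simp add: mult.assoc)
    finally show "\<bar>X x\<bar> \<le> C * x powr k" .
    have "\<bar>Y x\<bar> \<le> norm \<kappa> * norm (\<eta> z x)" unfolding Y_def using abs_Re_le_cmod[of "\<kappa> * \<eta> z x"] by (simp add: norm_mult)
    also have "\<dots> \<le> norm \<kappa> * (D * x powr (k - 1))" using D x by (intro mult_left_mono) auto
    also have "\<dots> \<le> C * x powr (k - 1)" using C1[of "x powr (k - 1)"] by (simp add: mult.assoc)
    finally show "\<bar>Y x\<bar> \<le> C * x powr (k - 1)" .
    have "\<bar>V x\<bar> \<le> norm \<kappa> * norm z * norm (\<xi> z x)" unfolding V_def using abs_Re_le_cmod[of "\<kappa> * z * \<xi> z x"] by (simp add: norm_mult)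
    also have "\<dots> \<le> norm \<kappa> * norm z * (D * x powr k)" using D x by (intro mult_left_mono) auto
    also have "\<dots> \<le> C * x powr k" using C2[of "x powr k"] by (simp add: mult.assoc)
    finally show "\<bar>V x\<bar> \<le> C * x powr k" .
  qed
  have cXYV: "continuous_on {0<..a} X" "continuous_on {0<..a} Y" "continuous_on {0<..a} V"
    unfolding X_def[abs_def] Y_def[abs_def] V_def[abs_def] by (intro continuous_intros xi_cont eta_cont)+
  define u where "u x = (if x = 0 then 0 else X x * \<tau> x)" for x
  define u' where "u' x = Y x * \<tau> x + X x * \<tau>' x" for x
  define f0 where "f0 x = V x * \<tau> x - 2 * Y x * \<tau>' x - X x * \<tau>'' x" for x
  define f where "f x = (if x = 0 then 0 else f0 x)" for x
  have xk: "x powr k \<le> a powr (k - m) * x powr m" "x powr (k - 1) \<le> a powr (k - m) * x powr (m - 1)" if "x \<in> {0<..a}" for x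
  proof -
    have le: "x powr (k - m) \<le> a powr (k - m)" using that m_le by (intro powr_mono2) auto
    have "x powr k = x powr (k - m) * x powr m" by (simp flip: powr_add)
    also have "\<dots> \<le> a powr (k - m) * x powr m" by (intro mult_right_mono le) auto
    finally show "x powr k \<le> a powr (k - m) * x powr m" .
    have "x powr (k - 1) = x powr (k - m) * x powr (m - 1)" by (simp flip: powr_add)
    also have "\<dots> \<le> a powr (k - m) * x powr (m - 1)" by (intro mult_right_mono le) auto
    finally show "x powr (k - 1) \<le> a powr (k - m) * x powr (m - 1)" .
  qed
  have bu: "\<bar>X x * \<tau> x\<bar> \<le> C * x powr k" if "x \<in> {0<..a}" for x
  proof -
    have "\<bar>X x * \<tau> x\<bar> \<le> (C * x powr k) * 1"
      unfolding abs_mult using bX[OF that] \<tau>1[of x] by (intro mult_mono) auto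
    then show ?thesis by simp
  qed
  have bu': "\<bar>u' x\<bar> \<le> (C + C * (M * a * a)) * x powr (k - 1)" if x: "x \<in> {0<..a}" for x
  proof -
    have "\<bar>u' x\<bar> \<le> \<bar>Y x\<bar> * \<bar>\<tau> x\<bar> + \<bar>X x\<bar> * \<bar>\<tau>' x\<bar>"
      unfolding u'_def by (rule order_trans[OF abs_triangle_ineq]) (simp add: abs_mult)
    also have "\<dots> \<le> (C * x powr (k - 1)) * 1 + (C * x powr k) * (M * x)"
      using bY[OF x] bX[OF x] \<tau>1[of x] \<tau>2[of x] x C0 by (intro add_mono mult_mono) auto
    also have "x powr k = x powr (k - 1) * x" using x by (simp add: powr_diff)
    also have "(C * x powr (k - 1)) * 1 + (C * (x powr (k - 1) * x)) * (M * x) = C * x powr (k - 1) + C * x powr (k - 1) * M * (x * x)"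
      by (simp add: algebra_simps)
    also have "\<dots> \<le> C * x powr (k - 1) + C * x powr (k - 1) * M * (a * a)"
      using x C0 M0 by (intro add_left_mono mult_left_mono mult_mono) auto
    finally show ?thesis by (simp add: algebra_simps)
  qed
  have uc: "continuous_on {0..a} u"
    unfolding u_def[abs_def]
    by (rule extend_by_zero_continuous[where p = k and C = C])
      (use k_gt bu in \<open>auto intro!: continuous_intros cXYV c\<tau>\<close>)
  have fc: "continuous_on {0..a} f"
    unfolding f_def[abs_def]
  proof (rule extend_by_zero_continuous[where p = k and C = "C + 2 * C * M + C * M2"])
    show "continuous_on {0<..a} f0" unfolding f0_def[abs_def] by (intro continuous_intros cXYV c\<tau>)
    fix x assume x: "x \<in> {0<..a}"
    have "\<bar>f0 x\<bar> \<le> \<bar>V x\<bar> * \<bar>\<tau> x\<bar> + 2 * \<bar>Y x\<bar> * \<bar>\<tau>' x\<bar> + \<bar>X x\<bar> * \<bar>\<tau>'' x\<bar>"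
      unfolding f0_def using abs_triangle_ineq4[of "V x * \<tau> x - 2 * Y x * \<tau>' x" "X x * \<tau>'' x"]
        abs_triangle_ineq4[of "V x * \<tau> x" "2 * Y x * \<tau>' x"] by (simp add: abs_mult)
    also have "\<dots> \<le> (C * x powr k) * 1 + 2 * (C * x powr (k - 1)) * (M * x) + (C * x powr k) * M2"
      using bV[OF x] bY[OF x] bX[OF x] \<tau>1[of x] \<tau>2[of x] M2(2)[of x] x C0
      by (intro add_mono mult_mono mult_left_mono) auto
    also have "2 * (C * x powr (k - 1)) * (M * x) = 2 * C * M * (x powr (k - 1) * x)" by simp
    also have "x powr (k - 1) * x = x powr k" using x by (simp add: powr_diff)
    finally show "norm (f0 x) \<le> (C + 2 * C * M + C * M2) * x powr k" by (simp add: algebra_simps)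
  qed (use k_gt in auto)
  have "dom u u' f"
    unfolding dom_def
  proof (intro conjI ballI)
    show "continuous_on {0..a} u" "continuous_on {0..a} f" by (rule uc fc)+
    show "continuous_on {0<..a} u'" unfolding u'_def[abs_def] by (intro continuous_intros cXYV c\<tau>)
    fix x assume "x \<in> {0<..<a}"
    then have x: "0 < x" "x < a" "x \<in> {0<..a}" by auto
    note S = solD[OF sol_xi x(3), unfolded at_within_interior_a[OF x(1,2)]]
    have lin: "bounded_linear (\<lambda>w. Re (\<kappa> * w))"
      by (intro bounded_linear_compose[OF bounded_linear_Re] bounded_linear_mult_right)
    have "(X has_vector_derivative Y x) (at x)"
      unfolding X_def[abs_def] Y_def by (rule bounded_linear.has_vector_derivative[OF lin S(1)])
    then have X': "(X has_real_derivative Y x) (at x)" by (simp add: has_real_derivative_iff_has_vector_derivative)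
    have "(Y has_vector_derivative Re (\<kappa> * ((of_real (P x) - z) * \<xi> z x))) (at x)"
      unfolding Y_def[abs_def] by (rule bounded_linear.has_vector_derivative[OF lin S(2)])
    moreover have "Re (\<kappa> * ((of_real (P x) - z) * \<xi> z x)) = P x * X x - V x"
      by (simp add: X_def V_def algebra_simps)
    ultimately have Y': "(Y has_real_derivative P x * X x - V x) (at x)"
      by (simp add: has_real_derivative_iff_has_vector_derivative)
    have "((\<lambda>x. X x * \<tau> x) has_real_derivative u' x) (at x)"
      using DERIV_mult[OF X' \<tau>(1)[of x, folded \<tau>_def]] by (simp add: u'_def algebra_simps)
    then show "(u has_real_derivative u' x) (at x)"
      by (rule has_field_derivative_transform_within_open[of _ _ _ "{0<..}"]) (use x in \<open>auto simp: u_def\<close>)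
    have "(u' has_real_derivative ((P x * X x - V x) * \<tau> x + \<tau>' x * Y x) + (Y x * \<tau>' x + \<tau>'' x * X x)) (at x)"
      unfolding u'_def[abs_def] by (intro DERIV_add DERIV_mult X' Y' \<tau>(1)[of x, folded \<tau>_def] \<tau>(2))
    then show "(u' has_real_derivative P x * u x - f x) (at x)"
      using x by (simp add: u_def f_def f0_def algebra_simps)
  next
    show "\<exists>C. \<forall>x\<in>{0<..a}. \<bar>u x\<bar> \<le> C * x powr m \<and> \<bar>u' x\<bar> \<le> C * x powr (m - 1)"
    proof (intro exI[of _ "(C + C * (M * a * a)) * a powr (k - m)"] ballI conjI)
      fix x assume x: "x \<in> {0<..a}"
      have CC: "C \<le> C + C * (M * a * a)" "0 \<le> C + C * (M * a * a)" using C0 M0 a by auto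
      have "\<bar>u x\<bar> \<le> C * x powr k" using bu[OF x] x by (simp add: u_def)
      also have "\<dots> \<le> (C + C * (M * a * a)) * (a powr (k - m) * x powr m)"
        using xk[OF x] CC by (intro mult_mono) auto
      finally show "\<bar>u x\<bar> \<le> (C + C * (M * a * a)) * a powr (k - m) * x powr m" by (simp only: mult.assoc)
      have "\<bar>u' x\<bar> \<le> (C + C * (M * a * a)) * x powr (k - 1)" by (rule bu'[OF x])
      also have "\<dots> \<le> (C + C * (M * a * a)) * (a powr (k - m) * x powr (m - 1))"
        using xk[OF x] CC by (intro mult_left_mono) auto
      finally show "\<bar>u' x\<bar> \<le> (C + C * (M * a * a)) * a powr (k - m) * x powr (m - 1)" by (simp only: mult.assoc)
    qed
    show "u a * cos \<gamma> + u' a * sin \<gamma> = 0" using \<tau>(4,5)[of a] cd by (simp add: u_def u'_def \<tau>_def)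
  qed
  then show ?thesis by (intro that[of u' f]) (simp only: u_def[abs_def] X_def \<tau>_def)
qed

end

subsection \<open>Square integrable functions and the transform\<close>

lemma lebesgue_cauchy_schwarz:
  fixes f g :: "'a \<Rightarrow> complex"
  assumes f: "f \<in> borel_measurable M" "integrable M (\<lambda>x. (norm (f x))\<^sup>2)"
    and g: "g \<in> borel_measurable M" "integrable M (\<lambda>x. (norm (g x))\<^sup>2)"
  shows "integrable M (\<lambda>x. f x * g x)"
    "(norm (LINT x|M. f x * g x))\<^sup>2 \<le> (LINT x|M. (norm (f x))\<^sup>2) * (LINT x|M. (norm (g x))\<^sup>2)"
proof -
  have le: "2 * (norm (f x) * norm (g x)) \<le> (norm (f x))\<^sup>2 + (norm (g x))\<^sup>2" for x
    using sum_squares_bound[of "norm (f x)" "norm (g x)"] by (simp add: mult.assoc)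
  have le': "norm (f x) * norm (g x) \<le> (norm (f x))\<^sup>2 + (norm (g x))\<^sup>2" for x
    using le[of x] mult_nonneg_nonneg[OF norm_ge_zero norm_ge_zero, of "f x" "g x"] by linarith
  show i: "integrable M (\<lambda>x. f x * g x)"
  proof (rule Bochner_Integration.integrable_bound)
    show "integrable M (\<lambda>x. (norm (f x))\<^sup>2 + (norm (g x))\<^sup>2)" by (intro Bochner_Integration.integrable_add f g)
    show "(\<lambda>x. f x * g x) \<in> borel_measurable M" using f g by measurable
    show "AE x in M. norm (f x * g x) \<le> norm ((norm (f x))\<^sup>2 + (norm (g x))\<^sup>2)"
      using le' by (intro AE_I2) (simp add: norm_mult)
  qed
  have i': "integrable M (\<lambda>x. norm (f x) * norm (g x))"
    using integrable_norm[OF i] by (simp add: norm_mult)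
  have "(LINT x|M. norm (f x) * norm (g x))\<^sup>2 \<le> (LINT x|M. (norm (f x))\<^sup>2) * (LINT x|M. (norm (g x))\<^sup>2)"
  proof (rule quadratic_discriminant_le)
    fix t :: real
    have "0 \<le> (LINT x|M. (norm (f x) + t * norm (g x))\<^sup>2)" by (intro Bochner_Integration.integral_nonneg) simp
    also have "(\<lambda>x. (norm (f x) + t * norm (g x))\<^sup>2) = (\<lambda>x. (norm (f x))\<^sup>2 + (2 * t) * (norm (f x) * norm (g x)) + t\<^sup>2 * (norm (g x))\<^sup>2)"
      by (auto simp: power2_eq_square algebra_simps)
    also have "(LINT x|M. (norm (f x))\<^sup>2 + (2 * t) * (norm (f x) * norm (g x)) + t\<^sup>2 * (norm (g x))\<^sup>2) =
        (LINT x|M. (norm (f x))\<^sup>2) + 2 * t * (LINT x|M. norm (f x) * norm (g x)) + t\<^sup>2 * (LINT x|M. (norm (g x))\<^sup>2)"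
      using f g i' by (subst Bochner_Integration.integral_add; simp)+
    finally show "0 \<le> (LINT x|M. (norm (f x))\<^sup>2) + 2 * t * (LINT x|M. norm (f x) * norm (g x)) + t\<^sup>2 * (LINT x|M. (norm (g x))\<^sup>2)" .
  qed (intro Bochner_Integration.integral_nonneg, simp)
  moreover have "norm (LINT x|M. f x * g x) \<le> (LINT x|M. norm (f x) * norm (g x))"
    using integral_norm_bound[of M "\<lambda>x. f x * g x"] by (simp add: norm_mult)
  then have "(norm (LINT x|M. f x * g x))\<^sup>2 \<le> (LINT x|M. norm (f x) * norm (g x))\<^sup>2" by (rule power_mono) simp
  ultimately show "(norm (LINT x|M. f x * g x))\<^sup>2 \<le> (LINT x|M. (norm (f x))\<^sup>2) * (LINT x|M. (norm (g x))\<^sup>2)" by linarith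
qed

lemma continuous_lebesgue_interior:
  fixes g :: "real \<Rightarrow> 'b::euclidean_space"
  assumes "continuous_on {0..c} g"
  shows "integrable (lebesgue_on {0<..<c}) g" "(LINT x|lebesgue_on {0<..<c}. g x) = integral {0..c} g"
proof -
  have "g absolutely_integrable_on {0<..<c}"
    by (rule set_integrable_subset[OF absolutely_integrable_continuous_real[OF assms]]) auto
  then show i: "integrable (lebesgue_on {0<..<c}) g" by (rule absolutely_integrable_imp_integrable) simp
  show "(LINT x|lebesgue_on {0<..<c}. g x) = integral {0..c} g"
    using lebesgue_integral_eq_integral[OF i] by (simp add: integral_open_interval_real)
qed

lemma L2D:
  assumes "\<phi> \<in> L2 s"
  shows "\<phi> \<in> borel_measurable (lebesgue_on {0<..<s})" "integrable (lebesgue_on {0<..<s}) (\<lambda>x. (norm (\<phi> x))\<^sup>2)"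
  using assms by (auto simp: L2_def)

lemma L2_continuous:
  fixes g :: "real \<Rightarrow> complex"
  assumes "continuous_on {0..c} g"
  shows "g \<in> L2 c"
  unfolding L2_def
proof (intro CollectI conjI)
  show "g \<in> borel_measurable (lebesgue_on {0<..<c})"
    using continuous_lebesgue_interior(1)[OF assms] by (rule borel_measurable_integrable)
  show "integrable (lebesgue_on {0<..<c}) (\<lambda>x. (norm (g x))\<^sup>2)"
    by (rule continuous_lebesgue_interior(1)) (intro continuous_intros assms)
qed

lemma L2_cong:
  assumes "\<phi> \<in> L2 s" "\<And>x. x \<in> {0<..<s} \<Longrightarrow> \<psi> x = \<phi> x"
  shows "\<psi> \<in> L2 s"
proof -
  have "\<psi> \<in> borel_measurable (lebesgue_on {0<..<s}) \<longleftrightarrow> \<phi> \<in> borel_measurable (lebesgue_on {0<..<s})"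
    by (rule measurable_cong) (use assms(2) in auto)
  moreover have "integrable (lebesgue_on {0<..<s}) (\<lambda>x. (norm (\<psi> x))\<^sup>2) \<longleftrightarrow> integrable (lebesgue_on {0<..<s}) (\<lambda>x. (norm (\<phi> x))\<^sup>2)"
    by (rule Bochner_Integration.integrable_cong) (use assms(2) in auto)
  ultimately show ?thesis using assms(1) by (simp add: L2_def)
qed

lemma L2_lin:
  assumes "\<phi> \<in> L2 s" "\<psi> \<in> L2 s"
  shows "(\<lambda>x. c * \<phi> x + d * \<psi> x) \<in> L2 s"
  unfolding L2_def
proof (intro CollectI conjI)
  note [measurable] = L2D(1)[OF assms(1)] L2D(1)[OF assms(2)]
  show "(\<lambda>x. c * \<phi> x + d * \<psi> x) \<in> borel_measurable (lebesgue_on {0<..<s})" by measurable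
  show "integrable (lebesgue_on {0<..<s}) (\<lambda>x. (norm (c * \<phi> x + d * \<psi> x))\<^sup>2)"
  proof (rule Bochner_Integration.integrable_bound)
    show "integrable (lebesgue_on {0<..<s}) (\<lambda>x. 2 * (norm c)\<^sup>2 * (norm (\<phi> x))\<^sup>2 + 2 * (norm d)\<^sup>2 * (norm (\<psi> x))\<^sup>2)"
      using L2D(2)[OF assms(1)] L2D(2)[OF assms(2)]
      by (intro Bochner_Integration.integrable_add integrable_mult_right) auto
    show "(\<lambda>x. (norm (c * \<phi> x + d * \<psi> x))\<^sup>2) \<in> borel_measurable (lebesgue_on {0<..<s})" by measurable
    show "AE x in lebesgue_on {0<..<s}. norm ((norm (c * \<phi> x + d * \<psi> x))\<^sup>2) \<le>
        norm (2 * (norm c)\<^sup>2 * (norm (\<phi> x))\<^sup>2 + 2 * (norm d)\<^sup>2 * (norm (\<psi> x))\<^sup>2)"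
    proof (intro AE_I2)
      fix x
      have "(norm (c * \<phi> x + d * \<psi> x))\<^sup>2 \<le> (norm c * norm (\<phi> x) + norm d * norm (\<psi> x))\<^sup>2"
        by (intro power_mono) (auto intro: order_trans[OF norm_triangle_ineq] simp: norm_mult)
      also have "\<dots> \<le> 2 * (norm c * norm (\<phi> x))\<^sup>2 + 2 * (norm d * norm (\<psi> x))\<^sup>2"
        using sum_squares_bound[of "norm c * norm (\<phi> x)" "norm d * norm (\<psi> x)"] by (simp add: power2_sum)
      finally show "norm ((norm (c * \<phi> x + d * \<psi> x))\<^sup>2) \<le> norm (2 * (norm c)\<^sup>2 * (norm (\<phi> x))\<^sup>2 + 2 * (norm d)\<^sup>2 * (norm (\<psi> x))\<^sup>2)"
        by (simp add: power_mult_distrib)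
    qed
  qed
qed

lemma L2_integrable:
  assumes "\<phi> \<in> L2 s"
  shows "integrable (lebesgue_on {0<..<s}) \<phi>"
proof -
  have "integrable (lebesgue_on {0<..<s}) (\<lambda>x. 1 * \<phi> x)"
    by (rule lebesgue_cauchy_schwarz(1)) (use L2D[OF assms] L2D[OF L2_continuous[of s "\<lambda>_. 1"]] in auto)
  then show ?thesis by simp
qed

lemma AE_lebesgue_on_negligible:
  assumes "negligible N" "S \<in> sets lebesgue" "\<And>x. x \<in> S \<Longrightarrow> x \<notin> N \<Longrightarrow> Q x"
  shows "AE x in lebesgue_on S. Q x"
proof -
  have "N \<in> null_sets lebesgue" using assms(1) by (simp add: negligible_iff_null_sets)
  then have "AE x in lebesgue. x \<notin> N" by (rule AE_not_in)
  then have "AE x in lebesgue. x \<in> S \<longrightarrow> Q x" by (rule AE_mp) (use assms(3) in auto)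
  then show ?thesis using assms(2) by (subst AE_restrict_space_iff) auto
qed

text \<open>Lebesgue differentiation: outside a null set \<open>h x\<close> is the limit of its
  averages over \<open>{x..x + t}\<close>, which vanish for small \<open>t\<close>.\<close>

lemma AE_zero_of_interval_integrals:
  fixes h :: "real \<Rightarrow> complex"
  assumes h: "integrable (lebesgue_on {0<..<s}) h"
    and z: "\<And>c d. 0 < c \<Longrightarrow> c < d \<Longrightarrow> d < s \<Longrightarrow> integral {c..d} h = 0"
  shows "AE x in lebesgue_on {0<..<s}. h x = 0"
proof -
  define F where "F x = (if x \<in> {0<..<s} then h x else 0)" for x
  have "h integrable_on {0<..<s}" by (rule integrable_on_lebesgue_on[OF h]) simp
  moreover have "h absolutely_integrable_on {0<..<s}"
    unfolding set_integrable_def using h by (subst (asm) integrable_restrict_space) auto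
  ultimately have "F absolutely_integrable_on UNIV"
    unfolding F_def by (subst absolutely_integrable_restrict_UNIV)
  then have Fi: "F integrable_on cbox c d" for c d
    using set_integrable_subset[of lebesgue UNIV F "cbox c d"] by (simp add: absolutely_integrable_on_def)
  obtain N where N: "negligible N" "\<And>x e. x \<notin> N \<Longrightarrow> 0 < e \<Longrightarrow> \<exists>d>0. \<forall>h. 0 < h \<and> h < d \<longrightarrow>
      norm (integral (cbox x (x + h *\<^sub>R One)) F /\<^sub>R h ^ DIM(real) - F x) < e"
    using integrable_ccontinuous_explicit[OF Fi] by metis
  show ?thesis
  proof (rule AE_lebesgue_on_negligible[OF N(1)])
    fix x assume x: "x \<in> {0<..<s}" "x \<notin> N"
    show "h x = 0"
    proof (rule ccontr)
      assume "h x \<noteq> 0"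
      then obtain d where d: "d > 0" "\<And>t. 0 < t \<Longrightarrow> t < d \<Longrightarrow> norm (integral {x..x + t} F /\<^sub>R t - F x) < norm (h x)"
        using N(2)[OF x(2), of "norm (h x)"] by auto
      define t where "t = min (d / 2) ((s - x) / 2)"
      have t: "0 < t" "t < d" "x + t < s" using d x by (auto simp: t_def min_def field_simps)
      have "integral {x..x + t} F = integral {x..x + t} h"
        by (rule integral_cong) (use x t in \<open>auto simp: F_def\<close>)
      also have "\<dots> = 0" using z[of x "x + t"] x t by auto
      finally show False using d(2)[OF t(1,2)] x by (simp add: F_def)
    qed
  qed simp
qed

section \<open>Completeness among square integrable functions and injectivity of the
  transform\<close>

context bessel_problem
begin

abbreviation "Leb \<equiv> lebesgue_on {0<..<a}"

definition xi0 :: "complex \<Rightarrow> real \<Rightarrow> complex" where "xi0 z x = (if x = 0 then 0 else \<xi> z x)"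

lemma xi0_cont: "continuous_on {0..a} (xi0 z)"
proof -
  obtain C where C: "0 < C" "\<And>x. x \<in> {0<..a} \<Longrightarrow> norm (\<xi> z x) \<le> C * x powr k"
    "\<And>x. x \<in> {0<..a} \<Longrightarrow> norm (\<eta> z x) \<le> C * x powr (k - 1)" by (rule xi_bound[where z = z]) blast
  show ?thesis
    unfolding xi0_def[abs_def]
    by (rule extend_by_zero_continuous[OF xi_cont _ C(2)]) (use k_gt in auto)
qed

lemma xi_L2: "\<xi> z \<in> L2 a"
  by (rule L2_cong[OF L2_continuous[OF xi0_cont[of z]]]) (auto simp: xi0_def)

lemma xi_times_integrable: "\<phi> \<in> L2 a \<Longrightarrow> integrable Leb (\<lambda>x. \<xi> z x * \<phi> x)"
  by (rule lebesgue_cauchy_schwarz(1)) (use L2D[OF xi_L2] L2D in auto)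

lemma Z_xi_ev: "l \<in> Z \<Longrightarrow> x \<in> {0<..<a} \<Longrightarrow> \<xi> l x = of_real (ev l x)"
  using ev_real[OF Z_real] by auto

text \<open>Density is available for real functions in \<open>dom\<close>, so real and imaginary
  part are approximated separately; the two families of coefficients are combined over the union of
  their index sets.\<close>

lemma cutoff_approx:
  assumes cd: "0 \<le> c" "c < d" "d \<le> a" and e: "0 < e"
  obtains L p where "finite L" "L \<subseteq> Z"
    "(LINT x|Leb. (norm (\<xi> z x * of_real (cutoff c d n x) - (\<Sum>l\<in>L. p l * \<xi> l x)))\<^sup>2) < e"
proof -
  define u where "u \<kappa> x = (if x = 0 then 0 else Re (\<kappa> * \<xi> z x) * cutoff c d n x)" for \<kappa> x
  have ex: "\<exists>L p. finite L \<and> L \<subseteq> Z \<and>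
      ip a (\<lambda>x. u \<kappa> x - (\<Sum>l\<in>L. p l * ev l x)) (\<lambda>x. u \<kappa> x - (\<Sum>l\<in>L. p l * ev l x)) < e / 2 \<and> continuous_on {0..a} (u \<kappa>)" for \<kappa>
  proof (rule cutoff_dom[OF cd, where \<kappa> = \<kappa> and z = z and n = n])
    fix u' f assume d: "dom (\<lambda>x. if x = 0 then 0 else Re (\<kappa> * \<xi> z x) * cutoff c d n x) u' f"
    show ?thesis
      by (rule complete_dom[OF d, of "e / 2"]) (use e domD(1)[OF d] in \<open>auto simp: u_def[abs_def]\<close>)
  qed
  obtain L1 p1 where L1: "finite L1" "L1 \<subseteq> Z"
    "ip a (\<lambda>x. u 1 x - (\<Sum>l\<in>L1. p1 l * ev l x)) (\<lambda>x. u 1 x - (\<Sum>l\<in>L1. p1 l * ev l x)) < e / 2" "continuous_on {0..a} (u 1)"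
    using ex[of 1] by blast
  obtain L2 p2 where L2: "finite L2" "L2 \<subseteq> Z"
    "ip a (\<lambda>x. u (- \<i>) x - (\<Sum>l\<in>L2. p2 l * ev l x)) (\<lambda>x. u (- \<i>) x - (\<Sum>l\<in>L2. p2 l * ev l x)) < e / 2" "continuous_on {0..a} (u (- \<i>))"
    using ex[of "- \<i>"] by blast
  define r1 where "r1 x = u 1 x - (\<Sum>l\<in>L1. p1 l * ev l x)" for x
  define r2 where "r2 x = u (- \<i>) x - (\<Sum>l\<in>L2. p2 l * ev l x)" for x
  have rc: "continuous_on {0..a} r1" "continuous_on {0..a} r2"
    unfolding r1_def[abs_def] r2_def[abs_def] by (intro continuous_intros L1 L2 ev_cont)+
  define p where "p l = of_real (if l \<in> L1 then p1 l else 0) + \<i> * of_real (if l \<in> L2 then p2 l else 0)" for l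
  have fin: "finite (L1 \<union> L2)" "L1 \<union> L2 \<subseteq> Z" using L1 L2 by auto
  have eq: "\<xi> z x * of_real (cutoff c d n x) - (\<Sum>l\<in>L1 \<union> L2. p l * \<xi> l x) = of_real (r1 x) + \<i> * of_real (r2 x)"
    if x: "x \<in> {0<..<a}" for x
  proof -
    have "(\<Sum>l\<in>L1 \<union> L2. p l * \<xi> l x) = (\<Sum>l\<in>L1 \<union> L2. of_real ((if l \<in> L1 then p1 l else 0) * ev l x) + \<i> * of_real ((if l \<in> L2 then p2 l else 0) * ev l x))"
      using fin x by (intro sum.cong refl) (auto simp: p_def Z_xi_ev algebra_simps)
    also have "\<dots> = of_real (\<Sum>l\<in>L1 \<union> L2. (if l \<in> L1 then p1 l else 0) * ev l x) + \<i> * of_real (\<Sum>l\<in>L1 \<union> L2. (if l \<in> L2 then p2 l else 0) * ev l x)"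
      by (simp add: sum.distrib sum_distrib_left)
    also have "(\<Sum>l\<in>L1 \<union> L2. (if l \<in> L1 then p1 l else 0) * ev l x) = (\<Sum>l\<in>L1. p1 l * ev l x)"
      using fin(1) by (intro sum.mono_neutral_cong_right) auto
    also have "(\<Sum>l\<in>L1 \<union> L2. (if l \<in> L2 then p2 l else 0) * ev l x) = (\<Sum>l\<in>L2. p2 l * ev l x)"
      using fin(1) by (intro sum.mono_neutral_cong_right) auto
    finally show ?thesis
      using x by (simp add: r1_def r2_def u_def complex_eq_iff)
  qed
  have "(LINT x|Leb. (norm (\<xi> z x * of_real (cutoff c d n x) - (\<Sum>l\<in>L1 \<union> L2. p l * \<xi> l x)))\<^sup>2) =
      (LINT x|Leb. r1 x * r1 x + r2 x * r2 x)"
  proof (rule Bochner_Integration.integral_cong)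
    fix x assume "x \<in> space Leb"
    then have "x \<in> {0<..<a}" by simp
    then show "(norm (\<xi> z x * of_real (cutoff c d n x) - (\<Sum>l\<in>L1 \<union> L2. p l * \<xi> l x)))\<^sup>2 = r1 x * r1 x + r2 x * r2 x"
      unfolding eq[OF \<open>x \<in> {0<..<a}\<close>] cmod_power2 by (simp add: power2_eq_square)
  qed simp
  also have "\<dots> = integral {0..a} (\<lambda>x. r1 x * r1 x + r2 x * r2 x)"
    by (rule continuous_lebesgue_interior(2)) (intro continuous_intros rc)
  also have "\<dots> = ip a r1 r1 + ip a r2 r2"
    unfolding ip_def by (rule Henstock_Kurzweil_Integration.integral_add) (rule ip_int[OF rc(1) rc(1)], rule ip_int[OF rc(2) rc(2)])
  also have "\<dots> < e" using L1(3) L2(3) unfolding r1_def[abs_def] r2_def[abs_def] by linarith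
  finally show ?thesis by (rule that[OF fin])
qed

lemma cutoff_measurable: "cutoff c d n \<in> borel_measurable (lebesgue_on S)"
proof -
  have "continuous_on UNIV (cutoff c d n)"
    unfolding cutoff_def[abs_def] bump_def by (intro continuous_intros)
  then have "cutoff c d n \<in> borel_measurable borel" by (rule borel_measurable_continuous_onI)
  then have "cutoff c d n \<in> borel_measurable lborel" by simp
  then have "cutoff c d n \<in> borel_measurable lebesgue" by (rule measurable_completion)
  then show ?thesis by (rule measurable_restrict_space1)
qed

text \<open>A function orthogonal to all eigenfunctions is orthogonal to \<open>\<xi>\<^sub>z\<close> times the indicator
  function of any interval; for nonreal \<open>z\<close> the function \<open>\<xi>\<^sub>z\<close> has no zeros.\<close>

lemma orthogonal_to_eigenfunctions:
  assumes \<phi>: "\<phi> \<in> L2 a" and orth: "\<And>l. l \<in> Z \<Longrightarrow> (LINT x|Leb. \<xi> l x * \<phi> x) = 0"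
  shows "AE x in Leb. \<phi> x = 0"
proof -
  define z where "z = \<i>"
  define h where "h x = \<xi> z x * \<phi> x" for x
  have h: "integrable Leb h" unfolding h_def[abs_def] by (rule xi_times_integrable[OF \<phi>])
  have cz: "(LINT x|Leb. of_real (cutoff c d n x) * h x) = 0" if cd: "0 \<le> c" "c < d" "d \<le> a" for c d n
  proof -
    define N where "N = (LINT x|Leb. (norm (\<phi> x))\<^sup>2)"
    let ?I = "LINT x|Leb. of_real (cutoff c d n x) * h x"
    have N0: "0 \<le> N" unfolding N_def by (intro Bochner_Integration.integral_nonneg) simp
    have "(norm ?I)\<^sup>2 \<le> e" if e: "0 < e" for e
    proof -
      obtain L p where L: "finite L" "L \<subseteq> Z"
        "(LINT x|Leb. (norm (\<xi> z x * of_real (cutoff c d n x) - (\<Sum>l\<in>L. p l * \<xi> l x)))\<^sup>2) < e / (N + 1)"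
        by (rule cutoff_approx[OF cd, where e = "e / (N + 1)" and z = z and n = n]) (use e N0 in auto)
      define r where "r x = \<xi> z x * of_real (cutoff c d n x) - (\<Sum>l\<in>L. p l * \<xi> l x)" for x
      have rL: "r \<in> L2 a"
      proof -
        have "continuous_on UNIV (cutoff c d n)" unfolding cutoff_def[abs_def] bump_def by (intro continuous_intros)
        then have "continuous_on {0..a} (cutoff c d n)" by (rule continuous_on_subset) simp
        then have "continuous_on {0..a} (\<lambda>x. xi0 z x * of_real (cutoff c d n x) - (\<Sum>l\<in>L. p l * xi0 l x))"
          by (intro continuous_intros xi0_cont)
        then have "(\<lambda>x. xi0 z x * of_real (cutoff c d n x) - (\<Sum>l\<in>L. p l * xi0 l x)) \<in> L2 a" by (rule L2_continuous)
        then show ?thesis by (rule L2_cong) (auto simp: r_def xi0_def)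
      qed
      have li: "integrable Leb (\<lambda>x. \<Sum>l\<in>L. p l * (\<xi> l x * \<phi> x))"
        using xi_times_integrable[OF \<phi>] by (intro Bochner_Integration.integrable_sum integrable_mult_right) auto
      have ri: "integrable Leb (\<lambda>x. r x * \<phi> x)"
        by (rule lebesgue_cauchy_schwarz(1)) (use L2D[OF rL] L2D[OF \<phi>] in auto)
      have "?I = (LINT x|Leb. r x * \<phi> x + (\<Sum>l\<in>L. p l * (\<xi> l x * \<phi> x)))"
        by (rule Bochner_Integration.integral_cong) (auto simp: r_def h_def sum_distrib_right sum_distrib_left algebra_simps)
      also have "\<dots> = (LINT x|Leb. r x * \<phi> x) + (LINT x|Leb. (\<Sum>l\<in>L. p l * (\<xi> l x * \<phi> x)))"
        by (rule Bochner_Integration.integral_add[OF ri li])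
      also have "(LINT x|Leb. (\<Sum>l\<in>L. p l * (\<xi> l x * \<phi> x))) = (\<Sum>l\<in>L. p l * (LINT x|Leb. \<xi> l x * \<phi> x))"
        using xi_times_integrable[OF \<phi>] by (subst Bochner_Integration.integral_sum) auto
      also have "\<dots> = 0" using orth L by (intro sum.neutral) auto
      finally have "?I = (LINT x|Leb. r x * \<phi> x)" by simp
      then have "(norm ?I)\<^sup>2 \<le> (LINT x|Leb. (norm (r x))\<^sup>2) * N"
        using lebesgue_cauchy_schwarz(2)[OF L2D[OF rL] L2D[OF \<phi>]] by (simp add: N_def)
      also have "\<dots> \<le> e / (N + 1) * N" using L(3) N0 by (intro mult_right_mono) (auto simp: r_def)
      also have "\<dots> \<le> e" using e N0 by (simp add: field_simps)
      finally show ?thesis .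
    qed
    then have "(norm ?I)\<^sup>2 \<le> 0" by (rule field_le_epsilon[of _ 0, simplified])
    then show ?thesis by simp
  qed
  have "AE x in Leb. h x = 0"
  proof (rule AE_zero_of_interval_integrals[OF h])
    fix c d assume cd: "0 < c" "c < d" "d < a"
    \<comment> \<open>The cutoffs tend boundedly to the indicator of \<open>(c, d)\<close>, so their
      vanishing integrals against \<open>h\<close> pass to the integral of \<open>h\<close> over the
      interval.\<close>
    have "(\<lambda>n. LINT x|Leb. of_real (cutoff c d n x) * h x) \<longlonglongrightarrow> (LINT x|Leb. (if c < x \<and> x < d then 1 else 0) * h x)"
    proof (rule integral_dominated_convergence[where w = "\<lambda>x. norm (h x)"])
      show "integrable Leb (\<lambda>x. norm (h x))" using h by simp
      show "(\<lambda>x. of_real (cutoff c d n x) * h x) \<in> borel_measurable Leb" for n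
        using borel_measurable_integrable[OF h] cutoff_measurable by measurable
      have "{x \<in> space Leb. c < x \<and> x < d} = {c<..<d}" using cd by (auto simp: space_restrict_space)
      moreover have "{c<..<d} \<in> sets Leb" using cd by (subst sets_restrict_space_iff) auto
      ultimately show "(\<lambda>x. (if c < x \<and> x < d then 1 else 0) * h x) \<in> borel_measurable Leb"
        using borel_measurable_integrable[OF h] by (intro borel_measurable_times measurable_If) auto
      show "AE x in Leb. (\<lambda>n. of_real (cutoff c d n x) * h x) \<longlonglongrightarrow> (if c < x \<and> x < d then 1 else 0) * h x"
      proof (intro AE_I2 tendsto_mult tendsto_const)
        fix x
        have "(\<lambda>n. complex_of_real (cutoff c d n x)) \<longlonglongrightarrow> of_real (if c < x \<and> x < d then 1 else 0)"
          by (intro tendsto_of_real cutoff_limit cd)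
        then show "(\<lambda>n. complex_of_real (cutoff c d n x)) \<longlonglongrightarrow> (if c < x \<and> x < d then 1 else 0)"
          by (simp only: if_distrib[of complex_of_real] of_real_1 of_real_0)
      qed
      show "AE x in Leb. norm (of_real (cutoff c d n x) * h x) \<le> norm (h x)" for n
        using cutoff_range[of c d n] by (intro AE_I2) (simp add: norm_mult mult_left_le_one_le)
    qed
    then have "(LINT x|Leb. (if c < x \<and> x < d then 1 else 0) * h x) = 0"
      using cz[of c d] cd by (simp add: LIMSEQ_const_iff)
    moreover have "(LINT x|Leb. (if c < x \<and> x < d then 1 else 0) * h x) = integral {0<..<a} (\<lambda>x. (if c < x \<and> x < d then 1 else 0) * h x)"
    proof (rule lebesgue_integral_eq_integral)
      have m: "{c<..<d} \<in> sets Leb" using cd by (subst sets_restrict_space_iff) auto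
      have "integrable Leb (\<lambda>x. indicator {c<..<d} x *\<^sub>R h x)" by (rule integrable_mult_indicator[OF m h])
      moreover have "(\<lambda>x. indicator {c<..<d} x *\<^sub>R h x) = (\<lambda>x. (if c < x \<and> x < d then 1 else 0) * h x)"
        by (auto simp: indicator_def)
      ultimately show "integrable Leb (\<lambda>x. (if c < x \<and> x < d then 1 else 0) * h x)" by simp
    qed simp
    moreover have "integral {0<..<a} (\<lambda>x. (if c < x \<and> x < d then 1 else 0) * h x) = integral {c<..<d} h"
    proof -
      have "integral {0<..<a} (\<lambda>x. (if c < x \<and> x < d then 1 else 0) * h x) = integral {0<..<a} (\<lambda>x. if x \<in> {c<..<d} then h x else 0)"
        by (rule Henstock_Kurzweil_Integration.integral_cong) auto
      also have "\<dots> = integral ({0<..<a} \<inter> {c<..<d}) h"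
        by (subst Int_commute) (rule integral_restrict_Int)
      also have "{0<..<a} \<inter> {c<..<d} = {c<..<d}" using cd by auto
      finally show ?thesis .
    qed
    ultimately show "integral {c..d} h = 0" by (simp add: integral_open_interval_real)
  qed
  moreover have "\<xi> z x \<noteq> 0" if "x \<in> {0<..<a}" for x
    using nonreal_quotient[of z x] that by (auto simp: z_def)
  then have "AE x in Leb. \<xi> z x \<noteq> 0" by (intro AE_I2) simp
  ultimately show ?thesis by eventually_elim (simp add: h_def)
qed

lemma transform_lin:
  assumes "\<phi> \<in> L2 a" "\<psi> \<in> L2 a"
  shows "transform \<xi> a (\<lambda>x. c * \<phi> x + d * \<psi> x) z = c * transform \<xi> a \<phi> z + d * transform \<xi> a \<psi> z"
proof -
  have "transform \<xi> a (\<lambda>x. c * \<phi> x + d * \<psi> x) z = (LINT x|Leb. c * (\<xi> z x * \<phi> x) + d * (\<xi> z x * \<psi> x))"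
    unfolding transform_def by (intro Bochner_Integration.integral_cong refl) (simp add: algebra_simps)
  also have "\<dots> = c * transform \<xi> a \<phi> z + d * transform \<xi> a \<psi> z"
    unfolding transform_def using xi_times_integrable[OF assms(1)] xi_times_integrable[OF assms(2)]
    by (subst Bochner_Integration.integral_add) auto
  finally show ?thesis .
qed

text \<open>Agreement at the points of \<open>Z\<close> already makes the difference orthogonal to
  all eigenfunctions.\<close>

lemma transform_inj:
  assumes \<phi>: "\<phi> \<in> L2 a" and \<psi>: "\<psi> \<in> L2 a" and eq: "transform \<xi> a \<phi> = transform \<xi> a \<psi>"
  shows "AE x in Leb. \<phi> x = \<psi> x"
proof -
  have d: "(\<lambda>x. 1 * \<phi> x + (-1) * \<psi> x) \<in> L2 a" by (rule L2_lin[OF \<phi> \<psi>])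
  have "AE x in Leb. 1 * \<phi> x + (-1) * \<psi> x = 0"
  proof (rule orthogonal_to_eigenfunctions[OF d])
    fix l
    show "(LINT x|Leb. \<xi> l x * (1 * \<phi> x + (-1) * \<psi> x)) = 0"
      using transform_lin[OF \<phi> \<psi>, of 1 "-1" l] eq by (simp add: transform_def)
  qed
  then show ?thesis by simp
qed

lemma L2_norm_cong_AE:
  assumes "\<phi> \<in> L2 a" "\<psi> \<in> L2 a" "AE x in Leb. \<phi> x = \<psi> x"
  shows "L2_norm_on a \<phi> = L2_norm_on a \<psi>"
proof -
  have "(LINT x|Leb. (norm (\<phi> x))\<^sup>2) = (LINT x|Leb. (norm (\<psi> x))\<^sup>2)"
    by (rule integral_cong_AE) (use L2D[OF assms(1)] L2D[OF assms(2)] assms(3) in \<open>auto elim: AE_mp\<close>)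
  then show ?thesis by (simp add: L2_norm_on_def)
qed

text \<open>The norm is read off a chosen preimage; by injectivity up to null sets the choice is
  immaterial.\<close>

lemma dB_norm_transform:
  assumes "\<phi> \<in> L2 a"
  shows "dB_norm \<xi> a (transform \<xi> a \<phi>) = L2_norm_on a \<phi>"
proof -
  define \<psi> where "\<psi> = (SOME \<psi>. \<psi> \<in> L2 a \<and> transform \<xi> a \<psi> = transform \<xi> a \<phi>)"
  have \<psi>: "\<psi> \<in> L2 a \<and> transform \<xi> a \<psi> = transform \<xi> a \<phi>"
    unfolding \<psi>_def by (rule someI[of _ \<phi>]) (use assms in simp)
  have "L2_norm_on a \<psi> = L2_norm_on a \<phi>"
    by (rule L2_norm_cong_AE[OF _ assms transform_inj[OF _ assms]]) (use \<psi> in auto)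
  then show ?thesis by (simp add: dB_norm_def \<psi>_def)
qed

end

subsection \<open>The spectrum\<close>

lemma Re_of_real_mult: "Re (complex_of_real r * w) = r * Re w"
  by simp

lemma integrable_interior_imp_absolutely_integrable:
  fixes h :: "real \<Rightarrow> 'b::euclidean_space"
  assumes "integrable (lebesgue_on {0<..<s}) h"
  shows "h absolutely_integrable_on {0..s}"
proof -
  have "h absolutely_integrable_on {0<..<s}"
    unfolding set_integrable_def using assms by (subst (asm) integrable_restrict_space) auto
  then show ?thesis using absolutely_integrable_on_open_interval[where f = h and a = 0 and b = s] by simp
qed

lemma AC_loc_derivI:
  fixes f g :: "real \<Rightarrow> 'b::euclidean_space"
  assumes "\<And>x y. 0 < x \<Longrightarrow> x \<le> y \<Longrightarrow> y \<le> s \<Longrightarrow> (g has_integral (f y - f x)) {x..y}"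
    and "\<And>x y. 0 < x \<Longrightarrow> x \<le> y \<Longrightarrow> y \<le> s \<Longrightarrow> g absolutely_integrable_on {x..y}"
  shows "AC_loc_deriv s f g"
  unfolding AC_loc_deriv_def
proof (intro allI impI)
  fix x y assume xy: "0 < x \<and> x \<le> y \<and> y \<le> s"
  then have "integrable (lebesgue_on {x..y}) g" by (intro absolutely_integrable_imp_integrable assms(2)) auto
  then show "integrable (lebesgue_on {x..y}) g \<and> f y - f x = (LINT t|lebesgue_on {x..y}. g t)"
    using assms(1)[of x y] xy lebesgue_integral_eq_integral[of "{x..y}" g] by (auto simp: integral_unique)
qed

lemma AC_loc_derivD:
  fixes f g :: "real \<Rightarrow> 'b::euclidean_space"
  assumes "AC_loc_deriv s f g" "0 < x" "x \<le> y" "y \<le> s"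
  shows "g absolutely_integrable_on {x..y}" "(g has_integral (f y - f x)) {x..y}"
proof -
  have i: "integrable (lebesgue_on {x..y}) g" and e: "f y - f x = (LINT t|lebesgue_on {x..y}. g t)"
    using assms by (auto simp: AC_loc_deriv_def)
  show "g absolutely_integrable_on {x..y}"
    unfolding set_integrable_def using i by (subst (asm) integrable_restrict_space) auto
  show "(g has_integral (f y - f x)) {x..y}"
    unfolding e by (rule has_integral_integral_lebesgue_on[OF i]) simp
qed

lemma AC_loc_deriv_continuous:
  fixes f g :: "real \<Rightarrow> 'b::euclidean_space"
  assumes "AC_loc_deriv s f g"
  shows "continuous_on {0<..s} f"
proof (rule continuous_on_half_open)
  fix c assume c: "0 < c" "c \<le> s"
  have "g integrable_on {c..s}" using AC_loc_derivD(2)[OF assms c(1,2) order_refl] by blast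
  then have "continuous_on {c..s} (\<lambda>x. f c + integral {c..x} g)"
    by (intro continuous_intros indefinite_integral_continuous_1)
  moreover have "f c + integral {c..x} g = f x" if "x \<in> {c..s}" for x
    using AC_loc_derivD(2)[OF assms c(1), of x] that by (auto simp: integral_unique)
  ultimately show "continuous_on {c..s} f" by (rule continuous_on_eq)
qed

lemma AC_loc_deriv_lin:
  fixes f1 f2 g1 g2 :: "real \<Rightarrow> complex"
  assumes "AC_loc_deriv s f1 g1" "AC_loc_deriv s f2 g2"
  shows "AC_loc_deriv s (\<lambda>x. c * f1 x + d * f2 x) (\<lambda>x. c * g1 x + d * g2 x)"
proof (rule AC_loc_derivI)
  fix x y assume xy: "0 < x" "x \<le> y" "y \<le> s"
  note D1 = AC_loc_derivD[OF assms(1) xy] and D2 = AC_loc_derivD[OF assms(2) xy]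
  have "((\<lambda>x. c * g1 x + d * g2 x) has_integral (c * (f1 y - f1 x) + d * (f2 y - f2 x))) {x..y}"
    by (intro has_integral_add has_integral_mult_right D1 D2)
  then show "((\<lambda>x. c * g1 x + d * g2 x) has_integral (c * f1 y + d * f2 y - (c * f1 x + d * f2 x))) {x..y}"
    by (simp add: algebra_simps)
  show "(\<lambda>x. c * g1 x + d * g2 x) absolutely_integrable_on {x..y}"
    by (intro set_integral_add set_integrable_mult_right D1 D2)
qed

section \<open>The operator graph, its inverse and uniqueness\<close>

context bessel_problem
begin

text \<open>Both terms in the bracket have order \<open>p\<close> and the prefactor has order
  \<open>k - 1\<close>. It is applied with \<open>p = k\<close> to \<open>\<xi>\<close> and with
  \<open>p = m\<close> to the resolvent.\<close>

lemma boundary_condition_at_zero: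
  assumes C: "\<And>x. x \<in> {0<..a} \<Longrightarrow> norm (u x) \<le> C * x powr p"
    "\<And>x. x \<in> {0<..a} \<Longrightarrow> norm (u' x) \<le> C * x powr (p - 1)" and p: "0 < p + k - 1"
  shows "((\<lambda>x. of_real (x powr (\<nu> - 1/2)) * (of_real (\<nu> + 1/2) * u x - of_real x * u' x)) \<longlongrightarrow> (0::complex)) (at_right 0)"
proof (rule Lim_null_comparison)
  show "\<forall>\<^sub>F x in at_right 0. norm (of_real (x powr (\<nu> - 1/2)) * (of_real (\<nu> + 1/2) * u x - of_real x * u' x))
      \<le> ((k + 1) * C) * x powr (p + k - 1)"
    unfolding eventually_at_right_field
  proof (intro exI[of _ a] conjI a allI impI)
    fix x assume x: "0 < x" "x < a"
    then have x': "x \<in> {0<..a}" by auto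
    have "norm (of_real (\<nu> + 1/2) * u x - of_real x * u' x) \<le> k * norm (u x) + x * norm (u' x)"
    proof -
      have "norm (complex_of_real (\<nu> + 1/2)) = k" using nu by (simp only: norm_of_real k_def)
      then show ?thesis
        using norm_triangle_ineq4[of "of_real (\<nu> + 1/2) * u x" "of_real x * u' x"] x by (simp only: norm_mult norm_of_real abs_of_pos)
    qed
    also have "\<dots> \<le> k * (C * x powr p) + x * (C * x powr (p - 1))"
      using C[OF x'] x k_gt by (intro add_mono mult_left_mono) auto
    also have "x * (C * x powr (p - 1)) = C * x powr p" using x by (simp add: powr_diff)
    also have "k * (C * x powr p) + C * x powr p = (k + 1) * C * x powr p" by (simp add: algebra_simps)
    finally have "norm (of_real (\<nu> + 1/2) * u x - of_real x * u' x) \<le> (k + 1) * C * x powr p" .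
    then have "x powr (k - 1) * norm (of_real (\<nu> + 1/2) * u x - of_real x * u' x) \<le> x powr (k - 1) * ((k + 1) * C * x powr p)"
      by (intro mult_left_mono) auto
    also have "\<dots> = (k + 1) * C * (x powr (k - 1) * x powr p)" by simp
    also have "x powr (k - 1) * x powr p = x powr (p + k - 1)" by (simp add: algebra_simps flip: powr_add)
    finally show "norm (of_real (x powr (\<nu> - 1/2)) * (of_real (\<nu> + 1/2) * u x - of_real x * u' x)) \<le> (k + 1) * C * x powr (p + k - 1)"
      by (simp add: norm_mult k_def)
  qed
  show "((\<lambda>x. ((k + 1) * C) * x powr (p + k - 1)) \<longlongrightarrow> 0) (at_right 0)"
    using tendsto_mult_left[OF powr_tendsto_0[OF p], of "(k + 1) * C"] by simp
qed

lemma sol_AC: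
  assumes "sol l u u'"
  shows "AC_loc_deriv a u u'" "AC_loc_deriv a u' (\<lambda>x. (of_real (P x) - l) * u x)"
proof -
  have sub: "{0<..a} \<subseteq> {0<..b}" using ab by auto
  have c: "continuous_on {0<..a} (\<lambda>x. (of_real (P x) - l) * u x)"
    by (intro continuous_intros sol_cont(1)[OF assms] continuous_on_subset[OF P_cont sub])
  show "AC_loc_deriv a u u'"
  proof (rule AC_loc_derivI)
    fix x y assume xy: "0 < x" "x \<le> y" "y \<le> a"
    have s: "{x..y} \<subseteq> {0<..a}" using xy by auto
    show "(u' has_integral (u y - u x)) {x..y}"
      using solD(1)[OF assms] s by (intro fundamental_theorem_of_calculus xy) (blast intro: has_vector_derivative_within_subset)
    show "u' absolutely_integrable_on {x..y}"
      by (intro absolutely_integrable_continuous_real continuous_on_subset[OF sol_cont(2)[OF assms] s])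
  qed
  show "AC_loc_deriv a u' (\<lambda>x. (of_real (P x) - l) * u x)"
  proof (rule AC_loc_derivI)
    fix x y assume xy: "0 < x" "x \<le> y" "y \<le> a"
    have s: "{x..y} \<subseteq> {0<..a}" using xy by auto
    show "((\<lambda>x. (of_real (P x) - l) * u x) has_integral (u' y - u' x)) {x..y}"
      using solD(2)[OF assms] s by (intro fundamental_theorem_of_calculus xy) (blast intro: has_vector_derivative_within_subset)
    show "(\<lambda>x. (of_real (P x) - l) * u x) absolutely_integrable_on {x..y}"
      by (intro absolutely_integrable_continuous_real continuous_on_subset[OF c s])
  qed
qed

lemma H_graphI:
  assumes "\<phi> \<in> L2 a" "\<psi> \<in> L2 a" "AC_loc_deriv a \<phi> \<phi>'" "AC_loc_deriv a \<phi>' \<phi>''"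
    and "AE x in Leb. \<psi> x = - \<phi>'' x + complex_of_real ((\<nu>\<^sup>2 - 1/4) / x\<^sup>2 + q x) * \<phi> x"
    and "\<phi> a * complex_of_real (cos \<gamma>) + \<phi>' a * of_real (sin \<gamma>) = 0"
    and "\<nu> < 1 \<Longrightarrow> ((\<lambda>x. of_real (x powr (\<nu> - 1/2)) * (of_real (\<nu> + 1/2) * \<phi> x - of_real x * \<phi>' x)) \<longlongrightarrow> (0::complex)) (at_right 0)"
  shows "H_graph \<nu> q a \<gamma> \<phi> \<psi>"
  unfolding H_graph_def using assms by blast

lemma H_graph_xi:
  assumes "l \<in> Z"
  shows "H_graph \<nu> q a \<gamma> (\<xi> l) (\<lambda>x. l * \<xi> l x)"
proof -
  obtain C where C: "0 < C" "\<And>x. x \<in> {0<..a} \<Longrightarrow> norm (\<xi> l x) \<le> C * x powr k"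
    "\<And>x. x \<in> {0<..a} \<Longrightarrow> norm (\<eta> l x) \<le> C * x powr (k - 1)" by (rule xi_bound[where z = l]) blast
  have L: "(\<lambda>x. l * \<xi> l x) \<in> L2 a" using L2_lin[OF xi_L2 xi_L2, of l l 0 l] by simp
  show ?thesis
  proof (rule H_graphI[OF xi_L2 L sol_AC[OF sol_xi] AE_I2 _ boundary_condition_at_zero[OF C(2,3)]])
    show "l * \<xi> l x = - ((of_real (P x) - l) * \<xi> l x) + of_real ((\<nu>\<^sup>2 - 1/4) / x\<^sup>2 + q x) * \<xi> l x" for x
      by (simp add: P_def algebra_simps)
    show "\<xi> l a * of_real (cos \<gamma>) + \<eta> l a * of_real (sin \<gamma>) = 0" using assms by (simp add: Z_def \<Delta>_def)
  qed (use k_gt in auto)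
qed

lemma H_graph_lin:
  assumes 1: "H_graph \<nu> q a \<gamma> \<phi>1 \<eta>1" and 2: "H_graph \<nu> q a \<gamma> \<phi>2 \<eta>2"
  shows "H_graph \<nu> q a \<gamma> (\<lambda>x. c * \<phi>1 x + d * \<phi>2 x) (\<lambda>x. c * \<eta>1 x + d * \<eta>2 x)"
proof -
  let ?lim = "\<lambda>\<phi> \<phi>'. ((\<lambda>x. of_real (x powr (\<nu> - 1/2)) * (of_real (\<nu> + 1/2) * \<phi> x - of_real x * \<phi>' x)) \<longlongrightarrow> (0::complex)) (at_right 0)"
  let ?eq = "\<lambda>\<phi> \<eta> \<phi>''. AE x in Leb. \<eta> x = - \<phi>'' x + complex_of_real ((\<nu>\<^sup>2 - 1/4) / x\<^sup>2 + q x) * \<phi> x"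
  let ?bc = "\<lambda>\<phi> \<phi>'. \<phi> a * complex_of_real (cos \<gamma>) + \<phi>' a * of_real (sin \<gamma>) = 0"
  obtain \<phi>1' \<phi>1'' where A: "\<phi>1 \<in> L2 a" "\<eta>1 \<in> L2 a" "AC_loc_deriv a \<phi>1 \<phi>1'" "AC_loc_deriv a \<phi>1' \<phi>1''"
    "?eq \<phi>1 \<eta>1 \<phi>1''" "?bc \<phi>1 \<phi>1'" "\<nu> < 1 \<Longrightarrow> ?lim \<phi>1 \<phi>1'"
    using 1 unfolding H_graph_def by blast
  obtain \<phi>2' \<phi>2'' where B: "\<phi>2 \<in> L2 a" "\<eta>2 \<in> L2 a" "AC_loc_deriv a \<phi>2 \<phi>2'" "AC_loc_deriv a \<phi>2' \<phi>2''"
    "?eq \<phi>2 \<eta>2 \<phi>2''" "?bc \<phi>2 \<phi>2'" "\<nu> < 1 \<Longrightarrow> ?lim \<phi>2 \<phi>2'"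
    using 2 unfolding H_graph_def by blast
  show ?thesis
  proof (rule H_graphI[OF L2_lin[OF A(1) B(1)] L2_lin[OF A(2) B(2)] AC_loc_deriv_lin[OF A(3) B(3)] AC_loc_deriv_lin[OF A(4) B(4)]])
    show "?eq (\<lambda>x. c * \<phi>1 x + d * \<phi>2 x) (\<lambda>x. c * \<eta>1 x + d * \<eta>2 x) (\<lambda>x. c * \<phi>1'' x + d * \<phi>2'' x)"
    proof -
      have lin: "c * e1 + d * e2 = - (c * p1 + d * p2) + Q * (c * f1 + d * f2)"
        if "e1 = - p1 + Q * f1" "e2 = - p2 + Q * f2" for e1 e2 p1 p2 f1 f2 Q :: complex
        unfolding that by (simp add: algebra_simps)
      show ?thesis using A(5) B(5) by eventually_elim (rule lin)
    qed
    have "?bc (\<lambda>x. c * \<phi>1 x + d * \<phi>2 x) (\<lambda>x. c * \<phi>1' x + d * \<phi>2' x) \<longleftrightarrow>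
        c * (\<phi>1 a * complex_of_real (cos \<gamma>) + \<phi>1' a * of_real (sin \<gamma>)) + d * (\<phi>2 a * complex_of_real (cos \<gamma>) + \<phi>2' a * of_real (sin \<gamma>)) = 0"
      by (simp add: algebra_simps)
    then show "?bc (\<lambda>x. c * \<phi>1 x + d * \<phi>2 x) (\<lambda>x. c * \<phi>1' x + d * \<phi>2' x)" using A(6) B(6) by simp
    assume "\<nu> < 1"
    from tendsto_add[OF tendsto_mult_left[OF A(7)[OF this], of c] tendsto_mult_left[OF B(7)[OF this], of d]]
    show "?lim (\<lambda>x. c * \<phi>1 x + d * \<phi>2 x) (\<lambda>x. c * \<phi>1' x + d * \<phi>2' x)" by (simp add: algebra_simps)
  qed
qed

lemma H_graph_L2: "H_graph \<nu> q a \<gamma> \<phi> \<psi> \<Longrightarrow> \<phi> \<in> L2 a" "H_graph \<nu> q a \<gamma> \<phi> \<psi> \<Longrightarrow> \<psi> \<in> L2 a"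
  by (auto simp: H_graph_def)

text \<open>The weak solutions supply a preimage of every square integrable right-hand side under
  the operator minus \<open>l\<close>, and their pointwise bound makes this inverse bounded.\<close>

lemma H_graph_resolvent:
  assumes l: "\<Delta> l \<noteq> 0"
  obtains C where "\<And>\<rho>. \<rho> \<in> L2 a \<Longrightarrow> \<exists>u. H_graph \<nu> q a \<gamma> u (\<lambda>x. \<rho> x + l * u x) \<and> L2_norm_on a u \<le> C * L2_norm_on a \<rho>"
proof -
  obtain B where B: "0 < B" "\<And>\<rho>. \<rho> absolutely_integrable_on {0..a} \<Longrightarrow> \<exists>u u'. weak_sol l \<rho> u u' B"
    by (rule resolvent_exists[OF l]) blast
  \<comment> \<open>\<open>a powr m\<close> bounds the weight; one factor \<open>sqrt a\<close>
    stems from the \<open>L1\<close> norm of \<open>\<rho>\<close>, the other from integrating a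
    constant over \<open>(0, a)\<close>.\<close>
  define C where "C = B * a powr m * a"
  show ?thesis
  proof (rule that[of C])
    fix \<rho> assume \<rho>: "\<rho> \<in> L2 a"
    have \<rho>a: "\<rho> absolutely_integrable_on {0..a}"
      by (rule integrable_interior_imp_absolutely_integrable[OF L2_integrable[OF \<rho>]])
    define J where "J = integral {0..a} (\<lambda>s. norm (\<rho> s))"
    have J0: "0 \<le> J" unfolding J_def using \<rho>a by (intro Henstock_Kurzweil_Integration.integral_nonneg) (auto simp: absolutely_integrable_on_def)
    obtain u u' where w: "weak_sol l \<rho> u u' B" using B(2)[OF \<rho>a] by blast
    then have u: "continuous_on {0<..a} u" "continuous_on {0<..a} u'"
      "\<And>x y. 0 < x \<Longrightarrow> x \<le> y \<Longrightarrow> y \<le> a \<Longrightarrow> (u' has_integral (u y - u x)) {x..y}"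
      "\<And>x y. 0 < x \<Longrightarrow> x \<le> y \<Longrightarrow> y \<le> a \<Longrightarrow> ((\<lambda>t. (of_real (P t) - l) * u t - \<rho> t) has_integral (u' y - u' x)) {x..y}"
      "\<And>x. x \<in> {0<..a} \<Longrightarrow> norm (u x) \<le> B * x powr m * J"
      "\<And>x. x \<in> {0<..a} \<Longrightarrow> norm (u' x) \<le> B * x powr (m - 1) * J"
      "u a * of_real (cos \<gamma>) + u' a * of_real (sin \<gamma>) = 0"
      unfolding weak_sol_def J_def by blast+
    have bu: "norm (u x) \<le> (B * J) * x powr m" "norm (u' x) \<le> (B * J) * x powr (m - 1)" if "x \<in> {0<..a}" for x
      using u(5,6)[OF that] by (simp_all add: mult_ac)
    define u0 where "u0 x = (if x = 0 then 0 else u x)" for x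
    have u0c: "continuous_on {0..a} u0"
      unfolding u0_def[abs_def] by (rule extend_by_zero_continuous[OF u(1) _ bu(1)]) (use m_gt in auto)
    have uL: "u \<in> L2 a" by (rule L2_cong[OF L2_continuous[OF u0c]]) (auto simp: u0_def)
    have \<psi>L: "(\<lambda>x. \<rho> x + l * u x) \<in> L2 a" using L2_lin[OF \<rho> uL, of 1 l] by simp
    have g: "H_graph \<nu> q a \<gamma> u (\<lambda>x. \<rho> x + l * u x)"
    proof (rule H_graphI[OF uL \<psi>L AC_loc_derivI AC_loc_derivI AE_I2 u(7) boundary_condition_at_zero[OF bu mk]])
      fix x y assume xy: "0 < x" "x \<le> y" "y \<le> a"
      have s: "{x..y} \<subseteq> {0<..a}" "{x..y} \<subseteq> {0<..b}" "{x..y} \<subseteq> {0..a}" using xy ab by auto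
      show "(u' has_integral (u y - u x)) {x..y}" by (rule u(3)[OF xy])
      show "((\<lambda>t. (of_real (P t) - l) * u t - \<rho> t) has_integral (u' y - u' x)) {x..y}" by (rule u(4)[OF xy])
      show "u' absolutely_integrable_on {x..y}"
        by (intro absolutely_integrable_continuous_real continuous_on_subset[OF u(2) s(1)])
      show "(\<lambda>t. (of_real (P t) - l) * u t - \<rho> t) absolutely_integrable_on {x..y}"
      proof (rule set_integral_diff(1))
        show "(\<lambda>t. (of_real (P t) - l) * u t) absolutely_integrable_on {x..y}"
          by (intro absolutely_integrable_continuous_real continuous_intros continuous_on_subset[OF u(1) s(1)] continuous_on_subset[OF P_cont s(2)])
        show "\<rho> absolutely_integrable_on {x..y}" by (rule set_integrable_subset[OF \<rho>a _ s(3)]) auto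
      qed
    next
      show "\<rho> x + l * u x = - ((of_real (P x) - l) * u x - \<rho> x) + of_real ((\<nu>\<^sup>2 - 1/4) / x\<^sup>2 + q x) * u x" for x
        by (simp add: P_def algebra_simps)
    qed auto
    have "L2_norm_on a u \<le> C * L2_norm_on a \<rho>"
    proof -
      have n\<rho>: "integrable Leb (\<lambda>x. norm (\<rho> x))" using L2_integrable[OF \<rho>] by simp
      have JL: "J = (LINT x|Leb. norm (\<rho> x))"
        unfolding J_def using lebesgue_integral_eq_integral[OF n\<rho>] by (simp add: integral_open_interval_real)
      have "(norm (LINT x|Leb. 1 * complex_of_real (norm (\<rho> x))))\<^sup>2 \<le>
          (LINT x|Leb. (norm (1::complex))\<^sup>2) * (LINT x|Leb. (norm (complex_of_real (norm (\<rho> x))))\<^sup>2)"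
        by (rule lebesgue_cauchy_schwarz(2)) (use L2D[OF \<rho>] L2D[OF L2_continuous[of a "\<lambda>_. 1"]] in auto)
      also have "(LINT x|Leb. (norm (1::complex))\<^sup>2) = a"
        using continuous_lebesgue_interior(2)[of a "\<lambda>_. 1::real"] a by simp
      also have "(LINT x|Leb. 1 * complex_of_real (norm (\<rho> x))) = of_real J"
        unfolding JL by simp
      finally have "J\<^sup>2 \<le> a * (LINT x|Leb. (norm (\<rho> x))\<^sup>2)" by simp
      then have "sqrt (J\<^sup>2) \<le> sqrt (a * (LINT x|Leb. (norm (\<rho> x))\<^sup>2))" by (rule real_sqrt_le_mono)
      then have J: "J \<le> sqrt a * L2_norm_on a \<rho>" using J0 by (simp add: real_sqrt_mult L2_norm_on_def)
      have ux: "norm (u x) \<le> B * a powr m * J" if "x \<in> {0<..<a}" for x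
      proof -
        have "x powr m \<le> a powr m" using that m_gt by (intro powr_mono2) auto
        then have "(B * J) * x powr m \<le> (B * J) * a powr m" using B(1) J0 by (intro mult_left_mono) auto
        then show ?thesis using bu(1)[of x] that by (simp add: mult_ac)
      qed
      have "(LINT x|Leb. (norm (u x))\<^sup>2) \<le> (LINT x|Leb. (B * a powr m * J)\<^sup>2)"
        using ux by (intro integral_mono L2D(2)[OF uL] continuous_lebesgue_interior(1) continuous_on_const power_mono) auto
      also have "\<dots> = (B * a powr m * J)\<^sup>2 * a"
        using continuous_lebesgue_interior(2)[of a "\<lambda>_. (B * a powr m * J)\<^sup>2"] a by simp
      finally have "sqrt (LINT x|Leb. (norm (u x))\<^sup>2) \<le> sqrt ((B * a powr m * J)\<^sup>2 * a)" by (rule real_sqrt_le_mono)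
      also have "\<dots> = B * a powr m * J * sqrt a" using B(1) J0 by (simp add: real_sqrt_mult)
      also have "\<dots> \<le> B * a powr m * (sqrt a * L2_norm_on a \<rho>) * sqrt a"
        using J B(1) a by (intro mult_right_mono mult_left_mono) auto
      also have "\<dots> = B * a powr m * L2_norm_on a \<rho> * (sqrt a * sqrt a)" by simp
      also have "\<dots> = C * L2_norm_on a \<rho>" using a by (simp add: C_def)
      finally show ?thesis by (simp add: L2_norm_on_def)
    qed
    then show "\<exists>u. H_graph \<nu> q a \<gamma> u (\<lambda>x. \<rho> x + l * u x) \<and> L2_norm_on a u \<le> C * L2_norm_on a \<rho>" using g by blast
  qed
qed

text \<open>The Wronskian is the expression of the condition at \<open>0\<close> times
  \<open>\<xi> / x powr (\<nu> + 1/2)\<close>, plus \<open>x powr (\<nu> - 1/2) * u\<close> times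
  \<open>\<eta> / x powr (\<nu> - 1/2) - (\<nu> + 1/2) * \<xi> / x powr (\<nu> + 1/2)\<close>. The
  last factor tends to \<open>0\<close> by the leading orders of \<open>\<xi>\<close> and
  \<open>\<eta>\<close>, and its cofactor is bounded by \<open>sol_bound\<close>.\<close>

lemma wronskian_limit_circle:
  assumes s: "sol l u u'"
    and lim: "((\<lambda>x. of_real (x powr (\<nu> - 1/2)) * (of_real (\<nu> + 1/2) * u x - of_real x * u' x)) \<longlongrightarrow> (0::complex)) (at_right 0)"
  shows "u a * \<eta> l a - u' a * \<xi> l a = 0"
proof -
  obtain C where C: "0 < C" "\<And>x. x \<in> {0<..a} \<Longrightarrow> norm (u x) \<le> C * x powr (1 - k)"
    "\<And>x. x \<in> {0<..a} \<Longrightarrow> norm (u' x) \<le> C * x powr (- k)" by (rule sol_bound[OF s]) blast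
  let ?A = "\<lambda>x. of_real (x powr (\<nu> - 1/2)) * (of_real (\<nu> + 1/2) * u x - of_real x * u' x)"
  let ?r = "\<lambda>x. \<xi> l x / of_real (x powr (\<nu> + 1/2))"
  let ?s = "\<lambda>x. \<eta> l x / of_real (x powr (\<nu> - 1/2))"
  let ?W = "\<lambda>x. u x * \<eta> l x - u' x * \<xi> l x"
  have 1: "((\<lambda>x. ?A x * ?r x) \<longlongrightarrow> 0 * of_real c0) (at_right 0)" by (intro tendsto_mult lim xi_lim)
  have "((\<lambda>x. ?s x - of_real (\<nu> + 1/2) * ?r x) \<longlongrightarrow> of_real ((\<nu> + 1/2) * c0) - of_real (\<nu> + 1/2) * of_real c0) (at_right 0)"
    by (intro tendsto_diff tendsto_mult tendsto_const xi_lim eta_lim)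
  then have d: "((\<lambda>x. ?s x - of_real (\<nu> + 1/2) * ?r x) \<longlongrightarrow> 0) (at_right 0)" by simp
  have 2: "((\<lambda>x. of_real (x powr (\<nu> - 1/2)) * u x * (?s x - of_real (\<nu> + 1/2) * ?r x)) \<longlongrightarrow> 0) (at_right 0)"
  proof (rule Lim_null_comparison)
    show "\<forall>\<^sub>F x in at_right 0. norm (of_real (x powr (\<nu> - 1/2)) * u x * (?s x - of_real (\<nu> + 1/2) * ?r x)) \<le> C * norm (?s x - of_real (\<nu> + 1/2) * ?r x)"
      unfolding eventually_at_right_field
    proof (intro exI[of _ a] conjI a allI impI)
      fix x assume x: "0 < x" "x < a"
      have "norm (of_real (x powr (\<nu> - 1/2)) * u x) \<le> x powr (k - 1) * (C * x powr (1 - k))"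
        unfolding norm_mult using C(2)[of x] x by (intro mult_mono) (auto simp: k_def)
      also have "\<dots> = C" using x by (simp add: mult.left_commute flip: powr_add)
      finally show "norm (of_real (x powr (\<nu> - 1/2)) * u x * (?s x - of_real (\<nu> + 1/2) * ?r x)) \<le> C * norm (?s x - of_real (\<nu> + 1/2) * ?r x)"
        unfolding norm_mult[of "of_real (x powr (\<nu> - 1/2)) * u x"] by (rule mult_right_mono) simp
    qed
    show "((\<lambda>x. C * norm (?s x - of_real (\<nu> + 1/2) * ?r x)) \<longlongrightarrow> 0) (at_right 0)"
      using tendsto_mult_left[OF tendsto_norm[OF d], of C] by simp
  qed
  have "((\<lambda>x. ?A x * ?r x + of_real (x powr (\<nu> - 1/2)) * u x * (?s x - of_real (\<nu> + 1/2) * ?r x)) \<longlongrightarrow> 0) (at_right 0)"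
    using tendsto_add[OF 1 2] by simp
  moreover have "\<forall>\<^sub>F x in at_right 0. ?A x * ?r x + of_real (x powr (\<nu> - 1/2)) * u x * (?s x - of_real (\<nu> + 1/2) * ?r x) = ?W a"
    unfolding eventually_at_right_field
  proof (intro exI[of _ a] conjI a allI impI)
    fix x assume x: "0 < x" "x < a"
    define y where "y = complex_of_real (x powr (\<nu> - 1/2))"
    have y: "y \<noteq> 0" using x by (simp add: y_def)
    have "\<nu> + 1/2 = (\<nu> - 1/2) + 1" by simp
    then have "x powr (\<nu> + 1/2) = x powr (\<nu> - 1/2) * x powr 1" by (simp only: powr_add)
    then have "x powr (\<nu> + 1/2) = x powr (\<nu> - 1/2) * x" using x by simp
    then have yx: "complex_of_real (x powr (\<nu> + 1/2)) = y * of_real x" by (simp add: y_def)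
    have "?A x * ?r x + of_real (x powr (\<nu> - 1/2)) * u x * (?s x - of_real (\<nu> + 1/2) * ?r x) = ?W x"
      unfolding yx y_def[symmetric] using y x by (simp add: field_simps)
    also have "?W x = ?W a" using x a by (intro wronskian_const[OF s sol_xi]) auto
    finally show "?A x * ?r x + of_real (x powr (\<nu> - 1/2)) * u x * (?s x - of_real (\<nu> + 1/2) * ?r x) = ?W a" .
  qed
  ultimately have "((\<lambda>x. ?W a) \<longlongrightarrow> 0) (at_right (0::real))" by (rule Lim_transform_eventually)
  then show ?thesis using tendsto_unique[OF trivial_limit_at_right_real tendsto_const] by metis
qed

text \<open>For \<open>\<nu> \<ge> 1\<close> a solution that is not a multiple of \<open>\<xi>\<close> is bounded below by a multiple of
  \<open>x\<^sup>1\<^sup>/\<^sup>2\<^sup>-\<^sup>\<nu>\<close> near \<open>0\<close>, hence not square integrable.\<close>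

lemma wronskian_limit_point:
  assumes s: "sol l u u'" and nu1: "1 \<le> \<nu>" and L: "u \<in> L2 a"
  shows "u a * \<eta> l a - u' a * \<xi> l a = 0"
proof (rule ccontr)
  define w where "w = u a * \<eta> l a - u' a * \<xi> l a"
  assume "u a * \<eta> l a - u' a * \<xi> l a \<noteq> 0"
  then have w0: "w \<noteq> 0" by (simp add: w_def)
  have W: "u x * \<eta> l x - u' x * \<xi> l x = w" if "x \<in> {0<..a}" for x
    unfolding w_def using a by (intro wronskian_const[OF s sol_xi that]) auto
  let ?r = "\<lambda>x. \<xi> l x / of_real (x powr k)"
  have "((\<lambda>x. 1 / (?r x)\<^sup>2) \<longlongrightarrow> 1 / (of_real c0)\<^sup>2) (at_right 0)"
    using xi_lim[of l] c0 unfolding k_def by (intro tendsto_intros) auto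
  then have "((\<lambda>x. Re (1 / (?r x)\<^sup>2)) \<longlongrightarrow> Re (1 / (of_real c0)\<^sup>2)) (at_right 0)" by (rule tendsto_Re)
  also have "Re (1 / (of_real c0)\<^sup>2) = 1 / c0\<^sup>2"
  proof -
    have "1 / (complex_of_real c0)\<^sup>2 = of_real (1 / c0\<^sup>2)" by simp
    then show ?thesis by (simp only: Re_complex_of_real)
  qed
  finally have "\<forall>\<^sub>F x in at_right 0. 1 / (2 * c0\<^sup>2) < Re (1 / (?r x)\<^sup>2)"
    by (rule order_tendstoD(1)) (use c0 in \<open>simp add: field_simps\<close>)
  then obtain e1 where e1: "0 < e1" "\<And>x. 0 < x \<Longrightarrow> x < e1 \<Longrightarrow> 1 / (2 * c0\<^sup>2) < Re (1 / (?r x)\<^sup>2)"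
    unfolding eventually_at_right_field by auto
  obtain e2 where e2: "0 < e2" "e2 \<le> a" "\<And>x. x \<in> {0<..e2} \<Longrightarrow> c0 / 2 * x powr k \<le> norm (\<xi> l x)"
    by (rule xi_lower[where z = l]) blast
  define d where "d = min (min (e1 / 2) e2) (min 1 (a / 2))"
  have d: "0 < d" "d < e1" "d \<le> e2" "d \<le> 1" "d < a" using e1 e2 a by (auto simp: d_def)
  have nz: "\<xi> l x \<noteq> 0" if "x \<in> {0<..d}" for x
  proof
    assume "\<xi> l x = 0"
    then have "c0 / 2 * x powr k \<le> 0" using e2(3)[of x] that d by simp
    moreover have "0 < c0 / 2 * x powr k" using c0 that by simp
    ultimately show False by linarith
  qed
  \<comment> \<open>For \<open>F\<close> as below, \<open>- F'\<close> is at least half of its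
    leading term, \<open>(norm w)\<^sup>2 / (2 * c0\<^sup>2) * x powr (- 2 * k)\<close>; integrating
    this lower bound gives \<open>A * x powr (- 2 * \<nu>)\<close>.\<close>
  define A where "A = (norm w)\<^sup>2 / (2 * c0\<^sup>2) / (2 * \<nu>)"
  have A: "0 < A" unfolding A_def using w0 c0 nu by simp
  \<comment> \<open>Multiplication by \<open>cnj w\<close> makes the leading part of the derivative
    \<open>- w / \<xi>\<^sup>2\<close> of \<open>u / \<xi>\<close> real and negative, so a real
    function carries the lower bound.\<close>
  define F where "F x = Re (cnj w * (u x / \<xi> l x))" for x
  have F: "F x - F d \<ge> A * x powr (- 2 * \<nu>) - A * d powr (- 2 * \<nu>)" if x: "0 < x" "x \<le> d" for x
  proof -
    have "- F x + A * x powr (- 2 * \<nu>) \<le> - F d + A * d powr (- 2 * \<nu>)"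
    proof (rule DERIV_nonneg_imp_increasing_open[OF x(2)])
      have sub: "{x..d} \<subseteq> {0<..a}" using x d by auto
      show "continuous_on {x..d} (\<lambda>x. - F x + A * x powr (- 2 * \<nu>))"
        unfolding F_def using x nz
        by (intro continuous_intros continuous_on_subset[OF sol_cont(1)[OF s] sub] continuous_on_subset[OF xi_cont sub]) auto
      fix t assume t: "x < t" "t < d"
      then have t': "t \<in> {0<..a}" "0 < t" "t < a" "t \<in> {0<..d}" using x d by auto
      note D = solD[OF s t'(1), unfolded at_within_interior_a[OF t'(2,3)]]
        solD[OF sol_xi t'(1), unfolded at_within_interior_a[OF t'(2,3)]]
      have lin: "bounded_linear (\<lambda>v. Re (cnj w * v))"
        by (intro bounded_linear_compose[OF bounded_linear_Re] bounded_linear_mult_right)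
      have "(F has_vector_derivative Re (cnj w * ((u' t * \<xi> l t - u t * \<eta> l t) / (\<xi> l t * \<xi> l t)))) (at t)"
        unfolding F_def[abs_def]
        by (rule bounded_linear.has_vector_derivative[OF lin has_vector_derivative_quotient[OF D(1) D(3) nz[OF t'(4)]]])
      moreover have "Re (cnj w * ((u' t * \<xi> l t - u t * \<eta> l t) / (\<xi> l t * \<xi> l t))) = - ((norm w)\<^sup>2 * t powr (- 2 * k) * Re (1 / (?r t)\<^sup>2))"
      proof -
        have "u' t * \<xi> l t - u t * \<eta> l t = - w" using W[OF t'(1)] by (simp add: algebra_simps)
        moreover have "(?r t)\<^sup>2 = \<xi> l t * \<xi> l t / of_real (t powr (2 * k))"
          by (simp add: power2_eq_square flip: of_real_mult powr_add)
        then have "1 / (\<xi> l t * \<xi> l t) = of_real (t powr (- 2 * k)) * (1 / (?r t)\<^sup>2)"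
          using t' nz[OF t'(4)] by (simp add: powr_minus field_simps)
        ultimately have "cnj w * ((u' t * \<xi> l t - u t * \<eta> l t) / (\<xi> l t * \<xi> l t)) =
            - (w * cnj w) * (of_real (t powr (- 2 * k)) * (1 / (?r t)\<^sup>2))"
          by (metis (no_types, lifting) divide_inverse mult.assoc mult.commute mult_1 mult_minus_left mult_minus_right)
        also have "\<dots> = of_real (- ((norm w)\<^sup>2 * t powr (- 2 * k))) * (1 / (?r t)\<^sup>2)"
          by (simp only: complex_norm_square of_real_minus of_real_mult mult_minus_left mult.assoc)
        finally have "Re (cnj w * ((u' t * \<xi> l t - u t * \<eta> l t) / (\<xi> l t * \<xi> l t))) = Re (of_real (- ((norm w)\<^sup>2 * t powr (- 2 * k))) * (1 / (?r t)\<^sup>2))"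
          by (rule arg_cong)
        also have "\<dots> = - ((norm w)\<^sup>2 * t powr (- 2 * k)) * Re (1 / (?r t)\<^sup>2)"
          by (rule Re_of_real_mult)
        finally show ?thesis by simp
      qed
      ultimately have F': "(F has_real_derivative - ((norm w)\<^sup>2 * t powr (- 2 * k) * Re (1 / (?r t)\<^sup>2))) (at t)"
        by (simp add: has_real_derivative_iff_has_vector_derivative)
      have p: "((\<lambda>x. A * x powr (- 2 * \<nu>)) has_real_derivative A * (- 2 * \<nu> * t powr (- 2 * \<nu> - 1))) (at t)"
        using t'(2) by (intro DERIV_cmult has_real_derivative_powr) auto
      have "((\<lambda>x. - F x + A * x powr (- 2 * \<nu>)) has_real_derivative
          (- (- ((norm w)\<^sup>2 * t powr (- 2 * k) * Re (1 / (?r t)\<^sup>2))) + A * (- 2 * \<nu> * t powr (- 2 * \<nu> - 1)))) (at t)"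
        by (intro DERIV_add DERIV_minus F' p)
      moreover have "- (- ((norm w)\<^sup>2 * t powr (- 2 * k) * Re (1 / (?r t)\<^sup>2))) + A * (- 2 * \<nu> * t powr (- 2 * \<nu> - 1)) \<ge> 0"
      proof -
        have e: "- 2 * \<nu> - 1 = - 2 * k" by (simp add: k_def)
        have "A * (2 * \<nu> * t powr (- 2 * k)) = (norm w)\<^sup>2 * t powr (- 2 * k) * (1 / (2 * c0\<^sup>2))"
          using nu by (simp add: A_def)
        also have "\<dots> \<le> (norm w)\<^sup>2 * t powr (- 2 * k) * Re (1 / (?r t)\<^sup>2)"
          using e1(2)[of t] t d x by (intro mult_left_mono) auto
        finally show ?thesis unfolding e by simp
      qed
      ultimately show "\<exists>y. ((\<lambda>x. - F x + A * x powr (- 2 * \<nu>)) has_real_derivative y) (at t) \<and> 0 \<le> y" by blast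
    qed
    then show ?thesis by linarith
  qed
  define D where "D = A * d powr (- 2 * \<nu>) + \<bar>F d\<bar>"
  have "((\<lambda>x::real. D * x powr (2 * \<nu>)) \<longlongrightarrow> D * 0) (at_right 0)"
    by (intro tendsto_mult tendsto_const powr_tendsto_0) (use nu in simp)
  then have "\<forall>\<^sub>F x in at_right 0. D * x powr (2 * \<nu>) < A / 2"
    by (rule order_tendstoD(2)) (use A in simp)
  then obtain e3 where e3: "0 < e3" "\<And>x. 0 < x \<Longrightarrow> x < e3 \<Longrightarrow> D * x powr (2 * \<nu>) < A / 2"
    unfolding eventually_at_right_field by auto
  define g where "g = min d (e3 / 2)"
  have g: "0 < g" "g \<le> d" "g < e3" using d e3 by (auto simp: g_def)
  define c where "c = A / 2 * (c0 / 2) / norm w"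
  have c: "0 < c" unfolding c_def using A c0 w0 by simp
  have low: "c\<^sup>2 * (1 / x) \<le> (norm (u x))\<^sup>2" if x: "0 < x" "x \<le> g" for x
  proof -
    have xd: "x \<in> {0<..d}" using x g by auto
    have "D * x powr (2 * \<nu>) * x powr (- 2 * \<nu>) \<le> A / 2 * x powr (- 2 * \<nu>)"
      using e3(2)[of x] x g by (intro mult_right_mono) auto
    then have "D \<le> A / 2 * x powr (- 2 * \<nu>)" using x by (simp add: mult.assoc flip: powr_add)
    then have "A / 2 * x powr (- 2 * \<nu>) \<le> F x"
      using F[of x] x g unfolding D_def by auto
    also have "F x \<le> norm w * norm (u x / \<xi> l x)"
      unfolding F_def using complex_Re_le_cmod[of "cnj w * (u x / \<xi> l x)"] by (simp only: norm_mult complex_mod_cnj)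
    finally have "A / 2 * x powr (- 2 * \<nu>) * norm (\<xi> l x) \<le> norm w * norm (u x)"
      using nz[OF xd] by (simp add: norm_divide field_simps)
    moreover have "A / 2 * x powr (- 2 * \<nu>) * (c0 / 2 * x powr k) \<le> A / 2 * x powr (- 2 * \<nu>) * norm (\<xi> l x)"
      using e2(3)[of x] xd d A by (intro mult_left_mono) auto
    ultimately have "A / 2 * x powr (- 2 * \<nu>) * (c0 / 2 * x powr k) \<le> norm w * norm (u x)" by linarith
    then have "A / 2 * (c0 / 2) * (x powr (- 2 * \<nu>) * x powr k) \<le> norm w * norm (u x)" by (simp add: mult_ac)
    also have "x powr (- 2 * \<nu>) * x powr k = x powr (1 - k)" unfolding powr_add[symmetric] by (simp add: k_def)
    finally have "c * x powr (1 - k) \<le> norm (u x)" unfolding c_def using w0 by (simp add: field_simps)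
    then have "(c * x powr (1 - k))\<^sup>2 \<le> (norm (u x))\<^sup>2" using c by (intro power_mono) auto
    \<comment> \<open>Here \<open>\<nu> >= 1\<close> enters: the exponent
      \<open>1 - 2 * \<nu>\<close> is at most \<open>-1\<close>, and \<open>x <= 1\<close>.\<close>
    moreover have "1 / x \<le> (x powr (1 - k))\<^sup>2"
    proof -
      have "(x powr (1 - k))\<^sup>2 = x powr (1 - 2 * \<nu>)" by (simp add: power2_eq_square k_def flip: powr_add)
      moreover have "x powr (- 1) \<le> x powr (1 - 2 * \<nu>)"
        using x g d nu1 by (intro powr_mono') auto
      ultimately show ?thesis using x by (simp add: powr_minus_divide)
    qed
    then have "c\<^sup>2 * (1 / x) \<le> c\<^sup>2 * (x powr (1 - k))\<^sup>2" by (intro mult_left_mono) auto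
    ultimately show ?thesis by (simp add: power_mult_distrib)
  qed
  define I where "I = integral {0..a} (\<lambda>x. (norm (u x))\<^sup>2)"
  have ui: "(\<lambda>x. (norm (u x))\<^sup>2) integrable_on {0..a}"
    using integrable_interior_imp_absolutely_integrable[OF L2D(2)[OF L]] by (simp add: absolutely_integrable_on_def)
  have lnb: "c\<^sup>2 * (ln g - ln e) \<le> I" if e: "0 < e" "e \<le> g" for e
  proof -
    have "((\<lambda>x. c\<^sup>2 * (1 / x)) has_integral (c\<^sup>2 * ln g - c\<^sup>2 * ln e)) {e..g}"
    proof (rule fundamental_theorem_of_calculus[OF e(2)])
      fix x assume "x \<in> {e..g}"
      then have "((\<lambda>x. c\<^sup>2 * ln x) has_real_derivative c\<^sup>2 * (1 / x)) (at x within {e..g})"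
        using e by (auto intro!: derivative_eq_intros)
      then show "((\<lambda>x. c\<^sup>2 * ln x) has_vector_derivative c\<^sup>2 * (1 / x)) (at x within {e..g})"
        by (simp add: has_real_derivative_iff_has_vector_derivative)
    qed
    then have "c\<^sup>2 * ln g - c\<^sup>2 * ln e = integral {e..g} (\<lambda>x. c\<^sup>2 * (1 / x))" and i: "(\<lambda>x. c\<^sup>2 * (1 / x)) integrable_on {e..g}"
      by (auto simp: integral_unique)
    then have "c\<^sup>2 * ln g - c\<^sup>2 * ln e = integral {e..g} (\<lambda>x. c\<^sup>2 * (1 / x))" by simp
    also have "\<dots> \<le> integral {e..g} (\<lambda>x. (norm (u x))\<^sup>2)"
      using low e g d by (intro integral_le i integrable_subinterval_real[OF ui]) auto
    also have "\<dots> \<le> I"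
      unfolding I_def using e g d by (intro integral_subset_le ui integrable_subinterval_real[OF ui]) auto
    finally show ?thesis by (simp add: algebra_simps)
  qed
  \<comment> \<open>Chosen so that \<open>c\<^sup>2 * (ln g - ln e)\<close> equals
    \<open>|I| + 1\<close>, more than the finite integral \<open>I\<close> permits.\<close>
  define e where "e = g * exp (- ((\<bar>I\<bar> + 1) / c\<^sup>2))"
  have e: "0 < e" "e \<le> g" using g c by (auto simp: e_def mult_le_cancel_left1)
  have "ln e = ln g - (\<bar>I\<bar> + 1) / c\<^sup>2" using g by (simp add: e_def ln_mult)
  then have "c\<^sup>2 * (ln g - ln e) = \<bar>I\<bar> + 1" using c by simp
  then show False using lnb[OF e] by linarith
qed

text \<open>The equation holds almost everywhere with a continuous right-hand side, so
  \<open>\<phi>\<close> is a classical solution. Its Wronskian with \<open>\<xi> l\<close> vanishes,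
  for \<open>\<nu> < 1\<close> by the condition at \<open>0\<close> and otherwise by square
  integrability; as \<open>\<Delta> l\<close> is nonzero, no multiple of \<open>\<xi> l\<close> but
  \<open>0\<close> meets the condition at \<open>a\<close>.\<close>

lemma H_graph_unique:
  assumes l: "\<Delta> l \<noteq> 0" and g: "H_graph \<nu> q a \<gamma> \<phi> \<psi>" and ae: "AE x in Leb. \<psi> x = l * \<phi> x" and x: "x \<in> {0<..a}"
  shows "\<phi> x = 0"
proof -
  obtain \<phi>' \<phi>'' where A: "\<phi> \<in> L2 a" "AC_loc_deriv a \<phi> \<phi>'" "AC_loc_deriv a \<phi>' \<phi>''"
    "AE x in Leb. \<psi> x = - \<phi>'' x + complex_of_real ((\<nu>\<^sup>2 - 1/4) / x\<^sup>2 + q x) * \<phi> x"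
    "\<phi> a * complex_of_real (cos \<gamma>) + \<phi>' a * of_real (sin \<gamma>) = 0"
    "\<nu> < 1 \<Longrightarrow> ((\<lambda>x. of_real (x powr (\<nu> - 1/2)) * (of_real (\<nu> + 1/2) * \<phi> x - of_real x * \<phi>' x)) \<longlongrightarrow> (0::complex)) (at_right 0)"
    using g unfolding H_graph_def by blast
  have "AE x in Leb. \<phi>'' x = (of_real (P x) - l) * \<phi> x"
    using A(4) ae by eventually_elim (simp add: P_def algebra_simps)
  then have "AE x in lebesgue. x \<in> {0<..<a} \<longrightarrow> \<phi>'' x = (of_real (P x) - l) * \<phi> x"
    by (subst (asm) AE_restrict_space_iff) auto
  then obtain N where N: "N \<in> null_sets lebesgue" "{x \<in> space lebesgue. \<not> (x \<in> {0<..<a} \<longrightarrow> \<phi>'' x = (of_real (P x) - l) * \<phi> x)} \<subseteq> N"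
    unfolding eventually_ae_filter by blast
  have N': "\<phi>'' t = (of_real (P t) - l) * \<phi> t" if "t \<in> {0<..<a}" "t \<notin> N" for t
    using N(2) that by auto
  have neg: "negligible (insert a N)" using N(1) by (simp add: negligible_iff_null_sets negligible_insert flip: negligible_iff_null_sets)
  have sub: "{0<..a} \<subseteq> {0<..b}" "{0<..<a} \<subseteq> {0<..a}" using ab by auto
  have c: "continuous_on {0<..a} \<phi>" "continuous_on {0<..a} \<phi>'"
    by (rule AC_loc_deriv_continuous[OF A(2)] AC_loc_deriv_continuous[OF A(3)])+
  have Pc: "continuous_on {0<..a} (\<lambda>x. (of_real (P x) - l) * \<phi> x)"
    by (intro continuous_intros c continuous_on_subset[OF P_cont sub(1)])
  \<comment> \<open>Changing the integrand on a negligible set to the continuous right-hand side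
    makes \<open>\<phi>'\<close> classically differentiable.\<close>
  have i2: "((\<lambda>x. (of_real (P x) - l) * \<phi> x) has_integral (\<phi>' y - \<phi>' x)) {x..y}" if xy: "0 < x" "x \<le> y" "y \<le> a" for x y
  proof (rule has_integral_spike[OF neg _ AC_loc_derivD(2)[OF A(3) xy]])
    fix t assume "t \<in> {x..y} - insert a N"
    then show "(of_real (P t) - l) * \<phi> t = \<phi>'' t" using xy by (intro N'[symmetric]) auto
  qed
  have s: "sol l \<phi> \<phi>'"
    unfolding sol_def
  proof (intro ballI conjI)
    fix x assume x: "x \<in> {0<..a}"
    show "(\<phi> has_vector_derivative \<phi>' x) (at x within {0<..a})"
    proof (rule derivative_within_half_open[OF c _ x])
      fix t assume t: "0 < t" "t < a"
      show "(\<phi> has_vector_derivative \<phi>' t) (at t)"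
        by (rule indefinite_integral_derivative[OF AC_loc_derivD(2)[OF A(2)] continuous_on_subset[OF c(2) sub(2)] t])
    qed
    show "(\<phi>' has_vector_derivative (of_real (P x) - l) * \<phi> x) (at x within {0<..a})"
    proof (rule derivative_within_half_open[OF c(2) Pc _ x])
      fix t assume t: "0 < t" "t < a"
      show "(\<phi>' has_vector_derivative (of_real (P t) - l) * \<phi> t) (at t)"
        by (rule indefinite_integral_derivative[OF i2 continuous_on_subset[OF Pc sub(2)] t])
    qed
  qed
  have "\<phi> a * \<eta> l a - \<phi>' a * \<xi> l a = 0"
    using wronskian_limit_circle[OF s] A(6) wronskian_limit_point[OF s _ A(1)] by (cases "\<nu> < 1") auto
  from sol_eq_0(1)[OF s A(5) l this x] show ?thesis .
qed

text \<open>For \<open>l \<in> Z\<close> the homogeneous equation has two solutions in the de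
  Branges space, \<open>0\<close> and the transform of \<open>\<xi> l\<close>. Off \<open>Z\<close>
  the resolvent gives existence and the bound, \<open>H_graph_unique\<close> gives uniqueness, and
  the injectivity of the transform carries all this over from square integrable functions.\<close>

lemma S_spectrum_eq: "S_spectrum \<xi> \<nu> q a \<gamma> = Z"
proof (intro equalityI subsetI)
  fix l assume l: "l \<in> Z"
  have lr: "Im l = 0" by (rule Z_real[OF l])
  show "l \<in> S_spectrum \<xi> \<nu> q a \<gamma>"
  proof (rule ccontr)
    assume "l \<notin> S_spectrum \<xi> \<nu> q a \<gamma>"
    then have ex1: "\<exists>!F. \<exists>G. S_graph \<xi> \<nu> q a \<gamma> F G \<and> (\<lambda>z. G z - l * F z) = R" if "R \<in> dB \<xi> a" for R
      using that unfolding S_spectrum_def by blast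
    define F1 where "F1 = transform \<xi> a (\<xi> l)"
    have z: "(\<lambda>_. 0) \<in> L2 a" by (rule L2_continuous) simp
    have t0: "transform \<xi> a (\<lambda>_. 0) = (\<lambda>_. 0)" by (auto simp: transform_def)
    have 0: "(\<lambda>_. 0) \<in> dB \<xi> a" unfolding dB_def using t0 z by (metis imageI)
    have G1: "S_graph \<xi> \<nu> q a \<gamma> F1 (transform \<xi> a (\<lambda>x. l * \<xi> l x))"
      unfolding S_graph_def F1_def using H_graph_xi[OF l] by blast
    have tl: "transform \<xi> a (\<lambda>x. l * \<xi> l x) z = l * F1 z" for z
      using transform_lin[OF xi_L2 xi_L2, of l l 0 l z] by (simp add: F1_def)
    have "H_graph \<nu> q a \<gamma> (\<lambda>x. 0 * \<xi> l x + 0 * \<xi> l x) (\<lambda>x. 0 * (l * \<xi> l x) + 0 * (l * \<xi> l x))"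
      by (rule H_graph_lin[OF H_graph_xi[OF l] H_graph_xi[OF l]])
    then have G0: "S_graph \<xi> \<nu> q a \<gamma> (\<lambda>_. 0) (\<lambda>_. 0)"
      unfolding S_graph_def by (intro exI[of _ "\<lambda>_. 0"]) (simp add: t0)
    have "F1 = (\<lambda>_. 0)"
    proof -
      have "\<exists>G. S_graph \<xi> \<nu> q a \<gamma> F1 G \<and> (\<lambda>z. G z - l * F1 z) = (\<lambda>_. 0)"
        using G1 tl by (intro exI[of _ "transform \<xi> a (\<lambda>x. l * \<xi> l x)"]) auto
      moreover have "\<exists>G. S_graph \<xi> \<nu> q a \<gamma> (\<lambda>_. 0) G \<and> (\<lambda>z. G z - l * (\<lambda>_. 0) z) = (\<lambda>_. 0)"
        using G0 by (intro exI[of _ "\<lambda>_. 0"]) auto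
      ultimately show ?thesis using ex1[OF 0] by blast
    qed
    \<comment> \<open>The two solutions differ: at \<open>l\<close> the transform of
      \<open>\<xi> l\<close> is the squared norm of the eigenfunction.\<close>
    moreover have "F1 l = of_real (ip a (ev l) (ev l))"
    proof -
      have "F1 l = (LINT x|Leb. of_real (ev l x * ev l x))"
        unfolding F1_def transform_def by (intro Bochner_Integration.integral_cong refl) (simp add: Z_xi_ev[OF l])
      also have "\<dots> = of_real (LINT x|Leb. ev l x * ev l x)" by (rule integral_complex_of_real)
      also have "(LINT x|Leb. ev l x * ev l x) = ip a (ev l) (ev l)"
        unfolding ip_def by (rule continuous_lebesgue_interior(2)) (intro continuous_intros ev_cont)
      finally show ?thesis .
    qed
    ultimately show False using ev_pos[OF lr] by simp
  qed
next
  fix l assume lS: "l \<in> S_spectrum \<xi> \<nu> q a \<gamma>"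
  show "l \<in> Z"
  proof (rule ccontr)
    assume "l \<notin> Z"
    then have l: "\<Delta> l \<noteq> 0" by (simp add: Z_def)
    obtain C where C: "\<And>\<rho>. \<rho> \<in> L2 a \<Longrightarrow> \<exists>u. H_graph \<nu> q a \<gamma> u (\<lambda>x. \<rho> x + l * u x) \<and> L2_norm_on a u \<le> C * L2_norm_on a \<rho>"
      by (rule H_graph_resolvent[OF l]) blast
    have uniq: "AE x in Leb. \<phi>1 x = \<phi>2 x"
      if h: "H_graph \<nu> q a \<gamma> \<phi>1 \<psi>1" "H_graph \<nu> q a \<gamma> \<phi>2 \<psi>2" "AE x in Leb. \<psi>1 x - l * \<phi>1 x = \<psi>2 x - l * \<phi>2 x" for \<phi>1 \<phi>2 \<psi>1 \<psi>2
    proof -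
      have "1 * \<phi>1 x + (-1) * \<phi>2 x = 0" if "x \<in> {0<..a}" for x
      proof (rule H_graph_unique[OF l H_graph_lin[OF h(1,2)] _ that])
        show "AE x in Leb. 1 * \<psi>1 x + (-1) * \<psi>2 x = l * (1 * \<phi>1 x + (-1) * \<phi>2 x)"
          using h(3) by eventually_elim (simp add: algebra_simps)
      qed
      then show ?thesis by (intro AE_I2) auto
    qed
    have tr: "(\<lambda>z. transform \<xi> a \<psi> z - l * transform \<xi> a \<phi> z) = transform \<xi> a (\<lambda>x. \<psi> x - l * \<phi> x)"
      "(\<lambda>x. \<psi> x - l * \<phi> x) \<in> L2 a" if "H_graph \<nu> q a \<gamma> \<phi> \<psi>" for \<phi> \<psi>
      using transform_lin[OF H_graph_L2(2)[OF that] H_graph_L2(1)[OF that], of 1 "- l"]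
        L2_lin[OF H_graph_L2(2)[OF that] H_graph_L2(1)[OF that], of 1 "- l"] by auto
    have "\<exists>!F. \<exists>G. S_graph \<xi> \<nu> q a \<gamma> F G \<and> (\<lambda>z. G z - l * F z) = R" if RD: "R \<in> dB \<xi> a" for R
    proof -
      obtain \<rho> where \<rho>: "\<rho> \<in> L2 a" "R = transform \<xi> a \<rho>" using RD by (auto simp: dB_def)
      obtain u where u: "H_graph \<nu> q a \<gamma> u (\<lambda>x. \<rho> x + l * u x)" using C[OF \<rho>(1)] by blast
      show ?thesis
      proof (rule ex1I[of _ "transform \<xi> a u"])
        show "\<exists>G. S_graph \<xi> \<nu> q a \<gamma> (transform \<xi> a u) G \<and> (\<lambda>z. G z - l * transform \<xi> a u z) = R"
          using u tr(1)[OF u] \<rho>(2) unfolding S_graph_def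
          by (intro exI[of _ "transform \<xi> a (\<lambda>x. \<rho> x + l * u x)"]) auto
        fix F assume "\<exists>G. S_graph \<xi> \<nu> q a \<gamma> F G \<and> (\<lambda>z. G z - l * F z) = R"
        then obtain \<phi> \<psi> where h: "H_graph \<nu> q a \<gamma> \<phi> \<psi>" "F = transform \<xi> a \<phi>"
          "(\<lambda>z. transform \<xi> a \<psi> z - l * transform \<xi> a \<phi> z) = R"
          unfolding S_graph_def by blast
        have "AE x in Leb. \<psi> x - l * \<phi> x = \<rho> x"
          by (rule transform_inj[OF tr(2)[OF h(1)] \<rho>(1)]) (use h(3) tr(1)[OF h(1)] \<rho>(2) in simp)
        then have "AE x in Leb. \<psi> x - l * \<phi> x = (\<rho> x + l * u x) - l * u x" by simp
        from uniq[OF h(1) u this] have ae: "AE x in Leb. \<phi> x = u x" .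
        show "F = transform \<xi> a u"
        proof
          fix z
          show "F z = transform \<xi> a u z"
            unfolding h(2) transform_def
          proof (rule integral_cong_AE)
            show "(\<lambda>x. \<xi> z x * \<phi> x) \<in> borel_measurable Leb" "(\<lambda>x. \<xi> z x * u x) \<in> borel_measurable Leb"
              using xi_times_integrable[OF H_graph_L2(1)[OF h(1)]] xi_times_integrable[OF H_graph_L2(1)[OF u]]
              by (auto intro: borel_measurable_integrable)
            show "AE x in Leb. \<xi> z x * \<phi> x = \<xi> z x * u x" using ae by eventually_elim simp
          qed
        qed
      qed
    qed
    moreover have "dB_norm \<xi> a F \<le> C * dB_norm \<xi> a (\<lambda>z. G z - l * F z)" if FG: "S_graph \<xi> \<nu> q a \<gamma> F G" for F G
    proof -
      obtain \<phi> \<psi> where h: "H_graph \<nu> q a \<gamma> \<phi> \<psi>" "F = transform \<xi> a \<phi>" "G = transform \<xi> a \<psi>"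
        using FG unfolding S_graph_def by blast
      define \<rho> where "\<rho> x = \<psi> x - l * \<phi> x" for x
      have \<rho>: "\<rho> \<in> L2 a" unfolding \<rho>_def[abs_def] by (rule tr(2)[OF h(1)])
      have r: "(\<lambda>z. G z - l * F z) = transform \<xi> a \<rho>" unfolding h(2,3) \<rho>_def[abs_def] by (rule tr(1)[OF h(1)])
      obtain u where u: "H_graph \<nu> q a \<gamma> u (\<lambda>x. \<rho> x + l * u x)" "L2_norm_on a u \<le> C * L2_norm_on a \<rho>"
        using C[OF \<rho>] by blast
      have "AE x in Leb. \<phi> x = u x" by (rule uniq[OF h(1) u(1)]) (simp add: \<rho>_def)
      then have "L2_norm_on a \<phi> = L2_norm_on a u"
        by (rule L2_norm_cong_AE[OF H_graph_L2(1)[OF h(1)] H_graph_L2(1)[OF u(1)]])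
      moreover have "dB_norm \<xi> a (\<lambda>z. G z - l * F z) = L2_norm_on a \<rho>"
        unfolding r by (rule dB_norm_transform[OF \<rho>])
      moreover have "dB_norm \<xi> a F = L2_norm_on a \<phi>"
        unfolding h(2) by (rule dB_norm_transform[OF H_graph_L2(1)[OF h(1)]])
      ultimately show ?thesis using u(2) by simp
    qed
    ultimately have "l \<notin> S_spectrum \<xi> \<nu> q a \<gamma>" unfolding S_spectrum_def by blast
    then show False using lS by blast
  qed
qed

subsection \<open>Sampling series\<close>

text \<open>Duality: \<open>u\<close> is the combination that represents evaluation at
  \<open>a\<close> in the shifted form, so \<open>u(a)\<close> and the shifted form of
  \<open>u\<close> both equal the sum \<open>S\<close>, and the form inequality gives
  \<open>S\<^sup>2 <= S\<close>.\<close>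

lemma trace_bound:
  assumes L: "finite L" "L \<subseteq> Z"
  shows "(\<Sum>l\<in>L. (ev l a)\<^sup>2 / (ip a (ev l) (ev l) * (Re l + T))) \<le> 1"
proof -
  define N where "N l = ip a (ev l) (ev l)" for l
  define \<alpha> where "\<alpha> l = ev l a / (N l * (Re l + T))" for l
  define S where "S = (\<Sum>l\<in>L. (ev l a)\<^sup>2 / (N l * (Re l + T)))"
  have N: "0 < N l" and T: "0 < Re l + T" if "l \<in> L" for l
    using that L Z_ge[of l] ev_pos[OF Z_real, of l] by (auto simp: N_def)
  define u where "u = (\<lambda>x. \<Sum>l\<in>L. \<alpha> l * ev l x)"
  define f where "f = (\<lambda>x. \<Sum>l\<in>L. \<alpha> l * (Re l * ev l x))"
  have d: "dom u (\<lambda>x. \<Sum>l\<in>L. \<alpha> l * Re (\<eta> l x)) f"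
    unfolding u_def f_def by (rule dom_sum[OF L(1)]) (use ev_dom L in auto)
  have uc: "continuous_on {0..a} u" by (rule domD(1)[OF d])
  have ua: "u a = S"
    unfolding u_def S_def by (intro sum.cong refl) (simp add: \<alpha>_def power2_eq_square)
  have ipl: "ip a (ev l) u = \<alpha> l * N l" if "l \<in> L" for l
    unfolding u_def N_def by (subst ip_commute) (rule ip_ev_sum(1)[OF L that])
  have uu: "ip a u u = (\<Sum>l\<in>L. (\<alpha> l)\<^sup>2 * N l)"
    unfolding u_def N_def by (rule ip_ev_sum(2)[OF L])
  have quot: "(e / w)\<^sup>2 * w = e\<^sup>2 / w" if "w \<noteq> 0" for e w :: real
    using that by (simp add: power2_eq_square)
  have "ip a f u = ip a (\<lambda>x. \<Sum>l\<in>L. (\<alpha> l * Re l) * ev l x) u" by (simp add: f_def mult.assoc)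
  also have "\<dots> = (\<Sum>l\<in>L. (\<alpha> l * Re l) * ip a (ev l) u)" by (rule ip_sum_left[OF L(1) ev_cont uc])
  also have "\<dots> = (\<Sum>l\<in>L. (\<alpha> l)\<^sup>2 * N l * Re l)"
    by (intro sum.cong refl) (simp add: ipl power2_eq_square)
  finally have "ip a f u + T * ip a u u = (\<Sum>l\<in>L. (\<alpha> l)\<^sup>2 * N l * (Re l + T))"
    by (simp add: uu sum_distrib_left algebra_simps flip: sum.distrib)
  also have "\<dots> = S"
    unfolding S_def
  proof (intro sum.cong refl)
    fix l assume "l \<in> L"
    then show "(\<alpha> l)\<^sup>2 * N l * (Re l + T) = (ev l a)\<^sup>2 / (N l * (Re l + T))"
      using quot[of "N l * (Re l + T)" "ev l a"] N[of l] T[of l] by (simp add: \<alpha>_def mult.assoc)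
  qed
  finally have "S\<^sup>2 \<le> S" using form[OF d] ip_nonneg[OF uc] ua by simp
  then have "S * S \<le> S * 1" by (simp add: power2_eq_square)
  then have "S \<le> 1" by (cases "0 < S") (auto dest: mult_left_le_imp_le)
  then show ?thesis by (simp add: S_def N_def)
qed

text \<open>In the energy \<open>t * |\<xi>|\<^sup>2 + |\<eta>|\<^sup>2\<close> with
  \<open>t = Re l + T + 1\<close> the spectral parameter cancels on differentiation, so the Gronwall
  constant is a bound of \<open>P + T + 1\<close> on \<open>{a..b}\<close>, independent of
  \<open>l\<close>. At \<open>a\<close> the boundary condition and \<open>t >= 1\<close> bound the
  energy by \<open>t * (1 + ct\<^sup>2) * (ev l a)\<^sup>2\<close>, and \<open>t\<close> is divided
  out at the end.\<close>

lemma eigenfunction_continuation_bound: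
  obtains M where "0 < M" "\<And>l x. l \<in> Z \<Longrightarrow> x \<in> {a..b} \<Longrightarrow> norm (\<xi> l x) \<le> M * \<bar>ev l a\<bar>"
proof -
  have sub: "{a..b} \<subseteq> {0<..b}" using a by auto
  have "continuous_on {a..b} (\<lambda>x. P x + T + 1)" by (intro continuous_intros continuous_on_subset[OF P_cont sub])
  then obtain K where K: "0 < K" "\<And>x. x \<in> {a..b} \<Longrightarrow> norm (P x + T + 1) \<le> K" using continuous_on_Icc_bounded by blast
  define ct where "ct = cos \<gamma> / sin \<gamma>"
  define M2 where "M2 = (1 + ct\<^sup>2) * exp (K * (b - a))"
  have M2: "0 < M2" unfolding M2_def by (intro mult_pos_pos add_pos_nonneg) auto
  show ?thesis
  proof (rule that[of "sqrt M2"])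
    show "0 < sqrt M2" using M2 by simp
    fix l x assume l: "l \<in> Z" and x: "x \<in> {a..b}"
    have li: "Im l = 0" by (rule Z_real[OF l])
    have lr: "l = of_real (Re l)" using li by (simp add: complex_eq_iff)
    define t where "t = Re l + T + 1"
    have t: "1 \<le> t" using Z_ge[OF l] by (simp add: t_def)
    define E where "E x = t * (\<xi> l x \<bullet> \<xi> l x) + \<eta> l x \<bullet> \<eta> l x" for x
    define E' where "E' x = 2 * (P x + T + 1) * (\<xi> l x \<bullet> \<eta> l x)" for x
    have D: "(\<xi> l has_vector_derivative \<eta> l s) (at s)" "(\<eta> l has_vector_derivative of_real (P s - Re l) * \<xi> l s) (at s)"
      if s: "a < s" "s < b" for s
    proof -
      have s': "s \<in> {0<..b}" using s a by auto
      have at: "at s within {0<..b} = at s"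
        by (rule at_within_interior) (use s a in \<open>auto intro!: interiorI[of "{0<..<b}"]\<close>)
      show "(\<xi> l has_vector_derivative \<eta> l s) (at s)" using xi_deriv[OF s', of l] unfolding at .
      have "of_real ((\<nu>\<^sup>2 - 1/4) / s\<^sup>2 + q s) - l = of_real (P s - Re l)"
        by (subst lr) (simp add: P_def)
      then show "(\<eta> l has_vector_derivative of_real (P s - Re l) * \<xi> l s) (at s)"
        using eta_deriv[OF s', of l] unfolding at by simp
    qed
    have le: "2 * (norm (\<xi> l s) * norm (\<eta> l s)) \<le> E s" for s
    proof -
      have "2 * (norm (\<xi> l s) * norm (\<eta> l s)) \<le> (norm (\<xi> l s))\<^sup>2 + (norm (\<eta> l s))\<^sup>2"
        using sum_squares_bound[of "norm (\<xi> l s)" "norm (\<eta> l s)"] by (simp add: mult.assoc)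
      also have "\<dots> = 1 * (\<xi> l s \<bullet> \<xi> l s) + \<eta> l s \<bullet> \<eta> l s" by (simp add: power2_norm_eq_inner)
      also have "\<dots> \<le> E s" unfolding E_def using t by (intro add_right_mono mult_right_mono) auto
      finally show ?thesis .
    qed
    have cont: "continuous_on {a..b} (\<xi> l)" "continuous_on {a..b} (\<eta> l)"
      by (rule continuous_on_subset[OF continuous_on_vector_derivative[OF xi_deriv] sub]
          continuous_on_subset[OF continuous_on_vector_derivative[OF eta_deriv] sub], assumption)+
    have "E x \<le> E a * exp (K * \<bar>x - a\<bar>)"
    proof (rule gronwall)
      show "continuous_on {a..b} E" unfolding E_def[abs_def] by (intro continuous_intros cont)
      show "x \<in> {a..b}" "a \<in> {a..b}" using x ab by auto
      fix s assume s: "a < s" "s < b"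
      have "(E has_vector_derivative t * (\<xi> l s \<bullet> \<eta> l s + \<eta> l s \<bullet> \<xi> l s) +
          (\<eta> l s \<bullet> (of_real (P s - Re l) * \<xi> l s) + (of_real (P s - Re l) * \<xi> l s) \<bullet> \<eta> l s)) (at s)"
        unfolding E_def[abs_def]
        by (intro has_vector_derivative_add has_vector_derivative_mult_right
            bounded_bilinear.has_vector_derivative[OF bounded_bilinear_inner] D[OF s])
      moreover have "t * (\<xi> l s \<bullet> \<eta> l s + \<eta> l s \<bullet> \<xi> l s) +
          (\<eta> l s \<bullet> (of_real (P s - Re l) * \<xi> l s) + (of_real (P s - Re l) * \<xi> l s) \<bullet> \<eta> l s) = E' s"
      proof -
        have c: "of_real (P s - Re l) * \<xi> l s = (P s - Re l) *\<^sub>R \<xi> l s" by (simp only: scaleR_conv_of_real)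
        have "t * (u \<bullet> v + v \<bullet> u) + (v \<bullet> (p *\<^sub>R u) + (p *\<^sub>R u) \<bullet> v) = 2 * (p + t) * (u \<bullet> v)" for u v :: complex and p
          by (simp only: inner_scaleR_left inner_scaleR_right inner_commute[of v u]) (simp add: algebra_simps)
        then show ?thesis unfolding c E'_def by (simp add: t_def)
      qed
      ultimately show "(E has_real_derivative E' s) (at s)" by (simp add: has_real_derivative_iff_has_vector_derivative)
      have "\<bar>E' s\<bar> = \<bar>P s + T + 1\<bar> * (2 * \<bar>\<xi> l s \<bullet> \<eta> l s\<bar>)"
        unfolding E'_def abs_mult by simp
      also have "\<dots> \<le> K * (2 * (norm (\<xi> l s) * norm (\<eta> l s)))"
        using K(2)[of s] s Cauchy_Schwarz_ineq2[of "\<xi> l s" "\<eta> l s"] K(1) by (intro mult_mono) auto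
      also have "\<dots> \<le> K * E s" using le[of s] K(1) by (intro mult_left_mono) auto
      finally show "\<bar>E' s\<bar> \<le> K * E s" .
    qed
    also have "\<dots> \<le> E a * exp (K * (b - a))"
    proof -
      have "0 \<le> E a" unfolding E_def using t by (intro add_nonneg_nonneg mult_nonneg_nonneg) auto
      then show ?thesis using x K(1) by (intro mult_left_mono) auto
    qed
    also have "E a \<le> t * ((1 + ct\<^sup>2) * (ev l a)\<^sup>2)"
    proof -
      have aa: "a \<in> {0<..a}" using a by simp
      have x1: "\<xi> l a = of_real (ev l a)" by (rule ev_real[OF li aa])
      have "\<xi> l a * of_real (cos \<gamma>) + \<eta> l a * of_real (sin \<gamma>) = 0" using l by (simp add: Z_def \<Delta>_def)
      then have "\<eta> l a * of_real (sin \<gamma>) = - of_real (ev l a * cos \<gamma>)" by (simp add: x1 add_eq_0_iff2)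
      then have "\<eta> l a = - of_real (ev l a * cos \<gamma>) / of_real (sin \<gamma>)"
        using sin_gamma by (intro nonzero_eq_divide_eq[THEN iffD2]) auto
      then have x2: "\<eta> l a = of_real (- ct * ev l a)" by (simp add: ct_def)
      have "E a = t * (ev l a)\<^sup>2 + 1 * (ct\<^sup>2 * (ev l a)\<^sup>2)"
        unfolding E_def x1 x2 by (simp add: inner_complex_def power2_eq_square)
      also have "\<dots> \<le> t * (ev l a)\<^sup>2 + t * (ct\<^sup>2 * (ev l a)\<^sup>2)"
        using t by (intro add_left_mono mult_right_mono) auto
      finally show ?thesis by (simp add: algebra_simps)
    qed
    finally have "E x \<le> t * (M2 * (ev l a)\<^sup>2)" by (simp add: M2_def mult_ac)
    moreover have "t * (norm (\<xi> l x))\<^sup>2 \<le> E x" by (simp add: E_def power2_norm_eq_inner)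
    ultimately have "t * (norm (\<xi> l x))\<^sup>2 \<le> t * (M2 * (ev l a)\<^sup>2)" by linarith
    then have "(norm (\<xi> l x))\<^sup>2 \<le> M2 * (ev l a)\<^sup>2" using t by simp
    then have "sqrt ((norm (\<xi> l x))\<^sup>2) \<le> sqrt (M2 * (ev l a)\<^sup>2)" by (rule real_sqrt_le_mono)
    then show "norm (\<xi> l x) \<le> sqrt M2 * \<bar>ev l a\<bar>" by (simp add: real_sqrt_mult)
  qed
qed

section \<open>The reproducing kernel at spectral points and the summable majorant\<close>

abbreviation "K \<equiv> dB_kernel \<xi> a"

lemma kernel_eq: "l \<in> Z \<Longrightarrow> K z l = (LINT x|Leb. \<xi> z x * \<xi> l x)"
proof -
  assume "l \<in> Z"
  then have "cnj l = l" using Z_real[of l] by (simp add: complex_eq_iff)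
  then show ?thesis by (simp add: dB_kernel_def)
qed

lemma kernel_eigen:
  assumes "l \<in> Z" "l' \<in> Z"
  shows "K l l' = of_real (ip a (ev l) (ev l'))"
proof -
  have "K l l' = (LINT x|Leb. complex_of_real (ev l x * ev l' x))"
    unfolding kernel_eq[OF assms(2)] by (intro Bochner_Integration.integral_cong refl) (simp add: Z_xi_ev assms)
  also have "\<dots> = of_real (LINT x|Leb. ev l x * ev l' x)" by (rule integral_complex_of_real)
  also have "(LINT x|Leb. ev l x * ev l' x) = ip a (ev l) (ev l')"
    unfolding ip_def by (rule continuous_lebesgue_interior(2)) (intro continuous_intros ev_cont)
  finally show ?thesis .
qed

text \<open>The Wronskian of \<open>\<xi> z\<close> and \<open>\<xi> l\<close> at \<open>a\<close>,
  with \<open>\<eta> l a\<close> eliminated through the boundary condition that holds for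
  \<open>l\<close>; at \<open>0\<close> it vanishes with order \<open>2 * \<nu>\<close>.\<close>

lemma kernel_lagrange:
  assumes l: "l \<in> Z"
  shows "(z - l) * K z l * of_real (sin \<gamma>) = - of_real (ev l a) * \<Delta> z"
proof -
  obtain C where C: "0 < C" "\<And>x. x \<in> {0<..a} \<Longrightarrow> norm (\<xi> z x) \<le> C * x powr k"
    "\<And>x. x \<in> {0<..a} \<Longrightarrow> norm (\<eta> z x) \<le> C * x powr (k - 1)" by (rule xi_bound[where z = z]) blast
  obtain D where D: "0 < D" "\<And>x. x \<in> {0<..a} \<Longrightarrow> norm (\<xi> l x) \<le> D * x powr k"
    "\<And>x. x \<in> {0<..a} \<Longrightarrow> norm (\<eta> l x) \<le> D * x powr (k - 1)" by (rule xi_bound[where z = l]) blast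
  let ?W = "\<lambda>x. \<xi> z x * \<eta> l x - \<eta> z x * \<xi> l x"
  have "((\<lambda>x. (z - l) * \<xi> z x * \<xi> l x) has_integral ?W a) {0..a}"
  proof (rule fundamental_theorem_of_calculus_zero[where p = "2 * \<nu>" and C = "2 * C * D" and F = ?W])
    show "continuous_on {0<..a} ?W" by (intro continuous_intros xi_cont eta_cont)
    fix x assume x: "x \<in> {0<..a}"
    have "norm (?W x) \<le> norm (\<xi> z x) * norm (\<eta> l x) + norm (\<eta> z x) * norm (\<xi> l x)"
      by (rule order_trans[OF norm_triangle_ineq4]) (simp add: norm_mult)
    also have "\<dots> \<le> (C * x powr k) * (D * x powr (k - 1)) + (C * x powr (k - 1)) * (D * x powr k)"
      using C D x by (intro add_mono mult_mono) auto
    also have "\<dots> = 2 * C * D * (x powr k * x powr (k - 1))" by simp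
    also have "x powr k * x powr (k - 1) = x powr (2 * \<nu>)" unfolding powr_add[symmetric] by (simp add: k_def)
    finally show "norm (?W x) \<le> 2 * C * D * x powr (2 * \<nu>)" .
  next
    fix x assume x: "0 < x" "x < a"
    then have x': "x \<in> {0<..a}" by auto
    show "(?W has_vector_derivative (z - l) * \<xi> z x * \<xi> l x) (at x)"
      using wronskian_has_derivative[OF sol_xi sol_xi x', of z l] unfolding at_within_interior_a[OF x] .
  qed (use nu a in auto)
  from integral_unique[OF this] have i: "integral {0..a} (\<lambda>x. (z - l) * (\<xi> z x * \<xi> l x)) = ?W a"
    by (simp only: mult.assoc)
  have "(z - l) * K z l = (LINT x|Leb. (z - l) * (\<xi> z x * \<xi> l x))" by (simp add: kernel_eq[OF l])
  also have "\<dots> = integral {0<..<a} (\<lambda>x. (z - l) * (\<xi> z x * \<xi> l x))"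
    by (rule lebesgue_integral_eq_integral) (intro integrable_mult_right xi_times_integrable xi_L2, simp)
  also have "\<dots> = ?W a" unfolding i[symmetric] by (rule integral_open_interval_real[symmetric])
  finally have W: "(z - l) * K z l = ?W a" .
  have "(z - l) * K z l * of_real (sin \<gamma>) = \<xi> z a * (\<eta> l a * of_real (sin \<gamma>)) - \<eta> z a * of_real (sin \<gamma>) * \<xi> l a"
    unfolding W by algebra
  also have "\<eta> l a * of_real (sin \<gamma>) = - of_real (cos \<gamma>) * \<xi> l a"
    using l by (simp add: Z_def \<Delta>_def add_eq_0_iff2 mult.commute)
  also have "\<xi> z a * (- of_real (cos \<gamma>) * \<xi> l a) - \<eta> z a * of_real (sin \<gamma>) * \<xi> l a = - \<xi> l a * \<Delta> z"
    by (simp add: \<Delta>_def algebra_simps)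
  also have "\<xi> l a = of_real (ev l a)" using ev_real[OF Z_real[OF l], of a] a by simp
  finally show ?thesis .
qed

text \<open>A common majorant: what is sampled from \<open>{a..b}\<close> is bounded by a multiple
  of \<open>|\<xi>(l, a)|\<close>, by \<open>eigenfunction_continuation_bound\<close>.\<close>

definition weight :: "complex \<Rightarrow> complex \<Rightarrow> real" where
  "weight z l = norm (K z l) * \<bar>ev l a\<bar> / ip a (ev l) (ev l)"

lemma weight_nonneg: "0 \<le> weight z l"
  unfolding weight_def using ip_nonneg[OF ev_cont] by simp

text \<open>Beyond the finite set \<open>L0\<close> the distance \<open>norm (z - l)\<close> is at
  least \<open>(Re l + T) / 2\<close>; Lagrange's identity then bounds the weight by a multiple of
  the terms of \<open>trace_bound\<close>.\<close>

lemma weight_summable: "weight z summable_on Z"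
proof -
  define L0 where "L0 = {l \<in> Z. Re l \<le> 2 * norm z + T}"
  have L0: "finite L0" "L0 \<subseteq> Z" unfolding L0_def using Z_finite_below by auto
  define C where "C = 2 * norm (\<Delta> z) / sin \<gamma>"
  have C: "0 \<le> C" unfolding C_def using sin_gamma by simp
  have le: "weight z l \<le> C * ((ev l a)\<^sup>2 / (ip a (ev l) (ev l) * (Re l + T)))" if l: "l \<in> Z - L0" for l
  proof -
    have lZ: "l \<in> Z" and big: "2 * norm z + T < Re l" using l by (auto simp: L0_def)
    have N: "0 < ip a (ev l) (ev l)" by (rule ev_pos[OF Z_real[OF lZ]])
    have t: "0 < Re l + T" using Z_ge[OF lZ] by simp
    have "Re l \<le> norm l" by (rule complex_Re_le_cmod)
    then have d: "(Re l + T) / 2 \<le> norm (z - l)"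
      using norm_triangle_ineq2[of l z] big by (simp add: norm_minus_commute)
    have "norm (z - l) * norm (K z l) * sin \<gamma> = \<bar>ev l a\<bar> * norm (\<Delta> z)"
      using arg_cong[OF kernel_lagrange[OF lZ, of z], of norm] sin_gamma by (simp add: norm_mult)
    moreover have "(Re l + T) / 2 * norm (K z l) * sin \<gamma> \<le> norm (z - l) * norm (K z l) * sin \<gamma>"
      using d sin_gamma by (intro mult_right_mono) auto
    ultimately have "(Re l + T) / 2 * norm (K z l) * sin \<gamma> \<le> \<bar>ev l a\<bar> * norm (\<Delta> z)" by linarith
    moreover have "k \<le> 2 * D / g * e / t" if "t / 2 * k * g \<le> e * D" "0 < t" "0 < g" for t k g e D :: real
      using that by (simp add: field_simps)
    ultimately have "norm (K z l) \<le> C * \<bar>ev l a\<bar> / (Re l + T)"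
      unfolding C_def using t sin_gamma by blast
    then have "weight z l \<le> C * \<bar>ev l a\<bar> / (Re l + T) * \<bar>ev l a\<bar> / ip a (ev l) (ev l)"
      unfolding weight_def using N by (intro divide_right_mono mult_right_mono) auto
    also have "\<dots> = C * ((ev l a)\<^sup>2 / (ip a (ev l) (ev l) * (Re l + T)))" by (simp add: power2_eq_square mult_ac)
    finally show ?thesis .
  qed
  have "weight z summable_on (Z - L0)"
  proof (rule nonneg_bdd_above_summable_on)
    show "0 \<le> weight z l" for l by (rule weight_nonneg)
    show "bdd_above (sum (weight z) ` {F. F \<subseteq> Z - L0 \<and> finite F})"
    proof (intro bdd_aboveI2)
      fix F assume F: "F \<in> {F. F \<subseteq> Z - L0 \<and> finite F}"
      then have "sum (weight z) F \<le> (\<Sum>l\<in>F. C * ((ev l a)\<^sup>2 / (ip a (ev l) (ev l) * (Re l + T))))"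
        using le by (intro sum_mono) auto
      also have "\<dots> = C * (\<Sum>l\<in>F. (ev l a)\<^sup>2 / (ip a (ev l) (ev l) * (Re l + T)))" by (simp add: sum_distrib_left)
      also have "\<dots> \<le> C * 1" using F C by (intro mult_left_mono trace_bound) auto
      finally show "sum (weight z) F \<le> C * 1" .
    qed
  qed
  then have "weight z summable_on ((Z - L0) \<union> L0)"
    by (rule summable_on_Un_disjoint[OF _ summable_on_finite[OF L0(1)]]) auto
  then show ?thesis using L0 by (simp add: Un_absorb2)
qed

lemma summable_by_weight:
  fixes f :: "complex \<Rightarrow> complex"
  assumes "\<And>l. l \<in> Z \<Longrightarrow> norm (f l) \<le> c * weight z l"
  shows "f summable_on Z"
proof (rule Infinite_Sum.abs_summable_summable)
  show "(\<lambda>l. norm (f l)) summable_on Z"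
    by (rule Infinite_Sum.abs_summable_on_comparison_test'[OF summable_on_cmult_right[OF weight_summable]]) (rule assms)
qed

lemma norm_kernel_quotient: "l \<in> Z \<Longrightarrow> norm (K z l / K l l) = norm (K z l) / ip a (ev l) (ev l)"
  using ip_nonneg[OF ev_cont, of l] by (simp add: kernel_eigen norm_divide)

lemma sampling_term_bound:
  assumes l: "l \<in> Z" and f: "norm (F l) \<le> c * \<bar>ev l a\<bar>"
  shows "norm (sampling_term \<xi> a F z l) \<le> c * weight z l"
proof -
  have "norm (sampling_term \<xi> a F z l) = norm (K z l) / ip a (ev l) (ev l) * norm (F l)"
    unfolding sampling_term_def norm_mult[of "K z l / K l l"] norm_kernel_quotient[OF l] ..
  also have "\<dots> \<le> norm (K z l) / ip a (ev l) (ev l) * (c * \<bar>ev l a\<bar>)"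
    using f ip_nonneg[OF ev_cont, of l] by (intro mult_left_mono) auto
  also have "\<dots> = c * weight z l" by (simp add: weight_def)
  finally show ?thesis .
qed

section \<open>Orthogonal expansion of \<open>\<xi> z\<close> and the sampling formula\<close>

lemma L2_sum:
  assumes "finite L" "\<And>l. l \<in> L \<Longrightarrow> f l \<in> L2 a"
  shows "(\<lambda>x. \<Sum>l\<in>L. c l * f l x) \<in> L2 a"
  using assms
proof (induction L rule: finite_induct)
  case empty
  have "(\<lambda>_. 0) \<in> L2 a" by (rule L2_continuous) simp
  then show ?case by simp
next
  case (insert l L)
  then show ?case using L2_lin[of "f l" a "\<lambda>x. \<Sum>l\<in>L. c l * f l x" "c l" 1] by simp
qed

lemma L2_mult_integrable:
  assumes "\<phi> \<in> L2 a" "\<psi> \<in> L2 a"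
  shows "integrable Leb (\<lambda>x. \<phi> x * \<psi> x)"
  by (rule lebesgue_cauchy_schwarz(1)) (use L2D[OF assms(1)] L2D[OF assms(2)] in auto)

text \<open>The cutoffs of the whole interval \<open>(0, a)\<close> times \<open>\<xi> z\<close>
  tend to \<open>\<xi> z\<close> by dominated convergence, and each such product is approximable by
  eigenfunctions.\<close>

lemma xi_approx:
  assumes e: "0 < e"
  obtains L p where "finite L" "L \<subseteq> Z" "(LINT x|Leb. (norm (\<xi> z x - (\<Sum>l\<in>L. p l * \<xi> l x)))\<^sup>2) < e"
proof -
  have "(\<lambda>n. LINT x|Leb. (norm (\<xi> z x * of_real (1 - cutoff 0 a n x)))\<^sup>2) \<longlonglongrightarrow> (LINT x|Leb. 0)"
  proof (rule integral_dominated_convergence[where w = "\<lambda>x. (norm (\<xi> z x))\<^sup>2"])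
    show "integrable Leb (\<lambda>x. (norm (\<xi> z x))\<^sup>2)" by (rule L2D(2)[OF xi_L2])
    show "(\<lambda>x. (norm (\<xi> z x * of_real (1 - cutoff 0 a n x)))\<^sup>2) \<in> borel_measurable Leb" for n
      using L2D(1)[OF xi_L2, of z] cutoff_measurable[of 0 a n] by measurable
    show "AE x in Leb. (\<lambda>n. (norm (\<xi> z x * of_real (1 - cutoff 0 a n x)))\<^sup>2) \<longlonglongrightarrow> 0"
    proof (rule AE_I2)
      fix x assume "x \<in> space Leb"
      then have "(\<lambda>n. cutoff 0 a n x) \<longlonglongrightarrow> 1" using cutoff_limit[OF a, of x] by simp
      then have "(\<lambda>n. (norm (\<xi> z x * of_real (1 - cutoff 0 a n x)))\<^sup>2) \<longlonglongrightarrow> (norm (\<xi> z x * of_real (1 - 1)))\<^sup>2"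
        by (intro tendsto_power tendsto_norm tendsto_mult tendsto_of_real tendsto_diff tendsto_const)
      then show "(\<lambda>n. (norm (\<xi> z x * of_real (1 - cutoff 0 a n x)))\<^sup>2) \<longlonglongrightarrow> 0" by simp
    qed
    show "AE x in Leb. norm ((norm (\<xi> z x * of_real (1 - cutoff 0 a n x)))\<^sup>2) \<le> (norm (\<xi> z x))\<^sup>2" for n
    proof (rule AE_I2)
      fix x
      have "norm (\<xi> z x * of_real (1 - cutoff 0 a n x)) \<le> norm (\<xi> z x) * 1"
        unfolding norm_mult norm_of_real using cutoff_range[of 0 a n x] by (intro mult_left_mono) auto
      then have "(norm (\<xi> z x * of_real (1 - cutoff 0 a n x)))\<^sup>2 \<le> (norm (\<xi> z x))\<^sup>2" by (intro power_mono) auto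
      then show "norm ((norm (\<xi> z x * of_real (1 - cutoff 0 a n x)))\<^sup>2) \<le> (norm (\<xi> z x))\<^sup>2" by simp
    qed
  qed simp
  then have "(\<lambda>n. LINT x|Leb. (norm (\<xi> z x * of_real (1 - cutoff 0 a n x)))\<^sup>2) \<longlonglongrightarrow> 0" by simp
  \<comment> \<open>Two errors of \<open>e / 4\<close> suffice, as the squared norm of a sum is at
    most twice the sum of the squared norms.\<close>
  moreover have "0 < e / 4" using e by simp
  ultimately have "\<forall>\<^sub>F n in sequentially. (LINT x|Leb. (norm (\<xi> z x * of_real (1 - cutoff 0 a n x)))\<^sup>2) < e / 4"
    by (rule order_tendstoD(2))
  then obtain n where n: "(LINT x|Leb. (norm (\<xi> z x * of_real (1 - cutoff 0 a n x)))\<^sup>2) < e / 4"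
    using eventually_happens' sequentially_bot by blast
  obtain L p where L: "finite L" "L \<subseteq> Z"
    "(LINT x|Leb. (norm (\<xi> z x * of_real (cutoff 0 a n x) - (\<Sum>l\<in>L. p l * \<xi> l x)))\<^sup>2) < e / 4"
    by (rule cutoff_approx[OF order_refl a order_refl \<open>0 < e / 4\<close>, where z = z and n = n]) blast
  define r1 where "r1 x = \<xi> z x * of_real (1 - cutoff 0 a n x)" for x
  define r2 where "r2 x = \<xi> z x * of_real (cutoff 0 a n x) - (\<Sum>l\<in>L. p l * \<xi> l x)" for x
  have "continuous_on UNIV (cutoff 0 a n)" unfolding cutoff_def[abs_def] bump_def by (intro continuous_intros)
  then have cc: "continuous_on {0..a} (cutoff 0 a n)" by (rule continuous_on_subset) simp
  have "continuous_on {0..a} (\<lambda>x. xi0 z x * of_real (1 - cutoff 0 a n x))"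
    by (intro continuous_intros xi0_cont cc)
  from L2_continuous[OF this] have r1: "r1 \<in> L2 a" by (rule L2_cong) (auto simp: r1_def xi0_def)
  have "continuous_on {0..a} (\<lambda>x. xi0 z x * of_real (cutoff 0 a n x) - (\<Sum>l\<in>L. p l * xi0 l x))"
    by (intro continuous_intros xi0_cont cc)
  from L2_continuous[OF this] have r2: "r2 \<in> L2 a" by (rule L2_cong) (auto simp: r2_def xi0_def)
  have r12: "(\<lambda>x. 1 * r1 x + 1 * r2 x) \<in> L2 a" by (rule L2_lin[OF r1 r2])
  have "(LINT x|Leb. (norm (\<xi> z x - (\<Sum>l\<in>L. p l * \<xi> l x)))\<^sup>2) = (LINT x|Leb. (norm (1 * r1 x + 1 * r2 x))\<^sup>2)"
    by (intro Bochner_Integration.integral_cong refl) (simp add: r1_def r2_def algebra_simps)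
  also have "\<dots> \<le> (LINT x|Leb. 2 * (norm (r1 x))\<^sup>2 + 2 * (norm (r2 x))\<^sup>2)"
  proof (rule integral_mono[OF L2D(2)[OF r12]])
    show "integrable Leb (\<lambda>x. 2 * (norm (r1 x))\<^sup>2 + 2 * (norm (r2 x))\<^sup>2)"
      by (intro Bochner_Integration.integrable_add integrable_mult_right L2D(2) r1 r2)
    fix x
    have "(norm (1 * r1 x + 1 * r2 x))\<^sup>2 \<le> (norm (r1 x) + norm (r2 x))\<^sup>2"
      by (intro power_mono) (auto intro: norm_triangle_ineq)
    also have "\<dots> \<le> 2 * (norm (r1 x))\<^sup>2 + 2 * (norm (r2 x))\<^sup>2"
      using sum_squares_bound[of "norm (r1 x)" "norm (r2 x)"] by (simp add: power2_sum)
    finally show "(norm (1 * r1 x + 1 * r2 x))\<^sup>2 \<le> 2 * (norm (r1 x))\<^sup>2 + 2 * (norm (r2 x))\<^sup>2" .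
  qed
  also have "\<dots> = 2 * (LINT x|Leb. (norm (r1 x))\<^sup>2) + 2 * (LINT x|Leb. (norm (r2 x))\<^sup>2)"
    using L2D(2)[OF r1] L2D(2)[OF r2] by (subst Bochner_Integration.integral_add) auto
  also have "\<dots> < e" using n L(3) unfolding r1_def[abs_def] r2_def[abs_def] by linarith
  finally show ?thesis by (rule that[OF L(1,2)])
qed

text \<open>The remainder of the expansion of \<open>\<xi>\<^sub>z\<close> is orthogonal to the eigenfunctions used, so it is
  at least as small as that of any other linear combination of them.\<close>

lemma expansion_remainder:
  assumes L: "finite L" "L \<subseteq> Z" and L0: "L0 \<subseteq> L"
  shows "(LINT x|Leb. (norm (\<xi> z x - (\<Sum>l\<in>L. K z l / K l l * \<xi> l x)))\<^sup>2) \<le>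
    (LINT x|Leb. (norm (\<xi> z x - (\<Sum>l\<in>L0. p l * \<xi> l x)))\<^sup>2)"
proof -
  define r where "r x = \<xi> z x - (\<Sum>l\<in>L. K z l / K l l * \<xi> l x)" for x
  define c where "c l = K z l / K l l - (if l \<in> L0 then p l else 0)" for l
  define g where "g x = (\<Sum>l\<in>L. c l * \<xi> l x)" for x
  \<comment> \<open>The conjugate of \<open>g\<close> on \<open>{0<..<a}\<close>, written again as a
    combination of the real eigenfunctions so that the orthogonality of \<open>r\<close>
    applies.\<close>
  define g' where "g' x = (\<Sum>l\<in>L. cnj (c l) * \<xi> l x)" for x
  have sL: "(\<lambda>x. \<Sum>l\<in>L. d l * \<xi> l x) \<in> L2 a" for d by (rule L2_sum[OF L(1) xi_L2])
  have r: "r \<in> L2 a"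
    using L2_lin[OF xi_L2 L2_sum[OF L(1) xi_L2], of 1 z "-1" "\<lambda>l. K z l / K l l"] by (simp add: r_def[abs_def])
  have g: "g \<in> L2 a" "g' \<in> L2 a" unfolding g_def[abs_def] g'_def[abs_def] by (rule sL)+
  have orth: "(LINT x|Leb. r x * \<xi> l x) = 0" if l: "l \<in> L" for l
  proof -
    have lZ: "l \<in> Z" using l L by auto
    have i: "integrable Leb (\<lambda>x. \<xi> l' x * \<xi> l x)" for l' by (rule xi_times_integrable[OF xi_L2])
    have "(LINT x|Leb. r x * \<xi> l x) = (LINT x|Leb. \<xi> z x * \<xi> l x - (\<Sum>l'\<in>L. K z l' / K l' l' * (\<xi> l' x * \<xi> l x)))"
      by (intro Bochner_Integration.integral_cong refl) (simp add: r_def left_diff_distrib sum_distrib_right mult.assoc)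
    also have "\<dots> = (LINT x|Leb. \<xi> z x * \<xi> l x) - (\<Sum>l'\<in>L. K z l' / K l' l' * (LINT x|Leb. \<xi> l' x * \<xi> l x))"
      using i by (subst Bochner_Integration.integral_diff) (auto simp: Bochner_Integration.integral_sum)
    also have "(\<Sum>l'\<in>L. K z l' / K l' l' * (LINT x|Leb. \<xi> l' x * \<xi> l x)) = (\<Sum>l'\<in>L. if l' = l then K z l else 0)"
    proof (intro sum.cong refl)
      fix l' assume l': "l' \<in> L"
      then have lZ': "l' \<in> Z" using L by auto
      have e: "(LINT x|Leb. \<xi> l' x * \<xi> l x) = of_real (ip a (ev l') (ev l))"
        using kernel_eigen[OF lZ' lZ] unfolding kernel_eq[OF lZ] .
      show "K z l' / K l' l' * (LINT x|Leb. \<xi> l' x * \<xi> l x) = (if l' = l then K z l else 0)"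
      proof (cases "l' = l")
        case True
        have "ip a (ev l) (ev l) \<noteq> 0" using ev_pos[OF Z_real[OF lZ]] by simp
        then show ?thesis unfolding e using True by (simp add: kernel_eigen[OF lZ lZ])
      next
        case False
        then show ?thesis by (simp add: e ev_orthogonal[OF lZ' lZ False])
      qed
    qed
    also have "\<dots> = K z l" using L(1) l by simp
    finally show ?thesis by (simp add: kernel_eq[OF lZ])
  qed
  have cg: "cnj (g x) = g' x" if "x \<in> {0<..<a}" for x
  proof -
    have "cnj (\<xi> l x) = \<xi> l x" if "l \<in> L" for l
      using xi_real(1)[OF Z_real, of l x] \<open>x \<in> {0<..<a}\<close> that L by auto
    then show ?thesis by (simp add: g_def g'_def)
  qed
  have rg0: "(LINT x|Leb. r x * g' x) = 0"
  proof -
    have "(LINT x|Leb. r x * g' x) = (LINT x|Leb. (\<Sum>l\<in>L. cnj (c l) * (r x * \<xi> l x)))"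
      by (intro Bochner_Integration.integral_cong refl) (simp add: g'_def sum_distrib_left mult_ac)
    also have "\<dots> = (\<Sum>l\<in>L. cnj (c l) * (LINT x|Leb. r x * \<xi> l x))"
      using L2_mult_integrable[OF r xi_L2] by (subst Bochner_Integration.integral_sum) auto
    also have "\<dots> = 0" using orth by simp
    finally show ?thesis .
  qed
  have irg: "integrable Leb (\<lambda>x. r x * g' x)" by (rule L2_mult_integrable[OF r g(2)])
  \<comment> \<open>Pythagoras: the competing remainder is \<open>r + g\<close>, and the cross term
    vanishes.\<close>
  have "(LINT x|Leb. (norm (r x))\<^sup>2) \<le> (LINT x|Leb. (norm (r x))\<^sup>2) + (LINT x|Leb. (norm (g x))\<^sup>2)"
    by (simp add: Bochner_Integration.integral_nonneg)
  also have "\<dots> = (LINT x|Leb. (norm (r x))\<^sup>2) + 2 * Re (LINT x|Leb. r x * g' x) + (LINT x|Leb. (norm (g x))\<^sup>2)"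
    by (simp add: rg0)
  also have "\<dots> = (LINT x|Leb. (norm (r x))\<^sup>2 + 2 * Re (r x * g' x) + (norm (g x))\<^sup>2)"
  proof -
    have iR: "integrable Leb (\<lambda>x. 2 * Re (r x * g' x))" using irg by (intro integrable_mult_right integrable_Re)
    have "(LINT x|Leb. (norm (r x))\<^sup>2 + 2 * Re (r x * g' x) + (norm (g x))\<^sup>2) =
        (LINT x|Leb. (norm (r x))\<^sup>2) + (LINT x|Leb. 2 * Re (r x * g' x)) + (LINT x|Leb. (norm (g x))\<^sup>2)"
      using L2D(2)[OF r] L2D(2)[OF g(1)] iR
      by (simp only: Bochner_Integration.integral_add Bochner_Integration.integrable_add)
    also have "(LINT x|Leb. 2 * Re (r x * g' x)) = 2 * Re (LINT x|Leb. r x * g' x)"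
      using irg by (simp only: integral_mult_right_zero integral_Re)
    finally show ?thesis by simp
  qed
  also have "\<dots> = (LINT x|Leb. (norm (\<xi> z x - (\<Sum>l\<in>L0. p l * \<xi> l x)))\<^sup>2)"
  proof (intro Bochner_Integration.integral_cong refl)
    fix x assume "x \<in> space Leb"
    then have x: "x \<in> {0<..<a}" by simp
    have fL0: "(\<Sum>l\<in>L. (if l \<in> L0 then p l else 0) * \<xi> l x) = (\<Sum>l\<in>L0. p l * \<xi> l x)"
      using L(1) L0 by (intro sum.mono_neutral_cong_right) auto
    have "r x + g x = \<xi> z x - (\<Sum>l\<in>L0. p l * \<xi> l x)"
      unfolding fL0[symmetric] by (simp add: r_def g_def c_def left_diff_distrib sum_subtractf)
    moreover have "(norm (r x + g x))\<^sup>2 = (norm (r x))\<^sup>2 + 2 * Re (r x * cnj (g x)) + (norm (g x))\<^sup>2"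
      unfolding cmod_power2 by (simp add: power2_eq_square algebra_simps)
    ultimately show "(norm (r x))\<^sup>2 + 2 * Re (r x * g' x) + (norm (g x))\<^sup>2 = (norm (\<xi> z x - (\<Sum>l\<in>L0. p l * \<xi> l x)))\<^sup>2"
      by (simp only: cg[OF x])
  qed
  finally show ?thesis by (simp add: r_def)
qed

text \<open>The error of a partial sum is the pairing of \<open>\<phi>\<close> with the remainder of
  the expansion of \<open>\<xi> z\<close>. Optimality of the expansion keeps this remainder small
  for every finite \<open>L\<close> that contains \<open>L0\<close>, which is what convergence of
  the unordered sum requires.\<close>

theorem sampling_formula:
  assumes \<phi>: "\<phi> \<in> L2 a"
  shows "(sampling_term \<xi> a (transform \<xi> a \<phi>) z has_sum transform \<xi> a \<phi> z) Z"
  unfolding has_sum_def tendsto_iff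
proof (intro allI impI)
  fix e :: real assume e: "0 < e"
  define N where "N = (LINT x|Leb. (norm (\<phi> x))\<^sup>2)"
  have N0: "0 \<le> N" unfolding N_def by (intro Bochner_Integration.integral_nonneg) simp
  \<comment> \<open>Cauchy-Schwarz multiplies the squared remainder by \<open>N\<close>; the summand
    \<open>1\<close> covers \<open>N = 0\<close>.\<close>
  define e' where "e' = e\<^sup>2 / (N + 1)"
  have e': "0 < e'" unfolding e'_def using e N0 by (intro divide_pos_pos) auto
  obtain L0 p where L0: "finite L0" "L0 \<subseteq> Z" "(LINT x|Leb. (norm (\<xi> z x - (\<Sum>l\<in>L0. p l * \<xi> l x)))\<^sup>2) < e'"
    by (rule xi_approx[OF e', where z = z]) blast
  have "dist (sum (sampling_term \<xi> a (transform \<xi> a \<phi>) z) L) (transform \<xi> a \<phi> z) < e"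
    if L: "finite L" "L0 \<subseteq> L" "L \<subseteq> Z" for L
  proof -
    define r where "r x = \<xi> z x - (\<Sum>l\<in>L. K z l / K l l * \<xi> l x)" for x
    have r: "r \<in> L2 a"
      using L2_lin[OF xi_L2 L2_sum[OF L(1) xi_L2], of 1 z "-1" "\<lambda>l. K z l / K l l"] by (simp add: r_def[abs_def])
    have rb: "(LINT x|Leb. (norm (r x))\<^sup>2) < e'"
      using expansion_remainder[OF L(1,3,2), of z p] L0(3) by (simp add: r_def)
    have "(LINT x|Leb. r x * \<phi> x) = (LINT x|Leb. \<xi> z x * \<phi> x - (\<Sum>l\<in>L. K z l / K l l * (\<xi> l x * \<phi> x)))"
      by (intro Bochner_Integration.integral_cong refl) (simp add: r_def left_diff_distrib sum_distrib_right mult.assoc)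
    also have "\<dots> = transform \<xi> a \<phi> z - sum (sampling_term \<xi> a (transform \<xi> a \<phi>) z) L"
      using xi_times_integrable[OF \<phi>]
      by (subst Bochner_Integration.integral_diff) (auto simp: Bochner_Integration.integral_sum transform_def sampling_term_def)
    finally have eq: "transform \<xi> a \<phi> z - sum (sampling_term \<xi> a (transform \<xi> a \<phi>) z) L = (LINT x|Leb. r x * \<phi> x)" by simp
    have "(norm (LINT x|Leb. r x * \<phi> x))\<^sup>2 \<le> (LINT x|Leb. (norm (r x))\<^sup>2) * N"
      unfolding N_def by (rule lebesgue_cauchy_schwarz(2)[OF L2D[OF r] L2D[OF \<phi>]])
    also have "\<dots> \<le> e' * N" using rb N0 by (intro mult_right_mono) auto
    also have "\<dots> < e\<^sup>2" using e N0 by (simp add: e'_def field_simps)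
    finally have "norm (LINT x|Leb. r x * \<phi> x) < e" using e by (intro power2_less_imp_less[of _ e]) auto
    then show ?thesis unfolding eq[symmetric] by (simp add: dist_norm norm_minus_commute)
  qed
  then show "\<forall>\<^sub>F L in finite_subsets_at_top Z. dist (sum (sampling_term \<xi> a (transform \<xi> a \<phi>) z) L) (transform \<xi> a \<phi> z) < e"
    unfolding eventually_finite_subsets_at_top using L0(1,2) by (intro exI[of _ L0]) auto
qed

section \<open>The contribution of the interval from \<open>a\<close> to \<open>b\<close>\<close>

lemma xi0_cont_b: "continuous_on {0..b} (xi0 z)"
proof -
  have sub: "{a..b} \<subseteq> {0<..b}" using a by auto
  have "continuous_on {0<..b} (\<xi> z)" by (rule continuous_on_vector_derivative[OF xi_deriv])
  then have "continuous_on {a..b} (\<xi> z)" by (rule continuous_on_subset[OF _ sub])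
  then have "continuous_on {a..b} (xi0 z)"
    by (rule continuous_on_eq) (use a in \<open>auto simp: xi0_def\<close>)
  then have "continuous_on ({0..a} \<union> {a..b}) (xi0 z)"
    by (intro continuous_on_closed_Un xi0_cont) auto
  moreover have "{0..a} \<union> {a..b} = {0..b}" using a ab by auto
  ultimately show ?thesis by simp
qed

lemma transform_split:
  assumes \<psi>: "\<psi> \<in> L2 b"
  shows "\<psi> \<in> L2 a" "\<psi> absolutely_integrable_on {a..b}" "(\<lambda>x. \<xi> z x * \<psi> x) integrable_on {a..b}"
    "transform \<xi> b \<psi> z = transform \<xi> a \<psi> z + integral {a..b} (\<lambda>x. \<xi> z x * \<psi> x)"
proof -
  have sub: "{0<..<a} \<subseteq> {0<..<b}" using ab by auto
  show \<psi>a: "\<psi> \<in> L2 a"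
    unfolding L2_def
  proof (intro CollectI conjI)
    show "\<psi> \<in> borel_measurable Leb" by (rule measurable_restrict_mono[OF L2D(1)[OF \<psi>] sub])
    have "(\<lambda>x. (norm (\<psi> x))\<^sup>2) absolutely_integrable_on {0<..<a}"
      by (rule set_integrable_subset[OF integrable_interior_imp_absolutely_integrable[OF L2D(2)[OF \<psi>]]]) (use ab in auto)
    then show "integrable Leb (\<lambda>x. (norm (\<psi> x))\<^sup>2)" by (rule absolutely_integrable_imp_integrable) simp
  qed
  show "\<psi> absolutely_integrable_on {a..b}"
    by (rule set_integrable_subset[OF integrable_interior_imp_absolutely_integrable[OF L2_integrable[OF \<psi>]]]) (use a in auto)
  have xb: "\<xi> z \<in> L2 b" by (rule L2_cong[OF L2_continuous[OF xi0_cont_b[of z]]]) (auto simp: xi0_def)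
  have i: "integrable (lebesgue_on {0<..<b}) (\<lambda>x. \<xi> z x * \<psi> x)"
    by (rule lebesgue_cauchy_schwarz(1)) (use L2D[OF xb] L2D[OF \<psi>] in auto)
  have ib: "(\<lambda>x. \<xi> z x * \<psi> x) integrable_on {0..b}"
    using integrable_interior_imp_absolutely_integrable[OF i] by (simp add: absolutely_integrable_on_def)
  show "(\<lambda>x. \<xi> z x * \<psi> x) integrable_on {a..b}"
    by (rule integrable_subinterval_real[OF ib]) (use a in auto)
  have "transform \<xi> b \<psi> z = integral {0..b} (\<lambda>x. \<xi> z x * \<psi> x)"
    unfolding transform_def using lebesgue_integral_eq_integral[OF i] by (simp add: integral_open_interval_real)
  moreover have "transform \<xi> a \<psi> z = integral {0..a} (\<lambda>x. \<xi> z x * \<psi> x)"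
    unfolding transform_def using lebesgue_integral_eq_integral[OF xi_times_integrable[OF \<psi>a]] by (simp add: integral_open_interval_real)
  moreover have "integral {0..a} (\<lambda>x. \<xi> z x * \<psi> x) + integral {a..b} (\<lambda>x. \<xi> z x * \<psi> x) = integral {0..b} (\<lambda>x. \<xi> z x * \<psi> x)"
    using a ab by (intro Henstock_Kurzweil_Integration.integral_combine ib) auto
  ultimately show "transform \<xi> b \<psi> z = transform \<xi> a \<psi> z + integral {a..b} (\<lambda>x. \<xi> z x * \<psi> x)" by simp
qed

lemma xi_ext_summable:
  assumes "x \<in> {a..b}"
  shows "sampling_term \<xi> a (\<lambda>l. \<xi> l x) z summable_on Z"
proof -
  obtain M where M: "0 < M" "\<And>l x. l \<in> Z \<Longrightarrow> x \<in> {a..b} \<Longrightarrow> norm (\<xi> l x) \<le> M * \<bar>ev l a\<bar>"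
    by (rule eigenfunction_continuation_bound) blast
  show ?thesis
    by (rule summable_by_weight[where c = M and z = z]) (intro sampling_term_bound M(2) assms)
qed

text \<open>The tail of the single series \<open>weight\<close> dominates the remainder for all
  \<open>x\<close> at once; this uniformity is what lets sum and integral be interchanged.\<close>

lemma xi_ext_remainder:
  obtains M where "0 < M" "\<And>l x. l \<in> Z \<Longrightarrow> x \<in> {a..b} \<Longrightarrow> norm (\<xi> l x) \<le> M * \<bar>ev l a\<bar>"
    "\<And>L x. finite L \<Longrightarrow> L \<subseteq> Z \<Longrightarrow> x \<in> {a..b} \<Longrightarrow>
      norm (xi_ext \<xi> a Z z x - (\<Sum>l\<in>L. sampling_term \<xi> a (\<lambda>l. \<xi> l x) z l)) \<le> M * (infsum (weight z) Z - sum (weight z) L)"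
proof -
  obtain M where M: "0 < M" "\<And>l x. l \<in> Z \<Longrightarrow> x \<in> {a..b} \<Longrightarrow> norm (\<xi> l x) \<le> M * \<bar>ev l a\<bar>"
    by (rule eigenfunction_continuation_bound) blast
  show ?thesis
  proof (rule that[OF M])
    fix L x assume L: "finite L" "L \<subseteq> Z" and x: "x \<in> {a..b}"
    let ?f = "sampling_term \<xi> a (\<lambda>l. \<xi> l x) z"
    have s: "?f summable_on Z" by (rule xi_ext_summable[OF x])
    have wD: "(\<lambda>l. M * weight z l) summable_on (Z - L)"
      by (intro summable_on_cmult_right summable_on_subset_banach[OF weight_summable]) auto
    have b: "norm (?f l) \<le> M * weight z l" if "l \<in> Z - L" for l
      using that by (intro sampling_term_bound M(2) x) auto
    have "xi_ext \<xi> a Z z x - sum ?f L = infsum ?f (Z - L)"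
      unfolding xi_ext_def sampling_sum_def using infsum_Diff[OF s summable_on_finite[OF L(1)] L(2)] L(1) by simp
    also have "norm \<dots> \<le> infsum (\<lambda>l. M * weight z l) (Z - L)"
      by (rule norm_infsum_le[OF has_sum_infsum has_sum_infsum b])
        (use wD summable_on_subset_banach[OF s, of "Z - L"] in auto)
    also have "\<dots> = M * infsum (weight z) (Z - L)" by (rule infsum_cmult_right')
    also have "infsum (weight z) (Z - L) = infsum (weight z) Z - sum (weight z) L"
      using infsum_Diff[OF weight_summable summable_on_finite[OF L(1)] L(2)] L(1) by simp
    finally show "norm (xi_ext \<xi> a Z z x - sum ?f L) \<le> M * (infsum (weight z) Z - sum (weight z) L)" .
  qed
qed

text \<open>Gives the supremum in \<open>h_bound\<close> its meaning: every value of the deviation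
  then lies below it.\<close>

lemma xi_ext_bdd: "bdd_above ((\<lambda>x. norm (xi_ext \<xi> a Z z x - \<xi> z x)) ` {a..b})"
proof -
  obtain M where M: "0 < M" "\<And>l x. l \<in> Z \<Longrightarrow> x \<in> {a..b} \<Longrightarrow> norm (\<xi> l x) \<le> M * \<bar>ev l a\<bar>"
    "\<And>L x. finite L \<Longrightarrow> L \<subseteq> Z \<Longrightarrow> x \<in> {a..b} \<Longrightarrow>
      norm (xi_ext \<xi> a Z z x - (\<Sum>l\<in>L. sampling_term \<xi> a (\<lambda>l. \<xi> l x) z l)) \<le> M * (infsum (weight z) Z - sum (weight z) L)"
    by (rule xi_ext_remainder[where z = z]) blast
  obtain B where B: "0 < B" "\<And>x. x \<in> {0..b} \<Longrightarrow> norm (xi0 z x) \<le> B"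
    using continuous_on_Icc_bounded[OF xi0_cont_b] by blast
  show ?thesis
  proof (intro bdd_aboveI2)
    fix x assume x: "x \<in> {a..b}"
    have "norm (xi_ext \<xi> a Z z x) \<le> M * infsum (weight z) Z" using M(3)[of "{}" x] x by simp
    moreover have "norm (\<xi> z x) \<le> B" using B(2)[of x] x a by (auto simp: xi0_def)
    ultimately show "norm (xi_ext \<xi> a Z z x - \<xi> z x) \<le> M * infsum (weight z) Z + B"
      using norm_triangle_ineq4[of "xi_ext \<xi> a Z z x" "\<xi> z x"] by linarith
  qed
qed

text \<open>The sampling formula reproduces the part of \<open>\<psi>\<close> on
  \<open>(0, a)\<close> exactly. For the rest the bound is shown for finite partial sums, with the
  tail of \<open>weight\<close> as error, and then passed to the limit along the finite subsets of
  \<open>Z\<close>.\<close>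

lemma oversampled_estimate:
  assumes \<psi>: "\<psi> \<in> L2 b"
  shows "sampling_term \<xi> a (transform \<xi> b \<psi>) z summable_on Z"
    "norm (transform \<xi> b \<psi> z - sampling_sum \<xi> a Z (transform \<xi> b \<psi>) z)
      \<le> h_bound \<xi> a b Z z * (LINT x|lebesgue_on {a..b}. norm (\<psi> x))"
proof -
  obtain M where M: "0 < M" "\<And>l x. l \<in> Z \<Longrightarrow> x \<in> {a..b} \<Longrightarrow> norm (\<xi> l x) \<le> M * \<bar>ev l a\<bar>"
    "\<And>L x. finite L \<Longrightarrow> L \<subseteq> Z \<Longrightarrow> x \<in> {a..b} \<Longrightarrow>
      norm (xi_ext \<xi> a Z z x - (\<Sum>l\<in>L. sampling_term \<xi> a (\<lambda>l. \<xi> l x) z l)) \<le> M * (infsum (weight z) Z - sum (weight z) L)"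
    by (rule xi_ext_remainder[where z = z]) blast
  note sp = transform_split[OF \<psi>]
  define I where "I = (LINT x|lebesgue_on {a..b}. norm (\<psi> x))"
  have n\<psi>: "(\<lambda>x. norm (\<psi> x)) integrable_on {a..b}" using sp(2) by (simp add: absolutely_integrable_on_def)
  have "integrable (lebesgue_on {a..b}) (\<lambda>x. norm (\<psi> x))"
    by (intro integrable_norm absolutely_integrable_imp_integrable sp(2)) simp
  from lebesgue_integral_eq_integral[OF this] have I: "I = integral {a..b} (\<lambda>x. norm (\<psi> x))" by (simp add: I_def)
  define F1 where "F1 = transform \<xi> a \<psi>"
  define F2 where "F2 w = integral {a..b} (\<lambda>x. \<xi> w x * \<psi> x)" for w
  have F: "transform \<xi> b \<psi> w = F1 w + F2 w" for w using sp(4) by (simp add: F1_def F2_def)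
  have ib: "norm (integral {a..b} (\<lambda>x. f x * \<psi> x)) \<le> c * I"
    if "(\<lambda>x. f x * \<psi> x) integrable_on {a..b}" "\<And>x. x \<in> {a..b} \<Longrightarrow> norm (f x) \<le> c" for f c
  proof -
    have "norm (integral {a..b} (\<lambda>x. f x * \<psi> x)) \<le> integral {a..b} (\<lambda>x. c * norm (\<psi> x))"
      by (rule Henstock_Kurzweil_Integration.integral_norm_bound_integral[OF that(1) integrable_on_mult_right[OF n\<psi>]])
        (use that(2) in \<open>simp add: norm_mult mult_right_mono\<close>)
    then show ?thesis by (simp add: I)
  qed
  have s1: "(sampling_term \<xi> a F1 z has_sum F1 z) Z" unfolding F1_def by (rule sampling_formula[OF sp(1)])
  have s2: "sampling_term \<xi> a F2 z summable_on Z"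
  proof (rule summable_by_weight[where c = "M * I" and z = z])
    fix l assume l: "l \<in> Z"
    have "norm (F2 l) \<le> (M * \<bar>ev l a\<bar>) * I" unfolding F2_def by (rule ib[OF sp(3) M(2)[OF l]])
    then show "norm (sampling_term \<xi> a F2 z l) \<le> M * I * weight z l"
      by (intro sampling_term_bound l) (simp add: mult_ac)
  qed
  have st: "sampling_term \<xi> a (transform \<xi> b \<psi>) z = (\<lambda>l. sampling_term \<xi> a F1 z l + sampling_term \<xi> a F2 z l)"
    by (rule ext) (simp add: sampling_term_def F distrib_left add_divide_distrib)
  show "sampling_term \<xi> a (transform \<xi> b \<psi>) z summable_on Z"
    unfolding st by (intro summable_on_add s2 has_sum_imp_summable[OF s1])
  have "(sampling_term \<xi> a (transform \<xi> b \<psi>) z has_sum (F1 z + infsum (sampling_term \<xi> a F2 z) Z)) Z"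
    unfolding st by (intro has_sum_add s1 has_sum_infsum s2)
  then have "sampling_sum \<xi> a Z (transform \<xi> b \<psi>) z = F1 z + infsum (sampling_term \<xi> a F2 z) Z"
    unfolding sampling_sum_def by (rule infsumI)
  then have eq: "transform \<xi> b \<psi> z - sampling_sum \<xi> a Z (transform \<xi> b \<psi>) z = F2 z - infsum (sampling_term \<xi> a F2 z) Z"
    by (simp add: F)
  define h where "h = h_bound \<xi> a b Z z"
  have h: "norm (xi_ext \<xi> a Z z x - \<xi> z x) \<le> h" if "x \<in> {a..b}" for x
    unfolding h_def h_bound_def by (rule cSUP_upper[OF that xi_ext_bdd])
  \<comment> \<open>Finite sums are integrated term by term; replacing the partial sum by
    \<open>xi_ext\<close> under the norm costs the tail of \<open>weight\<close>, uniformly in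
    \<open>x\<close>.\<close>
  have part: "norm (F2 z - sum (sampling_term \<xi> a F2 z) L) \<le> (h + M * (infsum (weight z) Z - sum (weight z) L)) * I"
    if L: "finite L" "L \<subseteq> Z" for L
  proof -
    define f where "f x = \<xi> z x - (\<Sum>l\<in>L. sampling_term \<xi> a (\<lambda>l. \<xi> l x) z l)" for x
    have "sum (sampling_term \<xi> a F2 z) L = (\<Sum>l\<in>L. integral {a..b} (\<lambda>x. K z l / K l l * (\<xi> l x * \<psi> x)))"
      by (simp add: sampling_term_def F2_def)
    also have "\<dots> = integral {a..b} (\<lambda>x. \<Sum>l\<in>L. K z l / K l l * (\<xi> l x * \<psi> x))"
      by (intro Henstock_Kurzweil_Integration.integral_sum[symmetric] L(1) integrable_on_mult_right sp(3))
    finally have e: "sum (sampling_term \<xi> a F2 z) L = integral {a..b} (\<lambda>x. \<Sum>l\<in>L. K z l / K l l * (\<xi> l x * \<psi> x))" .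
    have i: "(\<lambda>x. \<Sum>l\<in>L. K z l / K l l * (\<xi> l x * \<psi> x)) integrable_on {a..b}"
      by (intro Henstock_Kurzweil_Integration.integrable_sum L(1) integrable_on_mult_right sp(3))
    have ff: "(\<lambda>x. f x * \<psi> x) = (\<lambda>x. \<xi> z x * \<psi> x - (\<Sum>l\<in>L. K z l / K l l * (\<xi> l x * \<psi> x)))"
      by (auto simp: f_def sampling_term_def left_diff_distrib sum_distrib_right mult.assoc)
    have fi: "(\<lambda>x. f x * \<psi> x) integrable_on {a..b}"
      unfolding ff by (rule Henstock_Kurzweil_Integration.integrable_diff[OF sp(3) i])
    have "F2 z - sum (sampling_term \<xi> a F2 z) L = integral {a..b} (\<lambda>x. f x * \<psi> x)"
      unfolding e ff F2_def by (rule Henstock_Kurzweil_Integration.integral_diff[symmetric, OF sp(3) i])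
    moreover have "norm (f x) \<le> h + M * (infsum (weight z) Z - sum (weight z) L)" if x: "x \<in> {a..b}" for x
    proof -
      have "f x = - (xi_ext \<xi> a Z z x - \<xi> z x) + (xi_ext \<xi> a Z z x - (\<Sum>l\<in>L. sampling_term \<xi> a (\<lambda>l. \<xi> l x) z l))"
        by (simp add: f_def)
      then have "norm (f x) \<le> norm (xi_ext \<xi> a Z z x - \<xi> z x) + norm (xi_ext \<xi> a Z z x - (\<Sum>l\<in>L. sampling_term \<xi> a (\<lambda>l. \<xi> l x) z l))"
        by (metis norm_minus_cancel norm_triangle_ineq)
      then show ?thesis using h[OF x] M(3)[OF L x] by linarith
    qed
    ultimately show ?thesis using ib[OF fi] by simp
  qed
  have "norm (F2 z - infsum (sampling_term \<xi> a F2 z) Z) \<le> (h + M * (infsum (weight z) Z - infsum (weight z) Z)) * I"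
  proof (rule tendsto_le[OF finite_subsets_at_top_neq_bot])
    show "((\<lambda>L. (h + M * (infsum (weight z) Z - sum (weight z) L)) * I) \<longlongrightarrow> (h + M * (infsum (weight z) Z - infsum (weight z) Z)) * I) (finite_subsets_at_top Z)"
      by (intro tendsto_intros infsum_tendsto weight_summable)
    show "((\<lambda>L. norm (F2 z - sum (sampling_term \<xi> a F2 z) L)) \<longlongrightarrow> norm (F2 z - infsum (sampling_term \<xi> a F2 z) Z)) (finite_subsets_at_top Z)"
      by (intro tendsto_intros infsum_tendsto s2)
    show "\<forall>\<^sub>F L in finite_subsets_at_top Z. norm (F2 z - sum (sampling_term \<xi> a F2 z) L) \<le> (h + M * (infsum (weight z) Z - sum (weight z) L)) * I"
      unfolding eventually_finite_subsets_at_top using part by (intro exI[of _ "{}"]) auto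
  qed
  then show "norm (transform \<xi> b \<psi> z - sampling_sum \<xi> a Z (transform \<xi> b \<psi>) z)
      \<le> h_bound \<xi> a b Z z * (LINT x|lebesgue_on {a..b}. norm (\<psi> x))"
    unfolding eq by (simp add: h_def I_def)
qed

end

subsection \<open>Asymptotics at the singular end point\<close>

text \<open>The Taylor coefficients of the entire function that continues
  \<open>w powr (- \<nu> / 2)\<close> times the Bessel function of order \<open>\<nu>\<close> at
  \<open>2 * sqrt w\<close>.\<close>

definition bessel_coeff :: "real \<Rightarrow> nat \<Rightarrow> complex" where
  "bessel_coeff \<nu> n = (-1) ^ n / (fact n * of_real (Gamma (\<nu> + real n + 1)))"

definition bessel_series :: "real \<Rightarrow> complex \<Rightarrow> complex" where
  "bessel_series \<nu> w = (\<Sum>n. bessel_coeff \<nu> n * w ^ n)"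

text \<open>The values \<open>Gamma (\<nu> + n + 1)\<close> increase with \<open>n\<close>, so a
  multiple of the exponential series is a majorant.\<close>

lemma bessel_coeff_summable:
  assumes "0 < \<nu>"
  shows "summable (\<lambda>n. bessel_coeff \<nu> n * w ^ n)"
proof (rule summable_comparison_test')
  have "(\<lambda>n. norm w ^ n /\<^sub>R fact n) sums exp (norm w)" by (rule exp_converges)
  then show "summable (\<lambda>n. (1 / Gamma (\<nu> + 1)) * (norm w ^ n /\<^sub>R fact n))"
    by (intro summable_mult sums_summable)
  have G: "0 < Gamma (\<nu> + 1)" using assms by (intro Gamma_real_pos) simp
  have Gamma_mono: "Gamma (\<nu> + 1) \<le> Gamma (\<nu> + real n + 1)" for n
  proof (induction n)
    case (Suc n)
    have pos: "0 < Gamma (\<nu> + real n + 1)" using assms by (intro Gamma_real_pos) simp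
    have ne: "\<nu> + real n + 1 \<notin> \<int>\<^sub>\<le>\<^sub>0" using assms by (auto elim!: nonpos_Ints_cases)
    have "Gamma (\<nu> + real n + 1 + 1) = (\<nu> + real n + 1) * Gamma (\<nu> + real n + 1)"
      by (rule Gamma_plus1[OF ne])
    moreover have "1 * Gamma (\<nu> + real n + 1) \<le> (\<nu> + real n + 1) * Gamma (\<nu> + real n + 1)"
      using pos assms by (intro mult_right_mono) auto
    ultimately show ?case using Suc by (simp add: add_ac)
  qed simp
  fix n
  have "norm (bessel_coeff \<nu> n) = 1 / (fact n * \<bar>Gamma (\<nu> + real n + 1)\<bar>)"
    by (simp add: bessel_coeff_def norm_divide norm_mult norm_power)
  also have "\<dots> \<le> 1 / (fact n * Gamma (\<nu> + 1))"
    using Gamma_mono[of n] G by (intro divide_left_mono mult_left_mono mult_pos_pos) auto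
  finally have "norm (bessel_coeff \<nu> n) * norm w ^ n \<le> 1 / (fact n * Gamma (\<nu> + 1)) * norm w ^ n"
    by (rule mult_right_mono) simp
  then show "norm (bessel_coeff \<nu> n * w ^ n) \<le> (1 / Gamma (\<nu> + 1)) * (norm w ^ n /\<^sub>R fact n)"
    by (simp add: norm_mult norm_power divide_inverse mult_ac)
qed

lemma bessel_series_0: "bessel_series \<nu> 0 = of_real (1 / Gamma (\<nu> + 1))"
  unfolding bessel_series_def by (subst suminf_finite[of "{0}"]) (auto simp: bessel_coeff_def)

lemma bessel_series_derivative:
  assumes "0 < \<nu>"
  obtains G' where "\<And>w. (bessel_series \<nu> has_field_derivative G' w) (at w)" "isCont G' 0"
proof -
  note s = bessel_coeff_summable[OF assms]
  define G' where "G' w = (\<Sum>n. diffs (bessel_coeff \<nu>) n * w ^ n)" for w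
  show ?thesis
  proof (rule that)
    show "(bessel_series \<nu> has_field_derivative G' w) (at w)" for w
      unfolding bessel_series_def[abs_def] G'_def by (rule termdiffs_strong_converges_everywhere[OF s])
    show "isCont G' 0"
      unfolding G'_def[abs_def]
      by (rule DERIV_isCont[OF termdiffs_strong_converges_everywhere[OF termdiff_converges_all[OF s]]])
  qed
qed

text \<open>The coefficient of \<open>x powr (\<nu> + 1/2)\<close> in
  \<open>sqrt (pi * x / 2) * (x / 2) powr \<nu>\<close>.\<close>

definition bessel_const :: "real \<Rightarrow> real" where
  "bessel_const \<nu> = sqrt (pi / 2) * (1 / 2) powr \<nu>"

lemma xi_free_bessel_series:
  assumes "0 < x"
  shows "xi_free \<nu> z x = of_real (bessel_const \<nu> * x powr (\<nu> + 1/2)) * bessel_series \<nu> (of_real ((x / 2)\<^sup>2) * z)"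
proof -
  have "sqrt (pi * x / 2) = sqrt (pi / 2) * sqrt x" by (simp add: real_sqrt_mult[symmetric])
  moreover have "(x / 2) powr \<nu> = (1 / 2) powr \<nu> * x powr \<nu>"
    using assms powr_mult[of "1/2" x \<nu>] by simp
  ultimately have c: "sqrt (pi * x / 2) * (x / 2) powr \<nu> = bessel_const \<nu> * x powr (\<nu> + 1/2)"
    using assms by (simp only: bessel_const_def powr_add powr_half_sqrt less_imp_le mult_ac)
  have "bessel_coeff \<nu> n * (of_real ((x / 2)\<^sup>2) * z) ^ n =
      (-1) ^ n / (fact n * of_real (Gamma (\<nu> + real n + 1))) * of_real ((x / 2) ^ (2 * n)) * z ^ n" for n
    by (simp add: bessel_coeff_def power_mult_distrib power_mult)
  then show ?thesis unfolding xi_free_series[OF assms] c bessel_series_def by simp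
qed

lemma eventually_at_right_0_Ioo: "0 < b \<Longrightarrow> \<forall>\<^sub>F x in at_right 0. 0 < x \<and> x < (b::real)"
  by (auto simp: eventually_at_right_field)

text \<open>\<open>xi_free\<close> is a constant times \<open>x powr (\<nu> + 1/2)\<close> times an
  entire function of \<open>x\<^sup>2 * z / 4\<close> with value
  \<open>1 / Gamma (\<nu> + 1)\<close> at \<open>0\<close>; the leading order of the derivative
  follows from the product rule.\<close>

lemma xi_free_limits:
  assumes nu: "0 < \<nu>" and b: "0 < b"
  defines "c0 \<equiv> bessel_const \<nu> / Gamma (\<nu> + 1)"
  shows "((\<lambda>x. xi_free \<nu> z x / of_real (x powr (\<nu> + 1/2))) \<longlongrightarrow> of_real c0) (at_right 0)"
    "((\<lambda>x. dx b (xi_free \<nu> z) x / of_real (x powr (\<nu> - 1/2))) \<longlongrightarrow> of_real ((\<nu> + 1/2) * c0)) (at_right 0)"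
proof -
  define k where "k = \<nu> + 1/2"
  define c where "c = bessel_const \<nu>"
  obtain G' where G': "\<And>w. (bessel_series \<nu> has_field_derivative G' w) (at w)" "isCont G' 0"
    by (rule bessel_series_derivative[OF nu]) blast
  define w where "w x = of_real ((x / 2)\<^sup>2) * z" for x
  have "((\<lambda>x. of_real ((x / 2)\<^sup>2) * z) \<longlongrightarrow> of_real ((0 / 2)\<^sup>2) * z) (at_right 0)"
    by (intro tendsto_intros) simp
  then have w0: "(w \<longlongrightarrow> 0) (at_right 0)" by (simp add: w_def[abs_def])
  have Gl: "((\<lambda>x. bessel_series \<nu> (w x)) \<longlongrightarrow> of_real (1 / Gamma (\<nu> + 1))) (at_right 0)"
    using isCont_tendsto_compose[OF DERIV_isCont[OF G'(1)] w0] by (simp only: bessel_series_0)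
  have G'l: "((\<lambda>x. G' (w x)) \<longlongrightarrow> G' 0) (at_right 0)"
    by (rule isCont_tendsto_compose[OF G'(2) w0])
  have "((\<lambda>x. of_real c * bessel_series \<nu> (w x)) \<longlongrightarrow> of_real c * of_real (1 / Gamma (\<nu> + 1))) (at_right 0)"
    by (intro tendsto_mult tendsto_const Gl)
  then have "((\<lambda>x. of_real c * bessel_series \<nu> (w x)) \<longlongrightarrow> of_real c0) (at_right 0)" by (simp add: c0_def c_def)
  then show "((\<lambda>x. xi_free \<nu> z x / of_real (x powr (\<nu> + 1/2))) \<longlongrightarrow> of_real c0) (at_right 0)"
  proof (rule Lim_transform_eventually)
    show "\<forall>\<^sub>F x in at_right 0. of_real c * bessel_series \<nu> (w x) = xi_free \<nu> z x / of_real (x powr (\<nu> + 1/2))"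
      using eventually_at_right_0_Ioo[OF b] by eventually_elim (simp add: xi_free_bessel_series c_def w_def)
  qed
  have D: "dx b (xi_free \<nu> z) x = of_real (c * (k * x powr (k - 1))) * bessel_series \<nu> (w x) +
      of_real (c * x powr k) * (of_real (x / 2) * z * G' (w x))" if x: "0 < x" "x < b" for x
  proof -
    have at: "at x within {0<..b} = at x"
      by (rule at_within_interior) (use x in \<open>auto intro!: interiorI[of "{0<..<b}"]\<close>)
    have xb: "x \<in> {0<..b}" using x by auto
    have "((\<lambda>x. c * x powr k) has_real_derivative c * (k * x powr (k - 1))) (at x)"
      by (intro DERIV_cmult has_real_derivative_powr x(1))
    from has_vector_derivative_of_real[OF this]
    have d1: "((\<lambda>x. complex_of_real (c * x powr k)) has_vector_derivative of_real (c * (k * x powr (k - 1)))) (at x)" .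
    have "((\<lambda>x. (x / 2)\<^sup>2) has_real_derivative x / 2) (at x)"
      by (auto intro!: derivative_eq_intros simp: field_simps)
    from has_vector_derivative_mult_left[OF has_vector_derivative_of_real[OF this], of z]
    have d2: "(w has_vector_derivative of_real (x / 2) * z) (at x)" unfolding w_def[abs_def] .
    have d3: "((\<lambda>x. bessel_series \<nu> (w x)) has_vector_derivative of_real (x / 2) * z * G' (w x)) (at x)"
      using field_vector_diff_chain_at[OF d2 G'(1)] by (simp add: o_def)
    have "((\<lambda>x. of_real (c * x powr k) * bessel_series \<nu> (w x)) has_vector_derivative
        of_real (c * x powr k) * (of_real (x / 2) * z * G' (w x)) + of_real (c * (k * x powr (k - 1))) * bessel_series \<nu> (w x))
        (at x within {0<..b})"
      unfolding at by (rule has_vector_derivative_mult[OF d1 d3])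
    then have "(xi_free \<nu> z has_vector_derivative
        of_real (c * x powr k) * (of_real (x / 2) * z * G' (w x)) + of_real (c * (k * x powr (k - 1))) * bessel_series \<nu> (w x))
        (at x within {0<..b})"
      by (rule has_vector_derivative_transform[OF xb, rotated]) (auto simp: xi_free_bessel_series c_def k_def w_def)
    from vector_derivative_within[OF _ this] show ?thesis by (simp add: dx_def at)
  qed
  \<comment> \<open>After division by \<open>x powr (k - 1)\<close>, the term in which the entire
    factor is differentiated still carries \<open>x\<^sup>2\<close> and drops out.\<close>
  have "((\<lambda>x. of_real (c * k) * bessel_series \<nu> (w x) + of_real (c * x) * (of_real (x / 2) * z * G' (w x))) \<longlongrightarrow>
      of_real (c * k) * of_real (1 / Gamma (\<nu> + 1)) + of_real (c * 0) * (of_real (0 / 2) * z * G' 0)) (at_right 0)"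
    by (intro tendsto_intros Gl G'l) simp_all
  then have "((\<lambda>x. of_real (c * k) * bessel_series \<nu> (w x) + of_real (c * x) * (of_real (x / 2) * z * G' (w x))) \<longlongrightarrow>
      of_real ((\<nu> + 1/2) * c0)) (at_right 0)"
    by (simp add: c0_def c_def k_def mult.commute)
  then show "((\<lambda>x. dx b (xi_free \<nu> z) x / of_real (x powr (\<nu> - 1/2))) \<longlongrightarrow> of_real ((\<nu> + 1/2) * c0)) (at_right 0)"
  proof (rule Lim_transform_eventually)
    show "\<forall>\<^sub>F x in at_right 0. of_real (c * k) * bessel_series \<nu> (w x) + of_real (c * x) * (of_real (x / 2) * z * G' (w x)) =
        dx b (xi_free \<nu> z) x / of_real (x powr (\<nu> - 1/2))"
      using eventually_at_right_0_Ioo[OF b]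
    proof eventually_elim
      case (elim x)
      define p where "p = x powr (\<nu> - 1/2)"
      have p: "p \<noteq> 0" using elim by (simp add: p_def)
      have "x powr (\<nu> - 1/2 + 1) = x powr (\<nu> - 1/2) * x powr 1" by (rule powr_add)
      then have e: "x powr (k - 1) = p" "x powr k = x * p"
        using elim by (simp_all add: k_def p_def field_simps)
      show ?case
        unfolding p_def[symmetric] D[OF conjunct1[OF elim] conjunct2[OF elim]] e using p by (simp add: field_simps)
    qed
  qed
qed

text \<open>Divided by \<open>x powr p\<close> the right-hand side is bounded by a constant times
  the integral of \<open>u * |q u|\<close> over \<open>(0, x)\<close>, which tends to
  \<open>0\<close>. The range of \<open>p\<close> admits both exponents \<open>\<nu> + 1/2\<close>
  and \<open>\<nu> - 1/2\<close>; it makes \<open>(1 + s * x) powr (- p)\<close> at most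
  \<open>(1 + s * b) powr (1/2)\<close>.\<close>

lemma remainder_limit:
  fixes f :: "real \<Rightarrow> complex"
  assumes b: "0 < b" and p: "- (1/2) \<le> p" and s: "0 \<le> s" and e: "0 \<le> e"
    and q: "integrable (lebesgue_on {0<..<b}) (\<lambda>u. u * \<bar>q u\<bar>)"
    and f: "\<And>x. x \<in> {0<..b} \<Longrightarrow> norm (f x) \<le> C * (x / (1 + s * x)) powr p * exp (e * x) *
      (LINT u|lebesgue_on {0<..<x}. u * \<bar>q u\<bar> / (1 + s * u))"
  shows "((\<lambda>x. f x / of_real (x powr p)) \<longlongrightarrow> 0) (at_right 0)"
proof -
  define h where "h u = u * \<bar>q u\<bar>" for u
  define J where "J x = integral {0..x} h" for x
  define A where "A = \<bar>C\<bar> * (1 + s * b) powr (1/2) * exp (e * b)"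
  have A: "0 \<le> A" by (simp add: A_def)
  have hb: "h integrable_on {0..b}"
    using integrable_interior_imp_absolutely_integrable[OF q[folded h_def]] by (simp add: absolutely_integrable_on_def)
  have "continuous_on {0..b} J" unfolding J_def[abs_def] by (rule indefinite_integral_continuous_1[OF hb])
  then have "(J \<longlongrightarrow> J 0) (at 0 within {0..b})" using b by (auto simp: continuous_on_def)
  then have J0: "(J \<longlongrightarrow> 0) (at_right 0)" using b by (simp add: J_def at_within_Icc_at_right)
  have bound: "norm (f x / of_real (x powr p)) \<le> A * J x" if x: "0 < x" "x < b" for x
  proof -
    have hx: "integrable (lebesgue_on {0<..<x}) h"
    proof (rule absolutely_integrable_imp_integrable)
      show "h absolutely_integrable_on {0<..<x}"
        by (rule set_integrable_subset[OF integrable_interior_imp_absolutely_integrable[OF q[folded h_def]]]) (use x in auto)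
    qed simp
    have I: "(LINT u|lebesgue_on {0<..<x}. u * \<bar>q u\<bar> / (1 + s * u)) \<le> J x"
    proof -
      have "(LINT u|lebesgue_on {0<..<x}. u * \<bar>q u\<bar> / (1 + s * u)) \<le> (LINT u|lebesgue_on {0<..<x}. h u)"
      proof (rule integral_mono'[OF hx])
        fix u assume "u \<in> space (lebesgue_on {0<..<x})"
        then have u: "0 < u" by simp
        have "h u / (1 + s * u) \<le> h u / 1" using u mult_nonneg_nonneg[OF s, of u] by (intro divide_left_mono) (auto simp: h_def)
        then show "u * \<bar>q u\<bar> / (1 + s * u) \<le> h u" by (simp add: h_def)
        show "0 \<le> h u" using u by (simp add: h_def)
      qed
      also have "\<dots> = J x"
        unfolding J_def using lebesgue_integral_eq_integral[OF hx] by (simp add: integral_open_interval_real)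
      finally show ?thesis .
    qed
    have I0: "0 \<le> (LINT u|lebesgue_on {0<..<x}. u * \<bar>q u\<bar> / (1 + s * u))"
      using s by (intro Bochner_Integration.integral_nonneg) simp
    have sx: "1 \<le> 1 + s * x" using s x by simp
    have "(x / (1 + s * x)) powr p = x powr p * (1 + s * x) powr (- p)"
      using powr_divide[of x "1 + s * x" p] x sx by (simp add: powr_minus_divide)
    also have "(1 + s * x) powr (- p) \<le> (1 + s * x) powr (1/2)" using sx p by (intro powr_mono) auto
    also have "(1 + s * x) powr (1/2) \<le> (1 + s * b) powr (1/2)" using sx s x by (intro powr_mono2) (auto intro: mult_left_mono)
    finally have P: "(x / (1 + s * x)) powr p \<le> x powr p * (1 + s * b) powr (1/2)" by (simp add: mult_left_mono)
    have E: "exp (e * x) \<le> exp (e * b)" using e x by (simp add: mult_left_mono)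
    have "norm (f x) \<le> C * ((x / (1 + s * x)) powr p * exp (e * x) * (LINT u|lebesgue_on {0<..<x}. u * \<bar>q u\<bar> / (1 + s * u)))"
      using f[of x] x by (simp add: mult.assoc)
    also have "\<dots> \<le> \<bar>C\<bar> * ((x / (1 + s * x)) powr p * exp (e * x) * (LINT u|lebesgue_on {0<..<x}. u * \<bar>q u\<bar> / (1 + s * u)))"
      using I0 by (intro mult_right_mono mult_nonneg_nonneg) auto
    also have "\<dots> \<le> \<bar>C\<bar> * (x powr p * (1 + s * b) powr (1/2) * exp (e * b) * J x)"
      using I0 I E P by (intro mult_left_mono mult_mono) auto
    also have "\<dots> = x powr p * (A * J x)" by (simp add: A_def)
    finally have "norm (f x) / x powr p \<le> A * J x" using x by (simp add: divide_le_eq mult.commute)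
    then show ?thesis by (simp add: norm_divide)
  qed
  show ?thesis
  proof (rule tendsto_norm_zero_cancel, rule tendsto_sandwich[OF _ _ tendsto_const])
    show "\<forall>\<^sub>F x in at_right 0. 0 \<le> norm (f x / of_real (x powr p))" by simp
    show "\<forall>\<^sub>F x in at_right 0. norm (f x / of_real (x powr p)) \<le> A * J x"
      using eventually_at_right_0_Ioo[OF b] by eventually_elim (use bound in auto)
    show "((\<lambda>x. A * J x) \<longlongrightarrow> 0) (at_right 0)" using tendsto_mult[OF tendsto_const J0, of A] by simp
  qed
qed

text \<open>On a bounded interval constants are integrable, and \<open>|f| <= 1 + |f| powr p\<close>
  for finite exponents \<open>p >= 1\<close>.\<close>

lemma in_Lp_integrable:
  fixes f :: "real \<Rightarrow> real"
  assumes r: "1 \<le> r" and f: "in_Lp r b f"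
  shows "integrable (lebesgue_on {0<..<b}) f"
proof -
  have fm: "f \<in> borel_measurable (lebesgue_on {0<..<b})" using f by (simp add: in_Lp_def)
  have c: "integrable (lebesgue_on {0<..<b}) (\<lambda>x. M)" for M :: real
    by (rule continuous_lebesgue_interior) simp
  show ?thesis
  proof (cases "r = \<infinity>")
    case True
    then obtain M where M: "AE x in lebesgue_on {0<..<b}. norm (f x) \<le> M" using f by (auto simp: in_Lp_def)
    show ?thesis by (rule Bochner_Integration.integrable_bound[OF c[of M] fm]) (use M in \<open>auto elim!: eventually_mono\<close>)
  next
    case False
    define p where "p = real_of_ereal r"
    have p: "1 \<le> p" using r False by (cases r) (auto simp: p_def)
    have i: "integrable (lebesgue_on {0<..<b}) (\<lambda>x. norm (f x) powr p)" using f False by (simp add: in_Lp_def p_def)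
    show ?thesis
    proof (rule Bochner_Integration.integrable_bound[OF Bochner_Integration.integrable_add[OF c[of 1] i] fm], rule AE_I2)
      fix x
      have "\<bar>f x\<bar> \<le> 1 + \<bar>f x\<bar> powr p"
      proof (cases "\<bar>f x\<bar> \<le> 1")
        case True
        then show ?thesis using powr_ge_zero[of "\<bar>f x\<bar>" p] by linarith
      next
        case False
        then have "\<bar>f x\<bar> powr 1 \<le> \<bar>f x\<bar> powr p" using p by (intro powr_mono) auto
        then show ?thesis using False by simp
      qed
      then show "norm (f x) \<le> norm (1 + norm (f x) powr p)" by simp
    qed
  qed
qed

text \<open>\<open>\<xi> z\<close> and its derivative are the free ones plus remainders of smaller
  order at \<open>0\<close>, so both leading coefficients are those of \<open>xi_free\<close>,
  independent of \<open>z\<close>.\<close>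

lemma bessel_problem_regular_solution:
  fixes \<nu> a b \<gamma> :: real and q :: "real \<Rightarrow> real" and \<xi> :: "complex \<Rightarrow> real \<Rightarrow> complex"
  assumes nu: "0 < \<nu>" and a: "0 < a" and ab: "a < b" and g: "0 < \<gamma>" "\<gamma> < pi"
    and q: "AC_loc b q" and r: "2 < r" "in_Lp r b (\<lambda>x. x * q x)"
    and rs: "regular_solution \<nu> q b \<xi>"
  shows "bessel_problem \<nu> a b \<gamma> q \<xi> (\<lambda>z. dx b (\<xi> z)) (bessel_const \<nu> / Gamma (\<nu> + 1))"
proof
  have b: "0 < b" using a ab by simp
  have "1 \<le> r" using r(1) by (auto intro: order_trans[of _ 2])
  from integrable_norm[OF in_Lp_integrable[OF this r(2)]]
  have qi: "integrable (lebesgue_on {0<..<b}) (\<lambda>u. u * \<bar>q u\<bar>)"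
    by (rule Bochner_Integration.integrable_cong[THEN iffD1, OF refl, rotated]) (simp add: abs_mult)
  show "continuous_on {0<..b} q" using q AC_loc_deriv_continuous unfolding AC_loc_def by blast
  have "(\<lambda>x. x * \<bar>q x\<bar>) integrable_on {0..b}"
    using integrable_interior_imp_absolutely_integrable[OF qi] by (simp add: absolutely_integrable_on_def)
  then show "(\<lambda>x. x * \<bar>q x\<bar>) integrable_on {0..a}" by (rule integrable_subinterval_real) (use ab in auto)
  have ode: "(\<xi> z has_vector_derivative dx b (\<xi> z) x) (at x within {0<..b})"
      "(dx b (\<xi> z) has_vector_derivative dx b (dx b (\<xi> z)) x) (at x within {0<..b})"
      "- dx b (dx b (\<xi> z)) x + of_real ((\<nu>\<^sup>2 - 1/4) / x\<^sup>2 + q x) * \<xi> z x = z * \<xi> z x"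
    if "x \<in> {0<..b}" for z x
    using rs that unfolding regular_solution_def by blast+
  fix z
  show "(\<xi> z has_vector_derivative dx b (\<xi> z) x) (at x within {0<..b})" if "x \<in> {0<..b}" for x by (rule ode(1)[OF that])
  show "(dx b (\<xi> z) has_vector_derivative (of_real ((\<nu>\<^sup>2 - 1/4) / x\<^sup>2 + q x) - z) * \<xi> z x) (at x within {0<..b})"
    if x: "x \<in> {0<..b}" for x
  proof -
    have "dx b (dx b (\<xi> z)) x = (of_real ((\<nu>\<^sup>2 - 1/4) / x\<^sup>2 + q x) - z) * \<xi> z x"
      using ode(3)[OF x, of z] unfolding left_diff_distrib by algebra
    then show ?thesis using ode(2)[OF x, of z] by simp
  qed
  define s where "s = norm (csqrt z)"
  define e where "e = \<bar>Im (csqrt z)\<bar>"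
  obtain C where C: "\<And>x. x \<in> {0<..b} \<Longrightarrow> norm (\<xi> z x - xi_free \<nu> z x) \<le>
          C * (x / (1 + s * x)) powr (\<nu> + 1/2) * exp (e * x) * (LINT u|lebesgue_on {0<..<x}. u * \<bar>q u\<bar> / (1 + s * u))"
      "\<And>x. x \<in> {0<..b} \<Longrightarrow> norm (dx b (\<xi> z) x - dx b (xi_free \<nu> z) x) \<le>
          C * (x / (1 + s * x)) powr (\<nu> - 1/2) * exp (e * x) * (LINT u|lebesgue_on {0<..<x}. u * \<bar>q u\<bar> / (1 + s * u))"
    using rs unfolding regular_solution_def s_def e_def by blast
  have se: "0 \<le> s" "0 \<le> e" by (auto simp: s_def e_def)
  have "((\<lambda>x. xi_free \<nu> z x / of_real (x powr (\<nu> + 1/2)) + (\<xi> z x - xi_free \<nu> z x) / of_real (x powr (\<nu> + 1/2))) \<longlongrightarrow>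
      of_real (bessel_const \<nu> / Gamma (\<nu> + 1)) + 0) (at_right 0)"
    by (intro tendsto_add xi_free_limits(1)[OF nu b] remainder_limit[OF b _ se qi C(1)]) (use nu in auto)
  then show "((\<lambda>x. \<xi> z x / of_real (x powr (\<nu> + 1/2))) \<longlongrightarrow> of_real (bessel_const \<nu> / Gamma (\<nu> + 1))) (at_right 0)"
    by (simp add: add_divide_distrib[symmetric])
  have "((\<lambda>x. dx b (xi_free \<nu> z) x / of_real (x powr (\<nu> - 1/2)) +
        (dx b (\<xi> z) x - dx b (xi_free \<nu> z) x) / of_real (x powr (\<nu> - 1/2))) \<longlongrightarrow>
      of_real ((\<nu> + 1/2) * (bessel_const \<nu> / Gamma (\<nu> + 1))) + 0) (at_right 0)"
    by (intro tendsto_add xi_free_limits(2)[OF nu b] remainder_limit[OF b _ se qi C(2)]) (use nu in auto)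
  then show "((\<lambda>x. dx b (\<xi> z) x / of_real (x powr (\<nu> - 1/2))) \<longlongrightarrow> of_real ((\<nu> + 1/2) * (bessel_const \<nu> / Gamma (\<nu> + 1)))) (at_right 0)"
    by (simp only: add_divide_distrib[symmetric] add_diff_inverse add.right_neutral add.commute[of _ "_ - _"] diff_add_cancel)
  show "0 < bessel_const \<nu> / Gamma (\<nu> + 1)"
    using nu by (intro divide_pos_pos Gamma_real_pos) (auto simp: bessel_const_def)
qed (use nu a ab g in auto)

text \<open>Summability of both series and boundedness under the supremum belong to the conclusion:
  infinite sums and suprema are total functions, and the inequality alone could speak about default
  values. \<open>\<psi>\<close> ranges over all square integrable representatives of
  \<open>F\<close>.\<close>

theorem theorem4p4:
  fixes \<nu> a b \<gamma> :: real
    and r :: ereal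
    and q :: "real \<Rightarrow> real"
    and \<xi> :: "complex \<Rightarrow> real \<Rightarrow> complex"
    and \<sigma> :: "complex set"
  assumes "0 < \<nu>" and "0 < a" and "a < b" and "0 < \<gamma>" and "\<gamma> < pi"
    and "AC_loc b q"
    and "2 < r" and "in_Lp r b (\<lambda>x. x * q x)"
    and "regular_solution \<nu> q b \<xi>"
    and "\<sigma> = S_spectrum \<xi> \<nu> q a \<gamma>"
  shows "\<forall>z.
      (\<forall>x\<in>{a..b}. sampling_term \<xi> a (\<lambda>l. \<xi> l x) z summable_on \<sigma>) \<and>
      bdd_above ((\<lambda>x. norm (xi_ext \<xi> a \<sigma> z x - \<xi> z x)) ` {a..b}) \<and>
      (\<forall>F \<in> dB \<xi> b. sampling_term \<xi> a F z summable_on \<sigma> \<and>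
         (\<forall>\<psi> \<in> L2 b. F = transform \<xi> b \<psi> \<longrightarrow>
            norm (F z - sampling_sum \<xi> a \<sigma> F z)
              \<le> h_bound \<xi> a b \<sigma> z * (LINT x|lebesgue_on {a..b}. norm (\<psi> x))))"
proof -
  interpret bessel_problem \<nu> a b \<gamma> q \<xi> "\<lambda>z. dx b (\<xi> z)" "bessel_const \<nu> / Gamma (\<nu> + 1)"
    by (rule bessel_problem_regular_solution) (fact assms)+
  show ?thesis
    unfolding assms(10) S_spectrum_eq
  proof (intro allI conjI ballI impI)
    fix z
    show "sampling_term \<xi> a (\<lambda>l. \<xi> l x) z summable_on Z" if "x \<in> {a..b}" for x by (rule xi_ext_summable[OF that])
    show "bdd_above ((\<lambda>x. norm (xi_ext \<xi> a Z z x - \<xi> z x)) ` {a..b})" by (rule xi_ext_bdd)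
    fix F
    show "sampling_term \<xi> a F z summable_on Z" if "F \<in> dB \<xi> b" using that oversampled_estimate(1) by (auto simp: dB_def)
    show "norm (F z - sampling_sum \<xi> a Z F z) \<le> h_bound \<xi> a b Z z * (LINT x|lebesgue_on {a..b}. norm (\<psi> x))"
      if "\<psi> \<in> L2 b" "F = transform \<xi> b \<psi>" for \<psi>
      unfolding that(2) by (rule oversampled_estimate(2)[OF that(1)])
  qed
qed

end
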